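(* For all $n\ge 0$ let $\Delta\!\mathrm{tri}_n\in T_{2n,2n,2n}$ be the triangle element: the trivalent graph in the disk consisting of a triangle with all three sides colored $2n$, with one further edge colored $2n$ attached at each vertex of the triangle and running to one of the three boundary clusters. Then for all $n\ge 0$ and for all adequate closures of the element $\tau_{2n,2n,2n}$, i.e. for every wiring $x$ such that $\tau_{2n,2n,2n}^*(x)$ is adequate, $$(\Delta\!\mathrm{tri}_n)^*(x)\doteq_n \Lambda(q)\,\tau_{2n,2n,2n}^*(x),$$ where $$\Lambda(q)=(q;q)_\infty^2\sum_{i=0}^{\infty}\frac{(-1)^i q^{(i+3i^2)/2}}{(q;q)_i^3}.$$
   Context: $q$-notation: $(a;q)_n=\prod_{j=0}^{n-1}(1-aq^j)$, $(a;q)_\infty=\prod_{j\ge0}(1-aq^j)$. Skein theory. Work over $\mathbb{Q}(A)$ and put $q=A^4$. $\mathcal S(S^2)$ is the Kauffman bracket skein module of the sphere: diagrams modulo (crossing) $=A\,(A\text{-smoothing})+A^{-1}(B\text{-smoothing})$ and $L\sqcup\bigcirc=-(A^2+A^{-2})L$; it is identified with $\mathbb{Q}(A)$ by sending the empty diagram to $1$. $f^{(n)}$ denotes the $n$-th Jones–Wenzl idempotent in the Temperley–Lieb algebra $TL_n$ (the nonzero idempotent killed by every cup or cap on adjacent strands). $T_{a_1,\dots,a_m}$ is the space of skein elements in a disk with $a_1+\dots+a_m$ boundary points grouped in consecutive clusters of sizes $a_1,\dots,a_m$, with $f^{(a_i)}$ placed at the $i$-th cluster. For an admissible triple $(a,b,c)$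 (i.e. $a+b+c$ even and $a+b\ge c\ge|a-b|$), $T_{a,b,c}$ is one dimensional, spanned by $\tau_{a,b,c}$, the element in which $(a+b-c)/2$, $(a+c-b)/2$, $(b+c-a)/2$ parallel crossingless strands join the $a$- and $b$-boxes, the $a$- and $c$-boxes, and the $b$- and $c$-boxes respectively. A trivalent graph with colored edges stands for the skein element obtained by replacing each edge colored $m$ by $f^{(m)}$ and each vertex with colors $(a,b,c)$ by $\tau_{a,b,c}$. Closures. A wiring $x$ for $T_{a_1,\dots,a_m}$ is a diagram (arcs and idempotents) in the complementary disk of $S^2$ with the same boundary points; for $\Gamma\in T_{a_1,\dots,a_m}$, $\Gamma^*(x)\in\mathcal S(S^2)=\mathbb{Q}(A)$ is the evaluation of $\Gamma$ glued to $x$, called a closure of $\Gamma$. A crossingless skein element $D$ in $\mathcal S(S^2)$ consisting of arcs joining Jones–Wenzl idempotents is adequate if, after replacing every idempotent by the identity of the same number of strands (giving disjoint circles), each circle passes at most once through any given region where an idempotent was replaced. Relation $\doteq_n$. Rational functions are expanded as Laurent series in $q$ (after multiplication by a suitable, possibly fractional, power of $q$). For two such series, $P_1\doteq_n P_2$ means that, once both are multiplied by powers of $q$ so as to be power series starting in degree $0$, their first $n$ coefficients agree up to a common sign. *)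

theory Defs
  imports
    "HOL-Analysis.Analysis"
    "HOL-Library.Poly_Mapping"
    "HOL-Computational_Algebra.Computational_Algebra"
begin

type_synonym ratA = "rat poly fract"

definition varA :: ratA where
  "varA = Fract [:0, 1:] 1"

definition circle_value :: ratA where
  "circle_value = - (varA ^ 2 + inverse varA ^ 2)"

text \<open>
  The boundary points of a disk are listed along a line and numbered from the left, starting
  with 0; the skein element lies below the line. A crossingless diagram without closed circles
  and with \<open>k\<close> boundary points is given, up to isotopy, by a list \<open>p\<close> of length \<open>k\<close>: the arc
  starting at point \<open>i\<close> ends at point \<open>p ! i\<close>. These diagrams form a basis of the skein module
  of the disk, so a skein element is a finitely supported function on them. For \<open>k = 0\<close> the
  only basis element is the empty diagram \<open>[]\<close>, which identifies the skein module of the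
  sphere with the ground field.
\<close>

type_synonym skein = "nat list \<Rightarrow>\<^sub>0 ratA"

definition planar_matching :: "nat \<Rightarrow> nat list \<Rightarrow> bool" where
  "planar_matching k p \<longleftrightarrow> length p = k \<and>
     (\<forall>i<k. p ! i < k \<and> p ! i \<noteq> i \<and> p ! (p ! i) = i) \<and>
     (\<forall>i<k. \<forall>j<k. \<not> (i < j \<and> j < p ! i \<and> p ! i < p ! j))"

definition skein_space :: "nat \<Rightarrow> skein set" where
  "skein_space k = {v. \<forall>p \<in> Poly_Mapping.keys v. planar_matching k p}"

definition smul :: "ratA \<Rightarrow> skein \<Rightarrow> skein" where
  "smul c v = Poly_Mapping.map (\<lambda>x. c * x) v"

definition lin_ext :: "(nat list \<Rightarrow> skein) \<Rightarrow> skein \<Rightarrow> skein" where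
  "lin_ext f v = (\<Sum>p \<in> Poly_Mapping.keys v. smul (Poly_Mapping.lookup v p) (f p))"

definition shift_index :: "nat \<Rightarrow> nat \<Rightarrow> nat \<Rightarrow> nat" where
  "shift_index a k j = (if j < a then j else j + k)"

text \<open>
  Place the matching \<open>d\<close> on the line, directly to the left of the point \<open>a\<close> of \<open>p\<close>.
\<close>

definition insert_matching :: "nat \<Rightarrow> nat list \<Rightarrow> nat list \<Rightarrow> nat list" where
  "insert_matching a d p =
     map (\<lambda>i. if i < a then shift_index a (length d) (p ! i)
              else if i < a + length d then a + d ! (i - a)
              else shift_index a (length d) (p ! (i - length d)))
       [0..<length p + length d]"

definition insert_skein :: "nat \<Rightarrow> skein \<Rightarrow> skein \<Rightarrow> skein" where
  "insert_skein a f v =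
     lin_ext (\<lambda>d. lin_ext (\<lambda>p. Poly_Mapping.single (insert_matching a d p) 1) v) f"

text \<open>
  Join the adjacent points \<open>a\<close> and \<open>a + 1\<close> by an arc above the line. If they were already
  the two ends of one arc, this closes up a circle.
\<close>

definition cap_matching :: "nat \<Rightarrow> nat list \<Rightarrow> nat list" where
  "cap_matching a p =
     map (\<lambda>i. let j = p ! shift_index a 2 i;
                  j' = (if j = a then p ! Suc a else if j = Suc a then p ! a else j)
              in if j' < a then j' else j' - 2)
       [0..<length p - 2]"

definition cap_skein :: "nat \<Rightarrow> skein \<Rightarrow> skein" where
  "cap_skein a =
     lin_ext (\<lambda>p. Poly_Mapping.single (cap_matching a p) (if p ! a = Suc a then circle_value else 1))"

definition cup_skein :: "nat \<Rightarrow> skein \<Rightarrow> skein" where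
  "cup_skein a = insert_skein a (Poly_Mapping.single [1, 0] 1)"

text \<open>
  An element of the Temperley-Lieb algebra on \<open>m\<close> strands is a skein element with \<open>2 * m\<close>
  boundary points: going clockwise around the rectangle, the points \<open>0, \<dots>, m - 1\<close> are its
  bottom points from right to left, and \<open>m, \<dots>, 2 * m - 1\<close> its top points from left to right.
  \<open>apply_TL a m f v\<close> stacks \<open>f\<close> on the points \<open>a, \<dots>, a + m - 1\<close> of \<open>v\<close>: after the
  insertion of \<open>f\<close> behind these points, they are joined to the bottom points of \<open>f\<close> by
  \<open>m\<close> nested caps.
\<close>

definition apply_TL :: "nat \<Rightarrow> nat \<Rightarrow> skein \<Rightarrow> skein \<Rightarrow> skein" where
  "apply_TL a m f v =
     fold (\<lambda>i. cap_skein (a + m - 1 - i)) [0..<m] (insert_skein (a + m) f v)"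

abbreviation TL_mult :: "nat \<Rightarrow> skein \<Rightarrow> skein \<Rightarrow> skein" where
  "TL_mult m f g \<equiv> apply_TL m m f g"

text \<open>
  A cap at a position below \<open>m - 1\<close> joins two adjacent bottom points, a cap at a position from
  \<open>m\<close> on joins two adjacent top points.
\<close>

definition is_jones_wenzl :: "nat \<Rightarrow> skein \<Rightarrow> bool" where
  "is_jones_wenzl m f \<longleftrightarrow>
     f \<in> skein_space (2 * m) \<and> f \<noteq> 0 \<and> TL_mult m f f = f \<and>
     (\<forall>i. Suc i < m \<longrightarrow> cap_skein i f = 0 \<and> cap_skein (m + i) f = 0)"

definition jones_wenzl :: "nat \<Rightarrow> skein" where
  "jones_wenzl m = (THE f. is_jones_wenzl m f)"

text \<open>
  A diagram is cut by horizontal lines into elementary slices, listed from bottom to top. The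
  number \<open>a\<close> in a slice is the position, counted from the left, at which its arc, crossing or
  box begins; all other strands are vertical. \<open>Box a m\<close> is the Jones-Wenzl idempotent on \<open>m\<close>
  strands. The two kinds of crossing are told apart by their smoothings: in \<open>Cross True a\<close>
  the A-smoothing consists of two vertical strands, in \<open>Cross False a\<close> of a cap and a cup.
\<close>

datatype slice = Cup nat | Cap nat | Cross bool nat | Box nat nat

type_synonym diagram = "slice list"

fun slice_fits :: "slice \<Rightarrow> nat \<Rightarrow> bool" where
  "slice_fits (Cup a) w \<longleftrightarrow> a \<le> w"
| "slice_fits (Cap a) w \<longleftrightarrow> a + 2 \<le> w"
| "slice_fits (Cross b a) w \<longleftrightarrow> a + 2 \<le> w"
| "slice_fits (Box a m) w \<longleftrightarrow> a + m \<le> w"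

fun slice_target :: "slice \<Rightarrow> nat \<Rightarrow> nat" where
  "slice_target (Cup a) w = w + 2"
| "slice_target (Cap a) w = w - 2"
| "slice_target (Cross b a) w = w"
| "slice_target (Box a m) w = w"

text \<open>\<open>tangle k D l\<close>: the diagram \<open>D\<close> has \<open>k\<close> bottom points and \<open>l\<close> top points.\<close>

fun tangle :: "nat \<Rightarrow> diagram \<Rightarrow> nat \<Rightarrow> bool" where
  "tangle k [] l \<longleftrightarrow> k = l"
| "tangle k (s # D) l \<longleftrightarrow> slice_fits s k \<and> tangle (slice_target s k) D l"

fun slice_skein :: "slice \<Rightarrow> skein \<Rightarrow> skein" where
  "slice_skein (Cup a) v = cup_skein a v"
| "slice_skein (Cap a) v = cap_skein a v"
| "slice_skein (Cross b a) v =
     (if b then smul varA v + smul (inverse varA) (cup_skein a (cap_skein a v))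
      else smul varA (cup_skein a (cap_skein a v)) + smul (inverse varA) v)"
| "slice_skein (Box a m) v = apply_TL a m (jones_wenzl m) v"

definition attach :: "diagram \<Rightarrow> skein \<Rightarrow> skein" where
  "attach D v = fold slice_skein D v"

definition skein_of :: "diagram \<Rightarrow> skein" where
  "skein_of D = attach D (Poly_Mapping.single [] 1)"

text \<open>
  A wiring lives in the complementary disk of the sphere, that is, above the boundary line.
\<close>

definition wiring :: "nat \<Rightarrow> diagram \<Rightarrow> bool" where
  "wiring k x \<longleftrightarrow> tangle k x 0"

definition closure_value :: "skein \<Rightarrow> diagram \<Rightarrow> ratA" where
  "closure_value v x = Poly_Mapping.lookup (attach x v) []"

definition nested_cups :: "nat \<Rightarrow> nat \<Rightarrow> diagram" where
  "nested_cups a k = map (\<lambda>i. Cup (a + i)) [0..<k]"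

definition nested_caps :: "nat \<Rightarrow> nat \<Rightarrow> diagram" where
  "nested_caps a k = map (\<lambda>i. Cap (a + k - 1 - i)) [0..<k]"

text \<open>
  The vertex with legs colored \<open>a\<close>, \<open>b\<close>, \<open>c\<close> from left to right, placed directly to the left of
  position \<open>s\<close>; the parallel strands joining the \<open>a\<close>- and \<open>c\<close>-boxes run below all the others.
\<close>

definition vertex_at :: "nat \<Rightarrow> nat \<Rightarrow> nat \<Rightarrow> nat \<Rightarrow> diagram" where
  "vertex_at s a b c =
     (let ab = (a + b - c) div 2; ac = (a + c - b) div 2; bc = (b + c - a) div 2
      in nested_cups s ac @ nested_cups (s + ac) ab @ nested_cups (s + ac + 2 * ab) bc
         @ [Box s a, Box (s + a) b, Box (s + a + b) c])"

definition tau :: "nat \<Rightarrow> nat \<Rightarrow> nat \<Rightarrow> diagram" where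
  "tau a b c = vertex_at 0 a b c"

text \<open>
  An edge colored \<open>m\<close> between the adjacent legs at the points \<open>s, \<dots>, s + m - 1\<close> and
  \<open>s + m, \<dots>, s + 2 * m - 1\<close>.
\<close>

definition edge_at :: "nat \<Rightarrow> nat \<Rightarrow> diagram" where
  "edge_at s m = Box s m # nested_caps s m"

text \<open>
  Write \<open>o1, o2, o3\<close> for the legs running to the boundary and \<open>eij\<close> for the end of the side
  between the vertices \<open>i\<close> and \<open>j\<close>. The second and third vertex are inserted between the two
  inner legs of the first, which gives the order
  \<open>o1, e12, e12, o2, e23, e23, o3, e13, e13\<close>. Then the sides are joined one after the other,
  and the boundary edges receive their idempotents.
\<close>

definition triangle_graph :: "nat \<Rightarrow> diagram" where
  "triangle_graph m =
     vertex_at 0 m m m @ vertex_at (2 * m) m m m @ vertex_at (5 * m) m m m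
     @ edge_at m m @ edge_at (2 * m) m @ edge_at (3 * m) m
     @ [Box 0 m, Box m m, Box (2 * m) m]"

definition crossingless :: "diagram \<Rightarrow> bool" where
  "crossingless D \<longleftrightarrow> (\<forall>b a. Cross b a \<notin> set D)"

text \<open>
  The points of a crossingless diagram on the cutting lines are the pairs of the number of the
  line and the position on it. Two points are adjacent if they are joined within one slice once
  every idempotent is replaced by the identity. (Pairs outside of the diagram are only adjacent
  to each other.)
\<close>

inductive adjacent :: "diagram \<Rightarrow> nat \<times> nat \<Rightarrow> nat \<times> nat \<Rightarrow> bool" for D where
  cup_arc: "t < length D \<Longrightarrow> D ! t = Cup a \<Longrightarrow> adjacent D (Suc t, a) (Suc t, Suc a)"
| cup_strand: "t < length D \<Longrightarrow> D ! t = Cup a \<Longrightarrow> adjacent D (t, j) (Suc t, shift_index a 2 j)"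
| cap_arc: "t < length D \<Longrightarrow> D ! t = Cap a \<Longrightarrow> adjacent D (t, a) (t, Suc a)"
| cap_strand: "t < length D \<Longrightarrow> D ! t = Cap a \<Longrightarrow> adjacent D (t, shift_index a 2 j) (Suc t, j)"
| box_strand: "t < length D \<Longrightarrow> D ! t = Box a m \<Longrightarrow> adjacent D (t, j) (Suc t, j)"

definition same_circle :: "diagram \<Rightarrow> nat \<times> nat \<Rightarrow> nat \<times> nat \<Rightarrow> bool" where
  "same_circle D = equivclp (adjacent D)"

definition adequate :: "diagram \<Rightarrow> bool" where
  "adequate D \<longleftrightarrow> tangle 0 D 0 \<and> crossingless D \<and>
     (\<forall>t a m i j. t < length D \<and> D ! t = Box a m \<and> i < j \<and> j < m \<longrightarrow>
        \<not> same_circle D (t, a + i) (t, a + j))"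

definition laurent :: "ratA \<Rightarrow> rat fls" where
  "laurent r = (THE P. \<exists>f g. g \<noteq> 0 \<and> r = Fract f g \<and>
     P = fps_to_fls (fps_of_poly f) / fps_to_fls (fps_of_poly g))"

lemma laurent_Fract:
  assumes "g \<noteq> 0"
  shows "laurent (Fract f g) = fps_to_fls (fps_of_poly f) / fps_to_fls (fps_of_poly g)"
  unfolding laurent_def
proof (rule the_equality)
  show "\<exists>f' g'. g' \<noteq> 0 \<and> Fract f g = Fract f' g' \<and>
      fps_to_fls (fps_of_poly f) / fps_to_fls (fps_of_poly g) =
      fps_to_fls (fps_of_poly f') / fps_to_fls (fps_of_poly g')"
    using assms by blast
next
  fix P
  assume "\<exists>f' g'. g' \<noteq> 0 \<and> Fract f g = Fract f' g' \<and>
      P = fps_to_fls (fps_of_poly f') / fps_to_fls (fps_of_poly g')"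
  then obtain f' g' where nz: "g' \<noteq> 0" and eq: "Fract f g = Fract f' g'"
    and P: "P = fps_to_fls (fps_of_poly f') / fps_to_fls (fps_of_poly g')"
    by blast
  from assms nz eq have "f * g' = f' * g"
    by (simp add: eq_fract)
  then have "fps_to_fls (fps_of_poly f) * fps_to_fls (fps_of_poly g') =
      fps_to_fls (fps_of_poly f') * fps_to_fls (fps_of_poly g)"
    by (metis fls_times_fps_to_fls fps_of_poly_mult)
  with assms nz show "P = fps_to_fls (fps_of_poly f) / fps_to_fls (fps_of_poly g)"
    by (simp add: P frac_eq_eq)
qed

text \<open>The substitution \<open>q = A\<^sup>4\<close>.\<close>

definition q_series :: "rat fps \<Rightarrow> rat fls" where
  "q_series F = fls_compose_power (fps_to_fls F) 4"

text \<open>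
  Both arguments are Laurent series in \<open>A\<close>. Multiplication by a power of \<open>A\<close>, which is a
  fractional power of \<open>q\<close>, has to turn them into power series in \<open>q\<close> starting in degree 0,
  that is, with nonzero constant coefficient.
\<close>

definition agree_to_order :: "nat \<Rightarrow> rat fls \<Rightarrow> rat fls \<Rightarrow> bool" where
  "agree_to_order n P1 P2 \<longleftrightarrow>
     (\<exists>k1 k2 F1 F2 s.
        fls_X_intpow k1 * P1 = q_series F1 \<and> fps_nth F1 0 \<noteq> 0 \<and>
        fls_X_intpow k2 * P2 = q_series F2 \<and> fps_nth F2 0 \<noteq> 0 \<and>
        s \<in> {1, - 1} \<and> (\<forall>i<n. fps_nth F1 i = s * fps_nth F2 i))"

definition q_pochhammer :: "'a::comm_ring_1 \<Rightarrow> 'a \<Rightarrow> nat \<Rightarrow> 'a" where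
  "q_pochhammer a q n = (\<Prod>j<n. 1 - a * q ^ j)"

definition q_pochhammer_inf :: "'a::{t2_space, comm_ring_1} \<Rightarrow> 'a \<Rightarrow> 'a" where
  "q_pochhammer_inf a q = prodinf (\<lambda>j. 1 - a * q ^ j)"

definition Lambda_q :: "rat fps" where
  "Lambda_q = q_pochhammer_inf fps_X fps_X ^ 2 *
     suminf (\<lambda>i. (- 1) ^ i * fps_X ^ ((i + 3 * i ^ 2) div 2) / q_pochhammer fps_X fps_X i ^ 3)"

end

(*
  Write L for two adjacent idempotents on n strands. The idempotent on 2n strands is a linear
  combination of the elements obtained from L below and L above, where n - i strands on either side
  pass straight through and i nested strands turn back; the coefficients are determined by the
  condition that all caps vanish. Expanding one side of the triangle in this way turns every term
  into tau with extra caps between two adjacent idempotents, and each of these caps gives a scalar.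
  Hence the triangle element equals c_n * tau, where c_n is a power of A, up to sign, times
    sum_{i <= n} (-1)^i q^{i(i+1)/2} prod_{j < i} (1-q^{n-j})^2 / ((1-q^{2n-j}) (1-q^{j+1}))
                              * prod_{i < x <= n} (1-q^{x+2n+1}) (1-q^x) / (1-q^{x+n})^2.
  Modulo q^{n+1} this sum is (q;q)_n sum_i (-1)^i q^{i(i+1)/2} / (q;q)_i^2, which agrees with Lambda
  by the q-binomial theorem and a limiting case of the q-Vandermonde identity.

  It remains to see that the closure of tau is a power of A times a power series in q with nonzero
  constant term. Replacing an idempotent by the identity yields the circles of the adequate diagram.
  All other terms are obtained by hooks, each of which changes the number of circles by one, and by
  adequacy the first hook decreases it; so they are divisible by q relative to the identity term.
*)

theory Submission
  imports Defs
begin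

section \<open>Planar matchings\<close>

text \<open>The idempotents are treated as operators rather than multiplied as elements. Hooks (a
  cap followed by a cup at neighbouring points) act on skein elements with \<open>k\<close> boundary
  points, and \<open>jw k a m\<close> is Wenzl's recursion read in these hooks. Being 1 plus terms
  that contain hooks, such an operator passes through every linear map intertwining the hooks, fixes
  whatever all caps kill, and is absorbed by whatever kills all cups. Sliding, absorption and the
  uniqueness behind the definite description \<open>jones_wenzl\<close> all rest on these three
  facts. The box is expanded in halves because the middle cap has a two-term effect there: either it
  removes one strand joining the halves, or it moves below these strands and uses up one passing
  strand on each side. Hence the coefficients can be found by telescoping. Only one side of the
  triangle needs this; the other two are straightened away. In the lowest-order part the obstacle is
  to show that a hook changes the number of circles by exactly one, whatever lies above it. A
  surgery is pushed up through the slices, which destroys planarity; the parity of the endpoints is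
  the invariant that survives.\<close>

abbreviation cup_matching :: "nat \<Rightarrow> nat list \<Rightarrow> nat list" where
  "cup_matching a \<equiv> insert_matching a [Suc 0, 0]"

text \<open>The involution underlying \<open>planar_matching\<close>, without the noncrossing
  condition. It is kept apart because the surgeries in the count of circles may lead to matchings
  with crossings.\<close>

definition matching :: "nat \<Rightarrow> nat list \<Rightarrow> bool" where
  "matching k p \<longleftrightarrow> length p = k \<and> (\<forall>i<k. p ! i < k \<and> p ! i \<noteq> i \<and> p ! (p ! i) = i)"

lemma matchingD:
  assumes "matching k p"
  shows "length p = k" "i < k \<Longrightarrow> p ! i < k" "i < k \<Longrightarrow> p ! i \<noteq> i" "i < k \<Longrightarrow> p ! (p ! i) = i"
  using assms by (auto simp: matching_def)

lemma matching_eq_iff: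
  assumes "matching k p" "i < k" "j < k"
  shows "p ! i = j \<longleftrightarrow> p ! j = i"
  using assms by (auto simp: matching_def)

lemma planar_imp_matching: "planar_matching k p \<Longrightarrow> matching k p"
  by (simp add: planar_matching_def matching_def)

lemma length_insert_matching [simp]: "length (insert_matching a d p) = length p + length d"
  by (simp add: insert_matching_def)

lemma length_cap_matching [simp]: "length (cap_matching a p) = length p - 2"
  by (simp add: cap_matching_def)

lemma shift_index_inj [simp]: "shift_index a k i = shift_index a k j \<longleftrightarrow> i = j"
  by (auto simp: shift_index_def)

lemma nth_insert_shift:
  "i < length p \<Longrightarrow> a \<le> length p \<Longrightarrow>
    insert_matching a d p ! shift_index a (length d) i = shift_index a (length d) (p ! i)"
  by (auto simp: insert_matching_def shift_index_def)

lemma nth_insert_inside: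
  "i < length d \<Longrightarrow> a \<le> length p \<Longrightarrow> insert_matching a d p ! (a + i) = a + d ! i"
  by (auto simp: insert_matching_def)

lemma nth_cup:
  assumes "a \<le> length p"
  shows "i < length p \<Longrightarrow> cup_matching a p ! shift_index a 2 i = shift_index a 2 (p ! i)"
    "cup_matching a p ! a = Suc a" "cup_matching a p ! Suc a = a"
  using nth_insert_shift[of i p a "[Suc 0,0]"] nth_insert_inside[of 0 "[Suc 0,0]" a p]
    nth_insert_inside[of 1 "[Suc 0,0]" a p] assms by (simp_all add: numeral_2_eq_2)

text \<open>\<open>f\<close> with the points \<open>a\<close> and \<open>b\<close> joined to each other; the values at \<open>a\<close> and \<open>b\<close> are junk.\<close>

definition bypass :: "nat \<Rightarrow> nat \<Rightarrow> (nat \<Rightarrow> nat) \<Rightarrow> nat \<Rightarrow> nat" where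
  "bypass a b f i = (if f i = a then f b else if f i = b then f a else f i)"

text \<open>The new partner of a surviving point is never \<open>a\<close> or \<open>Suc a\<close>,
  so the renumbering can be inverted. Stating the value under \<open>shift_index\<close>, which is
  injective, avoids the subtraction in \<open>cap_matching\<close>.\<close>

lemma nth_cap:
  assumes "matching k p" "a + 2 \<le> k" "i + 2 < k"
  shows "shift_index a 2 (cap_matching a p ! i) = bypass a (Suc a) ((!) p) (shift_index a 2 i)"
proof -
  have s: "shift_index a 2 i < k" "shift_index a 2 i \<noteq> a" "shift_index a 2 i \<noteq> Suc a"
    using assms by (auto simp: shift_index_def)
  define j where "j = bypass a (Suc a) ((!) p) (shift_index a 2 i)"
  have "j \<noteq> a" "j \<noteq> Suc a"
    using matchingD[OF assms(1)] s assms(2) unfolding j_def bypass_def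
    by (smt (verit) Suc_le_eq add_2_eq_Suc' le_eq_less_or_eq lessI less_trans)+
  moreover have "cap_matching a p ! i = (if j < a then j else j - 2)"
    using assms matchingD(1)[OF assms(1)] by (simp add: cap_matching_def j_def bypass_def Let_def)
  ultimately show ?thesis unfolding j_def[symmetric] by (auto simp: shift_index_def)
qed

lemma shift_shift: "i \<le> j \<Longrightarrow> shift_index (j + l) m (shift_index i l x) = shift_index i l (shift_index j m x)"
  by (auto simp: shift_index_def)

lemma shift_cases:
  obtains "i < a" | j where "i = shift_index a l j" | j where "j < l" "i = a + j"
proof (cases "i < a")
  case False
  show ?thesis
  proof (cases "i < a + l")
    case True then show ?thesis using that(3)[of "i - a"] False by auto
  next
    case f: False then show ?thesis using that(2)[of "i - l"] False by (auto simp: shift_index_def)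
  qed
qed (use that in auto)

lemma insert_matching_nth: "i < length p + length d \<Longrightarrow> insert_matching a d p ! i =
   (if i < a then shift_index a (length d) (p ! i)
              else if i < a + length d then a + d ! (i - a)
              else shift_index a (length d) (p ! (i - length d)))"
  by (simp add: insert_matching_def)

lemma cap_matching_nth: "i < length p - 2 \<Longrightarrow> cap_matching a p ! i =
   (let j' = bypass a (Suc a) ((!) p) (shift_index a 2 i) in if j' < a then j' else j' - 2)"
  by (simp add: cap_matching_def bypass_def Let_def)

section \<open>Relations between cups, caps and inserted matchings\<close>

lemma cap_cup_same:
  assumes "a \<le> length p" shows "cap_matching a (cup_matching a p) = p"
proof (rule nth_equalityI)
  fix i assume "i < length (cap_matching a (cup_matching a p))"
  then have i: "i < length p" by simp
  then show "cap_matching a (cup_matching a p) ! i = p ! i" using assms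
    by (simp add: cap_matching_nth bypass_def nth_cup Let_def) (auto simp: shift_index_def)
qed simp

lemma insert_cup_left:
  assumes "j \<le> b" "b \<le> length p"
  shows "insert_matching (Suc (Suc b)) d (cup_matching j p) = cup_matching j (insert_matching b d p)"
proof (rule nth_equalityI)
  fix i assume i: "i < length (insert_matching (Suc (Suc b)) d (cup_matching j p))"
  then consider "i < j" | "i = j" | "i = Suc j" | "j + 2 \<le> i" "i < b + 2"
     | "b + 2 \<le> i" "i < b + 2 + length d" | "b + 2 + length d \<le> i" by linarith
  then show "insert_matching (Suc (Suc b)) d (cup_matching j p) ! i = cup_matching j (insert_matching b d p) ! i"
    using i assms by cases (simp_all add: insert_matching_nth, auto simp: shift_index_def)
qed simp

lemma insert_cup_inside:
  assumes "j \<le> length d" "b \<le> length p"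
  shows "insert_matching b (cup_matching j d) p = cup_matching (b + j) (insert_matching b d p)"
proof (rule nth_equalityI)
  fix i assume i: "i < length (insert_matching b (cup_matching j d) p)"
  then consider "i < b" | "b \<le> i" "i < b + j" | "i = b + j" | "i = Suc (b + j)" | "b + j + 2 \<le> i" "i < b + 2 + length d"
     | "b + 2 + length d \<le> i" by linarith
  then show "insert_matching b (cup_matching j d) p ! i = cup_matching (b + j) (insert_matching b d p) ! i"
    using i assms by cases (simp_all add: insert_matching_nth, auto simp: shift_index_def)
qed simp

lemma cup_cup: "i \<le> j \<Longrightarrow> j \<le> length p \<Longrightarrow>
   cup_matching (Suc (Suc j)) (cup_matching i p) = cup_matching i (cup_matching j p)"
  by (rule insert_cup_left)

lemma insert_matching_Nil [simp]: "insert_matching b [] p = p"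
  by (rule nth_equalityI) (auto simp: insert_matching_def shift_index_def)

lemma matching_cup:
  assumes "matching k p" "a \<le> k" shows "matching (k + 2) (cup_matching a p)"
  unfolding matching_def
proof (intro conjI allI impI)
  show "length (cup_matching a p) = k + 2" using assms by (simp add: matching_def)
  fix i assume i: "i < k + 2"
  have l: "length p = k" using assms by (simp add: matching_def)
  have sg: "shift_index a 2 j < k + 2 \<longleftrightarrow> j < k" "shift_index a 2 j \<noteq> a" "shift_index a 2 j \<noteq> Suc a"
     "a \<noteq> shift_index a 2 j" "Suc a \<noteq> shift_index a 2 j"  for j
    using assms(2) by (auto simp: shift_index_def)
  consider "i = a" | "i = Suc a" | j where "i = shift_index a 2 j" "j < k"
    using i assms(2) by (cases i rule: shift_cases[where a = a and l = 2]) (force simp: less_2_cases_iff shift_index_def split: if_splits)+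
  then have "cup_matching a p ! i < k + 2 \<and> cup_matching a p ! i \<noteq> i \<and> cup_matching a p ! (cup_matching a p ! i) = i"
    by cases (use assms(2) l matchingD[OF assms(1)] sg(1) in \<open>simp_all add: nth_cup sg(2-)\<close>)
  then show "cup_matching a p ! i < k + 2" "cup_matching a p ! i \<noteq> i" "cup_matching a p ! (cup_matching a p ! i) = i"
    by auto
qed

lemma bypass_involution:
  assumes "f (f a) = a" "f (f b) = b" "f (f x) = x" "f x \<noteq> x" "a \<noteq> x" "b \<noteq> x" "a \<noteq> b"
    "f a \<noteq> a" "f b \<noteq> b"
  shows "bypass a b f x \<noteq> x" "bypass a b f (bypass a b f x) = x"
  using assms unfolding bypass_def by (smt (verit))+

lemma matching_cap:
  assumes "matching (k+2) p" "a \<le> k" shows "matching k (cap_matching a p)"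
  unfolding matching_def
proof (intro conjI allI impI)
  let ?q = "cap_matching a p"
  have l: "length p = k + 2" using assms by (simp add: matching_def)
  then show "length ?q = k" by simp
  fix i assume i: "i < k"
  have n: "shift_index a 2 (?q ! i) = bypass a (Suc a) ((!) p) (shift_index a 2 i)" if "i < k" for i
    using nth_cap[OF assms(1)] that assms(2) by simp
  have s: "shift_index a 2 i < k + 2" "shift_index a 2 i \<noteq> a" "shift_index a 2 i \<noteq> Suc a"
    using assms i by (auto simp: shift_index_def)
  note m = matchingD[OF assms(1)]
  have a: "a < k+2" "Suc a < k + 2" using assms(2) by auto
  have "bypass a (Suc a) ((!) p) (shift_index a 2 i) < k + 2" using m s a by (simp add: bypass_def)
  then have "shift_index a 2 (?q ! i) < k + 2" using n[OF i] by simp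
  then show 1: "?q ! i < k" using assms(2) by (auto simp: shift_index_def split: if_splits)
  define f where "f = (!) p"
  define x where "x = shift_index a 2 i"
  have f: "f (f a) = a" "f (f (Suc a)) = Suc a" "f (f x) = x" "f x \<noteq> x" "a \<noteq> x" "Suc a \<noteq> x" "f a \<noteq> a" "f (Suc a) \<noteq> Suc a"
    using m a s by (auto simp: f_def x_def)
  have b: "bypass a (Suc a) f x \<noteq> x" "bypass a (Suc a) f (bypass a (Suc a) f x) = x"
    using bypass_involution[of f a "Suc a" x] f by simp_all
  from b(1) have "bypass a (Suc a) ((!) p) (shift_index a 2 i) \<noteq> shift_index a 2 i" by (simp add: f_def x_def)
  then show "?q ! i \<noteq> i" using n[OF i] by metis
  from b(2) have "bypass a (Suc a) ((!) p) (bypass a (Suc a) ((!) p) (shift_index a 2 i)) = shift_index a 2 i"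
    by (simp add: f_def x_def)
  then have "shift_index a 2 (?q ! (?q ! i)) = shift_index a 2 i" using n[OF i] n[OF 1] by metis
  then show "?q ! (?q ! i) = i" by simp
qed

lemma insert_matching_eqI:
  assumes "a \<le> length p" "length q = length p + length d"
    and "\<And>i. i < length p \<Longrightarrow> q ! shift_index a (length d) i = shift_index a (length d) (p ! i)"
    and "\<And>i. i < length d \<Longrightarrow> q ! (a + i) = a + d ! i"
  shows "q = insert_matching a d p"
proof (rule nth_equalityI)
  fix i assume i: "i < length q"
  show "q ! i = insert_matching a d p ! i"
  proof (cases i rule: shift_cases[where a = a and l = "length d"])
    case 1
    then have "i = shift_index a (length d) i" "i < length p" using assms(1) by (auto simp: shift_index_def)
    then show ?thesis using assms(3)[of i] nth_insert_shift[of i p a d] assms(1) by metis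
  next
    case (2 j)
    then have "j < length p" using i assms(1,2) by (auto simp: shift_index_def split: if_splits)
    then show ?thesis using 2 assms(3)[of j] nth_insert_shift[of j p a d] assms(1) by metis
  next
    case (3 j)
    then show ?thesis using assms(4)[of j] nth_insert_inside[of j d a p] assms(1) by metis
  qed
qed (use assms in simp)

lemma cap_matching_eqI:
  assumes "matching (k+2) p" "a \<le> k" "length q = k"
    and "\<And>i. i < k \<Longrightarrow> shift_index a 2 (q ! i) = bypass a (Suc a) ((!) p) (shift_index a 2 i)"
  shows "cap_matching a p = q"
proof (rule nth_equalityI)
  show "length (cap_matching a p) = length q" using assms by (simp add: matching_def)
  fix i assume "i < length (cap_matching a p)"
  then have "i < k" using assms by (simp add: matching_def)
  then have "shift_index a 2 (cap_matching a p ! i) = shift_index a 2 (q ! i)"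
    using assms(4) nth_cap[OF assms(1), of a i] assms(2) by simp
  then show "cap_matching a p ! i = q ! i" by simp
qed

text \<open>A zigzag: the cap leads the strand at \<open>a\<close> into the left foot of the cup,
  and the strand leaves through the right foot.\<close>

lemma cap_cup_right:
  assumes "matching k p" "Suc a \<le> k" shows "cap_matching a (cup_matching (Suc a) p) = p"
proof (rule cap_matching_eqI[of k])
  show "matching (k + 2) (cup_matching (Suc a) p)" using matching_cup assms by blast
  show "a \<le> k" "length p = k" using assms by (simp_all add: matching_def)
  let ?c = "cup_matching (Suc a) p"
  fix i assume i: "i < k"
  note m = matchingD(1)[OF assms(1)] matchingD(2-4)[OF assms(1) i]
  have c: "?c ! Suc a = Suc (Suc a)" "?c ! Suc (Suc a) = Suc a"
     "?c ! shift_index (Suc a) 2 j = shift_index (Suc a) 2 (p ! j)" if "j < k" for j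
    using that assms m(1) by (simp_all add: nth_cup)
  show "shift_index a 2 (p ! i) = bypass a (Suc a) ((!) ?c) (shift_index a 2 i)"
  proof (cases "i = a")
    case True
    then show ?thesis using c[OF i] m by (auto simp: bypass_def shift_index_def)
  next
    case False
    then have "shift_index a 2 i = shift_index (Suc a) 2 i" by (auto simp: shift_index_def)
    then show ?thesis using c[OF i] m by (auto simp: bypass_def shift_index_def)
  qed
qed

lemma cap_cup_left:
  assumes "matching k p" "Suc a \<le> k" shows "cap_matching (Suc a) (cup_matching a p) = p"
proof (rule cap_matching_eqI[of k])
  show "matching (k + 2) (cup_matching a p)" using matching_cup assms by auto
  show "Suc a \<le> k" "length p = k" using assms by (simp_all add: matching_def)
  let ?c = "cup_matching a p"
  fix i assume i: "i < k"
  note m = matchingD(1)[OF assms(1)] matchingD(2-4)[OF assms(1) i]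
  have c: "?c ! a = Suc a" "?c ! Suc a = a"
     "?c ! shift_index a 2 j = shift_index a 2 (p ! j)" if "j < k" for j
    using that assms m(1) by (simp_all add: nth_cup)
  have ca: "?c ! Suc (Suc a) = shift_index a 2 (p ! a)" using c(3)[of a] assms by (simp add: shift_index_def)
  show "shift_index (Suc a) 2 (p ! i) = bypass (Suc a) (Suc (Suc a)) ((!) ?c) (shift_index (Suc a) 2 i)"
  proof (cases "i = a")
    case True
    then show ?thesis using c[OF i] ca m by (auto simp: bypass_def shift_index_def)
  next
    case False
    then have "shift_index a 2 i = shift_index (Suc a) 2 i" by (auto simp: shift_index_def)
    then show ?thesis using c[OF i] m by (auto simp: bypass_def shift_index_def)
  qed
qed

text \<open>Naturality under renumbering; it carries a cap through the renumbering caused by an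
  insertion or by another cap.\<close>

lemma bypass_map:
  assumes "inj \<phi>" "\<And>z. z \<in> {a, b, x} \<Longrightarrow> F (\<phi> z) = \<phi> (f z)"
  shows "bypass (\<phi> a) (\<phi> b) F (\<phi> x) = \<phi> (bypass a b f x)"
  using assms by (auto simp: bypass_def dest: injD)

lemma inj_shift_index: "inj (shift_index a l)"
  by (rule injI) simp

lemma cap_insert_right:
  assumes "matching (k+2) p" "i \<le> j" "j \<le> k"
  shows "cap_matching i (insert_matching (Suc (Suc j)) d p) = insert_matching j d (cap_matching i p)"
proof (rule insert_matching_eqI)
  have l: "length p = k + 2" using assms by (simp add: matching_def)
  then show "j \<le> length (cap_matching i p)" using assms by simp
  show "length (cap_matching i (insert_matching (Suc (Suc j)) d p)) = length (cap_matching i p) + length d"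
    using l by simp
  let ?L = "cap_matching i (insert_matching (Suc (Suc j)) d p)"
  let ?s = "shift_index (Suc (Suc j)) (length d)"
  have fix_i: "?s i = i" "?s (Suc i) = Suc i"
    using assms by (auto simp: shift_index_def)
  have nth: "bypass i (Suc i) ((!) (insert_matching (Suc (Suc j)) d p)) (?s x)
     = ?s (bypass i (Suc i) ((!) p) x)" if "x < k + 2" for x
  proof -
    have "bypass (?s i) (?s (Suc i)) ((!) (insert_matching (Suc (Suc j)) d p)) (?s x) = ?s (bypass i (Suc i) ((!) p) x)"
      by (rule bypass_map[OF inj_shift_index]) (use that l assms in \<open>auto simp: nth_insert_shift\<close>)
    then show ?thesis by (simp only: fix_i)
  qed
  { fix x assume "x < length (cap_matching i p)"
    then have x: "x < k" using l by simp
    have n: "bypass i (Suc i) ((!) p) (shift_index i 2 x) = shift_index i 2 (cap_matching i p ! x)"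
      using nth_cap[OF assms(1), of i x] x assms by simp
    have sx: "shift_index i 2 x < k + 2" using x by (simp add: shift_index_def)
    have "bypass i (Suc i) ((!) (insert_matching (Suc (Suc j)) d p)) (shift_index i 2 (shift_index j (length d) x))
      = shift_index i 2 (shift_index j (length d) (cap_matching i p ! x))"
      using nth[OF sx] assms(2) by (simp add: shift_shift[of i j 2, symmetric] n)
    then show "?L ! shift_index j (length d) x = shift_index j (length d) (cap_matching i p ! x)"
      using x l assms by (auto simp add: cap_matching_nth shift_index_def Let_def split: if_splits) }
  { fix x assume x: "x < length d"
    have "shift_index i 2 (j + x) = Suc (Suc j) + x" using assms by (simp add: shift_index_def)
    moreover have "insert_matching (Suc (Suc j)) d p ! (Suc (Suc j) + x) = Suc (Suc j) + d ! x"
      using nth_insert_inside[OF x, of "Suc (Suc j)" p] l assms by simp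
    ultimately show "?L ! (j + x) = j + d ! x"
      using assms x l by (auto simp: cap_matching_nth bypass_def) }
qed

lemma cap_insert_left:
  assumes "matching (k+2) p" "i \<le> j" "j \<le> k" "\<And>x. x < length d \<Longrightarrow> d ! x < length d"
  shows "cap_matching (j + length d) (insert_matching i d p) = insert_matching i d (cap_matching j p)"
proof (rule insert_matching_eqI)
  have l: "length p = k + 2" using assms by (simp add: matching_def)
  then show "i \<le> length (cap_matching j p)" using assms by simp
  show "length (cap_matching (j + length d) (insert_matching i d p)) = length (cap_matching j p) + length d"
    using l by simp
  let ?L = "cap_matching (j + length d) (insert_matching i d p)"
  let ?s = "shift_index i (length d)"
  have fix_i: "?s j = j + length d" "?s (Suc j) = Suc (j + length d)"
    using assms by (auto simp: shift_index_def)
  have nth: "bypass (j + length d) (Suc (j + length d)) ((!) (insert_matching i d p)) (?s x)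
     = ?s (bypass j (Suc j) ((!) p) x)" if "x < k + 2" for x
  proof -
    have "bypass (?s j) (?s (Suc j)) ((!) (insert_matching i d p)) (?s x) = ?s (bypass j (Suc j) ((!) p) x)"
      by (rule bypass_map[OF inj_shift_index]) (use that l assms in \<open>auto simp: nth_insert_shift\<close>)
    then show ?thesis by (simp only: fix_i)
  qed
  { fix x assume "x < length (cap_matching j p)"
    then have x: "x < k" using l by simp
    have n: "bypass j (Suc j) ((!) p) (shift_index j 2 x) = shift_index j 2 (cap_matching j p ! x)"
      using nth_cap[OF assms(1), of j x] x assms by simp
    have sx: "shift_index j 2 x < k + 2" using x by (simp add: shift_index_def)
    have "bypass (j + length d) (Suc (j + length d)) ((!) (insert_matching i d p)) (shift_index (j + length d) 2 (?s x))
      = shift_index (j + length d) 2 (?s (cap_matching j p ! x))"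
      using nth[OF sx] assms(2) by (simp add: shift_shift n)
    then show "?L ! ?s x = ?s (cap_matching j p ! x)"
      using x l assms by (auto simp add: cap_matching_nth shift_index_def Let_def split: if_splits) }
  { fix x assume x: "x < length d"
    have "shift_index (j + length d) 2 (i + x) = i + x" using assms x by (simp add: shift_index_def)
    moreover have "insert_matching i d p ! (i + x) = i + d ! x"
      using nth_insert_inside[OF x] l assms by simp
    ultimately show "?L ! (i + x) = i + d ! x"
      using assms(1-3) assms(4)[OF x] x l by (auto simp: cap_matching_nth bypass_def) }
qed

lemma loop_insert_right:
  assumes "length p = k + 2" "i \<le> j" "j \<le> k"
  shows "insert_matching (Suc (Suc j)) d p ! i = Suc i \<longleftrightarrow> p ! i = Suc i"
  using assms by (auto simp: insert_matching_nth shift_index_def)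

lemma loop_insert_left:
  assumes "length p = k + 2" "i \<le> j" "j \<le> k"
  shows "insert_matching i d p ! (j + length d) = Suc (j + length d) \<longleftrightarrow> p ! j = Suc j"
  using assms by (auto simp: insert_matching_nth shift_index_def)

lemma cap_insert_inside:
  assumes "matching (l+2) d" "matching k p" "j \<le> l" "b \<le> k"
  shows "insert_matching b (cap_matching j d) p = cap_matching (b + j) (insert_matching b d p)"
proof (rule insert_matching_eqI[symmetric])
  have l: "length d = l + 2" "length p = k" using assms by (auto simp: matching_def)
  note md = matchingD[OF assms(1)] and mp = matchingD[OF assms(2)]
  let ?q = "insert_matching b d p"
  show "b \<le> length p" "length (cap_matching (b + j) ?q) = length p + length (cap_matching j d)"
    using l assms by auto
  { fix x assume "x < length p"
    then have x: "x < k" using l by simp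
    have s: "shift_index (b + j) 2 (shift_index b l y) = shift_index b (l + 2) y" for y
      using assms by (auto simp: shift_index_def)
    have "shift_index b (l + 2) (p ! x) \<noteq> b + j" "shift_index b (l + 2) (p ! x) \<noteq> Suc (b + j)"
      using assms by (auto simp: shift_index_def)
    then have "bypass (b + j) (Suc (b + j)) ((!) ?q) (shift_index b (l + 2) x) = shift_index b (l + 2) (p ! x)"
      using nth_insert_shift[of x p b d] l x assms by (simp add: bypass_def)
    then have "bypass (b + j) (Suc (b + j)) ((!) ?q) (shift_index (b + j) 2 (shift_index b l x)) = shift_index b (l + 2) (p ! x)"
      by (simp only: s)
    moreover have "shift_index b l x < length ?q - 2" using x l by (auto simp: shift_index_def)
    ultimately have "cap_matching (b + j) ?q ! shift_index b l x = shift_index b l (p ! x)"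
      using l assms by (simp only: cap_matching_nth Let_def) (auto simp: shift_index_def)
    then show "cap_matching (b + j) ?q ! shift_index b (length (cap_matching j d)) x
         = shift_index b (length (cap_matching j d)) (p ! x)"
      using l by simp }
  { fix x assume "x < length (cap_matching j d)"
    then have x: "x < l" using l by simp
    have s: "shift_index (b + j) 2 (b + y) = b + shift_index j 2 y" for y
      by (auto simp: shift_index_def)
    have "bypass (b + j) (b + Suc j) ((!) ?q) (b + shift_index j 2 x) = b + bypass j (Suc j) ((!) d) (shift_index j 2 x)"
    proof (rule bypass_map)
      fix z assume "z \<in> {j, Suc j, shift_index j 2 x}"
      then have "z < length d" using l assms x by (auto simp: shift_index_def)
      then show "?q ! (b + z) = b + d ! z" using nth_insert_inside l assms by simp
    qed simp
    also have "\<dots> = b + shift_index j 2 (cap_matching j d ! x)"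
      using nth_cap[OF assms(1), of j x] x assms by simp
    finally have "bypass (b + j) (Suc (b + j)) ((!) ?q) (shift_index (b + j) 2 (b + x)) = b + shift_index j 2 (cap_matching j d ! x)"
      by (simp add: s)
    moreover have "b + x < length ?q - 2" using x l assms by auto
    ultimately show "cap_matching (b + j) ?q ! (b + x) = b + cap_matching j d ! x"
      by (simp only: cap_matching_nth Let_def) (auto simp: shift_index_def) }
qed

lemma loop_insert_inside:
  assumes "length d = l + 2" "b \<le> length p" "j \<le> l"
  shows "insert_matching b d p ! (b + j) = Suc (b + j) \<longleftrightarrow> d ! j = Suc j"
  using assms nth_insert_inside[of j d b p] by simp

definition loop_value :: "nat \<Rightarrow> nat list \<Rightarrow> ratA" where
  "loop_value a p = (if p ! a = Suc a then circle_value else 1)"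

lemma bypass_commute:
  assumes "f (f a) = a" "f (f b) = b" "f (f c) = c" "f (f d) = d" "f (f x) = x"
    "a \<noteq> b" "a \<noteq> c" "a \<noteq> d" "b \<noteq> c" "b \<noteq> d" "c \<noteq> d" "x \<notin> {a,b,c,d}"
  shows "bypass a b (bypass c d f) x = bypass c d (bypass a b f) x"
  using assms unfolding bypass_def by (smt (verit) insert_iff)

text \<open>Two caps close equally many circles in either order. Equivalence of the conjunctions and
  of the disjunctions says that equally many of the two propositions hold, the form that
  \<open>if_mult_cong\<close> turns into an equality of products.\<close>

lemma bypass_loops:
  assumes "f (f a) = a" "f (f b) = b" "f (f c) = c" "f (f d) = d"
    "a \<noteq> b" "a \<noteq> c" "a \<noteq> d" "b \<noteq> c" "b \<noteq> d" "c \<noteq> d"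
  shows "f c = d \<and> bypass c d f a = b \<longleftrightarrow> f a = b \<and> bypass a b f c = d"
    "f c = d \<or> bypass c d f a = b \<longleftrightarrow> f a = b \<or> bypass a b f c = d"
  using assms unfolding bypass_def by (smt (verit))+
lemma if_mult_cong:
  assumes "A \<and> B \<longleftrightarrow> C \<and> D" "A \<or> B \<longleftrightarrow> C \<or> D"
  shows "(if A then d else 1) * (if B then d else 1) = (if C then d else 1) * (if D then d else (1::ratA))"
  using assms by auto

lemma
  assumes "matching (k+2+2) p" "i \<le> j" "j \<le> k"
  shows cap_cap: "cap_matching i (cap_matching (Suc (Suc j)) p) = cap_matching j (cap_matching i p)"
    and loop_value_cap_cap: "loop_value (Suc (Suc j)) p * loop_value i (cap_matching (Suc (Suc j)) p)
        = loop_value i p * loop_value j (cap_matching i p)"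
proof -
  let ?s = "shift_index i 2" let ?t = "shift_index (Suc (Suc j)) 2"
  have p2: "matching ((k + 2) + 2) p" using assms by simp
  have l: "length p = k + 4" using assms by (simp add: matching_def)
  note m = matchingD[OF assms(1)]
  have t_fix: "?t i = i" "?t (Suc i) = Suc i" "?s j = Suc (Suc j)" "?s (Suc j) = Suc (Suc (Suc j))" using assms by (auto simp: shift_index_def)
  have mi: "matching (k+2) (cap_matching i p)" and mj: "matching (k+2) (cap_matching (Suc (Suc j)) p)"
    using matching_cap[OF p2, of i] matching_cap[OF p2, of "Suc (Suc j)"] assms by auto
  have ni: "?s (cap_matching i p ! x) = bypass i (Suc i) ((!) p) (?s x)" if "x < k + 2" for x
    using nth_cap[OF assms(1)] that assms by simp
  have nj: "?t (cap_matching (Suc (Suc j)) p ! x) = bypass (Suc (Suc j)) (Suc (Suc (Suc j))) ((!) p) (?t x)" if "x < k + 2" for x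
    using nth_cap[OF assms(1)] that assms by simp
  have A: "?t (bypass i (Suc i) ((!) (cap_matching (Suc (Suc j)) p)) x)
       = bypass i (Suc i) (bypass (Suc (Suc j)) (Suc (Suc (Suc j))) ((!) p)) (?t x)" if "x < k+2" for x
  proof -
    have "bypass (?t i) (?t (Suc i)) (bypass (Suc (Suc j)) (Suc (Suc (Suc j))) ((!) p)) (?t x)
       = ?t (bypass i (Suc i) ((!) (cap_matching (Suc (Suc j)) p)) x)"
      by (rule bypass_map[OF inj_shift_index]) (use nj that assms(2,3) in auto)
    then show ?thesis by (simp only: t_fix)
  qed
  have B: "?s (bypass j (Suc j) ((!) (cap_matching i p)) x)
       = bypass (Suc (Suc j)) (Suc (Suc (Suc j))) (bypass i (Suc i) ((!) p)) (?s x)" if "x < k+2" for x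
  proof -
    have "bypass (?s j) (?s (Suc j)) (bypass i (Suc i) ((!) p)) (?s x)
       = ?s (bypass j (Suc j) ((!) (cap_matching i p)) x)"
      by (rule bypass_map[OF inj_shift_index]) (use ni that assms(2,3) in auto)
    then show ?thesis by (simp only: t_fix)
  qed
  show "cap_matching i (cap_matching (Suc (Suc j)) p) = cap_matching j (cap_matching i p)"
  proof (rule cap_matching_eqI[OF mj])
    show "i \<le> k" using assms by simp
    show "length (cap_matching j (cap_matching i p)) = k" using l by simp
    fix x assume x: "x < k"
    have sx: "?s x < k + 2" "shift_index j 2 x < k + 2" using x by (auto simp: shift_index_def)
    have ss: "?t (?s x) = ?s (shift_index j 2 x)" for x
      using shift_shift[of i j 2 2 x] assms by simp
    have "?t (bypass i (Suc i) ((!) (cap_matching (Suc (Suc j)) p)) (?s x)) =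
       bypass i (Suc i) (bypass (Suc (Suc j)) (Suc (Suc (Suc j))) ((!) p)) (?t (?s x))" by (rule A[OF sx(1)])
    also have "\<dots> = bypass (Suc (Suc j)) (Suc (Suc (Suc j))) (bypass i (Suc i) ((!) p)) (?t (?s x))"
      by (rule bypass_commute) (use m(4) x assms in \<open>auto simp: shift_index_def\<close>)
    also have "\<dots> = ?s (bypass j (Suc j) ((!) (cap_matching i p)) (shift_index j 2 x))"
      using B[OF sx(2)] ss by simp
    also have "\<dots> = ?s (shift_index j 2 (cap_matching j (cap_matching i p) ! x))"
      using nth_cap[OF mi] x assms by simp
    also have "\<dots> = ?t (?s (cap_matching j (cap_matching i p) ! x))" using ss by simp
    finally show "?s (cap_matching j (cap_matching i p) ! x) = bypass i (Suc i) ((!) (cap_matching (Suc (Suc j)) p)) (?s x)"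
      by simp
  qed
  have 1: "cap_matching (Suc (Suc j)) p ! i = Suc i \<longleftrightarrow> bypass (Suc (Suc j)) (Suc (Suc (Suc j))) ((!) p) i = Suc i"
    using nj[of i] t_fix assms shift_index_inj[of "Suc (Suc j)" 2 "cap_matching (Suc (Suc j)) p ! i" "Suc i"] by auto
  have 2: "cap_matching i p ! j = Suc j \<longleftrightarrow> bypass i (Suc i) ((!) p) (Suc (Suc j)) = Suc (Suc (Suc j))"
    using ni[of j] t_fix assms shift_index_inj[of i 2 "cap_matching i p ! j" "Suc j"] by auto
  have 3: "p ! (p ! z) = z" if "z \<in> {i, Suc i, Suc (Suc j), Suc (Suc (Suc j))}" for z
    using m(4) that assms by auto
  note b = bypass_loops[of "(!) p" i "Suc i" "Suc (Suc j)" "Suc (Suc (Suc j))"]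
  show "loop_value (Suc (Suc j)) p * loop_value i (cap_matching (Suc (Suc j)) p)
        = loop_value i p * loop_value j (cap_matching i p)"
    unfolding loop_value_def 1 2 by (rule if_mult_cong) (use b 3 assms in simp_all)
qed

section \<open>Noncrossing matchings\<close>

lemma planar_matching_iff:
  "planar_matching k p \<longleftrightarrow> matching k p \<and> (\<forall>i<k. \<forall>j. i < j \<and> j < p ! i \<longrightarrow> i < p ! j \<and> p ! j < p ! i)"
  (is "?L \<longleftrightarrow> ?R")
proof
  assume L: ?L
  then have m: "matching k p" by (rule planar_imp_matching)
  note mm = matchingD[OF m]
  from L have nc: "\<not> (i < j \<and> j < p ! i \<and> p ! i < p ! j)" if "i < k" "j < k" for i j
    using that by (auto simp: planar_matching_def)
  { fix i j assume i: "i < k" "i < j" "j < p ! i"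
    then have pi: "p ! i < k" "p ! (p ! i) = i" using mm by auto
    then have jk: "j < k" using i(3) by linarith
    then have j: "j < k" "p ! j < k" "p ! (p ! j) = j" using mm by auto
    have "p ! j \<noteq> p ! i" "p ! j \<noteq> i" using j(3) pi i by auto
    moreover have "\<not> p ! i < p ! j" using nc[OF i(1) j(1)] i by auto
    moreover have "\<not> p ! j < i" using nc[OF j(2) i(1)] j i by auto
    ultimately have "i < p ! j \<and> p ! j < p ! i" by auto }
  then show ?R using m by blast
next
  assume ?R
  then show ?L unfolding planar_matching_def matching_def by (meson less_asym)
qed

lemma planar_matchingD:
  assumes "planar_matching k p" "i < k" "i < j" "j < p ! i"
  shows "i < p ! j" "p ! j < p ! i"
  using assms unfolding planar_matching_iff by auto

lemma shift_index_less [simp]: "shift_index a l i < shift_index a l j \<longleftrightarrow> i < j"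
  by (auto simp: shift_index_def)

text \<open>A new arc is the concatenation of two old arcs through the neighbours \<open>a\<close>
  and \<open>b\<close>. The cases are whether the arc of \<open>I\<close> ends at \<open>a\<close>,
  at \<open>b\<close> or at neither; in each of them the old arcs ending at \<open>a\<close> and
  \<open>b\<close> confine the arc of \<open>J\<close>. Keeping \<open>b\<close> as a variable
  reduces its use to its order relation to \<open>a\<close>.\<close>

lemma noncrossing_bypass:
  fixes f :: "nat \<Rightarrow> nat"
  assumes f: "\<And>x. x < k \<Longrightarrow> f x < k" "\<And>x. x < k \<Longrightarrow> f x \<noteq> x" "\<And>x. x < k \<Longrightarrow> f (f x) = x"
    and nc: "\<And>x y. x < k \<Longrightarrow> x < y \<Longrightarrow> y < f x \<Longrightarrow> x < f y" "\<And>x y. x < k \<Longrightarrow> x < y \<Longrightarrow> y < f x \<Longrightarrow> f y < f x"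
    and a: "Suc a < k" "I < k" "J < k" "I \<noteq> a" "I \<noteq> Suc a" "J \<noteq> a" "J \<noteq> Suc a"
    and IJ: "I < J" "J < bypass a b f I"
    and b_def: "b = Suc a"
  shows "I < bypass a b f J \<and> bypass a b f J < bypass a b f I"
proof -
  have ab: "a < k" "b < k" "I \<noteq> b" "J \<noteq> b" "\<And>x. x < b \<longleftrightarrow> x < a \<or> x = a" "\<And>x. a < x \<longleftrightarrow> b < x \<or> x = b" using a by (auto simp: b_def)
  note inv = f(3)[OF ab(1)] f(3)[OF ab(2)] f(3)[OF a(2)] f(3)[OF a(3)]
  note ne = f(2)[OF ab(1)] f(2)[OF ab(2)] f(2)[OF a(2)] f(2)[OF a(3)]
  note lt = f(1)[OF ab(1)] f(1)[OF ab(2)] f(1)[OF a(2)] f(1)[OF a(3)]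
  note ncI = nc[OF a(2)] and nca = nc[OF ab(1)] and ncb = nc[OF ab(2)] and ncfa = nc[OF lt(1)] and ncfb = nc[OF lt(2)]
  consider "f I = a" | "f I = b" | "f I \<noteq> a" "f I \<noteq> b" by blast
  then show ?thesis
  proof cases
    case 1
    have fa: "f a = I" using 1 inv by auto
    have e: "bypass a b f I = f b" using 1 by (simp add: bypass_def)
    have J: "J < f b" using IJ(2) e by simp
    have "I < f J \<and> f J < f b \<and> f J \<noteq> a \<and> f J \<noteq> b"
    proof (cases "I < a")
      case True
      show ?thesis
      proof (cases "J < a")
        case Ja: True
        then have fJ: "I < f J" "f J < a" using ncI[of J] 1 IJ by auto
        have "\<not> f b < a" using ncI[of "f b"] 1 inv J IJ ab by auto
        then show ?thesis using fJ ab(5)[of "f J"] by auto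
      next
        case False
        then have "b < J" using ab a(6) by (metis linorder_neqE_nat)
        then show ?thesis using ncb[of J] J ab(6)[of I] True ab by (metis less_trans nat_neq_iff)
      qed
    next
      case False
      then have I: "b < I" using a(4) ab by (metis linorder_neqE_nat)
      then have fJ: "b < f J" "f J < f b" using ncb[of J] J IJ by auto
      have "\<not> f J < I" using nca[of "f J"] fa inv fJ IJ ab by auto
      moreover have "f J \<noteq> I" using inv 1 a by metis
      ultimately show ?thesis using fJ ab(6)[of "f J"] by auto
    qed
    then have "bypass a b f J = f J" "I < f J" "f J < f b" by (auto simp: bypass_def)
    then show ?thesis using e by simp
  next
    case 2
    have fb: "f b = I" using 2 inv by auto
    have nab: "b \<noteq> a" by (simp add: b_def)
    have e: "bypass a b f I = f a" using 2 nab by (simp add: bypass_def)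
    have J: "J < f a" using IJ(2) e by simp
    have "I < f J \<and> f J < f a \<and> f J \<noteq> a \<and> f J \<noteq> b"
    proof (cases "I < b")
      case True
      then have Ia: "I < a" using a ab by auto
      have "I < f a" "f a < b" using ncI[of a] 2 Ia ab by auto
      then have fa: "f a < a" using ab ne by auto
      have fJ: "I < f J" "f J < b" using ncI[of J] 2 IJ J fa ab(5)[of J] by auto
      have "\<not> f a < f J \<or> f J = a" using ncfa[of "f J"] inv fJ J ab(5)[of "f J"] by auto
      moreover have "f J \<noteq> a" "f J \<noteq> f a" using inv J a by (metis less_irrefl)+
      ultimately show ?thesis using fJ fa by auto
    next
      case False
      then have I: "b < I" "a < I" using ab by (metis linorder_neqE_nat)+
      then have fJ: "a < f J" "f J < f a" using nca[of J] J IJ by auto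
      have "f J \<noteq> b" using 2 inv IJ by (metis less_irrefl)
      then have "b < f J" using fJ ab(6) by auto
      then have "\<not> f J < I" using ncb[of "f J"] fb inv fJ IJ by auto
      moreover have "f J \<noteq> I" using inv 2 ab by metis
      ultimately show ?thesis using fJ \<open>f J \<noteq> b\<close> by auto
    qed
    then have "bypass a b f J = f J" "I < f J" "f J < f a" by (auto simp: bypass_def)
    then show ?thesis using e by simp
  next
    case 3
    have e: "bypass a b f I = f I" using 3 by (simp add: bypass_def)
    have J: "J < f I" using IJ(2) e by simp
    have fJ: "I < f J" "f J < f I" using ncI[of J] IJ J by auto
    have "I < f b \<and> f b < f I" if "f J = a"
      using ncI[of b] fJ that ab(5)[of "f I"] ab(6)[of "f I"] ab(5)[of I] 3 by auto
    moreover have "I < f a \<and> f a < f I" if "f J = b"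
      using ncI[of a] fJ that ab(5)[of "f I"] ab(6)[of "f I"] ab(5)[of I] 3 a by auto
    moreover have "bypass a b f J = (if f J = a then f b else if f J = b then f a else f J)" by (simp add: bypass_def)
    ultimately show ?thesis using e fJ by (simp split: if_splits)
  qed
qed

lemma planar_cap:
  assumes "planar_matching (k+2) p" "a \<le> k" shows "planar_matching k (cap_matching a p)"
  unfolding planar_matching_iff
proof (intro conjI allI impI)
  have m: "matching (k+2) p" using assms planar_imp_matching by blast
  show mq: "matching k (cap_matching a p)" using matching_cap m assms by blast
  let ?q = "cap_matching a p" let ?s = "shift_index a 2"
  fix i j assume i: "i < k" and ij: "i < j \<and> j < ?q ! i"
  then have j: "j < k" using matchingD(2)[OF mq i] by auto
  have n: "?s (?q ! x) = bypass a (Suc a) ((!) p) (?s x)" if "x < k" for x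
    using nth_cap[OF m] that assms(2) by simp
  define I where "I = ?s i" define J where "J = ?s j"
  have IJ: "I < k + 2" "J < k + 2" "I \<noteq> a" "I \<noteq> Suc a" "J \<noteq> a" "J \<noteq> Suc a"
    using i j by (auto simp: I_def J_def shift_index_def)
  have a: "a < k+2" "Suc a < k+2" using assms by auto
  have h: "I < J" "J < bypass a (Suc a) ((!) p) I" using ij n[OF i] shift_index_less[of a 2] unfolding I_def J_def by metis+
  note mm = matchingD(2-4)[OF m]
  note pd = planar_matchingD[OF assms(1)]
  have "I < bypass a (Suc a) ((!) p) J \<and> bypass a (Suc a) ((!) p) J < bypass a (Suc a) ((!) p) I"
    by (rule noncrossing_bypass[of "k+2"]) (use mm pd h IJ a in simp_all)
  then have "?s i < ?s (?q ! j)" "?s (?q ! j) < ?s (?q ! i)" using n[OF i] n[OF j] unfolding I_def J_def by metis+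
  then show "i < ?q ! j" "?q ! j < ?q ! i" by simp_all
qed

lemma cup_index_cases:
  assumes "x < k + 2" "a \<le> k"
  shows "x = a \<or> x = Suc a \<or> (\<exists>y<k. x = shift_index a 2 y)"
proof -
  consider "x < a" | "x = a" | "x = Suc a" | "a + 2 \<le> x" by linarith
  then show ?thesis
  proof cases
    case 1 then show ?thesis using assms by (auto simp: shift_index_def intro!: exI[of _ x])
  next
    case 4 then have "x - 2 < k" "x = shift_index a 2 (x - 2)" using assms by (auto simp: shift_index_def)
    then show ?thesis by blast
  qed auto
qed

lemma planar_cup:
  assumes "planar_matching k p" "a \<le> k" shows "planar_matching (k+2) (cup_matching a p)"
  unfolding planar_matching_iff
proof (intro conjI allI impI)
  have m: "matching k p" using assms planar_imp_matching by blast
  show mq: "matching (k+2) (cup_matching a p)" using matching_cup m assms by blast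
  let ?q = "cup_matching a p" let ?s = "shift_index a 2"
  fix i j assume i: "i < k+2" and ij: "i < j \<and> j < ?q ! i"
  then have j: "j < k+2" using matchingD(2)[OF mq i] by auto
  have l: "length p = k" using m by (simp add: matching_def)
  have nth: "?q ! a = Suc a" "?q ! Suc a = a" "\<And>x. x < k \<Longrightarrow> ?q ! ?s x = ?s (p ! x)" using nth_cup[of a p] assms l by auto
  note cs = cup_index_cases[OF _ assms(2)]
  obtain x where x: "i = ?s x" "x < k" using cs[OF i] nth ij by auto
  have pi: "?q ! i = ?s (p ! x)" using nth x by auto
  from cs[OF j] have "i < ?q ! j \<and> ?q ! j < ?q ! i"
  proof (elim disjE exE conjE)
    fix y assume y: "y < k" "j = ?s y"
    then have "x < p ! y" "p ! y < p ! x" using planar_matchingD[OF assms(1) x(2), of y] ij x y pi by auto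
    then show ?thesis using y nth x by auto
  qed (use ij x pi nth in \<open>auto simp: shift_index_def split: if_splits\<close>)
  then show "i < ?q ! j" "?q ! j < ?q ! i" by simp_all
qed

text \<open>The point next to the left end of a long arc belongs to an arc strictly inside it.
  Descending to shorter arcs ends at two neighbours.\<close>

lemma planar_short_arc:
  assumes "planar_matching k p" "i < k" "i < p ! i"
  shows "\<exists>j. i \<le> j \<and> Suc j \<le> p ! i \<and> p ! j = Suc j"
  using assms(2,3)
proof (induction "p ! i - i" arbitrary: i rule: less_induct)
  case less
  show ?case
  proof (cases "p ! i = Suc i")
    case False
    then have j: "i < Suc i" "Suc i < p ! i" using less.prems by auto
    note m = matchingD[OF planar_imp_matching[OF assms(1)]]
    have r: "i < p ! Suc i" "p ! Suc i < p ! i" using planar_matchingD[OF assms(1) less.prems(1) j] by auto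
    have k: "Suc i < k" using j m(2)[OF less.prems(1)] by auto
    then have "Suc i < p ! Suc i" using r(1) m(3)[OF k] by auto
    moreover have "p ! Suc i - Suc i < p ! i - i" using r j by linarith
    ultimately obtain x where "Suc i \<le> x" "Suc x \<le> p ! Suc i" "p ! x = Suc x"
      using less.hyps[OF _ k] by blast
    then show ?thesis using r by (intro exI[of _ x]) auto
  qed auto
qed

lemma cup_cap_restore:
  assumes "matching (k+2) p" "a \<le> k" "p ! a = Suc a"
  shows "cup_matching a (cap_matching a p) = p"
proof (rule insert_matching_eqI[symmetric])
  have l: "length p = k + 2" using assms by (simp add: matching_def)
  then show "a \<le> length (cap_matching a p)" "length p = length (cap_matching a p) + length [Suc 0, 0]" using assms by auto
  have b: "p ! Suc a = a" using matchingD(4)[OF assms(1), of a] assms by simp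
  { fix i assume "i < length (cap_matching a p)"
    then have i: "i < k" using l by simp
    have "shift_index a 2 (cap_matching a p ! i) = bypass a (Suc a) ((!) p) (shift_index a 2 i)"
      using nth_cap[OF assms(1)] i assms by simp
    also have "\<dots> = p ! shift_index a 2 i"
      using matchingD(4)[OF assms(1), of "shift_index a 2 i"] assms(3) b i by (auto simp: bypass_def shift_index_def split: if_splits)
    finally show "p ! shift_index a (length [Suc 0, 0]) i = shift_index a (length [Suc 0, 0]) (cap_matching a p ! i)"
      by (simp add: numeral_2_eq_2) }
  { fix i assume "i < length [Suc 0, 0]"
    then show "p ! (a + i) = a + [Suc 0, 0] ! i" using b assms(3) by (auto simp: less_Suc_eq) }
qed

lemma planar_matching_0 [simp]: "planar_matching 0 p \<longleftrightarrow> p = []"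
  by (auto simp: planar_matching_def)

text \<open>The induction principle for planar matchings: removing an innermost arc shows that each
  of them is built from the empty one by cups.\<close>

lemma planar_matching_cases:
  assumes "planar_matching k p"
  obtains "k = 0" "p = []" | l a p' where "k = l + 2" "a \<le> l" "planar_matching l p'" "p = cup_matching a p'" "p ! a = Suc a"
proof (cases "k = 0")
  case False
  note m = matchingD[OF planar_imp_matching[OF assms]]
  have "0 < p ! 0" using m(3)[of 0] False by auto
  then obtain j where j: "p ! j = Suc j" "Suc j \<le> p ! 0" using planar_short_arc[OF assms, of 0] False by auto
  then have k: "Suc j < k" using m(2)[of 0] False by auto
  define l where "l = k - 2"
  have l: "k = l + 2" "j \<le> l" using k by (auto simp: l_def)
  show thesis
  proof (rule that(2)[OF l])
    show "planar_matching l (cap_matching j p)" using planar_cap assms l by blast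
    show "p = cup_matching j (cap_matching j p)" using cup_cap_restore[OF _ l(2) j(1)] planar_imp_matching assms l by simp
  qed (rule j)
qed (use assms that in auto)

text \<open>Inserting an arc between neighbours shifts other points by two or not at all, so the
  parities survive. This is the source of the condition in \<open>alternating\<close>.\<close>

lemma planar_parity:
  assumes "planar_matching k p" "i < k" shows "odd (i + p ! i)"
  using assms
proof (induction k arbitrary: p i rule: less_induct)
  case (less k)
  from less.prems(1) show ?case
  proof (cases rule: planar_matching_cases)
    case (2 l a p')
    have l: "length p' = l" using 2 by (simp add: planar_matching_def)
    have par: "even (shift_index a 2 x) \<longleftrightarrow> even x" for x by (auto simp: shift_index_def)
    note cs = cup_index_cases[OF _ 2(2)]
    from cs[of i] show ?thesis using less.prems(2) 2 less.IH[of l p'] nth_cup[of a p'] l par by auto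
  qed (use less in auto)
qed

text \<open>An arc between two bottom points would contain a short one, so every bottom point is
  joined to the top. Noncrossing then makes the partners strictly decreasing, which leaves only the
  identity diagram.\<close>

lemma bottom_short_arc:
  assumes "planar_matching (2 * m) p" "\<And>i. Suc i < m \<Longrightarrow> p ! i \<noteq> Suc i" "i < m"
  shows "p ! i = 2 * m - 1 - i"
proof -
  note mt = planar_imp_matching[OF assms(1)]
  note mm = matchingD[OF mt]
  have top: "m \<le> p ! i" if "i < m" for i
  proof (rule ccontr)
    assume n: "\<not> m \<le> p ! i"
    define x where "x = min i (p ! i)"
    have x: "x < m" "x < p ! x" "p ! x < m" using n that mm(3)[of i] mm(4)[of i] by (auto simp: x_def min_def)
    then obtain j where "p ! j = Suc j" "Suc j \<le> p ! x" using planar_short_arc[OF assms(1), of x] by auto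
    then show False using assms(2)[of j] x by auto
  qed
  have dec: "p ! j < p ! i" if "i < j" "j < m" for i j
    using planar_matchingD(2)[OF assms(1), of i j] top[of i] that by auto
  \<comment> \<open>A strictly decreasing sequence of \<open>m\<close> values among the
    \<open>m\<close> top positions is squeezed from both sides.\<close>
  have lo: "p ! (m - 1 - d) \<ge> m + d" if "d < m" for d
    using that
  proof (induction d)
    case (Suc d)
    have "p ! (m - 1 - d) < p ! (m - 1 - Suc d)" by (rule dec) (use Suc.prems in auto)
    then show ?case using Suc by auto
  qed (use top[of "m-1"] in auto)
  have hi: "p ! d \<le> 2 * m - 1 - d" if "d < m" for d
    using that
  proof (induction d)
    case (Suc d)
    have "p ! Suc d < p ! d" by (rule dec) (use Suc.prems in auto)
    then show ?case using Suc by auto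
  qed (use mm(2)[of 0] in auto)
  show ?thesis using lo[of "m - 1 - i"] hi[of i] assms(3) by auto
qed

section \<open>Linear operations on skein elements\<close>

abbreviation lookup :: "skein \<Rightarrow> nat list \<Rightarrow> ratA" where "lookup \<equiv> Poly_Mapping.lookup"
abbreviation basis :: "nat list \<Rightarrow> skein" where "basis p \<equiv> Poly_Mapping.single p 1"

lemma lookup_smul [simp]: "lookup (smul c v) p = c * lookup v p"
  by (auto simp: smul_def Poly_Mapping.map.rep_eq when_def)

lemma smul_simps [simp]: "smul 0 v = 0" "smul c 0 = 0" "smul 1 v = v" "smul c (smul d v) = smul (c * d) v"
  by (auto intro!: poly_mapping_eqI simp: mult.assoc)

lemma smul_add: "smul c (u + v) = smul c u + smul c v" "smul (c + d) v = smul c v + smul d v"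
  by (auto intro!: poly_mapping_eqI simp: lookup_add algebra_simps)

lemma smul_minus: "smul c (- v) = - smul c v" "smul (- c) v = - smul c v"
  "smul (c - d) v = smul c v - smul d v"
  by (rule poly_mapping_eqI, simp add: lookup_minus left_diff_distrib)+

lemma smul_sum: "smul c (\<Sum>i\<in>I. f i) = (\<Sum>i\<in>I. smul c (f i))"
  by (auto intro!: poly_mapping_eqI simp: lookup_sum sum_distrib_left)

lemma smul_sum_left: "smul (\<Sum>i\<in>I. c i) v = (\<Sum>i\<in>I. smul (c i) v)"
  by (auto intro!: poly_mapping_eqI simp: lookup_sum sum_distrib_right)

lemma single_eq_smul: "Poly_Mapping.single p c = smul c (basis p)"
  by (auto intro!: poly_mapping_eqI simp: lookup_single when_def)

definition lin :: "(skein \<Rightarrow> skein) \<Rightarrow> bool" where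
  "lin F \<longleftrightarrow> (\<forall>u v. F (u + v) = F u + F v) \<and> (\<forall>c v. F (smul c v) = smul c (F v))"

lemma linD:
  assumes "lin F"
  shows "F (u + v) = F u + F v" "F (smul c v) = smul c (F v)" "F 0 = 0" "F (- v) = - F v" "F (u - v) = F u - F v"
proof -
  show a: "F (u + v) = F u + F v" for u v using assms by (simp add: lin_def)
  show s: "F (smul c v) = smul c (F v)" for c v using assms by (simp add: lin_def)
  show "F 0 = 0" using s[of 0 0] by simp
  show n: "F (- v) = - F v" for v using s[of "-1" v] by (simp add: smul_minus)
  show "F (u - v) = F u - F v" using a[of u "-v"] n by simp
qed

lemma lin_sum: "lin F \<Longrightarrow> F (\<Sum>i\<in>I. f i) = (\<Sum>i\<in>I. F (f i))"
  by (induction I rule: infinite_finite_induct) (simp_all add: linD)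

lemma lin_ident: "lin (\<lambda>v. v)" by (simp add: lin_def)
lemma lin_comp: "lin F \<Longrightarrow> lin G \<Longrightarrow> lin (\<lambda>v. F (G v))" by (simp add: lin_def)
lemma lin_plus: "lin F \<Longrightarrow> lin G \<Longrightarrow> lin (\<lambda>v. F v + G v)"
  by (simp add: lin_def smul_add add_ac)
lemma lin_smul: "lin F \<Longrightarrow> lin (\<lambda>v. smul c (F v))"
  by (simp add: lin_def smul_add mult.commute)
lemma lin_sum_fun: "(\<And>i. i \<in> I \<Longrightarrow> lin (F i)) \<Longrightarrow> lin (\<lambda>v. \<Sum>i\<in>I. F i v)"
  by (simp add: lin_def sum.distrib smul_sum)

text \<open>The supports of two vectors and of their sum differ; over a common superset their images
  can be added term by term.\<close>

lemma lin_ext_superset: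
  assumes "finite S" "Poly_Mapping.keys v \<subseteq> S"
  shows "lin_ext f v = (\<Sum>p\<in>S. smul (lookup v p) (f p))"
  unfolding lin_ext_def by (rule sum.mono_neutral_left) (use assms in \<open>auto simp: in_keys_iff\<close>)

lemma lin_lin_ext: "lin (lin_ext f)"
  unfolding lin_def
proof (intro conjI allI)
  fix u v :: skein and c
  let ?S = "Poly_Mapping.keys u \<union> Poly_Mapping.keys v"
  have "lin_ext f w = (\<Sum>p\<in>?S. smul (lookup w p) (f p))" if "Poly_Mapping.keys w \<subseteq> ?S" for w
    by (rule lin_ext_superset) (use that in auto)
  then show "lin_ext f (u + v) = lin_ext f u + lin_ext f v"
    using Poly_Mapping.keys_add[of u v] by (simp add: lookup_add smul_add sum.distrib)
  have "Poly_Mapping.keys (smul c v) \<subseteq> Poly_Mapping.keys v" by (auto simp: in_keys_iff)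
  then have "lin_ext f (smul c v) = (\<Sum>p\<in>Poly_Mapping.keys v. smul (lookup (smul c v) p) (f p))"
    by (intro lin_ext_superset) auto
  then show "lin_ext f (smul c v) = smul c (lin_ext f v)"
    by (simp add: lin_ext_def smul_sum)
qed

lemma lin_ext_basis [simp]: "lin_ext f (basis p) = f p"
  by (simp add: lin_ext_def)

lemma skein_expand: "v = (\<Sum>p\<in>Poly_Mapping.keys v. smul (lookup v p) (basis p))"
  by (rule poly_mapping_eqI) (auto simp: lookup_sum lookup_single when_def in_keys_iff if_distrib[of "\<lambda>x. _ * x"] cong: if_cong)

lemma lin_eqI:
  assumes "lin F" "lin G" "\<And>p. F (basis p) = G (basis p)"
  shows "F v = G v"
proof -
  have "F v = (\<Sum>p\<in>Poly_Mapping.keys v. smul (lookup v p) (F (basis p)))"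
    by (subst skein_expand) (simp add: lin_sum[OF assms(1)] linD[OF assms(1)])
  also have "\<dots> = G v"
    by (subst (5) skein_expand) (simp add: lin_sum[OF assms(2)] linD[OF assms(2)] assms(3))
  finally show ?thesis .
qed

definition proj :: "nat \<Rightarrow> skein \<Rightarrow> skein" where
  "proj k = lin_ext (\<lambda>p. if planar_matching k p then basis p else 0)"

text \<open>On lists that are not planar matchings, the operations on skein elements give junk. Composed with
  \<open>proj\<close>, they satisfy the Temperley-Lieb relations without assumptions on the argument.\<close>

definition capk :: "nat \<Rightarrow> nat \<Rightarrow> skein \<Rightarrow> skein" where
  "capk k a v = cap_skein a (proj (Suc (Suc k)) v)"

definition cupk :: "nat \<Rightarrow> nat \<Rightarrow> skein \<Rightarrow> skein" where
  "cupk k a v = cup_skein a (proj k v)"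

definition insk :: "nat \<Rightarrow> nat \<Rightarrow> nat \<Rightarrow> skein \<Rightarrow> skein \<Rightarrow> skein" where
  "insk l k b f v = insert_skein b (proj l f) (proj k v)"

lemma lin_proj: "lin (proj k)" by (simp add: proj_def lin_lin_ext)
lemma lin_cap_skein: "lin (cap_skein a)" by (simp add: cap_skein_def lin_lin_ext)
lemma lin_insert_skein1: "lin (\<lambda>f. insert_skein b f v)" by (simp add: insert_skein_def lin_lin_ext)
lemma lin_insert_skein2: "lin (insert_skein b f)"
  unfolding insert_skein_def lin_ext_def[of _ f]
  by (intro lin_sum_fun lin_smul lin_lin_ext)
lemma lin_cup_skein: "lin (cup_skein a)" by (simp add: cup_skein_def lin_insert_skein2)

lemma lin_capk: "lin (capk k a)" unfolding capk_def[abs_def] by (rule lin_comp[OF lin_cap_skein lin_proj])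
lemma lin_cupk: "lin (cupk k a)" unfolding cupk_def[abs_def] by (rule lin_comp[OF lin_cup_skein lin_proj])
lemma lin_insk1: "lin (\<lambda>f. insk l k b f v)" unfolding insk_def
  by (rule lin_comp[OF lin_insert_skein1 lin_proj])
lemma lin_insk2: "lin (insk l k b f)" unfolding insk_def[abs_def] by (rule lin_comp[OF lin_insert_skein2 lin_proj])

lemmas lin_intros = lin_ident lin_plus lin_smul lin_sum_fun lin_comp[OF lin_proj] lin_comp[OF lin_capk] lin_comp[OF lin_cupk]
  lin_comp[OF lin_insk1] lin_comp[OF lin_insk2] lin_proj lin_capk lin_cupk lin_insk2
lemmas lin_simps = linD[OF lin_proj] linD[OF lin_capk] linD[OF lin_cupk] linD[OF lin_insk1] linD[OF lin_insk2]

lemma insert_skein_basis [simp]: "insert_skein b (basis d) (basis p) = basis (insert_matching b d p)"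
  by (simp add: insert_skein_def)

lemma cup_skein_basis [simp]: "cup_skein a (basis p) = basis (cup_matching a p)"
  by (simp add: cup_skein_def)

lemma cap_skein_basis [simp]: "cap_skein a (basis p) = smul (loop_value a p) (basis (cap_matching a p))"
  by (simp add: cap_skein_def loop_value_def single_eq_smul[of _ circle_value])

lemma proj_basis: "proj k (basis p) = (if planar_matching k p then basis p else 0)"
  by (simp add: proj_def)

lemma capk_basis: "capk k a (basis p) =
  (if planar_matching (Suc (Suc k)) p then smul (loop_value a p) (basis (cap_matching a p)) else 0)"
  by (simp add: capk_def proj_basis linD[OF lin_cap_skein])

lemma cupk_basis: "cupk k a (basis p) = (if planar_matching k p then basis (cup_matching a p) else 0)"
  by (simp add: cupk_def proj_basis linD[OF lin_cup_skein])

lemma insk_basis: "insk l k b (basis d) (basis p) =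
   (if planar_matching l d \<and> planar_matching k p then basis (insert_matching b d p) else 0)"
  using linD(3)[OF lin_insert_skein1] by (simp add: insk_def proj_basis linD(3)[OF lin_insert_skein2])

lemma planar_cap': "planar_matching (Suc (Suc k)) p \<Longrightarrow> a \<le> k \<Longrightarrow> planar_matching k (cap_matching a p)"
  using planar_cap by simp
lemma planar_cup': "planar_matching k p \<Longrightarrow> a \<le> k \<Longrightarrow> planar_matching (Suc (Suc k)) (cup_matching a p)"
  using planar_cup by simp
lemma planar_length: "planar_matching k p \<Longrightarrow> length p = k" by (simp add: planar_matching_def)

text \<open>The inserted matching arises from the empty one by cups, and a cup may as well be added
  after the rest has been inserted into \<open>p\<close>.\<close>

lemma planar_insert: "planar_matching l d \<Longrightarrow> planar_matching k p \<Longrightarrow> b \<le> k \<Longrightarrow> planar_matching (k + l) (insert_matching b d p)"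
proof (induction l arbitrary: d rule: less_induct)
  case (less l)
  from less.prems(1) show ?case
  proof (cases rule: planar_matching_cases)
    case (2 m a d')
    have "planar_matching (k + m) (insert_matching b d' p)" by (rule less.IH) (use 2 less.prems in auto)
    then have "planar_matching (Suc (Suc (k + m))) (cup_matching (b + a) (insert_matching b d' p))"
      by (rule planar_cup') (use 2 less.prems in auto)
    moreover have "insert_matching b d p = cup_matching (b + a) (insert_matching b d' p)"
      unfolding 2(4) by (rule insert_cup_inside) (use 2 less.prems planar_length in auto)
    ultimately show ?thesis using 2 by simp
  qed (use less in auto)
qed

lemma proj_proj [simp]: "proj k (proj k v) = proj k v"
  by (rule lin_eqI[where v = v]) (auto intro!: lin_intros simp: proj_basis lin_simps)

lemma proj_capk [simp]: "a \<le> k \<Longrightarrow> proj k (capk k a v) = capk k a v"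
  by (rule lin_eqI[where v = v]) (auto intro!: lin_intros simp: proj_basis lin_simps capk_basis planar_cap')

lemma capk_proj [simp]: "capk k a (proj (Suc (Suc k)) v) = capk k a v"
  by (simp add: capk_def)

lemma proj_cupk [simp]: "a \<le> k \<Longrightarrow> proj (Suc (Suc k)) (cupk k a v) = cupk k a v"
  by (rule lin_eqI[where v = v]) (auto intro!: lin_intros simp: proj_basis lin_simps cupk_basis planar_cup')

lemma cupk_proj [simp]: "cupk k a (proj k v) = cupk k a v"
  by (simp add: cupk_def)

lemma insk_proj [simp]: "insk l k b (proj l f) v = insk l k b f v" "insk l k b f (proj k v) = insk l k b f v"
  by (simp_all add: insk_def)

section \<open>Temperley-Lieb relations for the projected operators\<close>

lemma capk_cupk_same: "a \<le> k \<Longrightarrow> capk k a (cupk k a v) = smul circle_value (proj k v)"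
  by (rule lin_eqI[where v = v])
    (auto intro!: lin_intros simp: proj_basis lin_simps capk_basis cupk_basis planar_cup' cap_cup_same planar_length
      loop_value_def nth_cup)

lemma capk_cupk_right: "Suc a \<le> k \<Longrightarrow> capk k a (cupk k (Suc a) v) = proj k v"
proof (rule lin_eqI[where v = v])
  fix p assume a: "Suc a \<le> k"
  have "loop_value a (cup_matching (Suc a) p) = 1" if "planar_matching k p"
    using that a planar_length[OF that] by (auto simp: loop_value_def insert_matching_nth shift_index_def split: if_splits)
  then show "capk k a (cupk k (Suc a) (basis p)) = proj k (basis p)"
    using a by (auto simp: proj_basis lin_simps capk_basis cupk_basis planar_cup' cap_cup_right[of k] planar_imp_matching)
qed (auto intro!: lin_intros)

lemma capk_cupk_left: "Suc a \<le> k \<Longrightarrow> capk k (Suc a) (cupk k a v) = proj k v"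
proof (rule lin_eqI[where v = v])
  fix p assume a: "Suc a \<le> k"
  have "loop_value (Suc a) (cup_matching a p) = 1" if "planar_matching k p"
    using that a planar_length[OF that] by (auto simp: loop_value_def insert_matching_nth shift_index_def split: if_splits)
  then show "capk k (Suc a) (cupk k a (basis p)) = proj k (basis p)"
    using a by (auto simp: proj_basis lin_simps capk_basis cupk_basis planar_cup' cap_cup_left[of k] planar_imp_matching)
qed (auto intro!: lin_intros)

lemma capk_capk: "i \<le> j \<Longrightarrow> j \<le> k \<Longrightarrow> capk k i (capk (Suc (Suc k)) (Suc (Suc j)) v) = capk k j (capk (Suc (Suc k)) i v)"
proof (rule lin_eqI[where v = v])
  fix p assume a: "i \<le> j" "j \<le> k"
  then show "capk k i (capk (Suc (Suc k)) (Suc (Suc j)) (basis p)) = capk k j (capk (Suc (Suc k)) i (basis p))"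
  proof (cases "planar_matching (k+2+2) p")
    case True
    note m = planar_imp_matching[OF True]
    have "planar_matching (Suc (Suc k)) (cap_matching (Suc (Suc j)) p)" "planar_matching (Suc (Suc k)) (cap_matching i p)"
      by (rule planar_cap'; use True a in simp)+
    then show ?thesis using True cap_cap[OF m a] loop_value_cap_cap[OF m a]
      by (simp add: lin_simps capk_basis)
  qed (simp add: lin_simps capk_basis)
qed (auto intro!: lin_intros)

lemma cupk_cupk: "i \<le> j \<Longrightarrow> j \<le> k \<Longrightarrow> cupk (Suc (Suc k)) (Suc (Suc j)) (cupk k i v) = cupk (Suc (Suc k)) i (cupk k j v)"
  by (rule lin_eqI[where v = v])
    (auto intro!: lin_intros simp: lin_simps cupk_basis planar_cup' cup_cup planar_length)

lemma capk_cupk_far1: "i \<le> j \<Longrightarrow> j \<le> k \<Longrightarrow> capk (Suc (Suc k)) i (cupk (Suc (Suc k)) (Suc (Suc j)) v) = cupk k j (capk k i v)"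
proof (rule lin_eqI[where v = v])
  fix p assume a: "i \<le> j" "j \<le> k"
  then show "capk (Suc (Suc k)) i (cupk (Suc (Suc k)) (Suc (Suc j)) (basis p)) = cupk k j (capk k i (basis p))"
  proof (cases "planar_matching (Suc (Suc k)) p")
    case True
    have m: "matching (k+2) p" using planar_imp_matching[OF True] by simp
    have l: "length p = k + 2" using planar_length[OF True] by simp
    have "planar_matching k (cap_matching i p)" "planar_matching (Suc (Suc (Suc (Suc k)))) (cup_matching (Suc (Suc j)) p)"
      using planar_cap'[OF True] planar_cup'[OF True] a by auto
    then show ?thesis using True cap_insert_right[OF m a] loop_insert_right[OF l a]
      by (simp add: lin_simps capk_basis cupk_basis loop_value_def)
  qed (simp add: lin_simps capk_basis cupk_basis)
qed (auto intro!: lin_intros)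

lemma capk_cupk_far2: "i \<le> j \<Longrightarrow> j \<le> k \<Longrightarrow> capk (Suc (Suc k)) (Suc (Suc j)) (cupk (Suc (Suc k)) i v) = cupk k i (capk k j v)"
proof (rule lin_eqI[where v = v])
  fix p assume a: "i \<le> j" "j \<le> k"
  then show "capk (Suc (Suc k)) (Suc (Suc j)) (cupk (Suc (Suc k)) i (basis p)) = cupk k i (capk k j (basis p))"
  proof (cases "planar_matching (Suc (Suc k)) p")
    case True
    have m: "matching (k+2) p" using planar_imp_matching[OF True] by simp
    have l: "length p = k + 2" using planar_length[OF True] by simp
    have "planar_matching k (cap_matching j p)" "planar_matching (Suc (Suc (Suc (Suc k)))) (cup_matching i p)"
      using planar_cap'[OF True] planar_cup'[OF True] a by auto
    moreover have "cap_matching (Suc (Suc j)) (cup_matching i p) = cup_matching i (cap_matching j p)"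
    proof -
      have "x < length [Suc 0, 0] \<Longrightarrow> [Suc 0, 0] ! x < length [Suc 0, 0]" for x by (auto simp: less_Suc_eq)
      from cap_insert_left[OF m a, of "[Suc 0, 0]", OF this] show ?thesis by simp
    qed
    ultimately show ?thesis using True loop_insert_left[OF l a, of "[Suc 0, 0]"]
      by (simp add: lin_simps capk_basis cupk_basis loop_value_def)
  qed (simp add: lin_simps capk_basis cupk_basis)
qed (auto intro!: lin_intros)

lemma lin_eqI2:
  assumes "\<And>v. lin (\<lambda>f. F f v)" "\<And>v. lin (\<lambda>f. G f v)" "\<And>f. lin (F f)" "\<And>f. lin (G f)"
    "\<And>d p. F (basis d) (basis p) = G (basis d) (basis p)"
  shows "F f v = G f v"
proof (rule lin_eqI[where F = "\<lambda>f. F f v" and G = "\<lambda>f. G f v"])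
  fix d show "F (basis d) v = G (basis d) v"
    by (rule lin_eqI) (use assms in auto)
qed (use assms in auto)

lemma proj_insk [simp]: "b \<le> k \<Longrightarrow> proj (k + l) (insk l k b f v) = insk l k b f v"
  by (rule lin_eqI2[where f = f and v = v]) (auto intro!: lin_intros simp: insk_basis proj_basis lin_simps planar_insert)

lemma insk_cupk_inside: "b \<le> k \<Longrightarrow> j \<le> l \<Longrightarrow>
   insk (Suc (Suc l)) k b (cupk l j f) v = cupk (k + l) (b + j) (insk l k b f v)"
  by (rule lin_eqI2[where f = f and v = v])
    (auto intro!: lin_intros simp: insk_basis cupk_basis lin_simps planar_insert planar_cup' insert_cup_inside planar_length)

lemma insk_capk_inside: "b \<le> k \<Longrightarrow> j \<le> l \<Longrightarrow>
   insk l k b (capk l j f) v = capk (k + l) (b + j) (insk (Suc (Suc l)) k b f v)"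
proof (rule lin_eqI2[where f = f and v = v])
  fix d p assume a: "b \<le> k" "j \<le> l"
  then show "insk l k b (capk l j (basis d)) (basis p) = capk (k + l) (b + j) (insk (Suc (Suc l)) k b (basis d) (basis p))"
  proof (cases "planar_matching (Suc (Suc l)) d \<and> planar_matching k p")
    case True
    then have t: "planar_matching (Suc (Suc l)) d" "planar_matching k p" by auto
    have m: "matching (l+2) d" "matching k p" using t planar_imp_matching by auto
    have l: "length d = l + 2" "b \<le> length p" using t planar_length a by auto
    have "planar_matching l (cap_matching j d)" "planar_matching (Suc (Suc (k + l))) (insert_matching b d p)"
      using planar_cap'[OF t(1)] planar_insert[OF t a(1)] a by auto
    then show ?thesis using t cap_insert_inside[OF m a(2) a(1)] loop_insert_inside[OF l a(2)]
      by (simp add: lin_simps capk_basis insk_basis loop_value_def)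
  qed (auto simp: lin_simps capk_basis insk_basis)
qed (auto intro!: lin_intros)

lemma insk_cupk_left: "j \<le> b \<Longrightarrow> b \<le> k \<Longrightarrow>
   insk l (Suc (Suc k)) (Suc (Suc b)) f (cupk k j v) = cupk (k + l) j (insk l k b f v)"
  by (rule lin_eqI2[where f = f and v = v])
    (auto intro!: lin_intros simp: insk_basis cupk_basis lin_simps planar_insert planar_cup' insert_cup_left planar_length)

lemma insk_capk_left: "j \<le> b \<Longrightarrow> b \<le> k \<Longrightarrow>
   capk (k + l) j (insk l (Suc (Suc k)) (Suc (Suc b)) f v) = insk l k b f (capk k j v)"
proof (rule lin_eqI2[where f = f and v = v])
  fix d p assume a: "j \<le> b" "b \<le> k"
  then show "capk (k + l) j (insk l (Suc (Suc k)) (Suc (Suc b)) (basis d) (basis p)) = insk l k b (basis d) (capk k j (basis p))"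
  proof (cases "planar_matching l d \<and> planar_matching (Suc (Suc k)) p")
    case True
    then have t: "planar_matching l d" "planar_matching (Suc (Suc k)) p" by auto
    have m: "matching (k+2) p" "length p = k + 2" using planar_imp_matching[OF t(2)] planar_length[OF t(2)] by auto
    have "planar_matching k (cap_matching j p)" "planar_matching (Suc (Suc (k + l))) (insert_matching (Suc (Suc b)) d p)"
      using planar_cap'[OF t(2)] planar_insert[OF t] a by auto
    then show ?thesis using t cap_insert_right[OF m(1) a] loop_insert_right[OF m(2) a]
      by (simp add: lin_simps capk_basis insk_basis loop_value_def)
  qed (auto simp: lin_simps capk_basis insk_basis)
qed (auto intro!: lin_intros)

lemma mem_skein_space_iff: "v \<in> skein_space k \<longleftrightarrow> proj k v = v"
proof
  assume a: "v \<in> skein_space k"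
  have "proj k v = (\<Sum>p\<in>Poly_Mapping.keys v. smul (lookup v p) (basis p))"
    unfolding proj_def lin_ext_def by (rule sum.cong) (use a in \<open>auto simp: skein_space_def\<close>)
  then show "proj k v = v"
    using skein_expand[of v] by simp
next
  assume "proj k v = v"
  moreover have "proj k v \<in> skein_space k"
  proof -
    have "Poly_Mapping.keys (proj k v) \<subseteq> (\<Union>p\<in>Poly_Mapping.keys v. Poly_Mapping.keys (smul (lookup v p) (if planar_matching k p then basis p else 0)))"
      unfolding proj_def lin_ext_def by (rule keys_sum)
    also have "\<dots> \<subseteq> {p. planar_matching k p}"
      by (auto simp: in_keys_iff lookup_single when_def split: if_splits)
    finally show ?thesis by (auto simp: skein_space_def)
  qed
  ultimately show "v \<in> skein_space k" by simp
qed

section \<open>The Jones-Wenzl idempotents\<close>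

abbreviation qA :: ratA where "qA \<equiv> varA ^ 4"

lemma varA_nonzero [simp]: "varA \<noteq> 0"
  by (simp add: varA_def Zero_fract_def eq_fract)

lemma varA_power: "varA ^ n = Fract (monom 1 n) 1"
  by (induction n) (simp_all add: varA_def One_fract_def monom_0 monom_Suc one_pCons)

lemma qA_power_neq_1 [simp]: "0 < m \<Longrightarrow> 1 - qA ^ m \<noteq> 0"
proof
  assume m: "0 < m" and e: "1 - qA ^ m = 0"
  from e have "varA ^ (4 * m) = 1" by (simp add: power_mult)
  then have "monom (1::rat) (4 * m) = 1" by (simp add: varA_power One_fract_def eq_fract)
  then have "degree (monom (1::rat) (4 * m)) = 0" by simp
  then show False using m by (simp add: degree_monom_eq)
qed

text \<open>The quotient [m]/[m+1] of the quantum integers [m] = (A^(2m) - A^(-2m)) / (A^2 -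
  A^(-2)), written so that the factor A^2 is its only part that is not a rational function of
  q.\<close>

definition wenzl_coeff :: "nat \<Rightarrow> ratA" where
  "wenzl_coeff m = varA ^ 2 * (1 - qA ^ m) / (1 - qA ^ Suc m)"

lemma wenzl_coeff_0 [simp]: "wenzl_coeff 0 = 0" by (simp add: wenzl_coeff_def)

lemma wenzl_field_identity:
  fixes a x :: "'a::field"
  assumes "a \<noteq> 0" "1 - a ^ 4 * x \<noteq> 0" "1 - a ^ 4 * (a ^ 4 * x) \<noteq> 0"
  shows "(a ^ 2 * (1 - a ^ 4 * x) / (1 - a ^ 4 * (a ^ 4 * x))) *
    (- (a ^ 2 + inverse a ^ 2) + a ^ 2 * (1 - x) / (1 - a ^ 4 * x)) = - 1"
proof -
  have "- (a ^ 2 + inverse a ^ 2) + a ^ 2 * (1 - x) / (1 - a ^ 4 * x)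
     = - (1 - a ^ 4 * (a ^ 4 * x)) / (a ^ 2 * (1 - a ^ 4 * x))"
    using assms(1,2) by (simp add: field_simps)
  moreover have "a ^ 2 \<noteq> 0" using assms(1) by simp
  ultimately show ?thesis using assms(2,3) by (simp only: times_divide_times_eq) (simp add: divide_eq_eq)
qed

text \<open>The three-term relation [2][m+1] = [m] + [m+2], where -[2] is the value of a circle. It
  is the cancellation that makes Wenzl's recursion kill the new hook.\<close>

lemma wenzl_coeff_Suc: "wenzl_coeff (Suc m) * (circle_value + wenzl_coeff m) = - 1"
  unfolding wenzl_coeff_def circle_value_def
  using wenzl_field_identity[of varA "qA ^ m"] qA_power_neq_1[of "Suc m"] qA_power_neq_1[of "Suc (Suc m)"] by simp

text \<open>Wenzl's recursion, for hooks acting as operators.\<close>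

fun JWop :: "(nat \<Rightarrow> skein \<Rightarrow> skein) \<Rightarrow> nat \<Rightarrow> skein \<Rightarrow> skein" where
  "JWop e 0 v = v"
| "JWop e (Suc m) v = JWop e m v + smul (wenzl_coeff (Suc m)) (JWop e m (e m (JWop e m v)))"

section \<open>Wenzl's recursion over abstract hooks\<close>

lemma lin_JWop: "(\<And>i. i < m \<Longrightarrow> lin (e i)) \<Longrightarrow> lin (JWop e m)"
proof (induction m)
  case 0
  show ?case using lin_ident by simp
next
  case (Suc m)
  then have l: "lin (JWop e m)" "lin (e m)" by auto
  have "lin (\<lambda>v. JWop e m v + smul (wenzl_coeff (Suc m)) (JWop e m (e m (JWop e m v))))"
    by (intro lin_plus lin_smul lin_comp[OF l(1)] lin_comp[OF l(2)] l(1))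
  then show ?case by simp
qed

text \<open>\<open>JWop\<close> is a polynomial in the hooks, so it suffices to intertwine the
  single hooks.\<close>

lemma JWop_transport:
  assumes "lin G" "\<And>i v. i < m \<Longrightarrow> G (e i v) = e' i (G v)"
  shows "G (JWop e m v) = JWop e' m (G v)"
  using assms(2)
proof (induction m arbitrary: v)
  case (Suc m)
  then have "\<And>v. G (JWop e m v) = JWop e' m (G v)" "\<And>v. G (e m v) = e' m (G v)" by auto
  then show ?case by (simp add: linD[OF assms(1)])
qed simp

text \<open>The polynomial has constant term 1, and in every other term some hook is applied first
  to \<open>w\<close>.\<close>

lemma JWop_fixed:
  assumes "\<And>i. i < m \<Longrightarrow> lin (e i)" "\<And>i. i < m \<Longrightarrow> e i w = 0"
  shows "JWop e m w = w"
  using assms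
proof (induction m)
  case (Suc m)
  then have "JWop e m w = w" "lin (JWop e m)" by (auto intro: lin_JWop)
  then show ?case using Suc.prems by (simp add: linD)
qed simp

lemma JWop_absorb:
  assumes "lin G" "\<And>i v. i < m \<Longrightarrow> G (e i v) = 0"
  shows "G (JWop e m v) = G v"
  using assms(2)
proof (induction m arbitrary: v)
  case (Suc m)
  then have "\<And>v. G (JWop e m v) = G v" "\<And>v. G (e m v) = 0" by auto
  then show ?case by (simp add: linD[OF assms(1)])
qed simp

text \<open>The Temperley-Lieb relations for a family of operators. The family is left abstract so
  that the same results hold for the hooks in reverse order, which yields the recursion that adds a
  strand on the left.\<close>

locale hooks =
  fixes e :: "nat \<Rightarrow> skein \<Rightarrow> skein" and N :: nat
  assumes lin_hook: "\<And>i. i < N \<Longrightarrow> lin (e i)"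
    and hook_square: "\<And>i v. i < N \<Longrightarrow> e i (e i v) = smul circle_value (e i v)"
    and hook_up: "\<And>i v. Suc i < N \<Longrightarrow> e i (e (Suc i) (e i v)) = e i v"
    and hook_down: "\<And>i v. Suc i < N \<Longrightarrow> e (Suc i) (e i (e (Suc i) v)) = e (Suc i) v"
    and hook_far: "\<And>i j v. Suc i < j \<Longrightarrow> j < N \<Longrightarrow> e i (e j v) = e j (e i v)"
begin

abbreviation F where "F \<equiv> JWop e"

lemma lin_F: "m \<le> N \<Longrightarrow> lin (F m)"
  by (rule lin_JWop) (auto intro: lin_hook)

lemma F_commute: "m < j \<Longrightarrow> j < N \<Longrightarrow> e j (F m v) = F m (e j v)"
  by (rule JWop_transport) (auto simp: lin_hook hook_far[symmetric])

text \<open>The two claims need each other. The second is a partial trace of the idempotent and,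
  together with \<open>wenzl_coeff_Suc\<close>, cancels the new hook; its next instance uses that
  smaller idempotents are absorbed, which follows from the first. For \<open>m = 0\<close> the
  truncated \<open>m - 1\<close> is again 0 and \<open>wenzl_coeff 0\<close> vanishes.\<close>

lemma F_main:
  "m \<le> N \<Longrightarrow> (\<forall>i<m. \<forall>v. e i (F m v) = 0 \<and> F m (e i v) = 0) \<and>
    (m < N \<longrightarrow> (\<forall>v. e m (F m (e m v)) = smul (circle_value + wenzl_coeff m) (F (m - 1) (e m v))))"
proof (induction m)
  case 0
  then show ?case by (simp add: hook_square)
next
  case (Suc m)
  then have mN: "m < N" "m \<le> N" by auto
  with Suc.IH have K: "\<And>i v. i < m \<Longrightarrow> e i (F m v) = 0" "\<And>i v. i < m \<Longrightarrow> F m (e i v) = 0"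
    and T: "\<And>v. e m (F m (e m v)) = smul (circle_value + wenzl_coeff m) (F (m - 1) (e m v))" by auto
  note lF = linD[OF lin_F[OF mN(2)]] and le = linD[OF lin_hook[OF mN(1)]]
  have left: "F j (F m v) = F m v" if "j \<le> m" for j v
    by (rule JWop_fixed) (use that mN K lin_hook in auto)
  have right: "F m (F j v) = F m v" if "j \<le> m" for j v
    by (rule JWop_absorb) (use that mN K lin_F in auto)
  have c: "wenzl_coeff (Suc m) * (circle_value + wenzl_coeff m) = - 1" by (rule wenzl_coeff_Suc)
  have "e i (F (Suc m) v) = 0 \<and> F (Suc m) (e i v) = 0" if "i < Suc m" for i v
  proof (cases "i < m")
    case True
    then have "lin (e i)" using lin_hook mN by auto
    then show ?thesis using True by (simp add: K linD lF le)
  next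
    case False
    then have [simp]: "i = m" using that by simp
    have x: "F (m - Suc 0) (e m (F m v)) = e m (F m v)"
    proof (cases m)
      case (Suc m')
      then have "F m' (e m (F m v)) = e m (F m' (F m v))" using F_commute[of m' m] mN by simp
      then show ?thesis using left[of m'] Suc by simp
    qed simp
    have "e m (F (Suc m) v) = e m (F m v) + smul (wenzl_coeff (Suc m) * (circle_value + wenzl_coeff m)) (e m (F m v))"
      by (simp add: le T x)
    then have 1: "e m (F (Suc m) v) = 0" unfolding c by (simp add: smul_minus)
    have "F (Suc m) (e m v) = F m (e m v) + smul (wenzl_coeff (Suc m) * (circle_value + wenzl_coeff m)) (F m (e m v))"
      by (simp add: lF T right)
    then have 2: "F (Suc m) (e m v) = 0" unfolding c by (simp add: smul_minus)
    from 1 2 show ?thesis by simp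
  qed
  moreover have "e (Suc m) (F (Suc m) (e (Suc m) v)) = smul (circle_value + wenzl_coeff (Suc m)) (F m (e (Suc m) v))"
    if s: "Suc m < N" for v
  proof -
    have cm: "e (Suc m) (F m w) = F m (e (Suc m) w)" for w using F_commute[of m "Suc m"] s by simp
    have "e (Suc m) (F m (e m (F m (e (Suc m) v)))) = F m (e (Suc m) (e m (e (Suc m) (F m v))))" by (simp add: cm)
    also have "\<dots> = F m (e (Suc m) (F m v))" using hook_down s by simp
    also have "\<dots> = F m (e (Suc m) v)" by (simp add: cm left)
    finally have "e (Suc m) (F m (e m (F m (e (Suc m) v)))) = F m (e (Suc m) v)" .
    moreover have "e (Suc m) (F m (e (Suc m) v)) = smul circle_value (F m (e (Suc m) v))"
      using s by (simp add: cm hook_square lF)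
    ultimately show ?thesis using linD[OF lin_hook[OF s]] by (simp add: smul_add)
  qed
  ultimately show ?case by simp
qed

lemma F_kills: "m \<le> N \<Longrightarrow> i < m \<Longrightarrow> e i (F m v) = 0" "m \<le> N \<Longrightarrow> i < m \<Longrightarrow> F m (e i v) = 0"
  using F_main by auto

end

text \<open>Both operators have constant term 1 and are annihilated by every hook on either side, so
  their product equals each of the two factors.\<close>

lemma JWop_reverse:
  assumes "hooks e N"
  shows "JWop (\<lambda>i. e (N - Suc i)) N v = JWop e N v"
proof -
  interpret hooks e N by fact
  define e' where "e' = (\<lambda>i. e (N - Suc i))"
  interpret r: hooks e' N
  proof
    fix i v assume "Suc i < N"
    then have "N - Suc i = Suc (N - Suc (Suc i))" by simp
    then show "e' i (e' (Suc i) (e' i v)) = e' i v" "e' (Suc i) (e' i (e' (Suc i) v)) = e' (Suc i) v"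
      using \<open>Suc i < N\<close> hook_down[of "N - Suc (Suc i)"] hook_up[of "N - Suc (Suc i)"] by (simp_all add: e'_def)
  next
    fix i j v assume "Suc i < j" "j < N"
    then show "e' i (e' j v) = e' j (e' i v)" using hook_far[of "N - Suc j" "N - Suc i"] by (simp add: e'_def)
  qed (auto simp: e'_def lin_hook hook_square)
  have e: "e i = e' (N - Suc i)" if "i < N" for i using that by (simp add: e'_def)
  have "F N (JWop e' N v) = JWop e' N v"
    by (rule JWop_fixed) (auto simp: lin_hook e r.F_kills r.lin_hook)
  moreover have "F N (JWop e' N v) = F N v"
    by (rule JWop_absorb) (auto simp: lin_F e'_def F_kills)
  ultimately show ?thesis by (simp add: e'_def)
qed

lemma circle_value_nonzero [simp]: "circle_value \<noteq> 0"
  using wenzl_coeff_Suc[of 0] by auto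

section \<open>The idempotents as operators on boundary points\<close>

definition hook :: "nat \<Rightarrow> nat \<Rightarrow> skein \<Rightarrow> skein" where
  "hook k i v = cupk k i (capk k i v)"

lemma lin_hook': "lin (hook k i)"
  unfolding hook_def[abs_def] by (rule lin_comp[OF lin_cupk lin_capk])

lemma hook_proj [simp]: "hook k i (proj (Suc (Suc k)) v) = hook k i v" by (simp add: hook_def)
lemma proj_hook [simp]: "i \<le> k \<Longrightarrow> proj (Suc (Suc k)) (hook k i v) = hook k i v" by (simp add: hook_def)

lemma hooks_at:
  assumes "a + N \<le> Suc k" shows "hooks (\<lambda>i. hook k (a + i)) N"
proof
  fix i v assume i: "i < N"
  show "lin (hook k (a + i))" by (rule lin_hook')
  show "hook k (a + i) (hook k (a + i) v) = smul circle_value (hook k (a + i) v)"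
    using i assms by (simp add: hook_def capk_cupk_same linD[OF lin_cupk])
next
  fix i v assume i: "Suc i < N"
  then have "Suc (a + i) \<le> k" using assms by simp
  then show "hook k (a + i) (hook k (a + Suc i) (hook k (a + i) v)) = hook k (a + i) v"
     "hook k (a + Suc i) (hook k (a + i) (hook k (a + Suc i) v)) = hook k (a + Suc i) v"
    by (simp_all add: hook_def capk_cupk_left capk_cupk_right)
next
  fix i j v assume ij: "Suc i < j" "j < N"
  define k' where "k' = k - 2"
  have k: "k = Suc (Suc k')" using ij assms by (simp add: k'_def)
  define j' where "j' = j - 2"
  have j: "j = Suc (Suc j')" "i \<le> j'" using ij by (simp_all add: j'_def)
  have b: "a + i \<le> a + j'" "a + j' \<le> k'" using ij j k assms by auto
  show "hook k (a + i) (hook k (a + j) v) = hook k (a + j) (hook k (a + i) v)"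
    unfolding j k hook_def add_Suc_right
    by (simp only: capk_cupk_far1[OF b] capk_cupk_far2[OF b] cupk_cupk[OF b] capk_capk[OF b])
qed

text \<open>The idempotent on the \<open>m\<close> strands from \<open>a\<close> on, acting on
  \<open>k\<close> points. There are \<open>m - 1\<close> hooks between \<open>m\<close> strands,
  and \<open>hook k\<close> acts on \<open>k + 2\<close> points, hence the two subtractions. For
  \<open>m\<close> at most 1 only the projection remains.\<close>

definition jw :: "nat \<Rightarrow> nat \<Rightarrow> nat \<Rightarrow> skein \<Rightarrow> skein" where
  "jw k a m v = JWop (\<lambda>i. hook (k - 2) (a + i)) (m - 1) (proj k v)"

lemma lin_jw: "lin (jw k a m)"
  unfolding jw_def[abs_def] by (rule lin_comp[OF _ lin_proj]) (rule lin_JWop, rule lin_hook')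

lemmas lin_jw_simps = linD[OF lin_jw]

lemma jw_proj [simp]: "jw k a m (proj k v) = jw k a m v" by (simp add: jw_def)
lemma jw_0 [simp]: "jw k a 0 v = proj k v" "jw k a (Suc 0) v = proj k v" by (simp_all add: jw_def)

lemma proj_jw [simp]:
  assumes "a + m \<le> k" shows "proj k (jw k a m v) = jw k a m v"
proof (cases "m < 2")
  case True then have "m = 0 \<or> m = 1" by auto
  then show ?thesis by auto
next
  case False
  define k' m' where "k' = k - 2" "m' = m - 2"
  then have k: "k = Suc (Suc k')" "m = Suc (Suc m')" using assms False by auto
  have "proj k (JWop (\<lambda>i. hook k' (a + i)) (Suc m') v) = JWop (\<lambda>i. hook k' (a + i)) (Suc m') (proj k v)" for v
    by (rule JWop_transport) (use assms k in \<open>auto simp: lin_proj\<close>)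
  then show ?thesis by (simp add: jw_def k)
qed

lemma smul_eq_0_iff: "smul c v = 0 \<longleftrightarrow> c = 0 \<or> v = 0"
proof
  assume a: "smul c v = 0"
  have "v = smul (inverse c) (smul c v)" if "c \<noteq> 0" using that by simp
  then show "c = 0 \<or> v = 0" using a by auto
qed auto

text \<open>A cup can be cancelled: capping it off multiplies by the circle value, which is
  invertible. This passes from vanishing hooks to vanishing caps.\<close>

lemma nonzero_via_cup: "i \<le> k \<Longrightarrow> cupk k i (capk k i v) = 0 \<Longrightarrow> capk k i v = 0"
  using capk_cupk_same[of i k "capk k i v"] linD(3)[OF lin_capk, of k i] smul_eq_0_iff
  by simp

lemma cap_jw:
  assumes "Suc i < m" "a + m \<le> Suc (Suc k)" shows "capk k (a + i) (jw (Suc (Suc k)) a m v) = 0"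
proof -
  interpret hooks "\<lambda>i. hook k (a + i)" "m - 1" by (rule hooks_at) (use assms in auto)
  have "hook k (a + i) (jw (Suc (Suc k)) a m v) = 0"
    unfolding jw_def using F_kills(1)[of "m-1" i] assms by simp
  then show ?thesis unfolding hook_def by (intro nonzero_via_cup) (use assms in auto)
qed

lemma jw_cup:
  assumes "Suc i < m" "a + m \<le> Suc (Suc k)" shows "jw (Suc (Suc k)) a m (cupk k (a + i) v) = 0"
proof -
  interpret hooks "\<lambda>i. hook k (a + i)" "m - 1" by (rule hooks_at) (use assms in auto)
  have "jw (Suc (Suc k)) a m (hook k (a + i) (cupk k (a + i) v)) = 0"
    unfolding jw_def using F_kills(2)[of "m-1" i] assms by simp
  moreover have "hook k (a + i) (cupk k (a + i) v) = smul circle_value (cupk k (a + i) v)"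
    using assms by (simp add: hook_def capk_cupk_same linD[OF lin_cupk])
  ultimately have "smul (inverse circle_value) (smul circle_value (jw (Suc (Suc k)) a m (cupk k (a + i) v))) = 0"
    by (simp add: lin_jw_simps)
  then show ?thesis by simp
qed

lemma jw_fixed:
  assumes "\<And>i k'. Suc i < m \<Longrightarrow> k = Suc (Suc k') \<Longrightarrow> capk k' (a + i) w = 0" "a + m \<le> k"
  shows "jw k a m w = proj k w"
  unfolding jw_def
proof (rule JWop_fixed)
  fix i assume i: "i < m - 1"
  then have "k = Suc (Suc (k - 2))" using assms(2) by auto
  then show "hook (k - 2) (a + i) (proj k w) = 0"
    using assms(1)[of i "k - 2"] i by (metis hook_proj hook_def linD(3)[OF lin_cupk] less_diff_conv Suc_eq_plus1)
qed (rule lin_hook')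

text \<open>The dual of \<open>jw_fixed\<close>. Since \<open>G\<close> is any linear map, it
  applies to nested caps, to stacking of diagrams and to the extraction of a coefficient.\<close>

lemma jw_absorb:
  assumes "lin G" "\<And>i k' u. Suc i < m \<Longrightarrow> k = Suc (Suc k') \<Longrightarrow> G (cupk k' (a + i) u) = 0" "a + m \<le> k"
  shows "G (jw k a m v) = G (proj k v)"
  unfolding jw_def
proof (rule JWop_absorb[OF assms(1)])
  fix i u assume i: "i < m - 1"
  then have "k = Suc (Suc (k - 2))" using assms(3) by auto
  then show "G (hook (k - 2) (a + i) u) = 0"
    using assms(2)[of i "k - 2"] i unfolding hook_def by auto
qed

lemma jw_jw_left:
  assumes "a \<le> b" "b + l \<le> a + m" "a + m \<le> k"
  shows "jw k b l (jw k a m v) = jw k a m v"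
proof -
  have "jw k b l (jw k a m v) = proj k (jw k a m v)"
  proof (rule jw_fixed)
    fix i k' assume "Suc i < l" "k = Suc (Suc k')"
    then show "capk k' (b + i) (jw k a m v) = 0"
      using cap_jw[of "b - a + i" m a k'] assms by simp
  qed (use assms in auto)
  then show ?thesis using assms by simp
qed

lemma jw_jw_right:
  assumes "a \<le> b" "b + l \<le> a + m" "a + m \<le> k"
  shows "jw k a m (jw k b l v) = jw k a m v"
proof -
  have "jw k a m (jw k b l v) = jw k a m (proj k v)"
  proof (rule jw_absorb[OF lin_jw])
    fix i k' u assume "Suc i < l" "k = Suc (Suc k')"
    then show "jw k a m (cupk k' (b + i) u) = 0"
      using jw_cup[of "b - a + i" m a k'] assms by simp
  qed (use assms in auto)
  then show ?thesis by simp
qed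

lemma jw_transport:
  assumes "lin G" "a + m \<le> k" "b + m \<le> l"
    "\<And>i k' l' u. Suc i < m \<Longrightarrow> k = Suc (Suc k') \<Longrightarrow> l = Suc (Suc l') \<Longrightarrow> G (hook k' (a + i) u) = hook l' (b + i) (G u)"
    "\<And>u. G (proj k u) = proj l (G u)"
  shows "G (jw k a m v) = jw l b m (G v)"
proof -
  have "G (JWop (\<lambda>i. hook (k - 2) (a + i)) (m - 1) w) = JWop (\<lambda>i. hook (l - 2) (b + i)) (m - 1) (G w)" for w
  proof (rule JWop_transport[OF assms(1)])
    fix i v assume i: "i < m - 1"
    then have "k = Suc (Suc (k - 2))" "l = Suc (Suc (l - 2))" using assms(2,3) by auto
    then show "G (hook (k - 2) (a + i) v) = hook (l - 2) (b + i) (G v)"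
      using assms(4)[of i "k - 2" "l - 2"] i by auto
  qed
  then show ?thesis by (simp add: jw_def assms(5))
qed

lemma cap_hook_left: "j \<le> i \<Longrightarrow> i \<le> k \<Longrightarrow> capk (Suc (Suc k)) j (hook (Suc (Suc k)) (Suc (Suc i)) v) = hook k i (capk (Suc (Suc k)) j v)"
  by (simp add: hook_def capk_cupk_far1 capk_capk)

lemma cap_hook_right: "i \<le> j \<Longrightarrow> j \<le> k \<Longrightarrow> capk (Suc (Suc k)) (Suc (Suc j)) (hook (Suc (Suc k)) i v) = hook k i (capk (Suc (Suc k)) (Suc (Suc j)) v)"
  by (simp add: hook_def capk_cupk_far2 capk_capk)

lemma hook_cup_left: "j \<le> i \<Longrightarrow> i \<le> k \<Longrightarrow> hook (Suc (Suc k)) (Suc (Suc i)) (cupk (Suc (Suc k)) j v) = cupk (Suc (Suc k)) j (hook k i v)"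
  by (simp add: hook_def capk_cupk_far2 cupk_cupk)

lemma hook_cup_right: "i \<le> j \<Longrightarrow> j \<le> k \<Longrightarrow> hook (Suc (Suc k)) i (cupk (Suc (Suc k)) (Suc (Suc j)) v) = cupk (Suc (Suc k)) (Suc (Suc j)) (hook k i v)"
  by (simp add: hook_def capk_cupk_far1 cupk_cupk)

lemma cap_jw_left:
  assumes "j \<le> a" "a + m \<le> k"
  shows "capk k j (jw (Suc (Suc k)) (Suc (Suc a)) m v) = jw k a m (capk k j v)"
proof (rule jw_transport[OF lin_capk])
  fix i k' l' u assume "Suc i < m" "Suc (Suc k) = Suc (Suc k')" "k = Suc (Suc l')"
  then show "capk k j (hook k' (Suc (Suc a) + i) u) = hook l' (a + i) (capk k j u)"
    using cap_hook_left[of j "a + i" l'] assms by simp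
qed (use assms in auto)

lemma cap_jw_right:
  assumes "a + m \<le> j" "j \<le> k"
  shows "capk k j (jw (Suc (Suc k)) a m v) = jw k a m (capk k j v)"
proof (rule jw_transport[OF lin_capk])
  fix i k' l' u assume "Suc i < m" "Suc (Suc k) = Suc (Suc k')" "k = Suc (Suc l')"
  then show "capk k j (hook k' (a + i) u) = hook l' (a + i) (capk k j u)"
    using cap_hook_right[of "a + i" "j - 2" l'] assms by (simp add: Suc_diff_Suc numeral_2_eq_2)
qed (use assms in auto)

lemma cup_jw_left:
  assumes "j \<le> a" "a + m \<le> k"
  shows "jw (Suc (Suc k)) (Suc (Suc a)) m (cupk k j v) = cupk k j (jw k a m v)"
proof (rule jw_transport[OF lin_cupk, symmetric])
  fix i k' l' u assume "Suc i < m" "Suc (Suc k) = Suc (Suc l')" "k = Suc (Suc k')"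
  then show "cupk k j (hook k' (a + i) u) = hook l' (Suc (Suc a) + i) (cupk k j u)"
    using hook_cup_left[of j "a + i" k'] assms by simp
qed (use assms in auto)

lemma cup_jw_right:
  assumes "a + m \<le> j" "j \<le> k"
  shows "jw (Suc (Suc k)) a m (cupk k j v) = cupk k j (jw k a m v)"
proof (rule jw_transport[OF lin_cupk, symmetric])
  fix i k' l' u assume "Suc i < m" "Suc (Suc k) = Suc (Suc l')" "k = Suc (Suc k')"
  then show "cupk k j (hook k' (a + i) u) = hook l' (a + i) (cupk k j u)"
    using hook_cup_right[of "a + i" "j - 2" k'] assms by (simp add: Suc_diff_Suc numeral_2_eq_2)
qed (use assms in auto)

lemma hook_jw_left:
  assumes "i + 2 \<le> a" "a + m \<le> Suc (Suc k)"
  shows "hook k i (jw (Suc (Suc k)) a m v) = jw (Suc (Suc k)) a m (hook k i v)"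
proof -
  define a' where "a' = a - 2"
  then have a: "a = Suc (Suc a')" using assms(1) by simp
  then show ?thesis using assms by (simp add: hook_def cap_jw_left cup_jw_left)
qed

lemma hook_jw_right:
  assumes "a + m \<le> i" "i \<le> k"
  shows "hook k i (jw (Suc (Suc k)) a m v) = jw (Suc (Suc k)) a m (hook k i v)"
  using assms by (simp add: hook_def cap_jw_right cup_jw_right)

lemma jw_commute:
  assumes "a + m \<le> b" "b + l \<le> k"
  shows "jw k a m (jw k b l v) = jw k b l (jw k a m v)"
  by (rule jw_transport[OF lin_jw]) (use assms hook_jw_right in auto)

lemma jw_Suc:
  assumes "a + m \<le> k"
  shows "jw (Suc (Suc k)) a (Suc (Suc m)) v = jw (Suc (Suc k)) a (Suc m) v +
    smul (wenzl_coeff (Suc m)) (jw (Suc (Suc k)) a (Suc m) (hook k (a + m) (jw (Suc (Suc k)) a (Suc m) v)))"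
  using assms by (simp add: jw_def)

lemma JWop_cong: "(\<And>i. i < m \<Longrightarrow> e i = e' i) \<Longrightarrow> JWop e m v = JWop e' m v"
  by (induction m arbitrary: v) simp_all

text \<open>Wenzl's recursion with the new strand on the left, obtained by reversing the order of
  the hooks. Two neighbouring idempotents are both expanded at the strands that face each other, so
  both forms are required.\<close>

lemma jw_Suc_left:
  assumes "a + m \<le> k"
  shows "jw (Suc (Suc k)) a (Suc (Suc m)) v = jw (Suc (Suc k)) (Suc a) (Suc m) v +
    smul (wenzl_coeff (Suc m)) (jw (Suc (Suc k)) (Suc a) (Suc m) (hook k a (jw (Suc (Suc k)) (Suc a) (Suc m) v)))"
proof -
  let ?e = "\<lambda>i. hook k (a + (Suc m - Suc i))"
  have 1: "jw (Suc (Suc k)) (Suc a) (Suc m) w = JWop ?e m (proj (Suc (Suc k)) w)" for w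
  proof -
    have "jw (Suc (Suc k)) (Suc a) (Suc m) w = JWop (\<lambda>i. hook k (Suc a + (m - Suc i))) m (proj (Suc (Suc k)) w)"
      unfolding jw_def using JWop_reverse[OF hooks_at[of "Suc a" m k]] assms by simp
    also have "\<dots> = JWop ?e m (proj (Suc (Suc k)) w)"
    proof (rule JWop_cong)
      fix i assume "i < m"
      then have "Suc a + (m - Suc i) = a + (Suc m - Suc i)" by linarith
      then show "hook k (Suc a + (m - Suc i)) = hook k (a + (Suc m - Suc i))" by (simp only:)
    qed
    finally show ?thesis .
  qed
  have "jw (Suc (Suc k)) a (Suc (Suc m)) v = JWop ?e (Suc m) (proj (Suc (Suc k)) v)"
    unfolding jw_def using JWop_reverse[OF hooks_at[of a "Suc m" k]] assms by simp
  then show ?thesis using assms by (simp add: 1)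
qed

section \<open>Nested cups and caps, and vertices\<close>

text \<open>Each new cup goes innermost, and \<open>ncap\<close> removes the innermost pair first.
  The index \<open>k\<close> counts the points outside the nest: \<open>ncup\<close> leads from
  \<open>k\<close> to \<open>k + 2 * m\<close> points and \<open>ncap\<close> back.\<close>

fun ncup :: "nat \<Rightarrow> nat \<Rightarrow> nat \<Rightarrow> skein \<Rightarrow> skein" where
  "ncup k a 0 v = proj k v"
| "ncup k a (Suc m) v = cupk (k + 2 * m) (a + m) (ncup k a m v)"

fun ncap :: "nat \<Rightarrow> nat \<Rightarrow> nat \<Rightarrow> skein \<Rightarrow> skein" where
  "ncap k a 0 v = proj k v"
| "ncap k a (Suc m) v = ncap k a m (capk (k + 2 * m) (a + m) v)"

lemma lin_ncup: "lin (ncup k a m)"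
proof (induction m)
  case (Suc m)
  show ?case using lin_comp[OF lin_cupk Suc] by simp
qed (simp add: lin_proj)

lemma lin_ncap: "lin (ncap k a m)"
proof (induction m)
  case (Suc m)
  show ?case using lin_comp[OF Suc lin_capk] by simp
qed (simp add: lin_proj)

lemma ncup_proj [simp]: "ncup k a m (proj k v) = ncup k a m v"
  by (induction m) simp_all

lemma proj_ncup [simp]: "a \<le> k \<Longrightarrow> proj (k + 2 * m) (ncup k a m v) = ncup k a m v"
  by (cases m) simp_all

lemma ncap_proj [simp]: "ncap k a m (proj (k + 2 * m) v) = ncap k a m v"
  by (cases m) simp_all

lemma proj_ncap [simp]: "a \<le> k \<Longrightarrow> proj k (ncap k a m v) = ncap k a m v"
  by (induction m arbitrary: v) simp_all

lemma ncup_add: "ncup k a (x + y) v = ncup (k + 2 * x) (a + x) y (ncup k a x v)" if "a \<le> k"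
  using that by (induction y) (simp_all add: add.assoc distrib_left)

lemma ncap_add: "ncap k a (x + y) v = ncap k a x (ncap (k + 2 * x) (a + x) y v)"
  by (induction y arbitrary: v) (simp_all add: add.assoc distrib_left)

lemma ncup_outer: "a \<le> k \<Longrightarrow> ncup k a (Suc m) v = ncup (Suc (Suc k)) (Suc a) m (cupk k a v)"
  using ncup_add[of a k 1 m v] by simp

lemma ncap_outer: "a \<le> k \<Longrightarrow> ncap k a (Suc m) v = capk k a (ncap (Suc (Suc k)) (Suc a) m v)"
  using ncap_add[of k a 1 m v] proj_capk[of a k "ncap (Suc (Suc k)) (Suc a) m v"] by simp

lemma cap_ncup_right: "a \<le> j \<Longrightarrow> j \<le> k \<Longrightarrow>
    capk (k + 2 * m) (j + 2 * m) (ncup (Suc (Suc k)) a m v) = ncup k a m (capk k j v)"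
  by (induction m) (simp_all add: capk_cupk_far2)

lemma cap_ncup_left: "j \<le> a \<Longrightarrow> a \<le> k \<Longrightarrow>
    capk (k + 2 * m) j (ncup (Suc (Suc k)) (Suc (Suc a)) m v) = ncup k a m (capk k j v)"
  by (induction m) (simp_all add: capk_cupk_far1)

lemma ncap_ncup_right: "a \<le> b \<Longrightarrow> b \<le> k \<Longrightarrow>
    ncap (k + 2 * m) (b + 2 * m) l (ncup (k + 2 * l) a m v) = ncup k a m (ncap k b l v)"
proof (induction l arbitrary: v)
  case (Suc l)
  have "capk (k + 2 * m + 2 * l) (b + 2 * m + l) (ncup (Suc (Suc (k + 2 * l))) a m v) = ncup (k + 2 * l) a m (capk (k + 2 * l) (b + l) v)"
    using cap_ncup_right[of a "b + l" "k + 2 * l" m v] Suc.prems by (simp add: ac_simps)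
  then show ?case using Suc by simp
qed simp

lemma ncap_ncup_left: "b \<le> a \<Longrightarrow> a \<le> k \<Longrightarrow>
    ncap (k + 2 * m) b l (ncup (k + 2 * l) (a + 2 * l) m v) = ncup k a m (ncap k b l v)"
proof (induction l arbitrary: v)
  case (Suc l)
  have "capk (k + 2 * m + 2 * l) (b + l) (ncup (Suc (Suc (k + 2 * l))) (Suc (Suc (a + 2 * l))) m v) = ncup (k + 2 * l) (a + 2 * l) m (capk (k + 2 * l) (b + l) v)"
    using cap_ncup_left[of "b + l" "a + 2 * l" "k + 2 * l" m v] Suc.prems by (simp add: ac_simps)
  then show ?case using Suc by simp
qed simp

lemma jw_ncup_right: "a \<le> b \<Longrightarrow> b + l \<le> k \<Longrightarrow> jw (k + 2 * m) (b + 2 * m) l (ncup k a m v) = ncup k a m (jw k b l v)"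
  by (induction m) (simp_all add: cup_jw_left)

lemma jw_ncup_left: "b + l \<le> a \<Longrightarrow> a \<le> k \<Longrightarrow> jw (k + 2 * m) b l (ncup k a m v) = ncup k a m (jw k b l v)"
  by (induction m) (simp_all add: cup_jw_right)

lemma jw_ncap_right: "a \<le> b \<Longrightarrow> b + l \<le> k \<Longrightarrow> ncap k a m (jw (k + 2 * m) (b + 2 * m) l v) = jw k b l (ncap k a m v)"
  by (induction m arbitrary: v) (simp_all add: cap_jw_left)

lemma jw_ncap_left: "b + l \<le> a \<Longrightarrow> a \<le> k \<Longrightarrow> ncap k a m (jw (k + 2 * m) b l v) = jw k b l (ncap k a m v)"
  by (induction m arbitrary: v) (simp_all add: cap_jw_right)

text \<open>The innermost cap meets the left foot of the outermost cup. Straightening this pair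
  leaves two nests of size \<open>m\<close>.\<close>

lemma zigzag_left: "c + m \<le> k \<Longrightarrow> ncap k c m (ncup k (c + m) m v) = proj k v"
proof (induction m arbitrary: v)
  case (Suc m)
  have "ncap k c (Suc m) (ncup k (c + Suc m) (Suc m) v)
      = ncap k c m (capk (k + 2 * m) (c + m) (ncup (Suc (Suc k)) (Suc (Suc (c + m))) m (cupk k (Suc (c + m)) v)))"
    using Suc.prems ncup_outer[of "c + Suc m" k m v] by simp
  also have "\<dots> = ncap k c m (ncup k (c + m) m (capk k (c + m) (cupk k (Suc (c + m)) v)))"
    using Suc.prems by (subst cap_ncup_left) auto
  also have "\<dots> = proj k v" using Suc by (simp add: capk_cupk_right)
  finally show ?case .
qed simp

lemma zigzag_right: "c + m \<le> k \<Longrightarrow> ncap k (c + m) m (ncup k c m v) = proj k v"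
proof (induction m arbitrary: c v)
  case (Suc m)
  have e: "c + Suc m + m = Suc c + 2 * m" by simp
  have "ncap k (c + Suc m) (Suc m) (ncup k c (Suc m) v)
      = ncap k (Suc c + m) m (capk (k + 2 * m) (Suc c + 2 * m) (ncup (Suc (Suc k)) (Suc c) m (cupk k c v)))"
    unfolding ncap.simps e using Suc.prems ncup_outer[of c k m v] by simp
  also have "\<dots> = ncap k (Suc c + m) m (ncup k (Suc c) m (capk k (Suc c) (cupk k c v)))"
    using Suc.prems by (subst cap_ncup_right) auto
  also have "\<dots> = proj k v" using Suc.IH[of "Suc c" v] Suc.prems by (simp add: capk_cupk_left)
  finally show ?case .
qed simp

text \<open>A cup under the right half of a nest slides along the nest and becomes a cap at the
  mirror position of the left half, here \<open>a + n - i\<close>; there it meets \<open>u\<close>,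
  which it kills.\<close>

lemma ncap_cup_zero_right:
  "i \<le> n \<Longrightarrow> a \<le> k \<Longrightarrow> capk (k + 2 * n) (a + n - i) u = 0 \<Longrightarrow>
    ncap k a (Suc (Suc n)) (cupk (Suc (Suc (k + 2 * n))) (Suc (Suc (a + n + i))) u) = 0"
proof (induction n arbitrary: i u)
  case 0
  then show ?case by (simp add: capk_cupk_right linD[OF lin_proj])
next
  case (Suc n)
  let ?W = "k + 2 * Suc n"
  show ?case
  proof (cases i)
    case 0
    have "capk (Suc (Suc ?W)) (Suc (a + Suc n)) (cupk (Suc (Suc ?W)) (Suc (Suc (a + Suc n))) u) = proj (Suc (Suc ?W)) u"
      by (rule capk_cupk_right) (use Suc.prems in auto)
    then show ?thesis using Suc.prems 0 by (simp add: linD[OF lin_ncap])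
  next
    case (Suc i')
    have "capk (Suc (Suc ?W)) (Suc (a + Suc n)) (cupk (Suc (Suc ?W)) (Suc (Suc (Suc (a + Suc n + i')))) u)
      = cupk ?W (Suc (a + Suc n + i')) (capk ?W (Suc (a + Suc n)) u)"
      by (rule capk_cupk_far1) (use Suc.prems Suc in auto)
    then have "ncap k a (Suc (Suc (Suc n))) (cupk (Suc (Suc ?W)) (Suc (Suc (a + Suc n + i))) u)
       = ncap k a (Suc (Suc n)) (cupk (Suc (Suc (k + 2 * n))) (Suc (Suc (a + n + i'))) (capk ?W (Suc (a + Suc n)) u))"
      unfolding Suc by (subst ncap.simps(2)) simp
    also have "\<dots> = 0"
    proof (rule Suc.IH)
      have "capk (k + 2 * n) (a + n - i') (capk ?W (Suc (Suc (a + n))) u) = capk (k + 2 * n) (a + n) (capk ?W (a + n - i') u)"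
        using capk_capk[of "a + n - i'" "a + n" "k + 2 * n" u] Suc.prems by simp
      also have "\<dots> = 0" using Suc.prems(3) Suc by (simp add: linD[OF lin_capk])
      finally show "capk (k + 2 * n) (a + n - i') (capk ?W (Suc (a + Suc n)) u) = 0" by simp
    qed (use Suc Suc.prems in auto)
    finally show ?thesis .
  qed
qed

text \<open>The mirror image: the cup lies under the left half. The position on the right is counted
  after the two feet of the cup are gone, which gives \<open>a + 2 * n - i\<close>.\<close>

lemma ncap_cup_zero_left:
  "i \<le> n \<Longrightarrow> a \<le> k \<Longrightarrow> capk (k + 2 * n) (a + 2 * n - i) u = 0 \<Longrightarrow>
    ncap k a (Suc (Suc n)) (cupk (Suc (Suc (k + 2 * n))) (a + i) u) = 0"
proof (induction n arbitrary: u)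
  case 0
  then show ?case by (simp add: capk_cupk_left linD[OF lin_proj])
next
  case (Suc n)
  let ?W = "k + 2 * Suc n"
  show ?case
  proof (cases "i = Suc n")
    case True
    have "capk (Suc (Suc ?W)) (Suc (a + i)) (cupk (Suc (Suc ?W)) (a + i) u) = proj (Suc (Suc ?W)) u"
      by (rule capk_cupk_left) (use Suc.prems in auto)
    then show ?thesis using Suc.prems True by (simp add: linD[OF lin_ncap] add.commute[of n a])
  next
    case False
    then have i: "i \<le> n" using Suc.prems by simp
    have "capk (Suc (Suc ?W)) (Suc (Suc (a + n))) (cupk (Suc (Suc ?W)) (a + i) u)
      = cupk ?W (a + i) (capk ?W (a + n) u)"
      by (rule capk_cupk_far2) (use Suc.prems i in auto)
    then have "ncap k a (Suc (Suc (Suc n))) (cupk (Suc (Suc ?W)) (a + i) u)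
       = ncap k a (Suc (Suc n)) (cupk (Suc (Suc (k + 2 * n))) (a + i) (capk ?W (a + n) u))"
      by (subst ncap.simps(2)) simp
    also have "\<dots> = 0"
    proof (rule Suc.IH)
      have "capk (k + 2 * n) (a + 2 * n - i) (capk ?W (a + n) u) = capk (k + 2 * n) (a + n) (capk ?W (Suc (Suc (a + 2 * n - i))) u)"
        using capk_capk[of "a + n" "a + 2 * n - i" "k + 2 * n" u] Suc.prems i by simp
      also have "\<dots> = 0" using Suc.prems(3) i by (simp add: linD[OF lin_capk] Suc_diff_le)
      finally show "capk (k + 2 * n) (a + 2 * n - i) (capk ?W (a + n) u) = 0" .
    qed (use i Suc.prems in auto)
    finally show ?thesis .
  qed
qed

text \<open>A cap on the right half of nested cups slides down and up again, becoming a cup at the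
  mirror position on the left. Only this cup matters to an idempotent on the left half, so the
  remaining element is left unspecified.\<close>

lemma cap_ncup_image:
  "i \<le> n \<Longrightarrow> a \<le> k \<Longrightarrow> \<exists>u. capk (Suc (Suc (k + 2 * n))) (Suc (Suc (a + n + i))) (ncup k a (Suc (Suc n)) v) = cupk (k + 2 * n) (a + n - i) u"
proof (induction n arbitrary: i)
  case 0
  then show ?case by (intro exI[of _ v]) (simp add: capk_cupk_left)
next
  case (Suc n)
  let ?W = "k + 2 * Suc n"
  show ?case
  proof (cases i)
    case 0
    have "capk (Suc (Suc ?W)) (Suc (Suc (a + Suc n))) (cupk (Suc (Suc ?W)) (Suc (a + Suc n)) (ncup k a (Suc (Suc n)) v)) = proj (Suc (Suc ?W)) (ncup k a (Suc (Suc n)) v)"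
      by (rule capk_cupk_left) (use Suc.prems in auto)
    then show ?thesis using Suc.prems 0 by (intro exI[of _ "ncup k a (Suc n) v"]) simp
  next
    case (Suc i')
    then obtain u where u: "capk ?W (Suc (Suc (a + n + i'))) (ncup k a (Suc (Suc n)) v) = cupk (k + 2 * n) (a + n - i') u"
      using Suc.IH[of i'] Suc.prems by auto
    have "capk (Suc (Suc ?W)) (Suc (Suc (Suc (Suc (a + n + i'))))) (cupk (Suc (Suc ?W)) (Suc (a + Suc n)) (ncup k a (Suc (Suc n)) v))
      = cupk ?W (Suc (a + Suc n)) (capk ?W (Suc (Suc (a + n + i'))) (ncup k a (Suc (Suc n)) v))"
      by (rule capk_cupk_far2) (use Suc.prems Suc in auto)
    also have "\<dots> = cupk ?W (Suc (Suc (a + n))) (cupk (k + 2 * n) (a + n - i') u)" unfolding u by simp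
    also have "\<dots> = cupk ?W (a + n - i') (cupk (k + 2 * n) (a + n) u)"
      using cupk_cupk[of "a + n - i'" "a + n" "k + 2 * n" u] Suc.prems by simp
    finally show ?thesis using Suc by (intro exI[of _ "cupk (k + 2 * n) (a + n) u"]) simp
  qed
qed

lemma two_leE:
  assumes "Suc i < m" obtains n where "m = Suc (Suc n)" "i \<le> n"
  using that[of "m - 2"] assms by auto

text \<open>Of two idempotents at the two ends of a bundle one suffices: a cup at one end becomes a
  cap on the idempotent at the other end.\<close>

lemma ncap_drop_right:
  assumes "a \<le> k"
  shows "ncap k a m (jw (k + 2 * m) (a + m) m (jw (k + 2 * m) a m v)) = ncap k a m (jw (k + 2 * m) a m v)"
proof -
  define G where "G = (\<lambda>w. ncap k a m (jw (k + 2 * m) a m w))"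
  have "G (jw (k + 2 * m) (a + m) m v) = G (proj (k + 2 * m) v)"
  proof (rule jw_absorb)
    show "lin G" unfolding G_def by (rule lin_comp[OF lin_ncap lin_jw])
    fix i k' u assume i: "Suc i < m" and k: "k + 2 * m = Suc (Suc k')"
    from i obtain n where n: "m = Suc (Suc n)" "i \<le> n" by (rule two_leE)
    have k': "k' = Suc (Suc (k + 2 * n))" using k n by simp
    have "G (cupk k' (a + m + i) u) = ncap k a m (cupk k' (a + m + i) (jw k' a m u))"
      unfolding G_def k by (subst cup_jw_right) (use assms n k' in auto)
    also have "\<dots> = ncap k a (Suc (Suc n)) (cupk (Suc (Suc (k + 2 * n))) (Suc (Suc (a + n + i))) (jw k' a m u))"
      using n k' by simp
    also have "\<dots> = 0"
      by (rule ncap_cup_zero_right) (use n assms cap_jw[of "n - i" m a "k + 2 * n" u] k' in auto)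
    finally show "G (cupk k' (a + m + i) u) = 0" .
  qed (use assms in auto)
  then show ?thesis using assms jw_commute[of a m "a + m" m "k + 2 * m" v] by (simp add: G_def)
qed

lemma ncap_drop_left:
  assumes "a \<le> k"
  shows "ncap k a m (jw (k + 2 * m) a m (jw (k + 2 * m) (a + m) m v)) = ncap k a m (jw (k + 2 * m) (a + m) m v)"
proof -
  define G where "G = (\<lambda>w. ncap k a m (jw (k + 2 * m) (a + m) m w))"
  have "G (jw (k + 2 * m) a m v) = G (proj (k + 2 * m) v)"
  proof (rule jw_absorb)
    show "lin G" unfolding G_def by (rule lin_comp[OF lin_ncap lin_jw])
    fix i k' u assume i: "Suc i < m" and k: "k + 2 * m = Suc (Suc k')"
    from i obtain n where n: "m = Suc (Suc n)" "i \<le> n" by (rule two_leE)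
    have k': "k' = Suc (Suc (k + 2 * n))" using k n by simp
    have "G (cupk k' (a + i) u) = ncap k a m (cupk k' (a + i) (jw k' (a + n) m u))"
      unfolding G_def k using cup_jw_left[of "a + i" "a + n" m k' u] assms n k' by simp
    also have "\<dots> = ncap k a (Suc (Suc n)) (cupk (Suc (Suc (k + 2 * n))) (a + i) (jw k' (a + n) m u))"
      using n k' by simp
    also have "\<dots> = 0"
    proof (rule ncap_cup_zero_left)
      have "a + 2 * n - i = a + n + (n - i)" using n by simp
      then show "capk (k + 2 * n) (a + 2 * n - i) (jw k' (a + n) m u) = 0"
        using cap_jw[of "n - i" m "a + n" "k + 2 * n" u] assms n k' by simp
    qed (use n assms in auto)
    finally show "G (cupk k' (a + i) u) = 0" .
  qed (use assms in auto)
  then show ?thesis using assms jw_commute[of a m "a + m" m "k + 2 * m" v] by (simp add: G_def)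
qed

text \<open>The same for a bundle of cups: any cap on the right end reaches the idempotent on the
  left end as a cup, so the right idempotent acts trivially.\<close>

lemma ncup_drop_right:
  assumes "a \<le> k"
  shows "jw (k + 2 * m) (a + m) m (jw (k + 2 * m) a m (ncup k a m v)) = jw (k + 2 * m) a m (ncup k a m v)"
proof -
  have "jw (k + 2 * m) (a + m) m (jw (k + 2 * m) a m (ncup k a m v)) = proj (k + 2 * m) (jw (k + 2 * m) a m (ncup k a m v))"
  proof (rule jw_fixed)
    fix i k' assume i: "Suc i < m" and k: "k + 2 * m = Suc (Suc k')"
    from i obtain n where n: "m = Suc (Suc n)" "i \<le> n" by (rule two_leE)
    have k': "k' = Suc (Suc (k + 2 * n))" using k n by simp
    obtain u where u: "capk k' (a + m + i) (ncup k a m v) = cupk (k + 2 * n) (a + n - i) u"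
      using cap_ncup_image[of i n a k v] n assms k' by auto
    have "capk k' (a + m + i) (jw (k + 2 * m) a m (ncup k a m v)) = jw k' a m (capk k' (a + m + i) (ncup k a m v))"
      unfolding k by (rule cap_jw_right) (use assms n k' in auto)
    also have "\<dots> = jw k' a m (cupk (k + 2 * n) (a + n - i) u)" unfolding u ..
    also have "\<dots> = 0" using jw_cup[of "n - i" m a "k + 2 * n" u] n assms k' by simp
    finally show "capk k' (a + m + i) (jw (k + 2 * m) a m (ncup k a m v)) = 0" .
  qed (use assms in auto)
  then show ?thesis using assms by simp
qed

text \<open>Two adjacent idempotents on top of \<open>w\<close>, joined to each other by \<open>x\<close> strands; \<open>y\<close> and \<open>z\<close>
  strands of the left and of the right one continue to \<open>w\<close>.\<close>

definition vertex_op :: "nat \<Rightarrow> nat \<Rightarrow> nat \<Rightarrow> nat \<Rightarrow> nat \<Rightarrow> skein \<Rightarrow> skein" where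
  "vertex_op k a y z x w =
     jw (k + 2 * x) a (x + y) (jw (k + 2 * x) (a + x + y) (x + z) (ncup k (a + y) x w))"

section \<open>Caps between two adjacent idempotents\<close>

lemma lin_vertex_op: "lin (vertex_op k a y z x)"
  unfolding vertex_op_def[abs_def] by (rule lin_comp[OF lin_jw lin_comp[OF lin_jw lin_ncup]])

text \<open>The case \<open>m = 0\<close> is included: the misplaced hook at
  \<open>a + m - 1\<close> then has the coefficient \<open>wenzl_coeff 0 = 0\<close>.\<close>

lemma jw_Suc':
  assumes "a + m \<le> Suc k"
  shows "jw (Suc (Suc k)) a (Suc m) v = jw (Suc (Suc k)) a m v +
    smul (wenzl_coeff m) (jw (Suc (Suc k)) a m (hook k (a + m - 1) (jw (Suc (Suc k)) a m v)))"
  by (cases m) (use assms jw_Suc in auto)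

lemma jw_Suc_left':
  assumes "a + m \<le> Suc k"
  shows "jw (Suc (Suc k)) a (Suc m) v = jw (Suc (Suc k)) (Suc a) m v +
    smul (wenzl_coeff m) (jw (Suc (Suc k)) (Suc a) m (hook k a (jw (Suc (Suc k)) (Suc a) m v)))"
  by (cases m) (use assms jw_Suc_left in auto)

text \<open>Both idempotents are expanded at the strands facing the cap. Of the four terms, the one
  without hooks closes a circle, those with one hook are zigzags that straighten, and the one with
  both hooks leaves a hook one level deeper.\<close>

lemma cap_jw_jw_cup:
  fixes k a b c :: nat and u :: skein
  assumes "a + b + c \<le> k"
  defines "A \<equiv> jw k a b" and "B \<equiv> jw k (a + b) c"
  shows "capk k (a + b) (jw (Suc (Suc k)) a (Suc b) (jw (Suc (Suc k)) (Suc (a + b)) (Suc c) (cupk k (a + b) u))) =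
    smul (circle_value + wenzl_coeff b + wenzl_coeff c) (A (B u))
    + smul (wenzl_coeff b * wenzl_coeff c) (A (B (hook (k - 2) (a + b - 1) (A (B u)))))"
proof -
  define K where "K = Suc (Suc k)"
  define F where "F = jw K a b"
  define G where "G = jw K (Suc (Suc (a + b))) c"
  define h where "h = hook k (a + b - 1)"
  define h' where "h' = hook k (Suc (a + b))"
  let ?c = "capk k (a + b)" and ?u = "cupk k (a + b)"
  note lins = lin_jw_simps linD[OF lin_hook'] linD[OF lin_capk] linD[OF lin_cupk]
  have cF: "?c (F v) = A (?c v)" and cG: "?c (G v) = B (?c v)" for v
    using assms by (simp_all add: A_def B_def F_def G_def K_def cap_jw_right cap_jw_left)
  have uF: "F (?u v) = ?u (A v)" and uG: "G (?u v) = ?u (B v)" for v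
    using assms by (simp_all add: A_def B_def F_def G_def K_def cup_jw_right cup_jw_left)
  have FG: "F (G v) = G (F v)" for v
    unfolding F_def G_def K_def by (rule jw_commute) (use assms in auto)
  have AB: "A (B v) = B (A v)" for v
    unfolding A_def B_def by (rule jw_commute) (use assms in auto)
  have AA: "A (A v) = A v" and BB: "B (B v) = B v" for v
    unfolding A_def B_def by (rule jw_jw_left; use assms in simp)+
  have pAB: "proj k (A v) = A v" "proj k (B v) = B v" for v using assms by (simp_all add: A_def B_def)
  have f: "jw K a (Suc b) v = F v + smul (wenzl_coeff b) (F (h (F v)))" for v
    unfolding K_def F_def h_def by (rule jw_Suc') (use assms in auto)
  have g: "jw K (Suc (a + b)) (Suc c) v = G v + smul (wenzl_coeff c) (G (h' (G v)))" for v
    unfolding K_def G_def h'_def by (rule jw_Suc_left') (use assms in auto)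
  have 1: "?c (F (G (?u u))) = smul circle_value (A (B u))"
    using assms by (simp add: cF cG capk_cupk_same) (simp add: A_def B_def lin_jw_simps)
  have 2: "?c (F (h (F (G (?u u))))) = A (B u)" if "b \<noteq> 0"
  proof -
    have "?c (h (?u w)) = proj k w" for w
      unfolding h_def hook_def using that assms capk_cupk_right[of "a + b - 1" k w] capk_cupk_left[of "a + b - 1" k "proj k w"] by simp
    then show ?thesis by (simp add: cF uG uF pAB AA)
  qed
  have 3: "?c (F (G (h' (G (?u u))))) = A (B u)" if "c \<noteq> 0"
  proof -
    have "?c (h' (?u w)) = proj k w" for w
      unfolding h'_def hook_def using that assms capk_cupk_right[of "a + b" k "proj k w"] capk_cupk_left[of "a + b" k w] by simp
    then show ?thesis by (simp add: cF cG uG pAB BB)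
  qed
  have 4: "?c (F (h (F (G (h' (G (?u u))))))) = A (B (hook (k - 2) (a + b - 1) (A (B u))))" if "b \<noteq> 0" "c \<noteq> 0"
  proof -
    define k' b' where "k' = k - 2" "b' = b - 1"
    then have k: "k = Suc (Suc k')" "b = Suc b'" using that assms by auto
    have Fh': "F (h' v) = h' (F v)" for v
      unfolding F_def h'_def K_def by (rule hook_jw_right[symmetric]) (use assms that in auto)
    have hG: "h (G v) = G (h v)" for v
      unfolding G_def h_def K_def by (rule hook_jw_left) (use assms that in auto)
    have hh: "?c (h (h' (?u w))) = hook (k - 2) (a + b - 1) w" for w
      unfolding h_def h'_def hook_def using k assms that capk_cupk_left[of "a + b" k w] capk_cupk_left[of "a + b'" k "capk k (a + b') (cupk k (Suc (a + b)) (proj k w))"]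
         capk_cupk_far1[of "a + b'" "a + b'" k' w] by simp
    have "?c (F (h (F (G (h' (G (?u u))))))) = ?c (F (G (h (h' (F (G (?u u)))))))"
      by (simp add: FG hG Fh')
    also have "\<dots> = A (B (hook (k - 2) (a + b - 1) (A (B u))))"
      by (simp add: cF cG uF uG hh)
    finally show ?thesis .
  qed
  have lF: "F (x + y) = F x + F y" "F (smul d x) = smul d (F x)" for x y d by (simp_all add: F_def lins)
  have lh: "h (x + y) = h x + h y" "h (smul d x) = smul d (h x)" for x y d by (simp_all add: h_def lins)
  have "?c (jw K a (Suc b) (jw K (Suc (a + b)) (Suc c) (?u u)))
     = ?c (F (G (?u u))) + smul (wenzl_coeff c) (?c (F (G (h' (G (?u u)))))) + smul (wenzl_coeff b) (?c (F (h (F (G (?u u))))))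
      + smul (wenzl_coeff b * wenzl_coeff c) (?c (F (h (F (G (h' (G (?u u))))))))"
    by (simp add: f g lF lh linD[OF lin_capk] smul_add add_ac)
  also have "\<dots> = smul circle_value (A (B u)) + smul (wenzl_coeff c) (A (B u)) + smul (wenzl_coeff b) (A (B u))
      + smul (wenzl_coeff b * wenzl_coeff c) (A (B (hook (k - 2) (a + b - 1) (A (B u)))))"
    using 1 2 3 4 by (cases "b = 0"; cases "c = 0") simp_all
  finally show ?thesis unfolding K_def by (simp add: smul_add add_ac)
qed

text \<open>Smaller idempotents below the cup slide up on both of its sides and disappear in the
  larger ones.\<close>

lemma jw_jw_cup_absorb:
  assumes "a + b + c \<le> k"
  shows "jw (Suc (Suc k)) a (Suc b) (jw (Suc (Suc k)) (Suc (a + b)) (Suc c) (cupk k (a + b) (jw k a b (jw k (a + b) c u))))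
    = jw (Suc (Suc k)) a (Suc b) (jw (Suc (Suc k)) (Suc (a + b)) (Suc c) (cupk k (a + b) u))"
proof -
  define K where "K = Suc (Suc k)"
  define P where "P = jw K a (Suc b)"
  define Q where "Q = jw K (Suc (a + b)) (Suc c)"
  have PQ: "P (Q v) = Q (P v)" for v unfolding P_def Q_def by (rule jw_commute) (use assms in \<open>auto simp: K_def\<close>)
  have "cupk k (a + b) (jw k a b (jw k (a + b) c u)) = jw K a b (jw K (Suc (Suc (a + b))) c (cupk k (a + b) u))"
    using assms by (simp add: K_def cup_jw_left cup_jw_right)
  moreover have "P (jw K a b v) = P v" "Q (jw K (Suc (Suc (a + b))) c v) = Q v" for v
    unfolding P_def Q_def by (rule jw_jw_right; use assms in \<open>simp add: K_def\<close>)+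
  ultimately show ?thesis unfolding K_def[symmetric] P_def[symmetric] Q_def[symmetric]
    by (metis PQ)
qed

text \<open>In quantum integers this is -[x][x+2y+1] / [x+y]^2, the value of a cap between two
  idempotents joined by \<open>x\<close> strands, with \<open>y\<close> strands of each passing
  on.\<close>

definition cap_coeff :: "nat \<Rightarrow> nat \<Rightarrow> ratA" where
  "cap_coeff x y = - (1 - qA ^ (x + y + y + 1)) * (1 - qA ^ x) / (varA ^ 2 * (1 - qA ^ (x + y)) ^ 2)"

text \<open>In quantum integers this is [y]^2 / [x+y]^2, the coefficient with which the cap slips
  below the joining strands.\<close>

definition pass_coeff :: "nat \<Rightarrow> nat \<Rightarrow> ratA" where
  "pass_coeff x y = qA ^ x * (1 - qA ^ y) ^ 2 / (1 - qA ^ (x + y)) ^ 2"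

lemma cap_coeff_0 [simp]: "cap_coeff 0 y = 0" by (simp add: cap_coeff_def)

text \<open>Here \<open>a\<close>, \<open>x\<close> and \<open>y\<close> stand for A, q^x and q^y.
  As an identity over an arbitrary field it becomes polynomial once denominators are
  cleared.\<close>

lemma cap_coeff_field_identity:
  fixes a x y :: "'a::field"
  assumes "a \<noteq> 0" "1 - x * y \<noteq> 0" "1 - a ^ 4 * (x * y) \<noteq> 0"
  shows "- (1 - a ^ 4 * (a ^ 4 * (x * (y * y)))) * (1 - a ^ 4 * x) / (a ^ 2 * (1 - a ^ 4 * (x * y)) ^ 2) =
    - (a ^ 2 + inverse a ^ 2) + a ^ 2 * (1 - x * y) / (1 - a ^ 4 * (x * y)) + a ^ 2 * (1 - x * y) / (1 - a ^ 4 * (x * y))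
    + (a ^ 2 * (1 - x * y) / (1 - a ^ 4 * (x * y))) * (a ^ 2 * (1 - x * y) / (1 - a ^ 4 * (x * y))) *
      (- (1 - a ^ 4 * (x * (y * y))) * (1 - x) / (a ^ 2 * (1 - x * y) ^ 2))"
  (is "?L = ?R")
proof -
  define D where "D = 1 - a ^ 4 * (x * y)"
  define E where "E = 1 - x * y"
  have nz: "a ^ 2 \<noteq> 0" "D \<noteq> 0" "E \<noteq> 0" using assms by (auto simp: D_def E_def)
  have R: "?R = (- (a ^ 4 + 1) * D ^ 2 + 2 * a ^ 4 * E * D - a ^ 4 * (1 - a ^ 4 * (x * (y * y))) * (1 - x)) / (a ^ 2 * D ^ 2)"
    unfolding D_def[symmetric] E_def[symmetric] using nz assms(1)
    by (simp add: divide_simps) (simp add: algebra_simps power2_eq_square power4_eq_xxxx)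
  have L: "?L = (- (1 - a ^ 4 * (a ^ 4 * (x * (y * y)))) * (1 - a ^ 4 * x)) / (a ^ 2 * D ^ 2)"
    by (simp add: D_def)
  have "- (1 - a ^ 4 * (a ^ 4 * (x * (y * y)))) * (1 - a ^ 4 * x) =
     - (a ^ 4 + 1) * D ^ 2 + 2 * a ^ 4 * E * D - a ^ 4 * (1 - a ^ 4 * (x * (y * y))) * (1 - x)"
    unfolding D_def E_def by algebra
  then show ?thesis unfolding L R by simp
qed

text \<open>The recursion dictated by \<open>cap_vertex_op_step\<close>. For
  \<open>x + y = 0\<close> the denominator of \<open>cap_coeff\<close> vanishes, so the start of the
  recursion is computed separately in \<open>cap_coeff_1_0\<close>.\<close>

lemma cap_coeff_Suc:
  assumes "0 < x + y"
  shows "cap_coeff (Suc x) y = circle_value + wenzl_coeff (x + y) + wenzl_coeff (x + y)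
    + wenzl_coeff (x + y) * wenzl_coeff (x + y) * cap_coeff x y"
  using cap_coeff_field_identity[of varA "qA ^ x" "qA ^ y"] qA_power_neq_1[OF assms] qA_power_neq_1[of "Suc (x + y)"]
  by (simp add: cap_coeff_def wenzl_coeff_def circle_value_def power_add mult_ac)

lemma cap_coeff_1_0: "cap_coeff (Suc 0) 0 = circle_value"
proof -
  define d where "d = 1 - qA"
  have d: "d \<noteq> 0" using qA_power_neq_1[of 1] by (simp add: d_def)
  have "cap_coeff (Suc 0) 0 = - (d * (1 + qA)) * d / (varA ^ 2 * d ^ 2)"
    by (simp add: cap_coeff_def d_def algebra_simps power2_eq_square)
  also have "\<dots> = - ((1 + qA) / varA ^ 2)" using d by (simp add: power2_eq_square)
  also have "\<dots> = circle_value" by (simp add: circle_value_def field_simps power2_eq_square power4_eq_xxxx)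
  finally show ?thesis .
qed

lemma pass_coeff_0 [simp]: "0 < y \<Longrightarrow> pass_coeff 0 y = 1"
  using qA_power_neq_1[of y] by (simp add: pass_coeff_def)

lemma pass_coeff_Suc:
  assumes "0 < y"
  shows "pass_coeff (Suc x) y = wenzl_coeff (x + y) * wenzl_coeff (x + y) * pass_coeff x y"
  using qA_power_neq_1[of "x + y"] qA_power_neq_1[of "Suc (x + y)"] assms
  by (simp add: pass_coeff_def wenzl_coeff_def divide_simps) (simp add: power2_eq_square power4_eq_xxxx algebra_simps)?

lemma vertex_op_eq_cup:
  "a + y + z \<le> k \<Longrightarrow> vertex_op k a y z (Suc x) w =
    jw (Suc (Suc (k + 2 * x))) a (Suc (x + y)) (jw (Suc (Suc (k + 2 * x))) (Suc (a + (x + y))) (Suc (x + z))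
      (cupk (k + 2 * x) (a + (x + y)) (vertex_op k a y z x w)))"
proof -
  assume "a + y + z \<le> k"
  then show ?thesis
    using jw_jw_cup_absorb[of a "x + y" "x + z" "k + 2 * x" "ncup k (a + y) x w"]
    by (simp add: vertex_op_def ac_simps)
qed

lemma cap_vertex_op_step:
  assumes "a + y + y \<le> k"
  shows "capk (k + 2 * x) (a + (x + y)) (vertex_op k a y y (Suc x) w) =
    smul (circle_value + wenzl_coeff (x + y) + wenzl_coeff (x + y)) (vertex_op k a y y x w)
    + smul (wenzl_coeff (x + y) * wenzl_coeff (x + y)) (jw (k + 2 * x) a (x + y) (jw (k + 2 * x) (a + (x + y)) (x + y)
       (hook (k + 2 * x - 2) (a + (x + y) - 1) (vertex_op k a y y x w))))"
  using cap_jw_jw_cup[of a "x + y" "x + y" "k + 2 * x" "ncup k (a + y) x w"] assms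
  by (simp add: vertex_op_def ac_simps)

text \<open>Without passing strands the cap has nowhere to slip to, and a single term
  remains.\<close>

lemma cap_vertex_op_closed:
  assumes "a \<le> k"
  shows "capk (k + 2 * x) (a + x) (vertex_op k a 0 0 (Suc x) w) = smul (cap_coeff (Suc x) 0) (vertex_op k a 0 0 x w)"
proof (induction x)
  case 0
  show ?case using cap_vertex_op_step[of a 0 k 0 w] assms by (simp add: cap_coeff_1_0)
next
  case (Suc x)
  have "jw (k + 2 * Suc x) a (Suc x) (jw (k + 2 * Suc x) (a + Suc x) (Suc x) (hook (k + 2 * Suc x - 2) (a + Suc x - 1) (vertex_op k a 0 0 (Suc x) w)))
    = smul (cap_coeff (Suc x) 0) (jw (k + 2 * Suc x) a (Suc x) (jw (k + 2 * Suc x) (a + Suc x) (Suc x) (cupk (k + 2 * x) (a + x) (vertex_op k a 0 0 x w))))"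
    by (simp add: hook_def Suc lin_jw_simps linD[OF lin_cupk])
  also have "\<dots> = smul (cap_coeff (Suc x) 0) (vertex_op k a 0 0 (Suc x) w)"
    using vertex_op_eq_cup[of a 0 0 k x w] assms by simp
  finally show ?case using cap_vertex_op_step[of a 0 k "Suc x" w] assms cap_coeff_Suc[of "Suc x" 0]
    by (simp add: smul_add)
qed

text \<open>The remaining hook in \<open>cap_vertex_op_step\<close> is a cup on top of the same cap
  with one joining strand fewer. Inserting the induction hypothesis for that cap gives the
  recursions of \<open>cap_coeff\<close> and \<open>pass_coeff\<close>.\<close>

lemma cap_vertex_op:
  assumes "a + y + y \<le> k" "jw (Suc (Suc k)) a (Suc y) w = w" "jw (Suc (Suc k)) (a + Suc y) (Suc y) w = w"
  shows "capk (k + 2 * x) (a + x + y) (vertex_op (Suc (Suc k)) a (Suc y) (Suc y) x w) =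
    smul (cap_coeff x (Suc y)) (vertex_op (Suc (Suc k)) a (Suc y) (Suc y) (x - 1) w)
    + smul (pass_coeff x (Suc y)) (vertex_op k a y y x (capk k (a + y) w))"
proof (induction x)
  case 0
  have w: "proj (Suc (Suc k)) w = w" using assms proj_jw[of a "Suc y" "Suc (Suc k)" w] by simp
  have "jw (Suc (Suc k)) a y w = w" using jw_jw_left[of a a y "Suc y" "Suc (Suc k)" w] assms by simp
  then have 1: "jw k a y (capk k (a + y) w) = capk k (a + y) w"
    using cap_jw_right[of a y "a + y" k w] assms by simp
  have "jw (Suc (Suc k)) (Suc (Suc (a + y))) y w = w"
    using jw_jw_left[of "a + Suc y" "Suc (Suc (a + y))" y "Suc y" "Suc (Suc k)" w] assms by simp
  then have 2: "jw k (a + y) y (capk k (a + y) w) = capk k (a + y) w"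
    using cap_jw_left[of "a + y" "a + y" y k w] assms by simp
  show ?case using assms w 1 2 by (simp add: vertex_op_def)
next
  case (Suc x)
  let ?k = "Suc (Suc k)"
  define c where "c = capk k (a + y) w"
  have k: "a + Suc y + Suc y \<le> ?k" using assms by simp
  have pos: "a + (x + Suc y) = Suc (a + x + y)" "a + (x + Suc y) - 1 = a + x + y" by simp_all
  have wd: "?k + 2 * x = Suc (Suc (k + 2 * x))" "?k + 2 * x - 2 = k + 2 * x" by simp_all
  define R where "R v = jw (?k + 2 * x) a (x + Suc y) (jw (?k + 2 * x) (a + (x + Suc y)) (x + Suc y) (cupk (k + 2 * x) (a + x + y) v))" for v
  have lR: "lin R" unfolding R_def[abs_def] by (rule lin_comp[OF lin_jw lin_comp[OF lin_jw lin_cupk]])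
  have "jw (?k + 2 * x) a (x + Suc y) (jw (?k + 2 * x) (a + (x + Suc y)) (x + Suc y)
       (hook (?k + 2 * x - 2) (a + (x + Suc y) - 1) (vertex_op ?k a (Suc y) (Suc y) x w)))
    = R (capk (k + 2 * x) (a + x + y) (vertex_op ?k a (Suc y) (Suc y) x w))"
    unfolding R_def hook_def pos wd by simp
  also have "\<dots> = smul (cap_coeff x (Suc y)) (R (vertex_op ?k a (Suc y) (Suc y) (x - 1) w))
    + smul (pass_coeff x (Suc y)) (R (vertex_op k a y y x c))"
    unfolding Suc c_def by (simp add: linD[OF lR])
  also have "R (vertex_op k a y y x c) = vertex_op k a y y (Suc x) c"
    using vertex_op_eq_cup[of a y y k x c] assms by (simp add: R_def ac_simps)
  also have "smul (cap_coeff x (Suc y)) (R (vertex_op ?k a (Suc y) (Suc y) (x - 1) w))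
     = smul (cap_coeff x (Suc y)) (vertex_op ?k a (Suc y) (Suc y) x w)"
  \<comment> \<open>For \<open>x = 0\<close> the truncated index \<open>x - 1\<close> is met by the
    coefficient \<open>cap_coeff 0 (Suc y) = 0\<close>.\<close>
  proof (cases x)
    case (Suc x')
    then show ?thesis using vertex_op_eq_cup[of a "Suc y" "Suc y" ?k x' w] k by (simp add: R_def ac_simps)
  qed simp
  finally have "jw (?k + 2 * x) a (x + Suc y) (jw (?k + 2 * x) (a + (x + Suc y)) (x + Suc y)
       (hook (?k + 2 * x - 2) (a + (x + Suc y) - 1) (vertex_op ?k a (Suc y) (Suc y) x w)))
     = smul (cap_coeff x (Suc y)) (vertex_op ?k a (Suc y) (Suc y) x w) + smul (pass_coeff x (Suc y)) (vertex_op k a y y (Suc x) c)" .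
  from cap_vertex_op_step[OF k, of x w, unfolded this]
  have "capk (?k + 2 * x) (a + (x + Suc y)) (vertex_op ?k a (Suc y) (Suc y) (Suc x) w) =
     smul (cap_coeff (Suc x) (Suc y)) (vertex_op ?k a (Suc y) (Suc y) x w) + smul (pass_coeff (Suc x) (Suc y)) (vertex_op k a y y (Suc x) c)"
    by (simp add: cap_coeff_Suc pass_coeff_Suc smul_add)
  then show ?case by (simp add: c_def add.assoc)
qed

text \<open>The coefficients for which the two terms of \<open>cap_vertex_op\<close> telescope in the sum of \<open>jw_expand\<close>,
  so that this sum is killed by the middle cap.\<close>

fun box_coeff :: "nat \<Rightarrow> nat \<Rightarrow> ratA" where
  "box_coeff n 0 = 1"
| "box_coeff n (Suc i) = - box_coeff n i * pass_coeff i (n - i) / cap_coeff (Suc i) (n - Suc i)"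

lemma cap_coeff_nonzero: "0 < x \<Longrightarrow> cap_coeff x y \<noteq> 0"
  unfolding cap_coeff_def using qA_power_neq_1[of "x + y + y + 1"] qA_power_neq_1[of x] qA_power_neq_1[of "x + y"] by simp

lemma box_coeff_recurrence:
  "box_coeff n (Suc i) * cap_coeff (Suc i) (n - Suc i) + box_coeff n i * pass_coeff i (n - i) = 0"
  using cap_coeff_nonzero[of "Suc i" "n - Suc i"] by simp

text \<open>The sum on the right is killed by every cap on the \<open>2 * n\<close> strands, so the
  idempotent fixes it. The idempotent also kills every summand that contains a cup, and in the
  summand \<open>i = 0\<close> it absorbs the two halves. Comparing the two results proves the
  expansion.\<close>

lemma jw_expand:
  fixes K a n :: nat and v :: skein
  assumes "a \<le> K"
  defines "L \<equiv> jw (K + 2 * n) a n (jw (K + 2 * n) (a + n) n v)"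
  defines "w \<equiv> \<lambda>i. ncap (K + 2 * (n - i)) (a + (n - i)) i L"
  shows "jw (K + 2 * n) a (2 * n) v =
    (\<Sum>i\<le>n. smul (box_coeff n i) (vertex_op (K + 2 * (n - i)) a (n - i) (n - i) i (w i)))"
    (is "_ = ?g")
proof (cases n)
  case 0
  then show ?thesis using assms by (simp add: vertex_op_def)
next
  case n: (Suc n')
  note aK = assms(1)
  define N where "N = K + 2 * n'"
  have N: "K + 2 * n = Suc (Suc N)" by (simp add: n N_def)
  define D where "D i = vertex_op (K + 2 * (n - i)) a (n - i) (n - i) i (w i)" for i
  have D: "D i = jw (K + 2 * n) a n (jw (K + 2 * n) (a + n) n (ncup (K + 2 * (n - i)) (a + (n - i)) i (w i)))" if "i \<le> n" for i
  proof -
    have "K + 2 * (n - i) + 2 * i = K + 2 * n" "i + (n - i) = n" "a + i + (n - i) = a + n" using that by auto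
    then show ?thesis unfolding D_def vertex_op_def by (simp only:)
  qed
  have LL: "jw (K + 2 * n) a n L = L" "jw (K + 2 * n) (a + n) n L = L"
  proof -
    show "jw (K + 2 * n) a n L = L" unfolding L_def using aK by (simp add: jw_jw_left)
    have "L = jw (K + 2 * n) (a + n) n (jw (K + 2 * n) a n v)"
      unfolding L_def by (rule jw_commute) (use aK in auto)
    then show "jw (K + 2 * n) (a + n) n L = L" using aK by (simp add: jw_jw_left)
  qed
  have wsuc: "capk (K + 2 * (n' - i)) (a + (n' - i)) (w i) = w (Suc i)" if "i \<le> n'" for i
  proof -
    have "n - i = Suc (n' - i)" "n - Suc i = n' - i" using that n by auto
    then show ?thesis unfolding w_def using aK ncap_outer[of "a + (n' - i)" "K + 2 * (n' - i)" i L] by simp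
  qed
  have wabs: "jw (K + 2 * (n - i)) a (n - i) (w i) = w i" "jw (K + 2 * (n - i)) (a + (n - i)) (n - i) (w i) = w i" if "i \<le> n" for i
  proof -
    have e: "K + 2 * (n - i) + 2 * i = K + 2 * n" "a + (n - i) + 2 * i = a + n + i" using that by auto
    have "ncap (K + 2 * (n - i)) (a + (n - i)) i (jw (K + 2 * (n - i) + 2 * i) a (n - i) L) = jw (K + 2 * (n - i)) a (n - i) (w i)"
      unfolding w_def by (rule jw_ncap_left) (use aK in auto)
    moreover have "jw (K + 2 * n) a (n - i) L = L" using jw_jw_left[of a a "n - i" n "K + 2 * n" L] LL aK by simp
    ultimately show "jw (K + 2 * (n - i)) a (n - i) (w i) = w i" unfolding e by (simp only: w_def)
    have "ncap (K + 2 * (n - i)) (a + (n - i)) i (jw (K + 2 * (n - i) + 2 * i) (a + (n - i) + 2 * i) (n - i) L)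
        = jw (K + 2 * (n - i)) (a + (n - i)) (n - i) (w i)"
      unfolding w_def by (rule jw_ncap_right) (use aK in auto)
    moreover have "jw (K + 2 * n) (a + n + i) (n - i) L = L"
      using jw_jw_left[of "a + n" "a + n + i" "n - i" n "K + 2 * n" L] LL aK that by simp
    ultimately show "jw (K + 2 * (n - i)) (a + (n - i)) (n - i) (w i) = w i" unfolding e by (simp only: w_def)
  qed
  \<comment> \<open>The common elements of the middle cap: it sends \<open>D i\<close> to a
    combination of \<open>Z (i - 1)\<close> and \<open>Z i\<close>, and
    \<open>box_coeff_recurrence\<close> says that the total coefficient of each \<open>Z i\<close>
    is 0.\<close>
  define Z where "Z i = vertex_op (K + 2 * (n' - i)) a (n' - i) (n' - i) i (w (Suc i))" for i
  have capD: "capk N (a + n') (D i) = smul (cap_coeff i (n - i)) (Z (i - 1)) + smul (pass_coeff i (n - i)) (Z i)" if "i \<le> n'" for i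
  proof -
    define y where "y = n' - i"
    have e: "n - i = Suc y" "n' = i + y" "K + 2 * (n - i) = Suc (Suc (K + 2 * y))" "N = K + 2 * y + 2 * i" "a + n' = a + i + y"
      using that n by (auto simp: y_def N_def)
    have "capk N (a + n') (D i) = smul (cap_coeff i (Suc y)) (vertex_op (Suc (Suc (K + 2 * y))) a (Suc y) (Suc y) (i - 1) (w i))
      + smul (pass_coeff i (Suc y)) (vertex_op (K + 2 * y) a y y i (capk (K + 2 * y) (a + y) (w i)))"
    proof -
      have i: "i \<le> n" using that n by simp
      have "jw (Suc (Suc (K + 2 * y))) a (Suc y) (w i) = w i" "jw (Suc (Suc (K + 2 * y))) (a + Suc y) (Suc y) (w i) = w i"
        using wabs[OF i] unfolding e(1) by simp_all
      moreover have "a + y + y \<le> K + 2 * y" using aK by simp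
      moreover have "K + 2 * Suc y = Suc (Suc (K + 2 * y))" by simp
      ultimately show ?thesis unfolding D_def e(1,4,5) by (simp only: cap_vertex_op)
    qed
    moreover have "capk (K + 2 * y) (a + y) (w i) = w (Suc i)" using wsuc[OF that] by (simp add: y_def)
    moreover have "smul (cap_coeff i (Suc y)) (vertex_op (Suc (Suc (K + 2 * y))) a (Suc y) (Suc y) (i - 1) (w i)) = smul (cap_coeff i (Suc y)) (Z (i - 1))"
    proof (cases i)
      case (Suc j)
      then have "n' - j = Suc y" using e(2) by simp
      then show ?thesis using Suc by (simp add: Z_def)
    qed simp
    ultimately show ?thesis by (simp add: e(1) Z_def y_def)
  qed
  \<comment> \<open>For \<open>i = n\<close> no strand passes, so this end of the telescoping sum
    has one term only.\<close>
  have capDn: "capk N (a + n') (D n) = smul (cap_coeff n 0) (Z n')"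
    unfolding D_def Z_def n N_def using cap_vertex_op_closed[of a K n'] aK by simp
  have "capk N (a + n') ?g = (\<Sum>i\<le>n. smul (box_coeff n i) (capk N (a + n') (D i)))"
    unfolding D_def[symmetric] by (simp add: lin_sum[OF lin_capk] linD[OF lin_capk])
  also have "\<dots> = (\<Sum>i\<le>n'. smul (box_coeff n i) (capk N (a + n') (D i))) + smul (box_coeff n n * cap_coeff n 0) (Z n')"
    unfolding n by (simp add: capDn[unfolded n])
  also have "(\<Sum>i\<le>n'. smul (box_coeff n i) (capk N (a + n') (D i)))
     = (\<Sum>i\<le>n'. smul (box_coeff n i * cap_coeff i (n - i)) (Z (i - 1))) + (\<Sum>i\<le>n'. smul (box_coeff n i * pass_coeff i (n - i)) (Z i))"
    by (simp add: capD smul_add sum.distrib)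
  also have "(\<Sum>i\<le>n'. smul (box_coeff n i * cap_coeff i (n - i)) (Z (i - 1)))
      = (\<Sum>i<n'. smul (box_coeff n (Suc i) * cap_coeff (Suc i) (n - Suc i)) (Z i))"
    by (subst sum.atMost_shift) simp
  also have "(\<Sum>i<n'. smul (box_coeff n (Suc i) * cap_coeff (Suc i) (n - Suc i)) (Z i)) + (\<Sum>i\<le>n'. smul (box_coeff n i * pass_coeff i (n - i)) (Z i))
      + smul (box_coeff n n * cap_coeff n 0) (Z n')
     = (\<Sum>i\<le>n'. smul (box_coeff n (Suc i) * cap_coeff (Suc i) (n - Suc i) + box_coeff n i * pass_coeff i (n - i)) (Z i))"
    by (simp only: smul_add sum.distrib) (simp add: n lessThan_Suc_atMost[symmetric] add_ac del: box_coeff.simps)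
  also have "\<dots> = 0" by (simp only: box_coeff_recurrence) simp
  finally have mid: "capk N (a + n') ?g = 0" .
  have "jw (K + 2 * n) a (2 * n) ?g = proj (K + 2 * n) ?g"
  proof (rule jw_fixed)
    fix j k' assume j: "Suc j < 2 * n" "K + 2 * n = Suc (Suc k')"
    then have k': "k' = N" using N by simp
    \<comment> \<open>All caps except the middle one lie entirely on one of the two half idempotents
      on top of \<open>D i\<close>.\<close>
    have "capk N (a + j) (D i) = 0" if "i \<le> n" "j \<noteq> n'" for i
    proof (cases "Suc j < n")
      case True
      then show ?thesis unfolding D[OF that(1)] N using cap_jw[of j n a N] aK by (simp add: N_def n)
    next
      case False
      then have "n \<le> j" using that n by auto
      then have "capk N (a + n + (j - n)) (jw (Suc (Suc N)) (a + n) n v) = 0" for v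
        by (intro cap_jw) (use j aK in \<open>auto simp: N_def n\<close>)
      moreover have "a + n + (j - n) = a + j" using \<open>n \<le> j\<close> by simp
      ultimately show ?thesis unfolding D[OF that(1)] N
        using jw_commute[of a n "a + n" n "Suc (Suc N)"] aK by (simp add: N_def n)
    qed
    then show "capk k' (a + j) ?g = 0"
      using mid unfolding k' D_def[symmetric] by (cases "j = n'") (simp_all add: lin_sum[OF lin_capk] linD[OF lin_capk])
  qed (use aK in auto)
  also have "proj (K + 2 * n) ?g = ?g"
    unfolding D_def[symmetric] using aK by (simp add: lin_sum[OF lin_proj] linD[OF lin_proj] D)
  finally have "?g = jw (K + 2 * n) a (2 * n) ?g" ..
  also have "\<dots> = (\<Sum>i\<le>n. smul (box_coeff n i) (jw (K + 2 * n) a (2 * n) (D i)))"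
    unfolding D_def[symmetric] by (simp add: lin_sum[OF lin_jw] lin_jw_simps)
  also have "\<dots> = jw (K + 2 * n) a (2 * n) (D 0)"
  proof -
    have abs: "jw (K + 2 * n) a (2 * n) (jw (K + 2 * n) a n (jw (K + 2 * n) (a + n) n u)) = jw (K + 2 * n) a (2 * n) u" for u
      using aK by (simp add: jw_jw_right)
    have "jw (K + 2 * n) a (2 * n) (D (Suc i)) = 0" if "Suc i \<le> n" for i
    proof -
      define y where "y = n - Suc i"
      have e: "n = Suc i + y" using that by (simp add: y_def)
      have "jw (K + 2 * n) a (2 * n) (D (Suc i)) = jw (K + 2 * n) a (2 * n) (ncup (K + 2 * y) (a + y) (Suc i) (w (Suc i)))"
        unfolding D[OF that] abs y_def ..
      also have "\<dots> = jw (Suc (Suc N)) a (2 * n) (cupk N (a + n') (ncup (K + 2 * y) (a + y) i (w (Suc i))))"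
        unfolding N using e n by (simp add: N_def algebra_simps)
      also have "\<dots> = 0" by (rule jw_cup) (use aK in \<open>auto simp: N_def n\<close>)
      finally show ?thesis .
    qed
    then have "(\<Sum>i\<le>n. smul (box_coeff n i) (jw (K + 2 * n) a (2 * n) (D i))) = (\<Sum>i\<in>{0}. smul (box_coeff n i) (jw (K + 2 * n) a (2 * n) (D i)))"
      by (intro sum.mono_neutral_right) (auto, metis not0_implies_Suc smul_simps(2))
    then show ?thesis by simp
  qed
  also have "\<dots> = jw (K + 2 * n) a (2 * n) v"
    using D[of 0] aK by (simp add: w_def L_def jw_jw_right)
  finally show ?thesis ..
qed

section \<open>The triangle\<close>

text \<open>A bundle of \<open>2 * n\<close> strands with its idempotent, bent into a cup. It
  carries the first leg of the vertex; its right end is where the other two legs are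
  separated.\<close>

definition leg_base :: "nat \<Rightarrow> skein" where
  "leg_base n = jw (4 * n) 0 (2 * n) (ncup 0 0 (2 * n) (basis []))"

text \<open>The vertex with colors 2n, n+x, n+x. Varying \<open>x\<close> keeps track of caps
  between the last two legs; \<open>x = n\<close> is the vertex of the theorem.\<close>

definition tau_op :: "nat \<Rightarrow> nat \<Rightarrow> skein" where
  "tau_op n x = vertex_op (4 * n) (2 * n) n n x (leg_base n)"

definition triangle_coeff :: "nat \<Rightarrow> ratA" where
  "triangle_coeff n = (\<Sum>i\<le>n. box_coeff n i * (\<Prod>x\<in>{Suc i..n}. cap_coeff x n))"

lemma leg_base_drop: "jw (4 * n) (2 * n) (2 * n) (leg_base n) = leg_base n"
  using ncup_drop_right[of 0 0 "2 * n" "basis []"] by (simp add: leg_base_def)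

text \<open>The passing term of \<open>cap_vertex_op\<close> drops out, because below the joining
  strands the cap meets the idempotent of the first leg.\<close>

lemma cap_tau_op:
  assumes "0 < n"
  shows "capk (4 * n + 2 * x) (3 * n + x) (tau_op n (Suc x)) = smul (cap_coeff (Suc x) n) (tau_op n x)"
proof -
  define k y where "k = 4 * n - 2" "y = n - 1"
  then have k: "4 * n = Suc (Suc k)" and y: "n = Suc y" using assms by auto
  have a: "jw (4 * n) (2 * n) n (leg_base n) = leg_base n"
    using jw_jw_left[of "2 * n" "2 * n" n "2 * n" "4 * n" "leg_base n"] leg_base_drop[of n] by simp
  have b: "jw (4 * n) (2 * n + n) n (leg_base n) = leg_base n"
    using jw_jw_left[of "2 * n" "3 * n" n "2 * n" "4 * n" "leg_base n"] leg_base_drop[of n] by simp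
  have le: "2 * n + y + y \<le> k" using k y by simp
  have "capk k (2 * n + y) (jw (4 * n) (2 * n) (2 * n) (leg_base n)) = 0"
    unfolding k by (rule cap_jw) (use k y in auto)
  then have c: "capk k (2 * n + y) (leg_base n) = 0" unfolding leg_base_drop .
  have e: "k + 2 * Suc x = 4 * n + 2 * x" "2 * n + Suc x + y = 3 * n + x" using k y by auto
  have "capk (k + 2 * Suc x) (2 * n + Suc x + y) (vertex_op (4 * n) (2 * n) n n (Suc x) (leg_base n)) =
    smul (cap_coeff (Suc x) n) (vertex_op (4 * n) (2 * n) n n (Suc x - 1) (leg_base n)) +
    smul (pass_coeff (Suc x) n) (vertex_op k (2 * n) y y (Suc x) (capk k (2 * n + y) (leg_base n)))"
    by (rule cap_vertex_op[OF le, of "leg_base n", folded k y, OF a b])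
  then show ?thesis unfolding tau_op_def e by (simp add: c linD[OF lin_vertex_op])
qed

lemma ncap_tau_op: "ncap (4 * n + 2 * i) (3 * n + i) m (tau_op n (i + m)) = smul (\<Prod>x\<in>{Suc i..i + m}. cap_coeff x n) (tau_op n i)"
  if "0 < n"
proof (induction m)
  case 0
  show ?case by (simp add: tau_op_def vertex_op_def)
next
  case (Suc m)
  have "capk (4 * n + 2 * i + 2 * m) (3 * n + i + m) (tau_op n (Suc (i + m))) = smul (cap_coeff (Suc (i + m)) n) (tau_op n (i + m))"
    using cap_tau_op[OF that, of "i + m"] by (simp add: algebra_simps)
  then show ?case using Suc by (simp add: linD[OF lin_ncap] mult.commute)
qed

definition legs :: "nat \<Rightarrow> skein \<Rightarrow> skein" where
  "legs n v = jw (6 * n) 0 (2 * n) (jw (6 * n) (2 * n) (2 * n) (jw (6 * n) (4 * n) (2 * n) v))"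

lemma lin_legs: "lin (legs n)"
  unfolding legs_def[abs_def] by (intro lin_comp[OF lin_jw] lin_jw)

lemma legs_absorb2:
  assumes "2 * n \<le> b" "b + l \<le> 4 * n" shows "legs n (jw (6 * n) b l v) = legs n v"
proof -
  have "jw (6 * n) (4 * n) (2 * n) (jw (6 * n) b l v) = jw (6 * n) b l (jw (6 * n) (4 * n) (2 * n) v)"
    by (rule jw_commute[symmetric]) (use assms in auto)
  then show ?thesis unfolding legs_def using jw_jw_right[of "2 * n" b l "2 * n" "6 * n"] assms by simp
qed

lemma legs_absorb3:
  assumes "4 * n \<le> b" "b + l \<le> 6 * n" shows "legs n (jw (6 * n) b l v) = legs n v"
  unfolding legs_def using jw_jw_right[of "4 * n" b l "2 * n" "6 * n"] assms by simp

lemma legs_ncup: "legs n (ncup (4 * n) (3 * n) n (leg_base n)) = tau_op n n"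
proof -
  let ?u = "ncup (4 * n) (3 * n) n (leg_base n)"
  have "jw (6 * n) 0 (2 * n) ?u = ?u"
  proof -
    have "jw (4 * n + 2 * n) 0 (2 * n) ?u = ncup (4 * n) (3 * n) n (jw (4 * n) 0 (2 * n) (leg_base n))"
      by (rule jw_ncup_left) auto
    also have "jw (4 * n) 0 (2 * n) (leg_base n) = leg_base n"
      unfolding leg_base_def by (rule jw_jw_left) auto
    finally show ?thesis by simp
  qed
  then have "legs n ?u = jw (6 * n) (2 * n) (2 * n) (jw (6 * n) (4 * n) (2 * n) ?u)"
    unfolding legs_def using jw_commute[of 0 "2 * n" "2 * n" "2 * n" "6 * n"] jw_commute[of 0 "2 * n" "4 * n" "2 * n" "6 * n"] by simp
  also have "\<dots> = tau_op n n"
  proof -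
    have "4 * n + 2 * n = 6 * n" "2 * n + n = 3 * n" "n + n = 2 * n" "3 * n + n = 4 * n" by auto
    then show ?thesis unfolding tau_op_def vertex_op_def by (simp only:)
  qed
  finally show ?thesis .
qed

lemma tau_op_absorb:
  shows "2 * n \<le> b \<Longrightarrow> b + l \<le> 4 * n \<Longrightarrow> jw (6 * n) b l (tau_op n n) = tau_op n n"
    and "4 * n \<le> b \<Longrightarrow> b + l \<le> 6 * n \<Longrightarrow> jw (6 * n) b l (tau_op n n) = tau_op n n"
    and "b + l \<le> 2 * n \<Longrightarrow> jw (6 * n) b l (tau_op n n) = tau_op n n"
    and "proj (6 * n) (tau_op n n) = tau_op n n"
proof -
  let ?u = "ncup (4 * n) (3 * n) n (leg_base n)"
  define P where "P i = jw (6 * n) (2 * n * i) (2 * n)" for i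
  have t: "tau_op n n = P 0 (P 1 (P 2 ?u))" using legs_ncup[of n] by (simp add: legs_def P_def)
  have c: "P i (P j v) = P j (P i v)" if "i < 3" "j < 3" for i j v
  proof -
    have "i < j \<or> j < i \<or> i = j" by auto
    then show ?thesis
    proof (elim disjE)
      assume "i < j"
      then have "2 * n * i + 2 * n \<le> 2 * n * j" by (metis Suc_leI mult_Suc_right mult_le_mono2 add.commute)
      moreover have "2 * n * j + 2 * n \<le> 6 * n" using \<open>j < 3\<close> by (auto simp: numeral_3_eq_3 less_Suc_eq)
      ultimately show ?thesis unfolding P_def by (rule jw_commute)
    next
      assume "j < i"
      then have "2 * n * j + 2 * n \<le> 2 * n * i" by (metis Suc_leI mult_Suc_right mult_le_mono2 add.commute)
      moreover have "2 * n * i + 2 * n \<le> 6 * n" using \<open>i < 3\<close> by (auto simp: numeral_3_eq_3 less_Suc_eq)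
      ultimately show ?thesis unfolding P_def by (rule jw_commute[symmetric])
    qed simp
  qed
  have a: "jw (6 * n) b l (P i v) = P i v" if "2 * n * i \<le> b" "b + l \<le> 2 * n * i + 2 * n" "i < 3" for b l i v
    unfolding P_def by (rule jw_jw_left) (use that in \<open>auto simp: numeral_3_eq_3 less_Suc_eq\<close>)
  have t0: "tau_op n n = P 0 (P 1 (P 2 ?u))" "tau_op n n = P 1 (P 0 (P 2 ?u))" "tau_op n n = P 2 (P 0 (P 1 ?u))"
    using t c[of 0 1] c[of 0 2] c[of 1 2] by (simp_all)
  show "jw (6 * n) b l (tau_op n n) = tau_op n n" if "2 * n \<le> b" "b + l \<le> 4 * n"
    using that a[of 1 b l] by (simp add: t0(2))
  show "jw (6 * n) b l (tau_op n n) = tau_op n n" if "4 * n \<le> b" "b + l \<le> 6 * n"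
    using that a[of 2 b l] by (simp add: t0(3))
  show "jw (6 * n) b l (tau_op n n) = tau_op n n" if "b + l \<le> 2 * n"
    using that a[of 0 b l] by (simp add: t0(1))
  show "proj (6 * n) (tau_op n n) = tau_op n n" unfolding t P_def by simp
qed

text \<open>The lower right half is absorbed by the second leg of the vertex, the lower left one by
  an outer leg, and the upper ones by an outer leg and by the facing end of a bundle. Then the
  strands straighten, which leaves \<open>m\<close> caps between the last two legs of the vertex.
  They yield the product of \<open>cap_coeff\<close>, and the outer idempotents rebuild the vertex
  from \<open>tau_op n i\<close>.\<close>

lemma triangle_term:
  fixes i m :: nat
  defines "n \<equiv> i + m"
  assumes "0 < n"
  defines "X \<equiv> ncup (6 * n) (3 * n) n (tau_op n n)"
  shows "legs n (ncap (6 * n) (5 * n) n (vertex_op (6 * n + 2 * m) (4 * n) m m i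
      (ncap (6 * n + 2 * m) (4 * n + m) i (jw (8 * n) (4 * n) n (jw (8 * n) (5 * n) n X)))))
    = smul (\<Prod>x\<in>{Suc i..n}. cap_coeff x n) (tau_op n n)"
proof -
  let ?V = "tau_op n n"
  have w8: "8 * n = 6 * n + 2 * n" "8 * n = (6 * n + 2 * m) + 2 * i" by (simp_all add: n_def)
  define Y where "Y = ncup (6 * n) (3 * n + i) m ?V"
  define Mid where "Mid u = ncap (6 * n) (5 * n) n (vertex_op (6 * n + 2 * m) (4 * n) m m i (ncap (6 * n + 2 * m) (4 * n + m) i u))" for u
  have vop: "vertex_op (6 * n + 2 * m) (4 * n) m m i u = jw (8 * n) (4 * n) n (jw (8 * n) (5 * n) n (ncup (6 * n + 2 * m) (4 * n + m) i u))" for u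
  proof -
    have "i + m = n" "4 * n + i + m = 5 * n" by (simp_all add: n_def)
    then show ?thesis unfolding vertex_op_def w8(2) by (simp only:)
  qed
  have "jw (8 * n) (5 * n) n X = X"
  proof -
    have "jw (6 * n + 2 * n) (3 * n + 2 * n) n X = ncup (6 * n) (3 * n) n (jw (6 * n) (3 * n) n ?V)"
      unfolding X_def by (rule jw_ncup_right) auto
    also have "jw (6 * n) (3 * n) n ?V = ?V" by (rule tau_op_absorb(1)) auto
    finally show ?thesis by (simp add: X_def)
  qed
  moreover have "legs n (Mid (jw (8 * n) (4 * n) n X)) = legs n (Mid X)"
  proof -
    \<comment> \<open>The second outer leg supplies an extra idempotent at \<open>3 * n\<close>.
      Pushed down to \<open>X\<close>, it sits on the other end of the bundle carrying the lower
      left half, which may therefore be dropped.\<close>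
    have push: "jw (6 * n) (3 * n) n (Mid u) = Mid (jw (8 * n) (3 * n) n u)" for u
    proof -
      have "Mid (jw (8 * n) (3 * n) n u) = ncap (6 * n) (5 * n) n (vertex_op (6 * n + 2 * m) (4 * n) m m i (jw (6 * n + 2 * m) (3 * n) n (ncap (6 * n + 2 * m) (4 * n + m) i u)))"
        unfolding Mid_def w8(2) by (subst jw_ncap_left) (auto simp: n_def)
      also have "vertex_op (6 * n + 2 * m) (4 * n) m m i (jw (6 * n + 2 * m) (3 * n) n v) = jw (8 * n) (3 * n) n (vertex_op (6 * n + 2 * m) (4 * n) m m i v)" for v
      proof -
        have "ncup (6 * n + 2 * m) (4 * n + m) i (jw (6 * n + 2 * m) (3 * n) n v) = jw (8 * n) (3 * n) n (ncup (6 * n + 2 * m) (4 * n + m) i v)"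
          unfolding w8(2) by (rule jw_ncup_left[symmetric]) auto
        moreover have "jw (8 * n) (3 * n) n (jw (8 * n) (4 * n) n u) = jw (8 * n) (4 * n) n (jw (8 * n) (3 * n) n u)"
           "jw (8 * n) (3 * n) n (jw (8 * n) (5 * n) n u) = jw (8 * n) (5 * n) n (jw (8 * n) (3 * n) n u)" for u
          by (rule jw_commute; simp)+
        ultimately show ?thesis unfolding vop by simp
      qed
      also have "ncap (6 * n) (5 * n) n (jw (8 * n) (3 * n) n v) = jw (6 * n) (3 * n) n (ncap (6 * n) (5 * n) n v)" for v
        unfolding w8(1) by (rule jw_ncap_left) auto
      finally show ?thesis unfolding Mid_def ..
    qed
    have "jw (8 * n) (3 * n) n (jw (8 * n) (4 * n) n X) = jw (8 * n) (3 * n) n X"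
    proof -
      have "jw (8 * n) (3 * n) n (jw (8 * n) (4 * n) n X) = jw (8 * n) (4 * n) n (jw (8 * n) (3 * n) n X)"
        by (rule jw_commute) auto
      then show ?thesis using ncup_drop_right[of "3 * n" "6 * n" n ?V] by (simp add: X_def)
    qed
    then have "legs n (jw (6 * n) (3 * n) n (Mid (jw (8 * n) (4 * n) n X))) = legs n (jw (6 * n) (3 * n) n (Mid X))"
      unfolding push by simp
    then show ?thesis by (simp add: legs_absorb2)
  qed
  moreover have "ncap (6 * n + 2 * m) (4 * n + m) i X = Y"
  proof -
    have "X = ncup (6 * n + 2 * i) (3 * n + i) m (ncup (6 * n) (3 * n) i ?V)"
      unfolding X_def n_def by (rule ncup_add) simp
    then have "ncap (6 * n + 2 * m) (3 * n + i + 2 * m) i X = ncup (6 * n) (3 * n + i) m (ncap (6 * n) (3 * n + i) i (ncup (6 * n) (3 * n) i ?V))"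
      by (simp only:) (rule ncap_ncup_right, auto simp: n_def)
    also have "ncap (6 * n) (3 * n + i) i (ncup (6 * n) (3 * n) i ?V) = ?V"
    proof -
      have "ncap (6 * n) (3 * n + i) i (ncup (6 * n) (3 * n) i ?V) = proj (6 * n) ?V"
        by (rule zigzag_right) (simp add: n_def)
      then show ?thesis by (simp only: tau_op_absorb(4))
    qed
    also have "3 * n + i + 2 * m = 4 * n + m" by (simp add: n_def)
    finally show ?thesis by (simp add: Y_def)
  qed
  moreover have "legs n (ncap (6 * n) (5 * n) n (jw (8 * n) (4 * n) n v)) = legs n (ncap (6 * n) (5 * n) n v)" for v
  proof -
    have "ncap (6 * n) (5 * n) n (jw (8 * n) (4 * n) n v) = jw (6 * n) (4 * n) n (ncap (6 * n) (5 * n) n v)"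
      unfolding w8(1) by (rule jw_ncap_left) auto
    then show ?thesis by (simp add: legs_absorb3)
  qed
  moreover have "ncap (6 * n) (5 * n) n (jw (8 * n) (5 * n) n (ncup (6 * n + 2 * m) (4 * n + m) i Y)) = ncap (6 * n) (4 * n + m) m Y"
  proof -
    let ?Z = "ncup (6 * n + 2 * m) (4 * n + m) i Y"
    have Z: "jw (8 * n) (6 * n) n ?Z = ?Z"
    proof -
      have "jw (6 * n + 2 * m + 2 * i) (4 * n + 2 * m + 2 * i) n ?Z = ncup (6 * n + 2 * m) (4 * n + m) i (jw (6 * n + 2 * m) (4 * n + 2 * m) n Y)"
        by (rule jw_ncup_right) (auto simp: n_def)
      also have "jw (6 * n + 2 * m) (4 * n + 2 * m) n Y = ncup (6 * n) (3 * n + i) m (jw (6 * n) (4 * n) n ?V)"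
        unfolding Y_def by (rule jw_ncup_right) (auto simp: n_def)
      also have "jw (6 * n) (4 * n) n ?V = ?V" by (rule tau_op_absorb(2)) auto
      also have "6 * n + 2 * m + 2 * i = 8 * n" by (simp add: n_def)
      also have "4 * n + 2 * m + 2 * i = 6 * n" by (simp add: n_def)
      finally show ?thesis unfolding Y_def .
    qed
    \<comment> \<open>The upper right half faces the strands of the third leg, which already carry
      an idempotent.\<close>
    have "ncap (6 * n) (5 * n) n (jw (8 * n) (5 * n) n ?Z) = ncap (6 * n) (5 * n) n ?Z"
    proof -
      have "ncap (6 * n) (5 * n) n (jw (6 * n + 2 * n) (5 * n) n (jw (6 * n + 2 * n) (5 * n + n) n ?Z)) = ncap (6 * n) (5 * n) n (jw (6 * n + 2 * n) (5 * n + n) n ?Z)"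
        by (rule ncap_drop_left) simp
      moreover have "6 * n + 2 * n = 8 * n" "5 * n + n = 6 * n" by simp_all
      ultimately show ?thesis by (simp only: Z)
    qed
    also have "ncap (6 * n) (5 * n) n ?Z = ncap (6 * n) (5 * n) i (ncap (6 * n + 2 * i) (5 * n + i) m ?Z)"
      using ncap_add[of "6 * n" "5 * n" i m ?Z] by (simp only: n_def)
    also have "ncap (6 * n + 2 * i) (5 * n + i) m ?Z = ncup (6 * n) (4 * n + m) i (ncap (6 * n) (4 * n + m) m Y)"
    proof -
      have "ncap (6 * n + 2 * i) (4 * n + m + 2 * i) m ?Z = ncup (6 * n) (4 * n + m) i (ncap (6 * n) (4 * n + m) m Y)"
        by (rule ncap_ncup_right) (auto simp: n_def)
      moreover have "4 * n + m + 2 * i = 5 * n + i" by (simp add: n_def)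
      ultimately show ?thesis by (simp only:)
    qed
    also have "ncap (6 * n) (5 * n) i (ncup (6 * n) (4 * n + m) i (ncap (6 * n) (4 * n + m) m Y)) = ncap (6 * n) (4 * n + m) m Y"
    proof -
      have "ncap (6 * n) (4 * n + m + i) i (ncup (6 * n) (4 * n + m) i (ncap (6 * n) (4 * n + m) m Y)) = proj (6 * n) (ncap (6 * n) (4 * n + m) m Y)"
        by (rule zigzag_right) (simp add: n_def)
      moreover have "4 * n + m + i = 5 * n" by (simp add: n_def)
      moreover have "4 * n + m \<le> 6 * n" by (simp add: n_def)
      ultimately show ?thesis by (simp only: proj_ncap)
    qed
    finally show ?thesis .
  qed
  moreover have "ncap (6 * n) (4 * n + m) m Y = smul (\<Prod>x\<in>{Suc i..n}. cap_coeff x n) (ncup (4 * n + 2 * i) (3 * n + i) m (tau_op n i))"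
  proof -
    have e: "4 * n + 2 * i + 2 * m = 6 * n" "3 * n + i + 2 * m = 4 * n + m" by (simp_all add: n_def)
    have "ncap (4 * n + 2 * i + 2 * m) (3 * n + i + 2 * m) m (ncup (4 * n + 2 * i + 2 * m) (3 * n + i) m ?V)
        = ncup (4 * n + 2 * i) (3 * n + i) m (ncap (4 * n + 2 * i) (3 * n + i) m ?V)"
      by (rule ncap_ncup_right) (auto simp: n_def)
    then have "ncap (6 * n) (4 * n + m) m Y = ncup (4 * n + 2 * i) (3 * n + i) m (ncap (4 * n + 2 * i) (3 * n + i) m ?V)"
      unfolding e Y_def .
    also have "ncap (4 * n + 2 * i) (3 * n + i) m ?V = smul (\<Prod>x\<in>{Suc i..n}. cap_coeff x n) (tau_op n i)"
      using ncap_tau_op[OF assms(2), of i m] by (simp only: n_def[symmetric])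
    finally show ?thesis by (simp only: linD[OF lin_ncup])
  qed
  moreover have "legs n (ncup (4 * n + 2 * i) (3 * n + i) m (tau_op n i)) = ?V"
  proof -
    let ?k = "4 * n + 2 * i"
    let ?w = "ncup (4 * n) (3 * n) i (leg_base n)"
    have e: "?k + 2 * m = 6 * n" "3 * n + i + 2 * m = 4 * n + m" by (simp_all add: n_def)
    have "2 * n + n = 3 * n" "2 * n + i + n = 3 * n + i" by simp_all
    then have "tau_op n i = jw ?k (2 * n) (i + n) (jw ?k (3 * n + i) (i + n) ?w)"
      unfolding tau_op_def vertex_op_def by (simp only:)
    moreover have "ncup ?k (3 * n + i) m (jw ?k (2 * n) (i + n) u) = jw (6 * n) (2 * n) (i + n) (ncup ?k (3 * n + i) m u)" for u
      unfolding e(1)[symmetric] by (rule jw_ncup_left[symmetric]) (auto simp: n_def)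
    moreover have "ncup ?k (3 * n + i) m (jw ?k (3 * n + i) (i + n) u) = jw (6 * n) (4 * n + m) (i + n) (ncup ?k (3 * n + i) m u)" for u
      unfolding e[symmetric] by (rule jw_ncup_right[symmetric]) (auto simp: n_def)
    moreover have "ncup ?k (3 * n + i) m ?w = ncup (4 * n) (3 * n) n (leg_base n)"
      using ncup_add[of "3 * n" "4 * n" i m "leg_base n"] by (simp add: n_def)
    moreover have "legs n (jw (6 * n) (2 * n) (i + n) u) = legs n u" for u by (rule legs_absorb2) (auto simp: n_def)
    moreover have "legs n (jw (6 * n) (4 * n + m) (i + n) u) = legs n u" for u by (rule legs_absorb3) (auto simp: n_def)
    ultimately show ?thesis by (simp only: legs_ncup)
  qed
  ultimately show ?thesis unfolding Mid_def vop by (simp only: linD[OF lin_legs])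
qed

text \<open>The box of the one side that survives the straightening is expanded into halves. The
  case \<open>n = 0\<close> is separate since the lemmas on caps of the vertex require a
  strand.\<close>

lemma triangle_op:
  "legs n (ncap (6 * n) (5 * n) n (jw (8 * n) (4 * n) (2 * n) (ncup (6 * n) (3 * n) n (tau_op n n))))
    = smul (triangle_coeff n) (tau_op n n)"
proof (cases "n = 0")
  case True
  then show ?thesis using tau_op_absorb(4)[of 0] by (simp add: legs_def triangle_coeff_def)
next
  case False
  let ?X = "ncup (6 * n) (3 * n) n (tau_op n n)"
  let ?t = "\<lambda>i. vertex_op (6 * n + 2 * (n - i)) (4 * n) (n - i) (n - i) i (ncap (6 * n + 2 * (n - i)) (4 * n + (n - i)) i (jw (8 * n) (4 * n) n (jw (8 * n) (5 * n) n ?X)))"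
  have "jw (8 * n) (4 * n) (2 * n) ?X = (\<Sum>i\<le>n. smul (box_coeff n i) (?t i))"
  proof -
    have "6 * n + 2 * n = 8 * n" "4 * n + n = 5 * n" by auto
    then show ?thesis using jw_expand[of "4 * n" "6 * n" n ?X] by (simp only:)
  qed
  then have "legs n (ncap (6 * n) (5 * n) n (jw (8 * n) (4 * n) (2 * n) ?X)) = (\<Sum>i\<le>n. smul (box_coeff n i) (legs n (ncap (6 * n) (5 * n) n (?t i))))"
    by (simp add: lin_sum[OF lin_ncap] linD[OF lin_ncap] lin_sum[OF lin_legs] linD[OF lin_legs])
  also have "\<dots> = (\<Sum>i\<le>n. smul (box_coeff n i) (smul (\<Prod>x\<in>{Suc i..n}. cap_coeff x n) (tau_op n n)))"
  proof (rule sum.cong[OF refl])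
    fix i assume "i \<in> {..n}"
    then have "i + (n - i) = n" by simp
    then show "smul (box_coeff n i) (legs n (ncap (6 * n) (5 * n) n (?t i))) = smul (box_coeff n i) (smul (\<Prod>x\<in>{Suc i..n}. cap_coeff x n) (tau_op n n))"
      using triangle_term[of i "n - i"] False by simp
  qed
  finally show ?thesis by (simp add: triangle_coeff_def smul_sum_left)
qed

section \<open>Evaluation of the graphs\<close>

definition TLk :: "nat \<Rightarrow> nat \<Rightarrow> nat \<Rightarrow> skein \<Rightarrow> skein \<Rightarrow> skein" where
  "TLk k a m f v = ncap k a m (insk (2 * m) k (a + m) f v)"

definition TL_id :: "nat \<Rightarrow> skein" where "TL_id m = ncup 0 0 m (basis [])"

text \<open>The operator turned into an element by applying it to the top points of the identity
  diagram.\<close>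

definition wenzl :: "nat \<Rightarrow> skein" where "wenzl m = jw (2 * m) m m (TL_id m)"

lemma lin_TLk: "lin (\<lambda>f. TLk k a m f v)" "lin (TLk k a m f)"
  unfolding TLk_def[abs_def] by (rule lin_comp[OF lin_ncap lin_insk1], rule lin_comp[OF lin_ncap lin_insk2])

lemma cap_skein_eq_capk: "proj (Suc (Suc k)) v = v \<Longrightarrow> cap_skein a v = capk k a v"
  by (simp add: capk_def)

lemma fold_caps: "proj (k + 2 * m) v = v \<Longrightarrow> a \<le> k \<Longrightarrow> fold (\<lambda>i. cap_skein (a + m - 1 - i)) [0..<m] v = ncap k a m v"
proof (induction m arbitrary: v)
  case (Suc m)
  have "[0..<Suc m] = 0 # map Suc [0..<m]" by (simp add: upt_conv_Cons map_Suc_upt del: upt_Suc)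
  then have "fold (\<lambda>i. cap_skein (a + Suc m - 1 - i)) [0..<Suc m] v
      = fold (\<lambda>i. cap_skein (a + m - 1 - i)) [0..<m] (cap_skein (a + m) v)"
    by (simp add: fold_map comp_def del: upt_Suc)
  also have "cap_skein (a + m) v = capk (k + 2 * m) (a + m) v"
    by (rule cap_skein_eq_capk) (use Suc.prems in simp)
  finally show ?case using Suc.IH Suc.prems by simp
qed simp

lemma apply_TL_eq_TLk:
  assumes "proj (2 * m) f = f" "proj k v = v" "a + m \<le> k"
  shows "apply_TL a m f v = TLk k a m f v"
proof -
  have "insert_skein (a + m) f v = insk (2 * m) k (a + m) f v" by (simp add: insk_def assms)
  then show ?thesis unfolding apply_TL_def TLk_def
    using fold_caps[of k m "insk (2 * m) k (a + m) f v" a] assms by simp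
qed

lemma proj_0_basis [simp]: "proj 0 (basis []) = basis []" by (simp add: proj_basis)

lemma proj_TL_id [simp]: "proj (2 * m) (TL_id m) = TL_id m"
  using proj_ncup[of 0 0 m "basis []"] by (simp add: TL_id_def)

lemma TLk_id: "a + m \<le> k \<Longrightarrow> TLk k a m (TL_id m) v = proj k v"
proof -
  assume a: "a + m \<le> k"
  have "insk (2 * m) k b (ncup 0 0 m (basis [])) v = ncup k b m v" if "b \<le> k" for b
  proof (induction m)
    case 0
    show ?case by (simp, rule lin_eqI[where v = v]) (auto intro!: lin_intros simp: insk_basis proj_basis)
  next
    case (Suc m)
    then show ?case using that by (simp add: insk_cupk_inside)
  qed
  then show ?thesis using a by (simp add: TLk_def TL_id_def zigzag_left)
qed

lemma TLk_jw:
  assumes "a + m \<le> k" shows "TLk k a m (jw (2 * m) m m g) v = jw k a m (TLk k a m g v)"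
proof -
  have "insk (2 * m) k (a + m) (jw (2 * m) m m g) v = jw (k + 2 * m) (a + 2 * m) m (insk (2 * m) k (a + m) g v)"
  proof (rule jw_transport[OF lin_insk1])
    fix i k' l' u assume i: "Suc i < m" and k': "2 * m = Suc (Suc k')" and "k + 2 * m = Suc (Suc l')"
    then have l': "l' = k + k'" by simp
    have e: "a + m + (m + i) = a + 2 * m + i" by simp
    have "m + i \<le> k'" using i k' by simp
    then have "insk (Suc (Suc k')) k (a + m) (hook k' (m + i) u) v
      = hook (k + k') (a + m + (m + i)) (insk (Suc (Suc k')) k (a + m) u v)"
      using assms by (simp add: hook_def insk_cupk_inside insk_capk_inside)
    then show "insk (2 * m) k (a + m) (hook k' (m + i) u) v = hook l' (a + 2 * m + i) (insk (2 * m) k (a + m) u v)"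
      unfolding e l' k'[symmetric] .
  qed (use assms in auto)
  then show ?thesis unfolding TLk_def using jw_ncap_right[of a a m k m] assms by simp
qed

lemma TLk_wenzl: "a + m \<le> k \<Longrightarrow> TLk k a m (wenzl m) v = jw k a m v"
  by (simp add: wenzl_def TLk_jw TLk_id)

lemma proj_wenzl [simp]: "proj (2 * m) (wenzl m) = wenzl m" by (simp add: wenzl_def)

text \<open>Coefficients are wrapped as multiples of the empty diagram, so that the lemmas on linear
  maps between skein elements apply to them.\<close>

lemma lookup_lin: "lin (\<lambda>v. Poly_Mapping.single ([]::nat list) (lookup v p))"
  unfolding lin_def
proof (intro conjI allI)
  fix u v c
  show "Poly_Mapping.single ([]::nat list) (lookup (u + v) p) = Poly_Mapping.single [] (lookup u p) + Poly_Mapping.single [] (lookup v p)"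
    by (simp add: lookup_add single_add)
  show "Poly_Mapping.single ([]::nat list) (lookup (smul c v) p) = smul c (Poly_Mapping.single [] (lookup v p))"
    by (rule poly_mapping_eqI) (simp add: lookup_single when_def)
qed

lemma lookup_cupk:
  assumes "p ! j \<noteq> Suc j" "j \<le> k" shows "lookup (cupk k j u) p = 0"
proof -
  have "Poly_Mapping.single ([]::nat list) (lookup (cupk k j u) p) = 0"
  proof (rule lin_eqI[where v = u and F = "\<lambda>v. Poly_Mapping.single [] (lookup (cupk k j v) p)" and G = "\<lambda>v. 0"])
    show "lin (\<lambda>v. Poly_Mapping.single ([]::nat list) (lookup (cupk k j v) p))" by (rule lin_comp[OF lookup_lin lin_cupk])
    show "lin (\<lambda>v. 0)" by (simp add: lin_def)
    fix r show "Poly_Mapping.single ([]::nat list) (lookup (cupk k j (basis r)) p) = 0"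
      using assms nth_cup(2)[of j r] by (auto simp: cupk_basis lookup_single when_def planar_length)
  qed
  then have "lookup (Poly_Mapping.single ([]::nat list) (lookup (cupk k j u) p)) [] = lookup 0 []" by (simp only:)
  then show ?thesis by simp
qed

definition nested_matching :: "nat \<Rightarrow> nat list" where
  "nested_matching m = map (\<lambda>i. 2 * m - 1 - i) [0..<2 * m]"

lemma nth_nested: "i < 2 * m \<Longrightarrow> nested_matching m ! i = 2 * m - 1 - i"
  by (simp add: nested_matching_def)

lemma nested_Suc: "nested_matching (Suc m) = cup_matching m (nested_matching m)"
proof (rule nth_equalityI)
  show "length (nested_matching (Suc m)) = length (cup_matching m (nested_matching m))" by (simp add: nested_matching_def)
  fix i assume "i < length (nested_matching (Suc m))"
  then have i: "i < 2 * m + 2" by (simp add: nested_matching_def)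
  have l: "length (nested_matching m) = 2 * m" by (simp add: nested_matching_def)
  from i have "i < m \<or> i = m \<or> i = Suc m \<or> m + 2 \<le> i" by linarith
  then show "nested_matching (Suc m) ! i = cup_matching m (nested_matching m) ! i"
    using i l by (elim disjE) (auto simp: insert_matching_nth nth_nested shift_index_def)
qed

lemma planar_nested: "planar_matching (2 * m) (nested_matching m)"
proof (induction m)
  case 0 then show ?case by (simp add: nested_matching_def)
next
  case (Suc m) then show ?case using planar_cup[of "2 * m" "nested_matching m" m] by (simp add: nested_Suc)
qed

lemma TL_id_eq: "TL_id m = basis (nested_matching m)"
  unfolding TL_id_def
proof (induction m)
  case 0 then show ?case by (simp add: nested_matching_def)
next
  case (Suc m) then show ?case by (simp add: cupk_basis planar_nested nested_Suc)
qed

text \<open>The coefficient of the identity diagram is 1: all other terms of the recursion have a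
  cup at the top, and the identity diagram has none.\<close>

lemma wenzl_nonzero: "wenzl m \<noteq> 0"
proof -
  let ?G = "\<lambda>v. Poly_Mapping.single ([]::nat list) (lookup v (nested_matching m))"
  have "?G (jw (2 * m) m m (TL_id m)) = ?G (proj (2 * m) (TL_id m))"
  proof (rule jw_absorb[OF lookup_lin])
    fix i k' u assume i: "Suc i < m" "2 * m = Suc (Suc k')"
    have "lookup (cupk k' (m + i) u) (nested_matching m) = 0"
      by (rule lookup_cupk) (use i in \<open>auto simp: nth_nested\<close>)
    then show "?G (cupk k' (m + i) u) = 0" by simp
  qed simp
  then have "?G (wenzl m) = Poly_Mapping.single [] 1" by (simp add: wenzl_def) (simp add: TL_id_eq)
  then have "lookup (?G (wenzl m)) [] = 1" by simp
  then show ?thesis by auto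
qed

lemma cap_ncup_image_left:
  "i \<le> n \<Longrightarrow> a \<le> k \<Longrightarrow> \<exists>u. capk (Suc (Suc (k + 2 * n))) (a + i) (ncup k a (Suc (Suc n)) v) = cupk (k + 2 * n) (a + 2 * n - i) u"
proof (induction n)
  case 0
  then show ?case by (intro exI[of _ v]) (simp add: capk_cupk_right)
next
  case (Suc n)
  let ?W = "k + 2 * Suc n"
  show ?case
  proof (cases "i = Suc n")
    case True
    have "capk (Suc (Suc ?W)) (a + Suc n) (cupk (Suc (Suc ?W)) (Suc (a + Suc n)) (ncup k a (Suc (Suc n)) v)) = proj (Suc (Suc ?W)) (ncup k a (Suc (Suc n)) v)"
      by (rule capk_cupk_right) (use Suc.prems in auto)
    then show ?thesis using Suc.prems True by (intro exI[of _ "ncup k a (Suc n) v"]) (simp add: add.commute[of n a])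
  next
    case False
    then have i: "i \<le> n" using Suc.prems by simp
    then obtain u where u: "capk ?W (a + i) (ncup k a (Suc (Suc n)) v) = cupk (k + 2 * n) (a + 2 * n - i) u"
      using Suc.IH Suc.prems by auto
    have "capk (Suc (Suc ?W)) (a + i) (cupk (Suc (Suc ?W)) (Suc (Suc (a + n))) (ncup k a (Suc (Suc n)) v))
      = cupk ?W (a + n) (capk ?W (a + i) (ncup k a (Suc (Suc n)) v))"
      by (rule capk_cupk_far1) (use Suc.prems i in auto)
    also have "\<dots> = cupk ?W (a + n) (cupk (k + 2 * n) (a + 2 * n - i) u)" unfolding u by simp
    also have "\<dots> = cupk ?W (Suc (Suc (a + 2 * n - i))) (cupk (k + 2 * n) (a + n) u)"
      using cupk_cupk[of "a + n" "a + 2 * n - i" "k + 2 * n" u] Suc.prems i by simp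
    finally show ?thesis using i by (intro exI[of _ "cupk (k + 2 * n) (a + n) u"]) (simp add: Suc_diff_le)
  qed
qed

lemma wenzl_caps:
  assumes "Suc i < m"
  shows "cap_skein i (wenzl m) = 0" "cap_skein (m + i) (wenzl m) = 0"
proof -
  from assms obtain n where n: "m = Suc (Suc n)" "i \<le> n" by (rule two_leE)
  have k: "2 * m = Suc (Suc (Suc (Suc (2 * n))))" using n by simp
  have "cap_skein (m + i) (wenzl m) = capk (Suc (Suc (2 * n))) (m + i) (wenzl m)"
    by (rule cap_skein_eq_capk) (use proj_wenzl[of m] k in simp)
  then show "cap_skein (m + i) (wenzl m) = 0"
    unfolding wenzl_def k using cap_jw[of i m m "Suc (Suc (2 * n))"] n by simp
  obtain u where u: "capk (Suc (Suc (2 * n))) i (TL_id m) = cupk (2 * n) (2 * n - i) u"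
    using cap_ncup_image_left[of i n 0 0 "basis []"] n by (auto simp: TL_id_def)
  have "cap_skein i (wenzl m) = capk (Suc (Suc (2 * n))) i (wenzl m)"
    by (rule cap_skein_eq_capk) (use proj_wenzl[of m] k in simp)
  also have "\<dots> = capk (Suc (Suc (2 * n))) i (jw (Suc (Suc (Suc (Suc (2 * n))))) (Suc (Suc n)) m (TL_id m))"
    unfolding wenzl_def k using n by simp
  also have "\<dots> = jw (Suc (Suc (2 * n))) n m (cupk (2 * n) (2 * n - i) u)"
    using cap_jw_left[of i n m "Suc (Suc (2 * n))" "TL_id m"] n u by simp
  also have "\<dots> = 0" using jw_cup[of "n - i" m n "2 * n" u] n by (simp add: mult_2)
  finally show "cap_skein i (wenzl m) = 0" .
qed

text \<open>A diagram other than the identity has an arc between neighbouring bottom points. Under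
  the caps used for stacking it becomes a cap on \<open>w\<close>.\<close>

lemma TLk_basis_kill:
  assumes "planar_matching (2 * m) p" "p \<noteq> nested_matching m" "a + m \<le> k"
    and "\<And>i k'. Suc i < m \<Longrightarrow> k = Suc (Suc k') \<Longrightarrow> capk k' (a + i) w = 0"
  shows "TLk k a m (basis p) w = 0"
proof -
  have "\<exists>i. Suc i < m \<and> p ! i = Suc i"
  proof (rule ccontr)
    assume "\<not> ?thesis"
    then have no: "Suc i < m \<Longrightarrow> p ! i \<noteq> Suc i" for i by blast
    note b = bottom_short_arc[OF assms(1) no]
    have mp: "matching (2 * m) p" using assms(1) by (rule planar_imp_matching)
    have "p = nested_matching m"
    proof (rule nth_equalityI)
      show "length p = length (nested_matching m)" using planar_length[OF assms(1)] by (simp add: nested_matching_def)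
      fix i assume "i < length p"
      then have i: "i < 2 * m" using planar_length[OF assms(1)] by simp
      show "p ! i = nested_matching m ! i"
      proof (cases "i < m")
        case True then show ?thesis using b[of i] i by (simp add: nth_nested)
      next
        case False
        then have "p ! (2 * m - 1 - i) = i" using b[of "2 * m - 1 - i"] i by simp
        then show ?thesis using matching_eq_iff[OF mp, of "2 * m - 1 - i" i] i by (simp add: nth_nested)
      qed
    qed
    then show False using assms(2) by simp
  qed
  then obtain i where i: "Suc i < m" "p ! i = Suc i" by blast
  from i(1) obtain n where n: "m = Suc (Suc n)" "i \<le> n" by (rule two_leE)
  define k' where "k' = k - 2"
  have k: "k = Suc (Suc k')" using assms(3) n by (simp add: k'_def)
  define p' where "p' = cap_matching i p"
  have pl: "planar_matching (Suc (Suc (Suc (Suc (2 * n))))) p" using assms(1) n by simp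
  then have p': "planar_matching (Suc (Suc (2 * n))) p'" unfolding p'_def by (rule planar_cap') (use n in simp)
  have "p = cup_matching i p'" unfolding p'_def
    using cup_cap_restore[of "Suc (Suc (2 * n))" p i] planar_imp_matching[OF pl] n i by simp
  then have p: "basis p = cupk (Suc (Suc (2 * n))) i (basis p')" using p' by (simp add: cupk_basis)
  let ?u = "insk (Suc (Suc (2 * n))) k (a + m) (basis p') w"
  have "TLk k a m (basis p) w = ncap k a (Suc (Suc n)) (cupk (k + Suc (Suc (2 * n))) (a + m + i) ?u)"
    unfolding TLk_def p n(1) using insk_cupk_inside[of "a + m" k i "Suc (Suc (2 * n))" "basis p'" w] n assms(3) by simp
  also have "\<dots> = ncap k a (Suc (Suc n)) (cupk (Suc (Suc (k + 2 * n))) (Suc (Suc (a + n + i))) ?u)"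
    using n by simp
  also have "\<dots> = 0"
  proof (rule ncap_cup_zero_right)
    have "capk (k' + Suc (Suc (2 * n))) (a + n - i) (insk (Suc (Suc (2 * n))) (Suc (Suc k')) (Suc (Suc (a + n))) (basis p') w)
       = insk (Suc (Suc (2 * n))) k' (a + n) (basis p') (capk k' (a + n - i) w)"
      by (rule insk_capk_left) (use assms(3) n k in auto)
    also have "capk k' (a + n - i) w = 0" using assms(4)[of "n - i" k'] n k by simp
    finally show "capk (k + 2 * n) (a + n - i) ?u = 0" using n k by (simp add: linD[OF lin_insk2])
  qed (use n assms in auto)
  finally show ?thesis .
qed

text \<open>On elements killed by all caps, \<open>f\<close> acts through its identity coefficient
  alone.\<close>

lemma TLk_kill:
  assumes f: "proj (2 * m) f = f" and "a + m \<le> k" "proj k w = w"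
    and "\<And>i k'. Suc i < m \<Longrightarrow> k = Suc (Suc k') \<Longrightarrow> capk k' (a + i) w = 0"
  shows "TLk k a m f w = smul (lookup f (nested_matching m)) w"
proof -
  have keys: "planar_matching (2 * m) p" if "p \<in> Poly_Mapping.keys f" for p
    using f that by (auto simp: mem_skein_space_iff[symmetric] skein_space_def)
  have "TLk k a m f w = (\<Sum>p\<in>Poly_Mapping.keys f. smul (lookup f p) (TLk k a m (basis p) w))"
  proof -
    have "TLk k a m f w = TLk k a m (\<Sum>p\<in>Poly_Mapping.keys f. smul (lookup f p) (basis p)) w" using skein_expand[of f] by simp
    then show ?thesis by (simp add: lin_sum[OF lin_TLk(1)] linD[OF lin_TLk(1)])
  qed
  also have "\<dots> = (\<Sum>p\<in>Poly_Mapping.keys f. if p = nested_matching m then smul (lookup f p) w else 0)"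
  proof (rule sum.cong[OF refl])
    fix p assume p: "p \<in> Poly_Mapping.keys f"
    show "smul (lookup f p) (TLk k a m (basis p) w) = (if p = nested_matching m then smul (lookup f p) w else 0)"
    proof (cases "p = nested_matching m")
      case True
      then show ?thesis using TLk_id[OF assms(2), of w] assms(3) by (simp add: TL_id_eq)
    next
      case False
      then show ?thesis using TLk_basis_kill[OF keys[OF p] False assms(2,4)] by simp
    qed
  qed
  also have "\<dots> = smul (lookup f (nested_matching m)) w"
    by (auto simp: in_keys_iff)
  finally show ?thesis .
qed

lemma insert_matching_empty [simp]: "insert_matching 0 p [] = p"
  by (rule nth_equalityI) (simp_all add: insert_matching_nth)

lemma TLk_id_right:
  assumes "proj (2 * m) f = f" shows "TLk (2 * m) m m f (TL_id m) = f"
proof -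
  have "insk l (2 * r) (2 * r) f (ncup 0 0 r (basis [])) = ncup l 0 r (insk l 0 0 f (basis []))" for l r
  proof (induction r)
    case 0 then show ?case using proj_insk[of 0 0 l f "basis []"] by simp
  next
    case (Suc r)
    have "insk l (Suc (Suc (2 * r))) (Suc (Suc (2 * r))) f (cupk (2 * r) r (ncup 0 0 r (basis []))) =
       cupk (2 * r + l) r (insk l (2 * r) (2 * r) f (ncup 0 0 r (basis [])))"
      by (rule insk_cupk_left) auto
    then show ?case using Suc by (simp add: add.commute)
  qed
  moreover have "insk (2 * m) 0 0 f (basis []) = proj (2 * m) f"
    by (rule lin_eqI[where v = f]) (auto intro!: lin_intros simp: insk_basis proj_basis)
  moreover have "m + m = 2 * m" by simp
  ultimately have "TLk (2 * m) m m f (TL_id m) = ncap (2 * m) m m (ncup (2 * m) 0 m f)"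
    unfolding TLk_def TL_id_def using assms by (simp only:)
  also have "\<dots> = f" using zigzag_right[of 0 m "2 * m" f] assms by simp
  finally show ?thesis .
qed

text \<open>The operator inside \<open>wenzl\<close> faces the bottom of \<open>f\<close>; a cup
  there is turned by the nested caps into a bottom cap of \<open>f\<close>, which vanishes.\<close>

lemma TLk_wenzl_right:
  assumes f: "proj (2 * m) f = f" and kill: "\<And>i. Suc i < m \<Longrightarrow> cap_skein i f = 0"
  shows "TLk (2 * m) m m f (wenzl m) = f"
proof -
  have "TLk (2 * m) m m f (jw (2 * m) m m (TL_id m)) = TLk (2 * m) m m f (proj (2 * m) (TL_id m))"
  proof (rule jw_absorb[OF lin_TLk(2)])
    fix i k' u assume i: "Suc i < m" and k: "2 * m = Suc (Suc k')"
    from i obtain n where n: "m = Suc (Suc n)" "i \<le> n" by (rule two_leE)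
    have k': "k' = Suc (Suc (2 * n))" using k n by simp
    have "TLk (2 * m) m m f (cupk k' (m + i) u) = ncap (2 * m) m m (insk (2 * m) (Suc (Suc k')) (Suc (Suc k')) f (cupk k' (m + i) u))"
      unfolding TLk_def using k by (simp add: mult_2[symmetric])
    also have "insk (2 * m) (Suc (Suc k')) (Suc (Suc k')) f (cupk k' (m + i) u) = cupk (k' + 2 * m) (m + i) (insk (2 * m) k' k' f u)"
      by (rule insk_cupk_left) (use k i in auto)
    also have "ncap (2 * m) m m (cupk (k' + 2 * m) (m + i) (insk (2 * m) k' k' f u))
       = ncap (2 * m) m (Suc (Suc n)) (cupk (Suc (Suc (2 * m + 2 * n))) (m + i) (insk (2 * m) k' k' f u))"
      using n k' by (simp add: ac_simps)
    also have "\<dots> = 0"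
    proof (rule ncap_cup_zero_left)
      have "capk k' (n - i) f = cap_skein (n - i) f"
        using cap_skein_eq_capk[of k' f "n - i"] f k by simp
      then have z: "capk k' (n - i) f = 0" using kill[of "n - i"] n by simp
      have "insk k' k' k' (capk k' (n - i) f) u = capk (k' + k') (k' + (n - i)) (insk (Suc (Suc k')) k' k' f u)"
        by (rule insk_capk_inside) (use n k' in auto)
      then have "capk (k' + k') (k' + (n - i)) (insk (2 * m) k' k' f u) = 0" using z k by (simp add: linD(3)[OF lin_insk1])
      moreover have "k' + k' = 2 * m + 2 * n" "k' + (n - i) = m + 2 * n - i" using k' n by auto
      ultimately show "capk (2 * m + 2 * n) (m + 2 * n - i) (insk (2 * m) k' k' f u) = 0" by (simp only:)
    qed (use n in auto)
    finally show "TLk (2 * m) m m f (cupk k' (m + i) u) = 0" .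
  qed simp
  then show ?thesis using TLk_id_right[OF f] by (simp add: wenzl_def)
qed

lemma is_jones_wenzl_wenzl: "is_jones_wenzl m (wenzl m)"
  unfolding is_jones_wenzl_def
proof (intro conjI allI impI)
  show "wenzl m \<in> skein_space (2 * m)" by (simp add: mem_skein_space_iff)
  have "TL_mult m (wenzl m) (wenzl m) = TLk (2 * m) m m (wenzl m) (wenzl m)"
    by (rule apply_TL_eq_TLk) auto
  also have "\<dots> = jw (2 * m) m m (wenzl m)" by (rule TLk_wenzl) simp
  also have "\<dots> = wenzl m" unfolding wenzl_def by (rule jw_jw_left) auto
  finally show "TL_mult m (wenzl m) (wenzl m) = wenzl m" .
qed (auto simp: wenzl_nonzero wenzl_caps)

text \<open>Let c be the identity coefficient of \<open>f\<close>. Idempotency gives c f = f, so c =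
  1 as \<open>f\<close> is nonzero; and the product of \<open>f\<close> and \<open>wenzl m\<close>
  is \<open>f\<close> on the one hand and c times \<open>wenzl m\<close> on the other.\<close>

lemma jones_wenzl_unique:
  assumes "is_jones_wenzl m f" shows "f = wenzl m"
proof -
  have f: "proj (2 * m) f = f" and nz: "f \<noteq> 0" and ff: "TL_mult m f f = f"
    and kill: "\<And>i. Suc i < m \<Longrightarrow> cap_skein i f = 0" "\<And>i. Suc i < m \<Longrightarrow> cap_skein (m + i) f = 0"
    using assms by (auto simp: is_jones_wenzl_def mem_skein_space_iff)
  let ?c = "lookup f (nested_matching m)"
  have "TL_mult m f f = TLk (2 * m) m m f f" by (rule apply_TL_eq_TLk) (use f in auto)
  also have "\<dots> = smul ?c f"
  proof (rule TLk_kill)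
    fix i k' assume "Suc i < m" "2 * m = Suc (Suc k')"
    then show "capk k' (m + i) f = 0" using kill(2)[of i] cap_skein_eq_capk[of k' f] f by simp
  qed (use f in auto)
  finally have "smul (?c - 1) f = 0" using ff by (simp add: smul_minus)
  then have c: "?c = 1" using nz by (simp add: smul_eq_0_iff)
  have "f = TLk (2 * m) m m f (wenzl m)" using TLk_wenzl_right[OF f kill(1)] by simp
  also have "\<dots> = smul ?c (wenzl m)"
  proof (rule TLk_kill)
    fix i k' assume "Suc i < m" "2 * m = Suc (Suc k')"
    then show "capk k' (m + i) (wenzl m) = 0"
      using wenzl_caps(2)[of i m] cap_skein_eq_capk[of k' "wenzl m"] proj_wenzl[of m] by simp
  qed (use f in auto)
  finally show ?thesis using c by simp
qed

lemma jones_wenzl_eq: "jones_wenzl m = wenzl m"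
  unfolding jones_wenzl_def using is_jones_wenzl_wenzl jones_wenzl_unique by (rule the_equality)

section \<open>From slices of a diagram to operators\<close>

lemma slice_skein_Box:
  assumes "proj k v = v" "a + m \<le> k" shows "slice_skein (Box a m) v = jw k a m v"
  using apply_TL_eq_TLk[OF proj_wenzl assms] TLk_wenzl[OF assms(2)] by (simp add: jones_wenzl_eq)

lemma slice_skein_Cup: "proj k v = v \<Longrightarrow> slice_skein (Cup a) v = cupk k a v"
  by (simp add: cupk_def)

lemma slice_skein_Cap: "proj (Suc (Suc k)) v = v \<Longrightarrow> slice_skein (Cap a) v = capk k a v"
  by (simp add: capk_def)

lemma attach_append: "attach (x @ y) v = attach y (attach x v)"
  by (simp add: attach_def)

lemma attach_Cons: "attach (s # D) v = attach D (slice_skein s v)"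
  by (simp add: attach_def)

lemma attach_Nil [simp]: "attach [] v = v" by (simp add: attach_def)

lemma attach_nested_cups: "proj k v = v \<Longrightarrow> a \<le> k \<Longrightarrow> attach (nested_cups a m) v = ncup k a m v"
proof (induction m)
  case (Suc m)
  then have "attach (nested_cups a (Suc m)) v = slice_skein (Cup (a + m)) (ncup k a m v)"
    by (simp add: nested_cups_def attach_append attach_Cons)
  then show ?case using slice_skein_Cup[of "k + 2 * m" "ncup k a m v" "a + m"] Suc by simp
qed (simp add: nested_cups_def)

lemma attach_nested_caps: "proj (k + 2 * m) v = v \<Longrightarrow> a \<le> k \<Longrightarrow> attach (nested_caps a m) v = ncap k a m v"
proof (induction m arbitrary: v)
  case (Suc m)
  have "nested_caps a (Suc m) = Cap (a + m) # nested_caps a m"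
    by (simp add: nested_caps_def upt_conv_Cons map_Suc_upt[symmetric] comp_def del: upt_Suc)
  then have "attach (nested_caps a (Suc m)) v = attach (nested_caps a m) (slice_skein (Cap (a + m)) v)"
    by (simp add: attach_Cons)
  also have "slice_skein (Cap (a + m)) v = capk (k + 2 * m) (a + m) v"
    by (rule slice_skein_Cap) (use Suc.prems in simp)
  finally show ?case using Suc by simp
qed (simp add: nested_caps_def)

lemma proj_ncup': "K = k + 2 * m \<Longrightarrow> a \<le> k \<Longrightarrow> proj K (ncup k a m v) = ncup k a m v"
  using proj_ncup by simp

lemma attach_vertex:
  assumes "proj k v = v" "s \<le> k"
  shows "attach (vertex_at s (2 * n) (2 * n) (2 * n)) v = jw (k + 6 * n) (s + 4 * n) (2 * n) (jw (k + 6 * n) (s + 2 * n) (2 * n)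
    (jw (k + 6 * n) s (2 * n) (ncup (k + 4 * n) (s + 3 * n) n (ncup (k + 2 * n) (s + n) n (ncup k s n v)))))"
proof -
  define u1 where "u1 = ncup k s n v"
  define u2 where "u2 = ncup (k + 2 * n) (s + n) n u1"
  define u3 where "u3 = ncup (k + 4 * n) (s + 3 * n) n u2"
  have p1: "proj (k + 2 * n) u1 = u1" unfolding u1_def using assms by simp
  have p2: "proj (k + 4 * n) u2 = u2" unfolding u2_def by (rule proj_ncup') (use assms in auto)
  have p3: "proj (k + 6 * n) u3 = u3" unfolding u3_def by (rule proj_ncup') (use assms in auto)
  have d: "(2 * n + 2 * n - 2 * n) div 2 = n" by simp
  have "attach (nested_cups s n) v = u1" unfolding u1_def by (rule attach_nested_cups) fact+
  moreover have "attach (nested_cups (s + n) n) u1 = u2" unfolding u2_def by (rule attach_nested_cups[OF p1]) (use assms in simp)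
  moreover have "attach (nested_cups (s + 3 * n) n) u2 = u3" unfolding u3_def by (rule attach_nested_cups[OF p2]) (use assms in simp)
  moreover have "s + n + 2 * n = s + 3 * n" "s + 2 * n + 2 * n = s + 4 * n" by simp_all
  ultimately have "attach (vertex_at s (2 * n) (2 * n) (2 * n)) v = attach [Box s (2 * n), Box (s + 2 * n) (2 * n), Box (s + 4 * n) (2 * n)] u3"
    unfolding vertex_at_def d Let_def attach_append by (simp only:)
  also have "\<dots> = jw (k + 6 * n) (s + 4 * n) (2 * n) (jw (k + 6 * n) (s + 2 * n) (2 * n) (jw (k + 6 * n) s (2 * n) u3))"
    unfolding attach_Cons attach_Nil using assms p3
    by (subst slice_skein_Box[where k = "k + 6 * n"], simp, simp)+ simp
  finally show ?thesis by (simp only: u1_def u2_def u3_def)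
qed

lemma boxes_eq_legs:
  "jw (6 * n) (4 * n) (2 * n) (jw (6 * n) (2 * n) (2 * n) (jw (6 * n) 0 (2 * n) v)) = legs n v"
  unfolding legs_def using jw_commute[of 0 "2 * n" "2 * n" "2 * n" "6 * n"] jw_commute[of 0 "2 * n" "4 * n" "2 * n" "6 * n"]
   jw_commute[of "2 * n" "2 * n" "4 * n" "2 * n" "6 * n"] by simp

lemma legs_absorb1:
  assumes "b + l \<le> 2 * n" shows "legs n (jw (6 * n) b l v) = legs n v"
  unfolding boxes_eq_legs[symmetric] using jw_jw_right[of 0 b l "2 * n" "6 * n"] assms by simp

lemma attach_tau: "attach (tau (2 * n) (2 * n) (2 * n)) (basis []) = tau_op n n"
proof -
  let ?u = "ncup (4 * n) (3 * n) n (ncup (2 * n) n n (ncup 0 0 n (basis [])))"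
  have "attach (tau (2 * n) (2 * n) (2 * n)) (basis []) = legs n ?u"
    unfolding tau_def using attach_vertex[of 0 "basis []" 0 n] boxes_eq_legs by simp
  also have "ncup (2 * n) n n (ncup 0 0 n (basis [])) = ncup 0 0 (2 * n) (basis [])"
    using ncup_add[of 0 0 n n "basis []"] by (simp add: mult_2)
  also have "legs n (ncup (4 * n) (3 * n) n (ncup 0 0 (2 * n) (basis []))) = legs n (ncup (4 * n) (3 * n) n (leg_base n))"
  proof -
    have "ncup (4 * n) (3 * n) n (leg_base n) = jw (4 * n + 2 * n) 0 (2 * n) (ncup (4 * n) (3 * n) n (ncup 0 0 (2 * n) (basis [])))"
      unfolding leg_base_def by (rule jw_ncup_left[symmetric]) auto
    then show ?thesis using legs_absorb1[of 0 "2 * n" n] by simp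
  qed
  finally show ?thesis by (simp only: legs_ncup)
qed

text \<open>This lemma and the following ones have variables with equations in place of sums, so
  that they match widths and positions that are numeral multiples of \<open>n\<close>.\<close>

lemma jw_ncup_right': "K = k + 2 * m \<Longrightarrow> B = b + 2 * m \<Longrightarrow> a \<le> b \<Longrightarrow> b + l \<le> k \<Longrightarrow> jw K B l (ncup k a m v) = ncup k a m (jw k b l v)"
  using jw_ncup_right by simp
lemma jw_ncup_left': "K = k + 2 * m \<Longrightarrow> b + l \<le> a \<Longrightarrow> a \<le> k \<Longrightarrow> jw K b l (ncup k a m v) = ncup k a m (jw k b l v)"
  using jw_ncup_left by simp
lemma jw_ncap_right': "K = k + 2 * m \<Longrightarrow> B = b + 2 * m \<Longrightarrow> a \<le> b \<Longrightarrow> b + l \<le> k \<Longrightarrow> ncap k a m (jw K B l v) = jw k b l (ncap k a m v)"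
  using jw_ncap_right by simp
lemma jw_ncap_left': "K = k + 2 * m \<Longrightarrow> b + l \<le> a \<Longrightarrow> a \<le> k \<Longrightarrow> ncap k a m (jw K b l v) = jw k b l (ncap k a m v)"
  using jw_ncap_left by simp
lemma ncap_ncup_right': "K = k + 2 * m \<Longrightarrow> B = b + 2 * m \<Longrightarrow> K' = k + 2 * l \<Longrightarrow> a \<le> b \<Longrightarrow> b \<le> k \<Longrightarrow>
    ncap K B l (ncup K' a m v) = ncup k a m (ncap k b l v)"
  using ncap_ncup_right by simp
lemma ncap_ncup_left': "K = k + 2 * m \<Longrightarrow> A = a + 2 * l \<Longrightarrow> K' = k + 2 * l \<Longrightarrow> b \<le> a \<Longrightarrow> a \<le> k \<Longrightarrow>
    ncap K b l (ncup K' A m v) = ncup k a m (ncap k b l v)"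
  using ncap_ncup_left by simp
lemma zigzag_left': "C = c + m \<Longrightarrow> c + m \<le> k \<Longrightarrow> proj k v = v \<Longrightarrow> ncap k c m (ncup k C m v) = v"
  using zigzag_left by simp
lemma zigzag_right': "C = c + m \<Longrightarrow> c + m \<le> k \<Longrightarrow> proj k v = v \<Longrightarrow> ncap k C m (ncup k c m v) = v"
  using zigzag_right by simp
lemma ncap_split: "K = k + 2 * n \<Longrightarrow> b = a + n \<Longrightarrow> ncap k a (2 * n) v = ncap k a n (ncap K b n v)"
  using ncap_add[of k a n n v] by (simp add: mult_2)
lemma ncap_drop_right': "K = k + 2 * m \<Longrightarrow> b = a + m \<Longrightarrow> a \<le> k \<Longrightarrow> jw K a m v = v \<Longrightarrow> ncap k a m (jw K b m v) = ncap k a m v"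
  using ncap_drop_right[of a k m v] by simp
lemma ncap_drop_left': "K = k + 2 * m \<Longrightarrow> b = a + m \<Longrightarrow> a \<le> k \<Longrightarrow> jw K b m v = v \<Longrightarrow> ncap k a m (jw K a m v) = ncap k a m v"
  using ncap_drop_left[of a k m v] by simp

text \<open>Joining a new vertex along an edge only splits the strands of the old leg into two
  halves with a nest of \<open>n\<close> cups between them. Thus two of the three sides lose their
  idempotents, and what remains is the situation of \<open>triangle_op\<close>, with the side
  between the second and third vertex still carrying its box.\<close>

lemma skein_of_triangle:
  "skein_of (triangle_graph (2 * n)) = smul (triangle_coeff n) (skein_of (tau (2 * n) (2 * n) (2 * n)))"
proof -
  let ?V = "tau_op n n"
  let ?b = "2 * n"
  define X where "X = ncup (6 * n) (3 * n) n ?V"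
  have pV: "proj (6 * n) ?V = ?V" by (rule tau_op_absorb(4))
  have pX: "proj (8 * n) X = X" unfolding X_def by (rule proj_ncup') auto
  have st1: "attach (vertex_at 0 ?b ?b ?b) (basis []) = ?V" using attach_tau by (simp add: tau_def)

  define u2 where "u2 = ncup (10 * n) (7 * n) n (ncup (8 * n) (5 * n) n (ncup (6 * n) (4 * n) n ?V))"
  define S2 where "S2 = jw (12 * n) (8 * n) ?b (jw (12 * n) (6 * n) ?b (jw (12 * n) (4 * n) ?b u2))"
  have pu2: "proj (12 * n) u2 = u2" unfolding u2_def by (rule proj_ncup') auto
  have st2: "attach (vertex_at (4 * n) ?b ?b ?b) ?V = S2"
    using attach_vertex[OF pV, of "4 * n" n] by (simp add: S2_def u2_def)
  have pS2: "proj (12 * n) S2 = S2" unfolding S2_def by (rule proj_jw) auto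

  \<comment> \<open>The result of joining the first two vertices: \<open>X\<close> is the first
    vertex with its second leg split, and the two boxes belong to the boundary leg of the second
    vertex and to its side towards the third one.\<close>
  define E1 where "E1 = jw (8 * n) (4 * n) ?b (jw (8 * n) (2 * n) ?b X)"
  have e1: "ncap (8 * n) (2 * n) ?b (jw (12 * n) (2 * n) ?b S2) = E1"
  proof -
    have abs: "jw (12 * n) (2 * n) ?b u2 = u2"
    proof -
      have "jw (12 * n) (2 * n) ?b u2 = ncup (10 * n) (7 * n) n (jw (10 * n) (2 * n) ?b (ncup (8 * n) (5 * n) n (ncup (6 * n) (4 * n) n ?V)))"
        unfolding u2_def by (rule jw_ncup_left') auto
      also have "jw (10 * n) (2 * n) ?b (ncup (8 * n) (5 * n) n (ncup (6 * n) (4 * n) n ?V)) = ncup (8 * n) (5 * n) n (jw (8 * n) (2 * n) ?b (ncup (6 * n) (4 * n) n ?V))"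
        by (rule jw_ncup_left') auto
      also have "jw (8 * n) (2 * n) ?b (ncup (6 * n) (4 * n) n ?V) = ncup (6 * n) (4 * n) n (jw (6 * n) (2 * n) ?b ?V)"
        by (rule jw_ncup_left') auto
      also have "jw (6 * n) (2 * n) ?b ?V = ?V" by (rule tau_op_absorb(1)) auto
      finally show ?thesis by (simp only: u2_def)
    qed
    have "jw (12 * n) (2 * n) ?b S2 = jw (12 * n) (8 * n) ?b (jw (12 * n) (6 * n) ?b (jw (12 * n) (4 * n) ?b (jw (12 * n) (2 * n) ?b u2)))"
      unfolding S2_def using jw_commute[of "2 * n" ?b "8 * n" ?b "12 * n"] jw_commute[of "2 * n" ?b "6 * n" ?b "12 * n"] jw_commute[of "2 * n" ?b "4 * n" ?b "12 * n"] by simp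
    then have "ncap (8 * n) (2 * n) ?b (jw (12 * n) (2 * n) ?b S2) = ncap (8 * n) (2 * n) ?b (jw (12 * n) (8 * n) ?b (jw (12 * n) (6 * n) ?b (jw (12 * n) (4 * n) ?b u2)))"
      unfolding abs by simp
    also have "\<dots> = jw (8 * n) (4 * n) ?b (ncap (8 * n) (2 * n) ?b (jw (12 * n) (6 * n) ?b (jw (12 * n) (4 * n) ?b u2)))"
      by (rule jw_ncap_right') auto
    also have "ncap (8 * n) (2 * n) ?b (jw (12 * n) (6 * n) ?b (jw (12 * n) (4 * n) ?b u2)) = jw (8 * n) (2 * n) ?b (ncap (8 * n) (2 * n) ?b (jw (12 * n) (4 * n) ?b u2))"
      by (rule jw_ncap_right') auto
    also have "ncap (8 * n) (2 * n) ?b (jw (12 * n) (4 * n) ?b u2) = ncap (8 * n) (2 * n) ?b u2"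
      by (rule ncap_drop_right') (use abs in auto)
    also have "\<dots> = ncap (8 * n) (2 * n) n (ncap (10 * n) (3 * n) n u2)"
      by (rule ncap_split) auto
    also have "ncap (10 * n) (3 * n) n u2 = ncup (8 * n) (5 * n) n (ncap (8 * n) (3 * n) n (ncup (8 * n) (5 * n) n (ncup (6 * n) (4 * n) n ?V)))"
      unfolding u2_def by (rule ncap_ncup_left') auto
    also have "ncap (8 * n) (3 * n) n (ncup (8 * n) (5 * n) n (ncup (6 * n) (4 * n) n ?V)) = ncup (6 * n) (3 * n) n (ncap (6 * n) (3 * n) n (ncup (6 * n) (4 * n) n ?V))"
      by (rule ncap_ncup_left') auto
    also have "ncap (6 * n) (3 * n) n (ncup (6 * n) (4 * n) n ?V) = ?V"
      by (rule zigzag_left') (use pV in auto)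
    also have "ncap (8 * n) (2 * n) n (ncup (8 * n) (5 * n) n (ncup (6 * n) (3 * n) n ?V)) = ncup (6 * n) (3 * n) n (ncap (6 * n) (2 * n) n (ncup (6 * n) (3 * n) n ?V))"
      by (rule ncap_ncup_left') auto
    also have "ncap (6 * n) (2 * n) n (ncup (6 * n) (3 * n) n ?V) = ?V"
      by (rule zigzag_left') (use pV in auto)
    finally show ?thesis by (simp only: E1_def X_def)
  qed
  have pE1: "proj (8 * n) E1 = E1" unfolding E1_def by (rule proj_jw) auto

  define w3 where "w3 = ncup (16 * n) (13 * n) n (ncup (14 * n) (11 * n) n (ncup (12 * n) (10 * n) n S2))"
  define S3 where "S3 = jw (18 * n) (14 * n) ?b (jw (18 * n) (12 * n) ?b (jw (18 * n) (10 * n) ?b w3))"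
  have st3: "attach (vertex_at (10 * n) ?b ?b ?b) S2 = S3"
    using attach_vertex[OF pS2, of "10 * n" n] by (simp add: S3_def w3_def)
  have pS3: "proj (18 * n) S3 = S3" unfolding S3_def by (rule proj_jw) auto

  define y3 where "y3 = ncup (12 * n) (9 * n) n (ncup (10 * n) (7 * n) n (ncup (8 * n) (6 * n) n E1))"
  define F where "F = jw (14 * n) (10 * n) ?b (jw (14 * n) (8 * n) ?b (jw (14 * n) (6 * n) ?b y3))"
  \<comment> \<open>The third vertex is present before the first edge is closed. It lies to the
    right of that edge, so the two operations commute and \<open>F\<close> is the third vertex
    attached to \<open>E1\<close>.\<close>
  have e2: "ncap (14 * n) (2 * n) ?b (jw (18 * n) (2 * n) ?b S3) = F"
  proof -
    have "jw (18 * n) (2 * n) ?b S3 = jw (18 * n) (14 * n) ?b (jw (18 * n) (12 * n) ?b (jw (18 * n) (10 * n) ?b (jw (18 * n) (2 * n) ?b w3)))"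
      unfolding S3_def using jw_commute[of "2 * n" ?b "14 * n" ?b "18 * n"] jw_commute[of "2 * n" ?b "12 * n" ?b "18 * n"] jw_commute[of "2 * n" ?b "10 * n" ?b "18 * n"] by simp
    also have "jw (18 * n) (2 * n) ?b w3 = ncup (16 * n) (13 * n) n (jw (16 * n) (2 * n) ?b (ncup (14 * n) (11 * n) n (ncup (12 * n) (10 * n) n S2)))"
      unfolding w3_def by (rule jw_ncup_left') auto
    also have "jw (16 * n) (2 * n) ?b (ncup (14 * n) (11 * n) n (ncup (12 * n) (10 * n) n S2)) = ncup (14 * n) (11 * n) n (jw (14 * n) (2 * n) ?b (ncup (12 * n) (10 * n) n S2))"
      by (rule jw_ncup_left') auto
    also have "jw (14 * n) (2 * n) ?b (ncup (12 * n) (10 * n) n S2) = ncup (12 * n) (10 * n) n (jw (12 * n) (2 * n) ?b S2)"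
      by (rule jw_ncup_left') auto
    finally have a: "jw (18 * n) (2 * n) ?b S3 = jw (18 * n) (14 * n) ?b (jw (18 * n) (12 * n) ?b (jw (18 * n) (10 * n) ?b (ncup (16 * n) (13 * n) n (ncup (14 * n) (11 * n) n (ncup (12 * n) (10 * n) n (jw (12 * n) (2 * n) ?b S2))))))" .
    let ?s = "jw (12 * n) (2 * n) ?b S2"
    have "ncap (14 * n) (2 * n) ?b (jw (18 * n) (14 * n) ?b v) = jw (14 * n) (10 * n) ?b (ncap (14 * n) (2 * n) ?b v)" for v
      by (rule jw_ncap_right') auto
    moreover have "ncap (14 * n) (2 * n) ?b (jw (18 * n) (12 * n) ?b v) = jw (14 * n) (8 * n) ?b (ncap (14 * n) (2 * n) ?b v)" for v
      by (rule jw_ncap_right') auto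
    moreover have "ncap (14 * n) (2 * n) ?b (jw (18 * n) (10 * n) ?b v) = jw (14 * n) (6 * n) ?b (ncap (14 * n) (2 * n) ?b v)" for v
      by (rule jw_ncap_right') auto
    moreover have "ncap (14 * n) (2 * n) ?b (ncup (16 * n) (13 * n) n v) = ncup (12 * n) (9 * n) n (ncap (12 * n) (2 * n) ?b v)" for v
      by (rule ncap_ncup_left') auto
    moreover have "ncap (12 * n) (2 * n) ?b (ncup (14 * n) (11 * n) n v) = ncup (10 * n) (7 * n) n (ncap (10 * n) (2 * n) ?b v)" for v
      by (rule ncap_ncup_left') auto
    moreover have "ncap (10 * n) (2 * n) ?b (ncup (12 * n) (10 * n) n v) = ncup (8 * n) (6 * n) n (ncap (8 * n) (2 * n) ?b v)" for v
      by (rule ncap_ncup_left') auto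
    ultimately show ?thesis unfolding a by (simp only: e1 F_def y3_def)
  qed
  have pF: "proj (14 * n) F = F" unfolding F_def by (rule proj_jw) auto

  define Q where "Q = ncup (8 * n) (5 * n) n E1"
  have pQ: "proj (10 * n) Q = Q" unfolding Q_def by (rule proj_ncup') auto
  \<comment> \<open>The second edge straightens like the first one, now splitting a leg of
    \<open>E1\<close>.\<close>
  have e3: "ncap (10 * n) (4 * n) ?b (jw (14 * n) (4 * n) ?b F) = jw (10 * n) (6 * n) ?b (jw (10 * n) (4 * n) ?b Q)"
  proof -
    have abs: "jw (14 * n) (4 * n) ?b y3 = y3"
    proof -
      have "jw (14 * n) (4 * n) ?b y3 = ncup (12 * n) (9 * n) n (jw (12 * n) (4 * n) ?b (ncup (10 * n) (7 * n) n (ncup (8 * n) (6 * n) n E1)))"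
        unfolding y3_def by (rule jw_ncup_left') auto
      also have "jw (12 * n) (4 * n) ?b (ncup (10 * n) (7 * n) n (ncup (8 * n) (6 * n) n E1)) = ncup (10 * n) (7 * n) n (jw (10 * n) (4 * n) ?b (ncup (8 * n) (6 * n) n E1))"
        by (rule jw_ncup_left') auto
      also have "jw (10 * n) (4 * n) ?b (ncup (8 * n) (6 * n) n E1) = ncup (8 * n) (6 * n) n (jw (8 * n) (4 * n) ?b E1)"
        by (rule jw_ncup_left') auto
      also have "jw (8 * n) (4 * n) ?b E1 = E1" unfolding E1_def by (rule jw_jw_left) auto
      finally show ?thesis by (simp only: y3_def)
    qed
    have "jw (14 * n) (4 * n) ?b F = jw (14 * n) (10 * n) ?b (jw (14 * n) (8 * n) ?b (jw (14 * n) (6 * n) ?b (jw (14 * n) (4 * n) ?b y3)))"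
      unfolding F_def using jw_commute[of "4 * n" ?b "10 * n" ?b "14 * n"] jw_commute[of "4 * n" ?b "8 * n" ?b "14 * n"] jw_commute[of "4 * n" ?b "6 * n" ?b "14 * n"] by simp
    then have "ncap (10 * n) (4 * n) ?b (jw (14 * n) (4 * n) ?b F) = ncap (10 * n) (4 * n) ?b (jw (14 * n) (10 * n) ?b (jw (14 * n) (8 * n) ?b (jw (14 * n) (6 * n) ?b y3)))"
      unfolding abs by simp
    also have "\<dots> = jw (10 * n) (6 * n) ?b (ncap (10 * n) (4 * n) ?b (jw (14 * n) (8 * n) ?b (jw (14 * n) (6 * n) ?b y3)))"
      by (rule jw_ncap_right') auto
    also have "ncap (10 * n) (4 * n) ?b (jw (14 * n) (8 * n) ?b (jw (14 * n) (6 * n) ?b y3)) = jw (10 * n) (4 * n) ?b (ncap (10 * n) (4 * n) ?b (jw (14 * n) (6 * n) ?b y3))"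
      by (rule jw_ncap_right') auto
    also have "ncap (10 * n) (4 * n) ?b (jw (14 * n) (6 * n) ?b y3) = ncap (10 * n) (4 * n) ?b y3"
      by (rule ncap_drop_right') (use abs in auto)
    also have "\<dots> = ncap (10 * n) (4 * n) n (ncap (12 * n) (5 * n) n y3)"
      by (rule ncap_split) auto
    also have "ncap (12 * n) (5 * n) n y3 = ncup (10 * n) (7 * n) n (ncap (10 * n) (5 * n) n (ncup (10 * n) (7 * n) n (ncup (8 * n) (6 * n) n E1)))"
      unfolding y3_def by (rule ncap_ncup_left') auto
    also have "ncap (10 * n) (5 * n) n (ncup (10 * n) (7 * n) n (ncup (8 * n) (6 * n) n E1)) = ncup (8 * n) (5 * n) n (ncap (8 * n) (5 * n) n (ncup (8 * n) (6 * n) n E1))"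
      by (rule ncap_ncup_left') auto
    also have "ncap (8 * n) (5 * n) n (ncup (8 * n) (6 * n) n E1) = E1"
      by (rule zigzag_left') (use pE1 in auto)
    also have "ncap (10 * n) (4 * n) n (ncup (10 * n) (7 * n) n (ncup (8 * n) (5 * n) n E1)) = ncup (8 * n) (5 * n) n (ncap (8 * n) (4 * n) n (ncup (8 * n) (5 * n) n E1))"
      by (rule ncap_ncup_left') auto
    also have "ncap (8 * n) (4 * n) n (ncup (8 * n) (5 * n) n E1) = E1"
      by (rule zigzag_left') (use pE1 in auto)
    finally show ?thesis by (simp only: Q_def)
  qed
  \<comment> \<open>The last edge has no new vertex to dissolve. It joins the split leg to the third
    leg of the first vertex, and one zigzag leaves \<open>n\<close> direct caps at
    \<open>5 * n\<close>.\<close>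
  have e4: "ncap (6 * n) (6 * n) ?b (jw (10 * n) (6 * n) ?b (jw (10 * n) (6 * n) ?b (jw (10 * n) (4 * n) ?b Q))) = jw (6 * n) (4 * n) ?b (ncap (6 * n) (5 * n) n E1)"
  proof -
    have abs: "jw (10 * n) (8 * n) ?b Q = Q"
    proof -
      have "jw (10 * n) (8 * n) ?b Q = ncup (8 * n) (5 * n) n (jw (8 * n) (6 * n) ?b E1)"
        unfolding Q_def by (rule jw_ncup_right') auto
      also have "jw (8 * n) (6 * n) ?b E1 = jw (8 * n) (4 * n) ?b (jw (8 * n) (2 * n) ?b (jw (8 * n) (6 * n) ?b X))"
        unfolding E1_def using jw_commute[of "4 * n" ?b "6 * n" ?b "8 * n"] jw_commute[of "2 * n" ?b "6 * n" ?b "8 * n"] by simp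
      also have "jw (8 * n) (6 * n) ?b X = ncup (6 * n) (3 * n) n (jw (6 * n) (4 * n) ?b ?V)"
        unfolding X_def by (rule jw_ncup_right') auto
      also have "jw (6 * n) (4 * n) ?b ?V = ?V" by (rule tau_op_absorb(2)) auto
      finally show ?thesis by (simp only: Q_def E1_def X_def)
    qed
    have "jw (10 * n) (6 * n) ?b (jw (10 * n) (6 * n) ?b (jw (10 * n) (4 * n) ?b Q)) = jw (10 * n) (4 * n) ?b (jw (10 * n) (6 * n) ?b Q)"
      using jw_commute[of "4 * n" ?b "6 * n" ?b "10 * n"] jw_jw_left[of "6 * n" "6 * n" ?b ?b "10 * n"] by simp
    then have "ncap (6 * n) (6 * n) ?b (jw (10 * n) (6 * n) ?b (jw (10 * n) (6 * n) ?b (jw (10 * n) (4 * n) ?b Q)))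
        = ncap (6 * n) (6 * n) ?b (jw (10 * n) (4 * n) ?b (jw (10 * n) (6 * n) ?b Q))" by simp
    also have "\<dots> = jw (6 * n) (4 * n) ?b (ncap (6 * n) (6 * n) ?b (jw (10 * n) (6 * n) ?b Q))"
      by (rule jw_ncap_left') auto
    also have "ncap (6 * n) (6 * n) ?b (jw (10 * n) (6 * n) ?b Q) = ncap (6 * n) (6 * n) ?b Q"
      by (rule ncap_drop_left') (use abs in auto)
    also have "\<dots> = ncap (6 * n) (6 * n) n (ncap (8 * n) (7 * n) n Q)"
      by (rule ncap_split) auto
    also have "ncap (8 * n) (7 * n) n Q = ncup (6 * n) (5 * n) n (ncap (6 * n) (5 * n) n E1)"
      unfolding Q_def by (rule ncap_ncup_right') auto
    also have "ncap (6 * n) (6 * n) n (ncup (6 * n) (5 * n) n (ncap (6 * n) (5 * n) n E1)) = ncap (6 * n) (5 * n) n E1"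
      by (rule zigzag_right') auto
    finally show ?thesis .
  qed
  have E1': "ncap (6 * n) (5 * n) n E1 = jw (6 * n) (2 * n) ?b (ncap (6 * n) (5 * n) n (jw (8 * n) (4 * n) ?b X))"
  proof -
    have "E1 = jw (8 * n) (2 * n) ?b (jw (8 * n) (4 * n) ?b X)" unfolding E1_def by (rule jw_commute[symmetric]) auto
    then show ?thesis by (simp only:) (rule jw_ncap_left', auto)
  qed

  have edge: "attach (edge_at s ?b) v = ncap k s ?b (jw K s ?b v)" if "proj K v = v" "K = k + 4 * n" "s \<le> k" for s k K v
  proof -
    have "slice_skein (Box s ?b) v = jw K s ?b v" by (rule slice_skein_Box) (use that in auto)
    then show ?thesis unfolding edge_at_def attach_Cons
      using attach_nested_caps[of k ?b "jw K s ?b v" s] that by simp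
  qed
  have "skein_of (triangle_graph ?b) = attach [Box 0 ?b, Box ?b ?b, Box (2 * ?b) ?b] (attach (edge_at (3 * ?b) ?b) (attach (edge_at (2 * ?b) ?b) (attach (edge_at ?b ?b)
      (attach (vertex_at (5 * ?b) ?b ?b ?b) (attach (vertex_at (2 * ?b) ?b ?b ?b) (attach (vertex_at 0 ?b ?b ?b) (basis [])))))))"
    by (simp only: skein_of_def triangle_graph_def attach_append)
  also have "\<dots> = attach [Box 0 ?b, Box ?b ?b, Box (4 * n) ?b] (attach (edge_at (6 * n) ?b) (attach (edge_at (4 * n) ?b) (attach (edge_at ?b ?b)
      (attach (vertex_at (10 * n) ?b ?b ?b) (attach (vertex_at (4 * n) ?b ?b ?b) (attach (vertex_at 0 ?b ?b ?b) (basis [])))))))"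
    by simp
  also have "\<dots> = attach [Box 0 ?b, Box ?b ?b, Box (4 * n) ?b] (attach (edge_at (6 * n) ?b) (attach (edge_at (4 * n) ?b) (attach (edge_at ?b ?b) S3)))"
    by (simp only: st1 st2 st3)
  also have "attach (edge_at ?b ?b) S3 = F"
  proof -
    have "18 * n = 14 * n + 4 * n" "2 * n \<le> 14 * n" by simp_all
    from edge[OF pS3 this] e2 show ?thesis by (simp only:)
  qed
  also have "attach (edge_at (4 * n) ?b) F = jw (10 * n) (6 * n) ?b (jw (10 * n) (4 * n) ?b Q)"
  proof -
    have "14 * n = 10 * n + 4 * n" "4 * n \<le> 10 * n" by simp_all
    from edge[OF pF this] e3 show ?thesis by (simp only:)
  qed
  also have "attach (edge_at (6 * n) ?b) (jw (10 * n) (6 * n) ?b (jw (10 * n) (4 * n) ?b Q)) = jw (6 * n) (4 * n) ?b (ncap (6 * n) (5 * n) n E1)"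
  proof -
    have "proj (10 * n) (jw (10 * n) (6 * n) ?b (jw (10 * n) (4 * n) ?b Q)) = jw (10 * n) (6 * n) ?b (jw (10 * n) (4 * n) ?b Q)"
      by (rule proj_jw) simp
    moreover have "10 * n = 6 * n + 4 * n" "6 * n \<le> 6 * n" by simp_all
    ultimately show ?thesis unfolding e4[symmetric] by (rule edge)
  qed
  also have "attach [Box 0 ?b, Box ?b ?b, Box (4 * n) ?b] (jw (6 * n) (4 * n) ?b (ncap (6 * n) (5 * n) n E1)) =
     legs n (jw (6 * n) (4 * n) ?b (ncap (6 * n) (5 * n) n E1))"
    unfolding attach_Cons attach_Nil boxes_eq_legs[symmetric]
    by (subst slice_skein_Box[where k = "6 * n"], simp, simp)+ simp
  also have "\<dots> = legs n (ncap (6 * n) (5 * n) n (jw (8 * n) (4 * n) ?b X))"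
  proof -
    have "legs n (jw (6 * n) (4 * n) ?b v) = legs n v" "legs n (jw (6 * n) (2 * n) ?b v) = legs n v" for v
      by (rule legs_absorb3, auto) (rule legs_absorb2, auto)
    then show ?thesis by (simp only: E1')
  qed
  also have "\<dots> = smul (triangle_coeff n) ?V" unfolding X_def by (rule triangle_op)
  finally show ?thesis by (simp add: skein_of_def attach_tau)
qed

section \<open>Circles and surgery\<close>

text \<open>The arcs at \<open>a\<close> and \<open>b\<close> are cut, \<open>a\<close> is joined to
  \<open>b\<close> and their former partners to each other. A hook does this at two neighbours;
  arbitrary points are allowed since a cap above may move the surgery to distant ones.\<close>

definition surgery :: "nat \<Rightarrow> nat \<Rightarrow> (nat \<Rightarrow> nat) \<Rightarrow> nat \<Rightarrow> nat" where
  "surgery a b f i = (if i = a then b else if i = b then a else if f i = a then f b else if f i = b then f a else f i)"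

definition surgery_matching :: "nat \<Rightarrow> nat \<Rightarrow> nat list \<Rightarrow> nat list" where
  "surgery_matching a b p = map (surgery a b ((!) p)) [0..<length p]"

text \<open>Replaces planarity in the induction over the slices: a surgery at points of different
  parity keeps this condition, while it may create crossings.\<close>

definition alternating :: "nat \<Rightarrow> nat list \<Rightarrow> bool" where
  "alternating k p \<longleftrightarrow> matching k p \<and> (\<forall>i<k. odd (i + p ! i))"

lemma planar_imp_alternating: "planar_matching k p \<Longrightarrow> alternating k p"
  unfolding alternating_def using planar_imp_matching planar_parity by blast

lemma length_surgery [simp]: "length (surgery_matching a b p) = length p"
  by (simp add: surgery_matching_def)

lemma nth_surgery: "i < length p \<Longrightarrow> surgery_matching a b p ! i = surgery a b ((!) p) i"
  by (simp add: surgery_matching_def)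

lemma surgery_commute: "surgery a b f i = surgery b a f i" if "a \<noteq> b" "f (f a) = a" "f (f b) = b"
  using that by (auto simp: surgery_def)

lemma surgery_involution:
  assumes "f (f a) = a" "f (f b) = b" "f (f x) = x" "f x \<noteq> x" "a \<noteq> b" "f a \<noteq> b" "f a \<noteq> a" "f b \<noteq> b"
  shows "surgery a b f x \<noteq> x" "surgery a b f (surgery a b f x) = x"
  using assms unfolding surgery_def by (smt (verit))+

lemma surgery_parity:
  assumes "odd (a + b)" "odd (x + f x)" "odd (a + f a)" "odd (b + f b)"
  shows "odd (x + surgery a b f x)"
  using assms unfolding surgery_def by (auto split: if_splits)

lemma alternating_surgery:
  assumes "alternating k p" "a < k" "b < k" "odd (a + b)" "p ! a \<noteq> b"
  shows "alternating k (surgery_matching a b p)"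
proof -
  have m: "matching k p" and par: "\<And>i. i < k \<Longrightarrow> odd (i + p ! i)" using assms(1) by (auto simp: alternating_def)
  note mm = matchingD[OF m]
  have ab: "a \<noteq> b" using assms(4) by auto
  have lt: "surgery a b ((!) p) i < k" if "i < k" for i using that assms mm by (auto simp: surgery_def)
  have inv: "surgery a b ((!) p) i \<noteq> i" "surgery a b ((!) p) (surgery a b ((!) p) i) = i" if "i < k" for i
    using surgery_involution[of "(!) p" a b i] that assms ab mm by auto
  have odd: "odd (i + surgery a b ((!) p) i)" if "i < k" for i
    by (rule surgery_parity) (use par assms that in auto)
  have n: "surgery_matching a b p ! i = surgery a b ((!) p) i" if "i < k" for i using that mm(1) by (simp add: nth_surgery)
  show ?thesis unfolding alternating_def matching_def
  proof (intro conjI allI impI)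
    show "length (surgery_matching a b p) = k" using mm(1) by simp
    fix i assume i: "i < k"
    show "surgery_matching a b p ! i < k" "surgery_matching a b p ! i \<noteq> i" "odd (i + surgery_matching a b p ! i)"
      unfolding n[OF i] using lt[OF i] inv(1)[OF i] odd[OF i] .
    show "surgery_matching a b p ! (surgery_matching a b p ! i) = i"
      unfolding n[OF i] n[OF lt[OF i]] using inv(2)[OF i] .
  qed
qed

lemma alternating_cup:
  assumes "alternating k p" "c \<le> k" shows "alternating (k + 2) (cup_matching c p)"
proof -
  have m: "matching k p" and par: "\<And>i. i < k \<Longrightarrow> odd (i + p ! i)" using assms(1) by (auto simp: alternating_def)
  have l: "length p = k" using m by (simp add: matching_def)
  have sp: "even (shift_index c 2 j) \<longleftrightarrow> even j" for j by (simp add: shift_index_def)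
  have "odd (i + cup_matching c p ! i)" if "i < k + 2" for i
    using cup_index_cases[OF that assms(2)] nth_cup[of c p] l assms(2) par sp by auto
  then show ?thesis using matching_cup[OF m assms(2)] by (simp add: alternating_def)
qed

lemma bypass_parity: "odd (c + d) \<Longrightarrow> odd (x + f x) \<Longrightarrow> odd (c + f c) \<Longrightarrow> odd (d + f d) \<Longrightarrow> odd (x + bypass c d f x)"
  unfolding bypass_def by (auto split: if_splits)

lemma alternating_cap:
  assumes "alternating (k + 2) p" "c \<le> k" shows "alternating k (cap_matching c p)"
proof -
  have m: "matching (k + 2) p" and par: "\<And>i. i < k + 2 \<Longrightarrow> odd (i + p ! i)" using assms(1) by (auto simp: alternating_def)
  have sp: "even (shift_index c 2 j) \<longleftrightarrow> even j" for j by (simp add: shift_index_def)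
  have "odd (i + cap_matching c p ! i)" if "i < k" for i
  proof -
    have "odd (shift_index c 2 i + bypass c (Suc c) ((!) p) (shift_index c 2 i))"
      by (rule bypass_parity) (use par[of c] par[of "Suc c"] par[of "shift_index c 2 i"] assms(2) that in \<open>auto simp: shift_index_def\<close>)
    then have "odd (shift_index c 2 i + shift_index c 2 (cap_matching c p ! i))" using nth_cap[OF m, of c i] assms(2) that by simp
    then show ?thesis using sp by auto
  qed
  then show ?thesis using matching_cap[OF m assms(2)] by (simp add: alternating_def)
qed

lemma surgery_map:
  assumes "inj \<phi>" "\<And>z. z \<in> {a, b, x} \<Longrightarrow> F (\<phi> z) = \<phi> (f z)"
  shows "surgery (\<phi> a) (\<phi> b) F (\<phi> x) = \<phi> (surgery a b f x)"
  using assms by (auto simp: surgery_def dest: injD)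

lemma cup_surgery:
  assumes "length p = k" "c \<le> k" "a < k" "b < k"
  shows "cup_matching c (surgery_matching a b p) = surgery_matching (shift_index c 2 a) (shift_index c 2 b) (cup_matching c p)"
proof (rule insert_matching_eqI[symmetric])
  let ?s = "shift_index c 2" let ?q = "cup_matching c p"
  show "c \<le> length (surgery_matching a b p)" "length (surgery_matching (?s a) (?s b) ?q) = length (surgery_matching a b p) + length [Suc 0, 0]"
    using assms by auto
  { fix i assume "i < length (surgery_matching a b p)"
    then have i: "i < k" using assms by simp
    have "surgery (?s a) (?s b) ((!) ?q) (?s i) = ?s (surgery a b ((!) p) i)"
      by (rule surgery_map[OF inj_shift_index]) (use assms i in \<open>auto simp: nth_cup\<close>)
    moreover have "?s i < length ?q" using i assms by (auto simp: shift_index_def)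
    ultimately show "surgery_matching (?s a) (?s b) ?q ! shift_index c (length [Suc 0, 0]) i = shift_index c (length [Suc 0, 0]) (surgery_matching a b p ! i)"
      using i assms by (simp add: nth_surgery numeral_2_eq_2) }
  { fix i assume i: "i < length [Suc 0, 0]"
    have ne: "?s z \<noteq> c" "?s z \<noteq> Suc c" for z by (auto simp: shift_index_def)
    have "surgery (?s a) (?s b) ((!) ?q) c = Suc c" "surgery (?s a) (?s b) ((!) ?q) (Suc c) = c"
      using assms ne ne[THEN not_sym] by (auto simp: surgery_def nth_cup)
    moreover have "c < length ?q" "Suc c < length ?q" using assms by auto
    ultimately have "surgery_matching (?s a) (?s b) ?q ! c = Suc c" "surgery_matching (?s a) (?s b) ?q ! Suc c = c"
      by (simp_all only: nth_surgery)
    then show "surgery_matching (?s a) (?s b) ?q ! (c + i) = c + [Suc 0, 0] ! i"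
      using i by (auto simp: less_Suc_eq) }
qed

text \<open>How a cap on \<open>c\<close> and \<open>d\<close> meets a surgery at \<open>a\<close>
  and \<open>b\<close>. In three positions the surgery leaves no trace on the surviving points; if
  \<open>a\<close> alone lies under the cap, the surgery moves to \<open>b\<close> and the partner
  of \<open>d\<close>; otherwise the two operations commute. Stated for an arbitrary involution, so
  that the roles of \<open>c\<close> and \<open>d\<close> can be exchanged.\<close>

lemma bypass_surgery_cases:
  assumes "f (f a) = a" "f (f b) = b" "f (f c) = c" "f (f d) = d" "f (f x) = x" "c \<noteq> d" "x \<noteq> c" "x \<noteq> d" "a \<noteq> b" "f a \<noteq> b"
    and "f a \<noteq> a" "f b \<noteq> b" "f c \<noteq> c" "f d \<noteq> d" "f x \<noteq> x"
  shows "a = c \<Longrightarrow> b = d \<Longrightarrow> bypass c d (surgery a b f) x = bypass c d f x"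
    and "a = c \<Longrightarrow> b \<noteq> d \<Longrightarrow> f c = d \<Longrightarrow> bypass c d (surgery a b f) x = bypass c d f x"
    and "a \<noteq> c \<Longrightarrow> a \<noteq> d \<Longrightarrow> b \<noteq> c \<Longrightarrow> b \<noteq> d \<Longrightarrow> f a = c \<Longrightarrow> f b = d \<Longrightarrow> bypass c d (surgery a b f) x = bypass c d f x"
    and "a = c \<Longrightarrow> b \<noteq> d \<Longrightarrow> f c \<noteq> d \<Longrightarrow> f d \<noteq> b \<Longrightarrow> bypass c d (surgery a b f) x = surgery b (f d) (bypass c d f) x"
    and "a \<noteq> c \<Longrightarrow> a \<noteq> d \<Longrightarrow> b \<noteq> c \<Longrightarrow> b \<noteq> d \<Longrightarrow> \<not> (f a = c \<and> f b = d) \<Longrightarrow> \<not> (f a = d \<and> f b = c) \<Longrightarrow>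
       bypass c d (surgery a b f) x = surgery a b (bypass c d f) x"
proof -
  have e: "f x = a \<longleftrightarrow> x = f a" "f x = b \<longleftrightarrow> x = f b" "f x = c \<longleftrightarrow> x = f c" "f x = d \<longleftrightarrow> x = f d" using assms by auto
  show "a = c \<Longrightarrow> b = d \<Longrightarrow> bypass c d (surgery a b f) x = bypass c d f x"
    using assms unfolding surgery_def bypass_def by (smt (verit))
  show "a = c \<Longrightarrow> b \<noteq> d \<Longrightarrow> f c = d \<Longrightarrow> bypass c d (surgery a b f) x = bypass c d f x"
    using assms unfolding surgery_def bypass_def by (smt (verit))
  show "a \<noteq> c \<Longrightarrow> a \<noteq> d \<Longrightarrow> b \<noteq> c \<Longrightarrow> b \<noteq> d \<Longrightarrow> f a = c \<Longrightarrow> f b = d \<Longrightarrow> bypass c d (surgery a b f) x = bypass c d f x"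
    using assms unfolding surgery_def bypass_def by (smt (verit))
  show "a = c \<Longrightarrow> b \<noteq> d \<Longrightarrow> f c \<noteq> d \<Longrightarrow> f d \<noteq> b \<Longrightarrow> bypass c d (surgery a b f) x = surgery b (f d) (bypass c d f) x"
    using assms unfolding surgery_def bypass_def by (smt (z3))
  show "a \<noteq> c \<Longrightarrow> a \<noteq> d \<Longrightarrow> b \<noteq> c \<Longrightarrow> b \<noteq> d \<Longrightarrow> \<not> (f a = c \<and> f b = d) \<Longrightarrow> \<not> (f a = d \<and> f b = c) \<Longrightarrow>
       bypass c d (surgery a b f) x = surgery a b (bypass c d f) x"
    using assms unfolding surgery_def bypass_def by (smt (z3))
qed

lemma bypass_swap: "c \<noteq> d \<Longrightarrow> bypass c d f x = bypass d c f x"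
  by (auto simp: bypass_def)

lemma bypass_nth_surgery:
  assumes "length p = k" "c < k" "d < k" "x < k"
  shows "bypass c d ((!) (surgery_matching a b p)) x = bypass c d (surgery a b ((!) p)) x"
  using assms by (simp add: bypass_def nth_surgery)

lemma cap_surgery_same:
  assumes "alternating (k + 2) p" "c \<le> k" "a < k + 2" "b < k + 2" "odd (a + b)" "p ! a \<noteq> b"
    and "\<And>x. x < k + 2 \<Longrightarrow> x \<noteq> c \<Longrightarrow> x \<noteq> Suc c \<Longrightarrow> bypass c (Suc c) (surgery a b ((!) p)) x = bypass c (Suc c) ((!) p) x"
  shows "cap_matching c (surgery_matching a b p) = cap_matching c p"
proof (rule cap_matching_eqI)
  have m: "matching (k + 2) p" using assms(1) by (simp add: alternating_def)
  have l: "length p = k + 2" using m by (simp add: matching_def)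
  show "matching (k + 2) (surgery_matching a b p)" using alternating_surgery[OF assms(1,3-6)] by (simp add: alternating_def)
  show "c \<le> k" "length (cap_matching c p) = k" using assms l by auto
  fix i assume i: "i < k"
  have s: "shift_index c 2 i < k + 2" "shift_index c 2 i \<noteq> c" "shift_index c 2 i \<noteq> Suc c" using i by (auto simp: shift_index_def)
  show "shift_index c 2 (cap_matching c p ! i) = bypass c (Suc c) ((!) (surgery_matching a b p)) (shift_index c 2 i)"
    using nth_cap[OF m, of c i] assms(2) i assms(7)[OF s] bypass_nth_surgery[OF l _ _ s(1), of c "Suc c" a b] by simp
qed

lemma cap_surgery_surgery:
  assumes "alternating (k + 2) p" "c \<le> k" "a < k + 2" "b < k + 2" "odd (a + b)" "p ! a \<noteq> b"
    and "\<And>x. x < k + 2 \<Longrightarrow> x \<noteq> c \<Longrightarrow> x \<noteq> Suc c \<Longrightarrow> bypass c (Suc c) (surgery a b ((!) p)) x =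
      surgery (shift_index c 2 u) (shift_index c 2 v) (bypass c (Suc c) ((!) p)) x"
    and "u < k" "v < k"
  shows "cap_matching c (surgery_matching a b p) = surgery_matching u v (cap_matching c p)"
proof (rule cap_matching_eqI)
  have m: "matching (k + 2) p" using assms(1) by (simp add: alternating_def)
  have l: "length p = k + 2" using m by (simp add: matching_def)
  show "matching (k + 2) (surgery_matching a b p)" using alternating_surgery[OF assms(1,3-6)] by (simp add: alternating_def)
  show "c \<le> k" "length (surgery_matching u v (cap_matching c p)) = k" using assms l by auto
  fix i assume i: "i < k"
  have s: "shift_index c 2 i < k + 2" "shift_index c 2 i \<noteq> c" "shift_index c 2 i \<noteq> Suc c" using i by (auto simp: shift_index_def)
  have "surgery (shift_index c 2 u) (shift_index c 2 v) (bypass c (Suc c) ((!) p)) (shift_index c 2 i)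
     = shift_index c 2 (surgery u v ((!) (cap_matching c p)) i)"
  proof (rule surgery_map[OF inj_shift_index])
    fix z assume "z \<in> {u, v, i}"
    then have "z + 2 < k + 2" using assms i by auto
    then show "bypass c (Suc c) ((!) p) (shift_index c 2 z) = shift_index c 2 (cap_matching c p ! z)"
      using nth_cap[OF m, of c z] assms(2) by simp
  qed
  then show "shift_index c 2 (surgery_matching u v (cap_matching c p) ! i) = bypass c (Suc c) ((!) (surgery_matching a b p)) (shift_index c 2 i)"
    using assms(2) i l assms(7)[OF s] bypass_nth_surgery[OF l _ _ s(1), of c "Suc c" a b] by (simp add: nth_surgery)
qed

text \<open>The number of circles if \<open>p\<close> is closed by \<open>D\<close> with every idempotent replaced by the identity.\<close>

fun loops :: "diagram \<Rightarrow> nat list \<Rightarrow> nat" where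
  "loops [] p = 0"
| "loops (Cup a # D) p = loops D (cup_matching a p)"
| "loops (Cap a # D) p = (if p ! a = Suc a then 1 else 0) + loops D (cap_matching a p)"
| "loops (Cross b a # D) p = loops D p"
| "loops (Box a m # D) p = loops D p"

text \<open>\<open>R\<close> contains the adjacencies of \<open>D\<close>, where the first cutting line of \<open>D\<close> has the number \<open>t\<close>.\<close>

fun connects :: "(nat \<times> nat \<Rightarrow> nat \<times> nat \<Rightarrow> bool) \<Rightarrow> diagram \<Rightarrow> nat \<Rightarrow> bool" where
  "connects R [] t = True"
| "connects R (Cup a # D) t = (R (Suc t, a) (Suc t, Suc a) \<and> (\<forall>j. R (t, j) (Suc t, shift_index a 2 j)) \<and> connects R D (Suc t))"
| "connects R (Cap a # D) t = (R (t, a) (t, Suc a) \<and> (\<forall>j. R (t, shift_index a 2 j) (Suc t, j)) \<and> connects R D (Suc t))"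
| "connects R (Cross b a # D) t = ((\<forall>j. R (t, j) (Suc t, j)) \<and> connects R D (Suc t))"
| "connects R (Box a m # D) t = ((\<forall>j. R (t, j) (Suc t, j)) \<and> connects R D (Suc t))"

lemma surgery_matching_swap:
  assumes "alternating k p" "a < k" "b < k" "a \<noteq> b"
  shows "surgery_matching a b p = surgery_matching b a p"
proof -
  have "p ! (p ! a) = a" "p ! (p ! b) = b" using assms by (simp_all add: alternating_def matching_def)
  then show ?thesis unfolding surgery_matching_def using surgery_commute[OF assms(4)] by simp
qed

lemma arcs_cup:
  assumes "equivp R" "length p = k" "c \<le> k" "\<And>i. i < k \<Longrightarrow> R (t, i) (t, p ! i)"
    "R (Suc t, c) (Suc t, Suc c)" "\<And>j. R (t, j) (Suc t, shift_index c 2 j)" "i < k + 2"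
  shows "R (Suc t, i) (Suc t, cup_matching c p ! i)"
proof -
  note [trans] = equivp_transp[OF assms(1)] and sym = equivp_symp[OF assms(1)]
  consider "i = c" | "i = Suc c" | y where "y < k" "i = shift_index c 2 y" using cup_index_cases[OF assms(7,3)] by auto
  then show ?thesis
  proof cases
    case 3
    have "R (Suc t, i) (t, y)" unfolding 3(2) by (rule sym) (rule assms(6))
    also have "R (t, y) (t, p ! y)" using assms(4) 3 by simp
    also have "R (t, p ! y) (Suc t, shift_index c 2 (p ! y))" by (rule assms(6))
    finally show ?thesis using 3 assms(2,3) by (simp add: nth_cup)
  qed (use assms(2,3,5) sym in \<open>auto simp: nth_cup\<close>)
qed

lemma arcs_cap:
  assumes "equivp R" "matching (k + 2) p" "c \<le> k" "\<And>i. i < k + 2 \<Longrightarrow> R (t, i) (t, p ! i)"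
    "R (t, c) (t, Suc c)" "\<And>j. R (t, shift_index c 2 j) (Suc t, j)" "i < k"
  shows "R (Suc t, i) (Suc t, cap_matching c p ! i)"
proof -
  note tr[trans] = equivp_transp[OF assms(1)] and sym = equivp_symp[OF assms(1)]
  let ?s = "shift_index c 2"
  have si: "?s i < k + 2" using assms(7) by (auto simp: shift_index_def)
  have n: "?s (cap_matching c p ! i) = bypass c (Suc c) ((!) p) (?s i)" using nth_cap[OF assms(2), of c i] assms(3,7) by simp
  have cc: "R (t, c) (t, p ! c)" "R (t, Suc c) (t, p ! Suc c)" using assms(3,4) by auto
  have "R (t, ?s i) (t, bypass c (Suc c) ((!) p) (?s i))"
  proof -
    have x: "R (t, ?s i) (t, p ! ?s i)" by (rule assms(4)[OF si])
    have "R (t, c) (t, p ! Suc c)" using tr[OF assms(5) cc(2)] .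
    moreover have "R (t, Suc c) (t, p ! c)" using tr[OF sym[OF assms(5)] cc(1)] .
    ultimately show ?thesis using x tr[OF x] unfolding bypass_def by auto
  qed
  then have "R (t, ?s i) (t, ?s (cap_matching c p ! i))" using n by simp
  have "R (Suc t, i) (t, ?s i)" by (rule sym) (rule assms(6))
  also have "R (t, ?s i) (t, ?s (cap_matching c p ! i))" by fact
  also have "R (t, ?s (cap_matching c p ! i)) (Suc t, cap_matching c p ! i)" by (rule assms(6))
  finally show ?thesis .
qed

text \<open>A surgery either merges two circles or cuts one, in which case the two points lie on the same
  circle. That the number of circles cannot stay the same is due to \<open>alternating\<close>, which makes the
  circles orientable in a way that is compatible with the surgery.\<close>

lemma loops_surgery:
  assumes "equivp R" "tangle k D 0" "connects R D t" "alternating k p" "\<And>i. i < k \<Longrightarrow> R (t, i) (t, p ! i)"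
    "a < k" "b < k" "odd (a + b)" "p ! a \<noteq> b"
  shows "loops D (surgery_matching a b p) + 1 = loops D p \<or> (loops D (surgery_matching a b p) = loops D p + 1 \<and> R (t, a) (t, b))"
  using assms(2-)
proof (induction D arbitrary: k t p a b)
  case Nil
  then show ?case by simp
next
  case (Cons s D)
  note tr[trans] = equivp_transp[OF assms(1)] and sym = equivp_symp[OF assms(1)]
  have m: "matching k p" using Cons.prems(3) by (simp add: alternating_def)
  have l: "length p = k" using m by (simp add: matching_def)
  have ab: "a \<noteq> b" using Cons.prems(7) by auto
  show ?case
  proof (cases s)
    case [simp]: (Cup c)
    have c: "c \<le> k" using Cons.prems(1) by simp
    have R1: "R (Suc t, c) (Suc t, Suc c)" and R2: "\<And>j. R (t, j) (Suc t, shift_index c 2 j)" using Cons.prems(2) by auto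
    let ?s = "shift_index c 2"
    have "loops D (surgery_matching (?s a) (?s b) (cup_matching c p)) + 1 = loops D (cup_matching c p) \<or>
      (loops D (surgery_matching (?s a) (?s b) (cup_matching c p)) = loops D (cup_matching c p) + 1 \<and> R (Suc t, ?s a) (Suc t, ?s b))"
    proof (rule Cons.IH)
      show "tangle (k + 2) D 0" "connects R D (Suc t)" using Cons.prems by auto
      show "alternating (k + 2) (cup_matching c p)" using alternating_cup Cons.prems c by blast
      show "R (Suc t, i) (Suc t, cup_matching c p ! i)" if "i < k + 2" for i
        by (rule arcs_cup[OF assms(1) l c _ R1 R2 that]) (use Cons.prems in auto)
      show "?s a < k + 2" "?s b < k + 2" using Cons.prems by (auto simp: shift_index_def)
      show "odd (?s a + ?s b)" using Cons.prems by (auto simp: shift_index_def)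
      show "cup_matching c p ! ?s a \<noteq> ?s b" using Cons.prems l c by (simp add: nth_cup)
    qed
    moreover have "R (Suc t, ?s a) (Suc t, ?s b) \<Longrightarrow> R (t, a) (t, b)" using R2[of a] R2[of b] tr sym by metis
    ultimately show ?thesis using cup_surgery[OF l c Cons.prems(5,6)] by auto
  next
    case [simp]: (Cap c)
    define k' where "k' = k - 2"
    have k: "k = k' + 2" "c \<le> k'" using Cons.prems(1) by (auto simp: k'_def)
    have tg: "tangle k' D 0" using Cons.prems(1) k by simp
    have R1: "R (t, c) (t, Suc c)" and R2: "\<And>j. R (t, shift_index c 2 j) (Suc t, j)" and cn: "connects R D (Suc t)" using Cons.prems(2) by auto
    note arcs = Cons.prems(4)
    let ?s = "shift_index c 2" let ?q = "cap_matching c p" let ?S = "surgery_matching a b p"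
    have alt: "alternating (k' + 2) p" using Cons.prems(3) k by simp
    have altq: "alternating k' ?q" using alternating_cap[OF alt k(2)] .
    have mk: "matching (k' + 2) p" using m k by simp
    have arcsq: "R (Suc t, i) (Suc t, ?q ! i)" if "i < k'" for i
      by (rule arcs_cap[OF assms(1) mk k(2) _ R1 R2 that]) (use arcs k in auto)
    have lt: "a < k' + 2" "b < k' + 2" using Cons.prems k by auto
    note same = cap_surgery_same[OF alt k(2) lt Cons.prems(7,8)]
    note surg = cap_surgery_surgery[OF alt k(2) lt Cons.prems(7,8)]
    have inv: "p ! (p ! z) = z" "p ! z \<noteq> z" if "z < k" for z using matchingD[OF m] that by auto
    have ck: "c < k" "Suc c < k" using k by auto
    have Sc: "?S ! c = surgery a b ((!) p) c" using ck l by (simp add: nth_surgery)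
    have par: "odd (z + p ! z)" if "z < k" for z using Cons.prems(3) that by (simp add: alternating_def)
    have nq: "?s (?q ! i) = bypass c (Suc c) ((!) p) (?s i)" if "i < k'" for i using nth_cap[OF mk, of c i] k that by simp
    have IH: "loops D (surgery_matching u v ?q) + 1 = loops D ?q \<or> (loops D (surgery_matching u v ?q) = loops D ?q + 1 \<and> R (t, ?s u) (t, ?s v))"
      if "u < k'" "v < k'" "odd (u + v)" "?q ! u \<noteq> v" for u v
    proof -
      have "R (Suc t, u) (Suc t, v) \<Longrightarrow> R (t, ?s u) (t, ?s v)" using R2[of u] R2[of v] tr sym by metis
      then show ?thesis using Cons.IH[OF tg cn altq arcsq that] by auto
    qed
    have idx: "\<exists>y<k'. x = ?s y" if "x < k" "x \<noteq> c" "x \<noteq> Suc c" for x using cup_index_cases[of x k' c] that k by auto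
    have sodd: "odd (?s u + ?s v) \<longleftrightarrow> odd (u + v)" for u v by (simp add: shift_index_def)
    have bc: "bypass c (Suc c) ((!) p) x = bypass c' d' ((!) p) x" "bypass c (Suc c) (surgery u v ((!) p)) x = bypass c' d' (surgery u v ((!) p)) x"
      if "(c' = c \<and> d' = Suc c) \<or> (c' = Suc c \<and> d' = c)" for c' d' u v x
      using that bypass_swap[of c "Suc c" "(!) p" x] bypass_swap[of c "Suc c" "surgery u v ((!) p)" x] by auto
    \<comment> \<open>the case in which one of the two points of the surgery lies under the cap\<close>
    have touch: "loops (Cap c # D) (surgery_matching u v p) + 1 = loops (Cap c # D) p \<or>
        (loops (Cap c # D) (surgery_matching u v p) = loops (Cap c # D) p + 1 \<and> R (t, u) (t, v))"
      if uv: "u < k" "v < k" "odd (u + v)" "p ! u \<noteq> v" and cd: "(u = c \<and> d' = Suc c) \<or> (u = Suc c \<and> d' = c)" and vd: "v \<noteq> d'" for u v d'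
    proof -
      let ?U = "surgery_matching u v p"
      have d': "d' < k" "d' \<noteq> u" "odd (u + d')" using cd ck by auto
      have vu: "v \<noteq> u" using uv(3) by auto
      have nl: "?U ! c \<noteq> Suc c" using cd vd vu l ck uv(2,4) inv(1)[OF uv(1)] inv(1)[OF uv(2)] inv[OF ck(1)] inv[OF ck(2)]
        by (auto simp: nth_surgery surgery_def)
      have ltu: "u < k' + 2" "v < k' + 2" using uv k by auto
      show ?thesis
      proof (cases "p ! u = d'")
        case True
        \<comment> \<open>Here the cap closes a circle of \<open>p\<close>. The surgery merges that
          circle with the arc through \<open>v\<close>, so exactly one circle is lost.\<close>
        have "p ! c = Suc c" using True cd inv ck by (metis)
        moreover have "cap_matching c ?U = ?q"
        proof (rule cap_surgery_same[OF alt k(2) ltu uv(3,4)])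
          fix x assume x: "x < k' + 2" "x \<noteq> c" "x \<noteq> Suc c"
          have xk: "x < k" "x \<noteq> u" "x \<noteq> d'" using x k cd by auto
          show "bypass c (Suc c) (surgery u v ((!) p)) x = bypass c (Suc c) ((!) p) x"
            unfolding bc[OF cd] by (rule bypass_surgery_cases(2)[OF inv(1)[OF uv(1)] inv(1)[OF uv(2)] inv(1)[OF uv(1)] inv(1)[OF d'(1)] inv(1)[OF xk(1)] d'(2)[symmetric] xk(2,3)
              vu[symmetric] uv(4) inv(2)[OF uv(1)] inv(2)[OF uv(2)] inv(2)[OF uv(1)] inv(2)[OF d'(1)] inv(2)[OF xk(1)] refl vd True])
        qed
        ultimately show ?thesis using nl by simp
      next
        case False
        \<comment> \<open>The cap leads from \<open>u\<close> through \<open>d'\<close> to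
          \<open>?y\<close>. After the surgery it therefore joins \<open>v\<close> to
          \<open>?y\<close>, which is a surgery at these two points above the cap.\<close>
        let ?y = "p ! d'"
        have y: "?y < k" "?y \<noteq> u" "?y \<noteq> d'" "p ! ?y = d'" using matchingD[OF m] d' False inv[OF uv(1)] by auto
        have yv: "?y \<noteq> v" using par[OF d'(1)] d'(3) uv(3) by auto
        have vcd: "v \<noteq> c" "v \<noteq> Suc c" "?y \<noteq> c" "?y \<noteq> Suc c" using cd vd vu y by auto
        obtain v' where v': "v' < k'" "v = ?s v'" using idx[OF uv(2) vcd(1,2)] by auto
        obtain y' where y': "y' < k'" "?y = ?s y'" using idx[OF y(1) vcd(3,4)] by auto
        have "p ! c \<noteq> Suc c" using False cd inv ck by metis
        moreover have "cap_matching c ?U = surgery_matching v' y' ?q"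
        proof (rule cap_surgery_surgery[OF alt k(2) ltu uv(3,4) _ v'(1) y'(1)])
          fix x assume x: "x < k' + 2" "x \<noteq> c" "x \<noteq> Suc c"
          have xk: "x < k" "x \<noteq> u" "x \<noteq> d'" using x k cd by auto
          have bf: "bypass c (Suc c) f = bypass u d' f" for f using cd bypass_swap[of c "Suc c" f] by (auto intro!: ext)
          show "bypass c (Suc c) (surgery u v ((!) p)) x = surgery (?s v') (?s y') (bypass c (Suc c) ((!) p)) x"
            unfolding bf v'(2)[symmetric] y'(2)[symmetric]
            by (rule bypass_surgery_cases(4)[OF inv(1)[OF uv(1)] inv(1)[OF uv(2)] inv(1)[OF uv(1)] inv(1)[OF d'(1)] inv(1)[OF xk(1)] d'(2)[symmetric] xk(2,3)
              vu[symmetric] uv(4) inv(2)[OF uv(1)] inv(2)[OF uv(2)] inv(2)[OF uv(1)] inv(2)[OF d'(1)] inv(2)[OF xk(1)] refl vd False yv])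
        qed
        moreover have "?q ! v' \<noteq> y'"
        proof
          assume "?q ! v' = y'"
          then have "bypass u d' ((!) p) v = ?y" using nq[OF v'(1)] y'(2) v'(2) bc(1)[OF cd] by simp
          moreover have "p ! v \<noteq> u" "p ! v \<noteq> d'" "p ! v \<noteq> ?y"
            using inv(1)[OF uv(2)] inv(1)[OF uv(1)] uv(4) y(4) vd yv by auto
          ultimately show False by (simp add: bypass_def)
        qed
        \<comment> \<open>Parity is passed on because \<open>u\<close> and \<open>d'\<close> are
          neighbours and arcs change the parity.\<close>
        moreover have "odd (v' + y')" using sodd[of v' y'] v'(2) y'(2) par[OF d'(1)] d'(3) uv(3) by auto
        ultimately have "loops D (cap_matching c ?U) + 1 = loops D ?q \<or> (loops D (cap_matching c ?U) = loops D ?q + 1 \<and> R (t, v) (t, ?y))"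
          using IH[OF v'(1) y'(1)] v'(2) y'(2) by simp
        moreover have "R (t, v) (t, ?y) \<Longrightarrow> R (t, u) (t, v)"
        proof -
          assume r: "R (t, v) (t, ?y)"
          have "R (t, u) (t, d')" using R1 cd sym by auto
          also have "R (t, d') (t, ?y)" using arcs d' by simp
          also have "R (t, ?y) (t, v)" using r sym by blast
          finally show ?thesis .
        qed
        ultimately show ?thesis using nl \<open>p ! c \<noteq> Suc c\<close> by auto
      qed
    qed
    show ?thesis
    proof (cases "{a, b} = {c, Suc c}")
      case True
      then have cd: "(a = c \<and> b = Suc c) \<or> (a = Suc c \<and> b = c)" using ab by (auto simp: doubleton_eq_iff)
      have nl: "p ! c \<noteq> Suc c" using cd Cons.prems(8) inv ck by metis
      \<comment> \<open>The arc created by the surgery is closed by the cap, which gives one circle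
        more.\<close>
      have "?S ! c = Suc c" unfolding Sc using cd by (auto simp: surgery_def)
      moreover have "cap_matching c ?S = ?q"
      proof (rule same)
        fix x assume x: "x < k' + 2" "x \<noteq> c" "x \<noteq> Suc c"
        have xk: "x < k" "x \<noteq> a" "x \<noteq> b" using x k cd by auto
        note ia = inv[OF Cons.prems(5)] and ib = inv[OF Cons.prems(6)]
        show "bypass c (Suc c) (surgery a b ((!) p)) x = bypass c (Suc c) ((!) p) x"
          unfolding bc[OF cd] by (rule bypass_surgery_cases(1)[OF ia(1) ib(1) ia(1) ib(1) inv(1)[OF xk(1)] ab xk(2,3) ab Cons.prems(8)
            ia(2) ib(2) ia(2) ib(2) inv(2)[OF xk(1)] refl refl])
      qed
      moreover have "R (t, a) (t, b)" using cd R1 sym by auto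
      ultimately show ?thesis using nl by simp
    next
      case F1: False
      show ?thesis
      proof (cases "a = c \<or> a = Suc c")
        case True
        define d' where "d' = (if a = c then Suc c else c)"
        have "(a = c \<and> d' = Suc c) \<or> (a = Suc c \<and> d' = c)" "b \<noteq> d'" using True F1 by (auto simp: d'_def)
        from touch[OF Cons.prems(5-8) this] show ?thesis by simp
      next
        case F2: False
        show ?thesis
        proof (cases "b = c \<or> b = Suc c")
          case True
          define d' where "d' = (if b = c then Suc c else c)"
          have cd: "(b = c \<and> d' = Suc c) \<or> (b = Suc c \<and> d' = c)" "a \<noteq> d'" using True F1 F2 by (auto simp: d'_def)
          have "odd (b + a)" "p ! b \<noteq> a" using Cons.prems inv[of a] inv[of b] by (auto simp: add.commute)
          from touch[OF Cons.prems(6,5) this cd] show ?thesis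
            using surgery_matching_swap[OF Cons.prems(3,5,6) ab] sym by auto
        next
          case F3: False
          have n: "a \<noteq> c" "a \<noteq> Suc c" "b \<noteq> c" "b \<noteq> Suc c" using F2 F3 by auto
          show ?thesis
          proof (cases "(p ! a = c \<and> p ! b = Suc c) \<or> (p ! a = Suc c \<and> p ! b = c)")
            \<comment> \<open>Both former partners lie under the cap, so the surgery joins them to
              each other and the cap closes that arc. Before the surgery, the cap connected
              \<open>a\<close> with \<open>b\<close>.\<close>
            case True
            define c' where "c' = p ! a"
            define d' where "d' = p ! b"
            have cd: "(c' = c \<and> d' = Suc c) \<or> (c' = Suc c \<and> d' = c)" using True by (auto simp: c'_def d'_def)
            have pc: "p ! c' = a" "p ! d' = b" using inv Cons.prems by (auto simp: c'_def d'_def)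
            have "p ! c \<noteq> Suc c" using cd pc n by auto
            moreover have "?S ! c = Suc c" unfolding Sc using cd pc n by (auto simp: surgery_def c'_def d'_def)
            moreover have "cap_matching c ?S = ?q"
            proof (rule same)
              fix x assume x: "x < k' + 2" "x \<noteq> c" "x \<noteq> Suc c"
              have xk: "x < k" using x k by simp
              have lt': "c' < k" "d' < k" using cd ck by auto
              have ne: "c' \<noteq> d'" "x \<noteq> c'" "x \<noteq> d'" "a \<noteq> c'" "a \<noteq> d'" "b \<noteq> c'" "b \<noteq> d'" using cd x n by auto
              have "bypass c' d' (surgery a b ((!) p)) x = bypass c' d' ((!) p) x"
                by (rule bypass_surgery_cases(3)[OF inv(1)[OF Cons.prems(5)] inv(1)[OF Cons.prems(6)] inv(1)[OF lt'(1)] inv(1)[OF lt'(2)] inv(1)[OF xk]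
                   ne(1-3) ab Cons.prems(8) inv(2)[OF Cons.prems(5)] inv(2)[OF Cons.prems(6)] inv(2)[OF lt'(1)] inv(2)[OF lt'(2)] inv(2)[OF xk] ne(4-7)
                   c'_def[symmetric] d'_def[symmetric]])
              then show "bypass c (Suc c) (surgery a b ((!) p)) x = bypass c (Suc c) ((!) p) x"
                unfolding bc[OF cd] .
            qed
            moreover have "R (t, a) (t, b)"
            proof -
              have "R (t, a) (t, c')" using arcs Cons.prems by (simp add: c'_def)
              also have "R (t, c') (t, d')" using cd R1 sym by auto
              also have "R (t, d') (t, b)" using arcs[of b] Cons.prems sym by (simp add: d'_def)
              finally show ?thesis .
            qed
            ultimately show ?thesis by simp
          next
            \<comment> \<open>Cap and surgery are now independent, and the surgery continues at the
              renumbered points.\<close>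
            case F4: False
            obtain a' where a': "a' < k'" "a = ?s a'" using idx[OF Cons.prems(5) n(1,2)] by auto
            obtain b' where b': "b' < k'" "b = ?s b'" using idx[OF Cons.prems(6) n(3,4)] by auto
            have "?S ! c = Suc c \<longleftrightarrow> p ! c = Suc c"
              unfolding Sc using F4 n inv[OF ck(1)] inv[OF ck(2)] inv[OF Cons.prems(5)] inv[OF Cons.prems(6)] by (auto simp: surgery_def)
            moreover have "cap_matching c ?S = surgery_matching a' b' ?q"
            proof (rule surg[OF _ a'(1) b'(1)])
              fix x assume x: "x < k' + 2" "x \<noteq> c" "x \<noteq> Suc c"
              have xk: "x < k" using x k by simp
              have F5: "\<not> (p ! a = c \<and> p ! b = Suc c)" "\<not> (p ! a = Suc c \<and> p ! b = c)" "c \<noteq> Suc c" using F4 by auto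
              show "bypass c (Suc c) (surgery a b ((!) p)) x = surgery (?s a') (?s b') (bypass c (Suc c) ((!) p)) x"
                unfolding a'(2)[symmetric] b'(2)[symmetric]
                by (rule bypass_surgery_cases(5)[OF inv(1)[OF Cons.prems(5)] inv(1)[OF Cons.prems(6)] inv(1)[OF ck(1)] inv(1)[OF ck(2)] inv(1)[OF xk]
                   F5(3) x(2,3) ab Cons.prems(8) inv(2)[OF Cons.prems(5)] inv(2)[OF Cons.prems(6)] inv(2)[OF ck(1)] inv(2)[OF ck(2)] inv(2)[OF xk] n F5(1,2)])
            qed
            moreover have "?q ! a' \<noteq> b'"
            proof
              assume "?q ! a' = b'"
              then have "bypass c (Suc c) ((!) p) a = b" using nq[OF a'(1)] a'(2) b'(2) by simp
              then show False using F4 Cons.prems(8) inv[OF ck(1)] inv[OF ck(2)] unfolding bypass_def by metis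
            qed
            moreover have "odd (a' + b')" using sodd[of a' b'] a'(2) b'(2) Cons.prems(7) by simp
            ultimately show ?thesis using IH[OF a'(1) b'(1)] a'(2) b'(2) by auto
          qed
        qed
      qed
    qed
  next
    case [simp]: (Cross x c)
    have 1: "R (t, j) (Suc t, j)" for j using Cons.prems(2) by simp
    have tg: "tangle k D 0" and cn: "connects R D (Suc t)" using Cons.prems by simp_all
    have arcs: "R (Suc t, i) (Suc t, p ! i)" if "i < k" for i
      using Cons.prems(4)[OF that] 1 tr sym by metis
    have "R (Suc t, a) (Suc t, b) \<Longrightarrow> R (t, a) (t, b)" using 1[of a] 1[of b] tr sym by metis
    then show ?thesis using Cons.IH[OF tg cn Cons.prems(3) arcs Cons.prems(5-8)] by auto
  next
    case [simp]: (Box c m)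
    have 1: "R (t, j) (Suc t, j)" for j using Cons.prems(2) by simp
    have tg: "tangle k D 0" and cn: "connects R D (Suc t)" using Cons.prems by simp_all
    have arcs: "R (Suc t, i) (Suc t, p ! i)" if "i < k" for i
      using Cons.prems(4)[OF that] 1 tr sym by metis
    have "R (Suc t, a) (Suc t, b) \<Longrightarrow> R (t, a) (t, b)" using 1[of a] 1[of b] tr sym by metis
    then show ?thesis using Cons.IH[OF tg cn Cons.prems(3) arcs Cons.prems(5-8)] by auto
  qed
qed

section \<open>Power series in q\<close>

abbreviation qp :: "nat \<Rightarrow> rat fps" where "qp m \<equiv> q_pochhammer fps_X fps_X m"
abbreviation qi :: "nat \<Rightarrow> rat fps" where "qi m \<equiv> inverse (qp m)"

lemma qp_0 [simp]: "qp 0 = 1" by (simp add: q_pochhammer_def)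
lemma qp_Suc: "qp (Suc m) = qp m * (1 - fps_X ^ Suc m)" by (simp add: q_pochhammer_def)

lemma qp_nth_0 [simp]: "fps_nth (qp m) 0 = 1"
  by (induction m) (simp_all add: qp_Suc)

lemma qp_inverse: "qp m * qi m = 1" "qi m * qp m = 1"
  by (simp_all add: inverse_mult_eq_1 inverse_mult_eq_1')

lemma qp_neq_0 [simp]: "qp m \<noteq> 0"
  using qp_nth_0[of m] by fastforce

section \<open>Congruence of power series modulo a power of q\<close>

definition fps_cong :: "nat \<Rightarrow> rat fps \<Rightarrow> rat fps \<Rightarrow> bool" where
  "fps_cong N f g \<longleftrightarrow> fps_X ^ N dvd f - g"

lemma fps_cong_refl [simp]: "fps_cong N f f" by (simp add: fps_cong_def)
lemma fps_cong_sym: "fps_cong N f g \<Longrightarrow> fps_cong N g f"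
  unfolding fps_cong_def by (metis dvd_minus_iff minus_diff_eq)
lemma fps_cong_trans [trans]: "fps_cong N f g \<Longrightarrow> fps_cong N g h \<Longrightarrow> fps_cong N f h"
  unfolding fps_cong_def using dvd_add[of "fps_X ^ N" "f - g" "g - h"] by simp
lemma fps_cong_mult: "fps_cong N f g \<Longrightarrow> fps_cong N f' g' \<Longrightarrow> fps_cong N (f * f') (g * g')"
proof -
  assume "fps_cong N f g" "fps_cong N f' g'"
  then have "fps_X ^ N dvd (f - g) * f' + g * (f' - g')" unfolding fps_cong_def by (intro dvd_add dvd_mult2 dvd_mult)
  then show ?thesis unfolding fps_cong_def by (simp add: algebra_simps)
qed
lemma fps_cong_sum: "(\<And>i. i \<in> I \<Longrightarrow> fps_cong N (f i) (g i)) \<Longrightarrow> fps_cong N (sum f I) (sum g I)"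
  unfolding fps_cong_def sum_subtractf[symmetric] by (rule dvd_sum)
lemma fps_cong_prod: "(\<And>i. i \<in> I \<Longrightarrow> fps_cong N (f i) (g i)) \<Longrightarrow> fps_cong N (prod f I) (prod g I)"
  by (induction I rule: infinite_finite_induct) (auto intro: fps_cong_mult)
lemma fps_cong_power: "fps_cong N f g \<Longrightarrow> fps_cong N (f ^ k) (g ^ k)"
  by (induction k) (auto intro: fps_cong_mult)
lemma fps_cong_mono: "M \<le> N \<Longrightarrow> fps_cong N f g \<Longrightarrow> fps_cong M f g"
  unfolding fps_cong_def using le_imp_power_dvd dvd_trans by blast
text \<open>A factor X^a raises the precision by \<open>a\<close>. The triangular exponents use this
  gain to compensate for coarser congruences of the other factors.\<close>

lemma fps_cong_shift: "fps_cong N f g \<Longrightarrow> N' \<le> a + N \<Longrightarrow> fps_cong N' (fps_X ^ a * f) (fps_X ^ a * g)"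
proof -
  assume "fps_cong N f g" "N' \<le> a + N"
  then have "fps_X ^ (a + N) dvd fps_X ^ a * (f - g)" unfolding fps_cong_def power_add by (intro mult_dvd_mono) auto
  then have "fps_cong (a + N) (fps_X ^ a * f) (fps_X ^ a * g)" unfolding fps_cong_def by (simp add: algebra_simps)
  then show ?thesis using \<open>N' \<le> a + N\<close> fps_cong_mono by blast
qed
lemma fps_cong_nth: "fps_cong N f g \<Longrightarrow> i < N \<Longrightarrow> fps_nth f i = fps_nth g i"
proof -
  assume "fps_cong N f g" "i < N"
  from \<open>fps_cong N f g\<close> obtain h where "f - g = fps_X ^ N * h" unfolding fps_cong_def by (rule dvdE)
  then have "fps_nth (f - g) i = 0" using \<open>i < N\<close> by (simp add: fps_X_power_mult_nth)
  then show ?thesis by simp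
qed
lemma fps_congI: "(\<And>i. i < N \<Longrightarrow> fps_nth f i = fps_nth g i) \<Longrightarrow> fps_cong N f g"
proof -
  assume a: "\<And>i. i < N \<Longrightarrow> fps_nth f i = fps_nth g i"
  have "f - g = fps_X ^ N * fps_shift N (f - g)"
    by (rule fps_ext) (use a in \<open>auto simp: fps_X_power_mult_nth\<close>)
  then show ?thesis unfolding fps_cong_def by (metis dvd_triv_left)
qed

lemma fps_cong_one_minus: "N \<le> a \<Longrightarrow> fps_cong N (1 - fps_X ^ a) 1"
  by (simp add: fps_cong_def le_imp_power_dvd)

lemma fps_cong_inverse:
  assumes "fps_cong N f 1" "fps_nth f 0 = 1" shows "fps_cong N (inverse f) 1"
proof -
  have "fps_cong N (inverse f * f) (inverse f * 1)" using assms by (intro fps_cong_mult) auto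
  then show ?thesis using assms(2) by (simp add: inverse_mult_eq_1 fps_cong_sym)
qed

lemma qp_cong: "a \<le> b \<Longrightarrow> N \<le> Suc a \<Longrightarrow> fps_cong N (qp b) (qp a)"
proof (induction rule: dec_induct)
  case (step b)
  have "fps_cong N (qp b * (1 - fps_X ^ Suc b)) (qp a * 1)"
    using step by (intro fps_cong_mult fps_cong_one_minus) auto
  then show ?case by (simp add: qp_Suc)
qed simp

text \<open>Gaussian binomials by the q-Pascal rule, which avoids division. Where
  \<open>M - j\<close> is truncated, \<open>gbinom M j\<close> is 0.\<close>

fun gbinom :: "nat \<Rightarrow> nat \<Rightarrow> rat fps" where
  "gbinom M 0 = 1"
| "gbinom 0 (Suc j) = 0"
| "gbinom (Suc M) (Suc j) = gbinom M (Suc j) + fps_X ^ (M - j) * gbinom M j"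

lemma gbinom_eq_0: "M < j \<Longrightarrow> gbinom M j = 0"
proof (induction M arbitrary: j)
  case 0 then show ?case by (cases j) auto
next
  case (Suc M) then show ?case by (cases j) auto
qed

lemma gbinom_qp: "j \<le> M \<Longrightarrow> gbinom M j * (qp j * qp (M - j)) = qp M"
proof (induction M arbitrary: j)
  case 0 then show ?case by simp
next
  case (Suc M)
  show ?case
  proof (cases j)
    case (Suc i)
    then have i: "i \<le> M" using Suc.prems by simp
    have 2: "gbinom M i * (qp i * qp (M - i)) = qp M" using Suc.IH[OF i] .
    show ?thesis
    proof (cases "i = M")
      case True
      have "gbinom (Suc M) j * (qp j * qp (Suc M - j)) = gbinom M i * (qp i * qp (M - i)) * (1 - fps_X ^ Suc M)"
        using Suc True by (simp add: gbinom_eq_0 qp_Suc)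
      then show ?thesis using 2 by (simp add: qp_Suc)
    next
      case False
      then obtain d where d: "M = Suc (i + d)" using i less_iff_Suc_add[of i M] by auto
      have 1: "gbinom M (Suc i) * (qp (Suc i) * qp (M - Suc i)) = qp M" using Suc.IH[of "Suc i"] d by simp
      have "gbinom (Suc M) j * (qp j * qp (Suc M - j)) = gbinom M (Suc i) * (qp (Suc i) * qp (M - Suc i)) * (1 - fps_X ^ Suc d)
         + fps_X ^ Suc d * (gbinom M i * (qp i * qp (M - i))) * (1 - fps_X ^ Suc i)"
        using Suc d by (simp add: qp_Suc algebra_simps)
      also have "\<dots> = qp M * (1 - fps_X ^ Suc d * fps_X ^ Suc i)" unfolding 1 2 by (simp add: algebra_simps)
      also have "\<dots> = qp (Suc M)" using d by (simp add: qp_Suc power_add[symmetric] del: power_Suc)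
      finally show ?thesis .
    qed
  qed simp
qed

lemma gbinom_eq: "j \<le> M \<Longrightarrow> gbinom M j = qp M * qi j * qi (M - j)"
proof -
  assume "j \<le> M"
  from gbinom_qp[OF this, symmetric] have "qp M * qi j * qi (M - j) = gbinom M j * (qp j * qi j) * (qp (M - j) * qi (M - j))" by (simp add: mult_ac)
  then show ?thesis by (simp add: qp_inverse)
qed

section \<open>Identities relating the sum of the triangle to Lambda\<close>

lemma triangular_Suc: "(j + 1) * (j + 2) div 2 = j * (j + 1) div 2 + (j + 1)" for j :: nat
  by (simp add: algebra_simps)

lemma triangular_add: "(i + j) * (i + j + 1) div 2 = i * (i + 1) div 2 + j * (j + 1) div 2 + i * j" for i j :: nat
proof (induction j)
  case (Suc j)
  have "(i + Suc j) * (i + Suc j + 1) div 2 = (i + j) * (i + j + 1) div 2 + (i + j + 1)" using triangular_Suc[of "i + j"] by simp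
  moreover have "Suc j * (Suc j + 1) div 2 = j * (j + 1) div 2 + (j + 1)" using triangular_Suc[of j] by simp
  ultimately show ?case using Suc by simp
qed simp

lemma triangular_ge: "i \<le> i * (i + 1) div 2" for i :: nat
proof (induction i)
  case (Suc i)
  have "Suc i * (Suc i + 1) div 2 = i * (i + 1) div 2 + (i + 1)" using triangular_Suc[of i] by simp
  then show ?case by simp
qed simp

text \<open>The exponent splits into a triangular number, which belongs to the q-binomial theorem,
  and a square, which belongs to the Durfee identity.\<close>

lemma Lambda_exponent: "(i + 3 * i\<^sup>2) div 2 = i * (i + 1) div 2 + i\<^sup>2" for i :: nat
proof -
  have "i + 3 * i\<^sup>2 = i * (i + 1) + i\<^sup>2 * 2" by (simp add: power2_eq_square algebra_simps)
  then show ?thesis by simp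
qed

definition qbin_term :: "rat fps \<Rightarrow> nat \<Rightarrow> nat \<Rightarrow> rat fps" where
  "qbin_term z M j = (-1) ^ j * fps_X ^ (j * (j + 1) div 2) * z ^ j * gbinom M j"

lemma qbin_term_Suc:
  assumes "j \<le> M"
  shows "qbin_term z (Suc M) (Suc j) = qbin_term z M (Suc j) - z * fps_X ^ Suc M * qbin_term z M j"
proof -
  have e: "Suc j * (Suc j + 1) div 2 = j * (j + 1) div 2 + Suc j" using triangular_Suc[of j] by simp
  define a b Y :: "rat fps" where "a = fps_X ^ Suc j" "b = fps_X ^ (M - j)" "Y = fps_X ^ (j * (j + 1) div 2)"
  have x: "fps_X ^ Suc M = a * b" using assms unfolding a_b_Y_def by (simp add: power_add[symmetric] del: power_Suc)
  have y: "fps_X ^ (Suc j * (Suc j + 1) div 2) = Y * a" unfolding e power_add a_b_Y_def ..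
  show ?thesis unfolding qbin_term_def x y gbinom.simps a_b_Y_def(2,3)[symmetric] power_Suc[of z] power_Suc[of "-1"] by (simp add: algebra_simps)
qed

lemma sum_mult_one_minus: "sum f I * (1 - w) = sum f I - (\<Sum>j\<in>I. w * f j)" for w :: "'a::comm_ring_1"
  by (simp add: right_diff_distrib sum_distrib_left sum_subtractf mult.commute)

lemma q_binomial_theorem: "(\<Prod>x\<in>{1..M}. 1 - z * fps_X ^ x) = (\<Sum>j\<le>M. qbin_term z M j)"
proof (induction M)
  case 0 then show ?case by (simp add: qbin_term_def)
next
  case (Suc M)
  have 0: "qbin_term z M (Suc M) = 0" "qbin_term z N 0 = 1" for N by (simp_all add: qbin_term_def gbinom_eq_0)
  have "(\<Prod>x\<in>{1..Suc M}. 1 - z * fps_X ^ x) = (\<Sum>j\<le>M. qbin_term z M j) * (1 - z * fps_X ^ Suc M)"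
    using Suc by (simp add: mult.commute)
  also have "\<dots> = (\<Sum>j\<le>M. qbin_term z M j) - (\<Sum>j\<le>M. z * fps_X ^ Suc M * qbin_term z M j)"
    by (rule sum_mult_one_minus)
  also have "(\<Sum>j\<le>M. qbin_term z M j) = (\<Sum>j\<le>Suc M. qbin_term z M j)" by (simp add: 0)
  also have "\<dots> = 1 + (\<Sum>j\<le>M. qbin_term z M (Suc j))" by (simp only: sum.atMost_Suc_shift 0)
  also have "1 + (\<Sum>j\<le>M. qbin_term z M (Suc j)) - (\<Sum>j\<le>M. z * fps_X ^ Suc M * qbin_term z M j)
      = 1 + (\<Sum>j\<le>M. qbin_term z M (Suc j) - z * fps_X ^ Suc M * qbin_term z M j)"
    by (simp only: sum_subtractf) (simp only: add_diff_eq)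
  also have "\<dots> = 1 + (\<Sum>j\<le>M. qbin_term z (Suc M) (Suc j))"
    by (intro arg_cong[where f = "\<lambda>x. 1 + x"] sum.cong) (simp_all only: atMost_iff qbin_term_Suc)
  also have "\<dots> = (\<Sum>j\<le>Suc M. qbin_term z (Suc M) j)" by (simp only: sum.atMost_Suc_shift 0)
  finally show ?case .
qed

text \<open>The parameter \<open>a\<close> is there for the induction: the q-Pascal rule turns the
  sum for \<open>Suc N\<close> into the sum for \<open>N\<close> with the same \<open>a\<close> and,
  times a power of q, the one with \<open>Suc a\<close>.\<close>

lemma q_vandermonde_limit:
  "(\<Sum>i\<le>N. fps_X ^ (i\<^sup>2 + a * i) * gbinom N i * qi (i + a)) = qi (N + a)"
proof (induction N arbitrary: a)
  case 0 then show ?case by simp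
next
  case (Suc N)
  let ?t = "\<lambda>N a i. fps_X ^ (i\<^sup>2 + a * i) * gbinom N i * qi (i + a)"
  have "(\<Sum>i\<le>Suc N. ?t (Suc N) a i) = ?t (Suc N) a 0 + (\<Sum>i\<le>N. ?t (Suc N) a (Suc i))"
    by (rule sum.atMost_Suc_shift)
  also have "(\<Sum>i\<le>N. ?t (Suc N) a (Suc i)) = (\<Sum>i\<le>N. ?t N a (Suc i) + fps_X ^ Suc (N + a) * ?t N (Suc a) i)"
  proof (rule sum.cong[OF refl])
    fix i assume i: "i \<in> {..N}"
    have e: "(Suc i)\<^sup>2 + a * Suc i + (N - i) = Suc (N + a) + (i\<^sup>2 + Suc a * i)" using i by (simp add: power2_eq_square algebra_simps)
    have "?t (Suc N) a (Suc i) = ?t N a (Suc i) + fps_X ^ ((Suc i)\<^sup>2 + a * Suc i + (N - i)) * gbinom N i * qi (Suc i + a)"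
      by (simp add: algebra_simps power_add)
    then show "?t (Suc N) a (Suc i) = ?t N a (Suc i) + fps_X ^ Suc (N + a) * ?t N (Suc a) i"
      unfolding e power_add by (simp add: mult_ac)
  qed
  also have "?t (Suc N) a 0 + (\<Sum>i\<le>N. ?t N a (Suc i) + fps_X ^ Suc (N + a) * ?t N (Suc a) i)
     = (\<Sum>i\<le>Suc N. ?t N a i) + fps_X ^ Suc (N + a) * (\<Sum>i\<le>N. ?t N (Suc a) i)"
    by (subst sum.atMost_Suc_shift) (simp add: sum.distrib sum_distrib_left add_ac)
  also have "(\<Sum>i\<le>Suc N. ?t N a i) = (\<Sum>i\<le>N. ?t N a i)" by (simp add: gbinom_eq_0)
  also have "\<dots> = qi (N + a)" by (rule Suc.IH)
  also have "(\<Sum>i\<le>N. ?t N (Suc a) i) = qi (N + Suc a)" by (rule Suc.IH)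
  also have "qi (N + a) + fps_X ^ Suc (N + a) * qi (N + Suc a) = qi (Suc N + a)"
  proof -
    have "qi (N + a) = qi (Suc (N + a)) * (1 - fps_X ^ Suc (N + a))"
    proof -
      have "qi (N + a) = qi (N + a) * (qp (Suc (N + a)) * qi (Suc (N + a)))" by (simp add: qp_inverse)
      also have "\<dots> = (qi (N + a) * qp (N + a)) * (1 - fps_X ^ Suc (N + a)) * qi (Suc (N + a))" unfolding qp_Suc by (simp add: mult_ac)
      finally show ?thesis by (simp add: qp_inverse mult.commute)
    qed
    then show ?thesis by (simp add: algebra_simps)
  qed
  finally show ?case .
qed

text \<open>After multiplication by (q;q)_N this is the case \<open>a = 0\<close>, which classifies
  partitions into at most \<open>N\<close> parts by the side \<open>i\<close> of their Durfee
  square.\<close>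

lemma durfee_sum: "(\<Sum>i\<le>N. fps_X ^ (i\<^sup>2) * qi i ^ 2 * qi (N - i)) = qi N ^ 2"
proof -
  have "qp N * (\<Sum>i\<le>N. fps_X ^ (i\<^sup>2) * qi i ^ 2 * qi (N - i)) = (\<Sum>i\<le>N. fps_X ^ (i\<^sup>2) * gbinom N i * qi i)"
    unfolding sum_distrib_left by (intro sum.cong) (auto simp: gbinom_eq power2_eq_square mult_ac)
  also have "\<dots> = qi N" using q_vandermonde_limit[where a = 0] by simp
  finally have "qi N * (qp N * (\<Sum>i\<le>N. fps_X ^ (i\<^sup>2) * qi i ^ 2 * qi (N - i))) = qi N ^ 2" by (simp add: power2_eq_square)
  then show ?thesis by (simp add: mult.assoc[symmetric] qp_inverse)
qed

lemma qp_tail: "i \<le> n \<Longrightarrow> qp n * qi i = (\<Prod>x\<in>{Suc i..n}. 1 - fps_X ^ x)"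
proof (induction n rule: dec_induct)
  case (step n)
  then have "qp (Suc n) * qi i = (\<Prod>x\<in>{Suc i..n}. 1 - fps_X ^ x) * (1 - fps_X ^ Suc n)" unfolding qp_Suc by (simp add: mult_ac)
  then show ?case using step(1) by (simp add: mult.commute)
qed (simp add: qp_inverse)

text \<open>The product over \<open>x\<close> from \<open>Suc i\<close> to \<open>n\<close> is
  expanded by the q-binomial theorem with z = q^i, and each Gaussian binomial is replaced by its
  limit 1 / (q;q)_j.\<close>

lemma qp_tail_cong:
  assumes "i \<le> n"
  shows "fps_cong (Suc n) (fps_X ^ ((i + 3 * i\<^sup>2) div 2) * (qp n * qi i))
    (\<Sum>j\<le>n - i. (-1) ^ j * fps_X ^ ((i + j) * (i + j + 1) div 2 + i\<^sup>2) * qi j)"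
proof -
  have "(\<Prod>x\<in>{Suc i..n}. 1 - fps_X ^ x) = (\<Prod>x\<in>{1..n - i}. 1 - fps_X ^ i * fps_X ^ x :: rat fps)"
    by (rule prod.reindex_bij_witness[of _ "\<lambda>x. x + i" "\<lambda>x. x - i"]) (use assms in \<open>auto simp: power_add[symmetric]\<close>)
  also have "\<dots> = (\<Sum>j\<le>n - i. qbin_term (fps_X ^ i) (n - i) j)"
    by (rule q_binomial_theorem)
  finally have 1: "fps_X ^ ((i + 3 * i\<^sup>2) div 2) * (qp n * qi i) = (\<Sum>j\<le>n - i. fps_X ^ ((i + 3 * i\<^sup>2) div 2) * qbin_term (fps_X ^ i) (n - i) j)"
    unfolding qp_tail[OF assms] by (simp only: sum_distrib_left)
  show ?thesis unfolding 1
  proof (rule fps_cong_sum)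
    fix j assume "j \<in> {..n - i}"
    then have j: "i + j \<le> n" "j \<le> n - i" using assms by auto
    define e where "e = (i + j) * (i + j + 1) div 2 + i\<^sup>2"
    have e: "e = (i + 3 * i\<^sup>2) div 2 + j * (j + 1) div 2 + i * j"
      unfolding e_def Lambda_exponent triangular_add by simp
    \<comment> \<open>The exponent is at least \<open>i + j\<close>, which raises the precision
      \<open>Suc (n - (i + j))\<close> of the limit to \<open>Suc n\<close>.\<close>
    have ge: "i + j \<le> e" unfolding e_def using triangular_ge[of "i + j"] by linarith
    have "fps_cong (Suc (n - (i + j))) (gbinom (n - i) j) (qi j)"
    proof -
      have "fps_cong (Suc (n - (i + j))) (qp (n - i) * (qi (n - i - j) * qi j)) (qp (n - i - j) * (qi (n - i - j) * qi j))"
        by (intro fps_cong_mult[OF qp_cong fps_cong_refl]) auto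
      moreover have "qp (n - i - j) * (qi (n - i - j) * qi j) = qi j" by (simp add: mult.assoc[symmetric] qp_inverse)
      moreover have "qp (n - i) * (qi (n - i - j) * qi j) = gbinom (n - i) j" unfolding gbinom_eq[OF j(2)] by (simp only: mult_ac)
      ultimately show ?thesis by (simp only:)
    qed
    then have "fps_cong (Suc n) (fps_X ^ e * gbinom (n - i) j) (fps_X ^ e * qi j)"
      by (rule fps_cong_shift) (use ge j in auto)
    then have "fps_cong (Suc n) ((-1) ^ j * (fps_X ^ e * gbinom (n - i) j)) ((-1) ^ j * (fps_X ^ e * qi j))"
      by (rule fps_cong_mult[OF fps_cong_refl])
    moreover have "fps_X ^ ((i + 3 * i\<^sup>2) div 2) * qbin_term (fps_X ^ i) (n - i) j = (-1) ^ j * (fps_X ^ e * gbinom (n - i) j)"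
      unfolding qbin_term_def e power_add power_mult by (simp only: mult_ac)
    ultimately show "fps_cong (Suc n) (fps_X ^ ((i + 3 * i\<^sup>2) div 2) * qbin_term (fps_X ^ i) (n - i) j) ((-1) ^ j * fps_X ^ ((i + j) * (i + j + 1) div 2 + i\<^sup>2) * qi j)"
      unfolding e_def by (simp only: mult.assoc)
  qed
qed

text \<open>One factor 1 / (q;q)_i is expanded together with (q;q)_n. Since the exponent of q
  depends only on i + j apart from the square of i, collecting the terms with i + j = N leaves an
  inner sum that \<open>durfee_sum\<close> evaluates.\<close>

lemma triple_to_double_sum:
  "fps_cong (Suc n) (qp n * (\<Sum>i\<le>n. (-1) ^ i * fps_X ^ ((i + 3 * i\<^sup>2) div 2) * qi i ^ 3)) (\<Sum>i\<le>n. (-1) ^ i * fps_X ^ (i * (i + 1) div 2) * qi i ^ 2)"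
proof -
  define T where "T N = (fps_X ^ (N * (N + 1) div 2) :: rat fps)" for N
  define Q where "Q i = (fps_X ^ i\<^sup>2 :: rat fps)" for i
  define u where "u i j = (-1) ^ (i + j) * (T (i + j) * Q i) * qi i ^ 2 * qi j" for i j
  define L where "L i = (fps_X ^ ((i + 3 * i\<^sup>2) div 2) :: rat fps)" for i
  have cube: "qi i ^ 3 = qi i ^ 2 * qi i" for i by (simp only: power3_eq_cube power2_eq_square)
  have 1: "qp n * (\<Sum>i\<le>n. (-1) ^ i * L i * qi i ^ 3) = (\<Sum>i\<le>n. ((-1) ^ i * qi i ^ 2) * (L i * (qp n * qi i)))"
    unfolding sum_distrib_left cube by (simp only: mult_ac)
  have 2: "fps_cong (Suc n) (\<Sum>i\<le>n. ((-1) ^ i * qi i ^ 2) * (L i * (qp n * qi i))) (\<Sum>i\<le>n. ((-1) ^ i * qi i ^ 2) * (\<Sum>j\<le>n - i. (-1) ^ j * (T (i + j) * Q i) * qi j))"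
  proof (rule fps_cong_sum, rule fps_cong_mult[OF fps_cong_refl])
    fix i assume "i \<in> {..n}"
    then show "fps_cong (Suc n) (L i * (qp n * qi i)) (\<Sum>j\<le>n - i. (-1) ^ j * (T (i + j) * Q i) * qi j)"
      using qp_tail_cong[of i n] unfolding T_def Q_def L_def power_add by simp
  qed
  have "(\<Sum>i\<le>n. ((-1) ^ i * qi i ^ 2) * (\<Sum>j\<le>n - i. (-1) ^ j * (T (i + j) * Q i) * qi j)) = (\<Sum>i\<le>n. \<Sum>j\<le>n - i. u i j)"
    unfolding sum_distrib_left u_def power_add by (simp only: mult_ac)
  also have "\<dots> = (\<Sum>(i,j)\<in>Sigma {..n} (\<lambda>i. {..n - i}). u i j)"
    by (rule sum.Sigma) auto
  also have "\<dots> = (\<Sum>(N,i)\<in>Sigma {..n} (\<lambda>N. {..N}). u i (N - i))"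
    by (rule sum.reindex_bij_witness[of _ "\<lambda>(N,i). (i, N - i)" "\<lambda>(i,j). (i + j, i)"]) auto
  also have "\<dots> = (\<Sum>N\<le>n. \<Sum>i\<le>N. u i (N - i))" by (rule sum.Sigma[symmetric]) auto
  also have "\<dots> = (\<Sum>N\<le>n. (-1) ^ N * T N * qi N ^ 2)"
  proof (rule sum.cong[OF refl])
    fix N
    have "(\<Sum>i\<le>N. u i (N - i)) = (\<Sum>i\<le>N. (-1) ^ N * T N * (Q i * qi i ^ 2 * qi (N - i)))"
    proof (rule sum.cong[OF refl])
      fix i assume "i \<in> {..N}"
      then have "i + (N - i) = N" by simp
      then show "u i (N - i) = (-1) ^ N * T N * (Q i * qi i ^ 2 * qi (N - i))" unfolding u_def by (simp only: mult_ac)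
    qed
    also have "\<dots> = (-1) ^ N * T N * (\<Sum>i\<le>N. Q i * qi i ^ 2 * qi (N - i))"
      unfolding sum_distrib_left ..
    also have "(\<Sum>i\<le>N. Q i * qi i ^ 2 * qi (N - i)) = qi N ^ 2" unfolding Q_def by (rule durfee_sum)
    finally show "(\<Sum>i\<le>N. u i (N - i)) = (-1) ^ N * T N * qi N ^ 2" .
  qed
  finally show ?thesis using 2 unfolding 1[symmetric] unfolding L_def T_def by (simp only:)
qed

section \<open>Laurent expansions in A as series in q\<close>

lemma poly_to_fls_hom:
  "fps_to_fls (fps_of_poly (f * g)) = fps_to_fls (fps_of_poly f) * fps_to_fls (fps_of_poly g)"
  "fps_to_fls (fps_of_poly (f + g)) = fps_to_fls (fps_of_poly f) + fps_to_fls (fps_of_poly g)"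
  "fps_to_fls (fps_of_poly f) = 0 \<longleftrightarrow> f = 0" for f g :: "rat poly"
  by (simp_all add: fps_of_poly_mult fps_of_poly_add fls_times_fps_to_fls)

lemma laurent_mult: "laurent (r * s) = laurent r * laurent s"
proof -
  obtain f g where r: "r = Fract f g" "g \<noteq> 0" by (cases r)
  obtain h k where s: "s = Fract h k" "k \<noteq> 0" by (cases s)
  show ?thesis using r s by (simp add: laurent_Fract poly_to_fls_hom)
qed

lemma laurent_add: "laurent (r + s) = laurent r + laurent s"
proof -
  obtain f g where r: "r = Fract f g" "g \<noteq> 0" by (cases r)
  obtain h k where s: "s = Fract h k" "k \<noteq> 0" by (cases s)
  show ?thesis using r s by (simp add: laurent_Fract poly_to_fls_hom add_frac_eq)
qed

lemma laurent_0 [simp]: "laurent 0 = 0"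
  using laurent_add[of 0 0] by simp

lemma laurent_1 [simp]: "laurent 1 = 1"
  using laurent_Fract[of 1 1] by (simp add: One_fract_def)

lemma laurent_uminus: "laurent (- r) = - laurent r"
  using laurent_add[of r "- r"] by (simp add: eq_neg_iff_add_eq_0 add.commute)

lemma laurent_inverse: "laurent (inverse r) = inverse (laurent r)"
proof (cases "r = 0")
  case False
  then have "laurent r * laurent (inverse r) = 1" by (simp add: laurent_mult[symmetric])
  then show ?thesis by (simp add: inverse_unique)
qed simp

lemma laurent_power: "laurent (r ^ m) = laurent r ^ m"
  by (induction m) (simp_all add: laurent_mult)

lemma laurent_varA: "laurent varA = fls_X"
  using laurent_Fract[of 1 "[:0, 1:]"] by (simp add: varA_def fps_of_poly_pCons)

lemma q_series_0 [simp]: "q_series 0 = 0" and q_series_1 [simp]: "q_series 1 = 1"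
  by (simp_all add: q_series_def)

lemma q_series_add: "q_series (F + G) = q_series F + q_series G"
  and q_series_uminus: "q_series (- F) = - q_series F"
  and q_series_mult: "q_series (F * G) = q_series F * q_series G"
  by (simp_all add: q_series_def fls_times_fps_to_fls)

lemma fls_X_power: "(fls_X :: rat fls) ^ m = fls_X_intpow (int m)"
  by (rule fls_X_power_conv_shift_1)

lemma q_series_X: "q_series fps_X = fls_X ^ 4"
  by (simp add: q_series_def fls_X_power)

definition expands :: "ratA \<Rightarrow> rat fps \<Rightarrow> bool" where
  "expands r F \<longleftrightarrow> laurent r = q_series F"

lemma expands_0 [simp]: "expands 0 0" and expands_1 [simp]: "expands 1 1"
  and expands_qA: "expands qA fps_X"
  by (simp_all add: expands_def laurent_power laurent_varA q_series_X)

lemma expands_add: "expands r F \<Longrightarrow> expands s G \<Longrightarrow> expands (r + s) (F + G)"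
  and expands_mult: "expands r F \<Longrightarrow> expands s G \<Longrightarrow> expands (r * s) (F * G)"
  and expands_uminus: "expands r F \<Longrightarrow> expands (- r) (- F)"
  by (simp_all add: expands_def laurent_add laurent_mult laurent_uminus q_series_add q_series_mult q_series_uminus)

lemma expands_diff: "expands r F \<Longrightarrow> expands s G \<Longrightarrow> expands (r - s) (F - G)"
  using expands_add[OF _ expands_uminus] by fastforce

lemma expands_power: "expands r F \<Longrightarrow> expands (r ^ m) (F ^ m)"
  by (induction m) (simp_all add: expands_mult)

lemma expands_sum: "(\<And>i. i \<in> I \<Longrightarrow> expands (f i) (F i)) \<Longrightarrow> expands (\<Sum>i\<in>I. f i) (\<Sum>i\<in>I. F i)"
  by (induction I rule: infinite_finite_induct) (simp_all add: expands_add)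

lemma expands_prod: "(\<And>i. i \<in> I \<Longrightarrow> expands (f i) (F i)) \<Longrightarrow> expands (\<Prod>i\<in>I. f i) (\<Prod>i\<in>I. F i)"
  by (induction I rule: infinite_finite_induct) (simp_all add: expands_mult)

lemma expands_inverse:
  assumes "expands r F" "fps_nth F 0 \<noteq> 0" shows "expands (inverse r) (inverse F)"
proof -
  have "q_series F * q_series (inverse F) = 1"
    using assms(2) by (simp add: q_series_mult[symmetric] inverse_mult_eq_1')
  then show ?thesis using assms(1) by (simp add: expands_def laurent_inverse inverse_unique)
qed

lemma expands_divide: "expands r F \<Longrightarrow> expands s G \<Longrightarrow> fps_nth G 0 \<noteq> 0 \<Longrightarrow> expands (r / s) (F * inverse G)"
  using expands_mult[OF _ expands_inverse] by (simp add: divide_inverse)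

lemma expands_one_minus: "expands (1 - qA ^ m) (1 - fps_X ^ m)"
  by (intro expands_diff expands_power expands_qA expands_1)

definition regular :: "bool \<Rightarrow> ratA \<Rightarrow> bool" where
  "regular b r \<longleftrightarrow> (\<exists>F. expands r F \<and> (b \<longrightarrow> fps_nth F 0 = 0))"

lemma regular_add: "regular b r \<Longrightarrow> regular b s \<Longrightarrow> regular b (r + s)"
  unfolding regular_def
proof -
  assume "\<exists>F. expands r F \<and> (b \<longrightarrow> fps_nth F 0 = 0)" "\<exists>F. expands s F \<and> (b \<longrightarrow> fps_nth F 0 = 0)"
  then obtain F G where "expands r F" "b \<longrightarrow> fps_nth F 0 = 0" "expands s G" "b \<longrightarrow> fps_nth G 0 = 0" by blast
  then show "\<exists>F. expands (r + s) F \<and> (b \<longrightarrow> fps_nth F 0 = 0)" by (intro exI[of _ "F + G"]) (auto simp: expands_add)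
qed

lemma regular_mult:
  assumes "regular b r" "regular c s" shows "regular (b \<or> c) (r * s)"
proof -
  obtain F G where "expands r F" "b \<longrightarrow> fps_nth F 0 = 0" "expands s G" "c \<longrightarrow> fps_nth G 0 = 0"
    using assms unfolding regular_def by blast
  then show ?thesis unfolding regular_def by (intro exI[of _ "F * G"]) (auto simp: expands_mult)
qed

lemma regular_uminus: "regular b r \<Longrightarrow> regular b (- r)"
  unfolding regular_def by (metis expands_uminus fps_neg_nth neg_equal_0_iff_equal)

lemma regular_0 [simp]: "regular b 0" unfolding regular_def by (intro exI[of _ 0]) auto
lemma regular_1 [simp]: "regular False 1" unfolding regular_def by (intro exI[of _ 1]) auto
lemma regular_qA: "regular True qA" unfolding regular_def by (intro exI[of _ fps_X]) (simp add: expands_qA)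
lemma regular_weaken: "regular b r \<Longrightarrow> regular False r" by (auto simp: regular_def)

lemma regular_wenzl_ratio: "regular False ((1 - qA ^ m) / (1 - qA ^ Suc m))"
  unfolding regular_def by (rule exI, rule conjI, rule expands_divide[OF expands_one_minus expands_one_minus]) auto

lemma wenzl_coeff_eq: "wenzl_coeff m = ((1 - qA ^ m) / (1 - qA ^ Suc m)) * varA ^ 2"
  by (simp add: wenzl_coeff_def)

lemma circle_value_scaled: "varA ^ 2 * circle_value = - (1 + qA)"
proof -
  have "varA ^ 2 * inverse varA ^ 2 = 1" using varA_nonzero by (simp add: power_mult_distrib[symmetric])
  then show ?thesis by (simp add: circle_value_def right_diff_distrib power_add[symmetric])
qed

section \<open>Truncations of Lambda\<close>

lemma fps_limit:
  assumes "\<And>m n. n \<le> m \<Longrightarrow> fps_cong (Suc n) (f m) (f n)"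
  obtains L where "f \<longlonglongrightarrow> L" "\<And>n. fps_cong (Suc n) L (f n)"
proof
  define L where "L = Abs_fps (\<lambda>k. fps_nth (f k) k)"
  have nth: "fps_nth (f m) k = fps_nth (f k) k" if "k \<le> m" for m k
    using fps_cong_nth[OF assms[OF that]] by simp
  show "f \<longlonglongrightarrow> L"
  proof (rule tendsto_fpsI)
    fix k show "\<forall>\<^sub>F m in sequentially. fps_nth (f m) k = fps_nth L k"
      using eventually_ge_at_top[of k] unfolding L_def fps_nth_Abs_fps by (rule eventually_mono) (rule nth)
  qed
  show "fps_cong (Suc n) L (f n)" for n
    by (intro fps_congI) (simp add: L_def nth[of _ n, symmetric])
qed

text \<open>The partial products of an infinite product run over all factors up to an index
  inclusively, so they are \<open>qp (Suc m)\<close>. Convergence as a product requires a nonzero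
  limit, which the constant term 1 provides.\<close>

lemma q_pochhammer_inf_cong: "fps_cong (Suc n) (q_pochhammer_inf fps_X fps_X) (qp n)"
proof -
  have cong: "fps_cong (Suc l) (qp (Suc m)) (qp (Suc l))" if "l \<le> m" for l m
    by (rule qp_cong) (use that in auto)
  obtain L where L: "(\<lambda>m. qp (Suc m)) \<longlonglongrightarrow> L" "\<And>n. fps_cong (Suc n) L (qp (Suc n))"
    using fps_limit[of "\<lambda>m. qp (Suc m)"] cong by blast
  have "fps_nth L 0 = 1" using fps_cong_nth[OF L(2)[of 0], of 0] by simp
  then have "L \<noteq> 0" by auto
  with L(1) have "(\<lambda>j. 1 - fps_X * fps_X ^ j) has_prod L"
    by (simp add: has_prod_def raw_has_prod_def q_pochhammer_def lessThan_Suc_atMost)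
  then have "q_pochhammer_inf fps_X fps_X = L" unfolding q_pochhammer_inf_def by (rule has_prod_unique[symmetric])
  moreover have "fps_cong (Suc n) (qp (Suc n)) (qp n)" by (rule qp_cong) auto
  ultimately show ?thesis using L(2)[of n] fps_cong_trans by blast
qed

lemma suminf_cong_partial:
  assumes "\<And>i. fps_cong i (t i) 0"
  shows "fps_cong (Suc n) (suminf t) (\<Sum>i\<le>n. t i)"
proof -
  have cong: "fps_cong (Suc l) (\<Sum>i\<le>m. t i) (\<Sum>i\<le>l. t i)" if "l \<le> m" for l m
    using that
  proof (induction rule: dec_induct)
    case (step m)
    have "fps_cong (Suc l) (t (Suc m)) 0" by (rule fps_cong_mono[OF _ assms]) (use step in simp)
    then have "fps_X ^ Suc l dvd (sum t {..m} - sum t {..l}) + t (Suc m)"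
      using step.IH unfolding fps_cong_def by (intro dvd_add) auto
    then show ?case unfolding fps_cong_def by (simp add: algebra_simps)
  qed simp
  obtain L where "(\<lambda>m. \<Sum>i\<le>m. t i) \<longlonglongrightarrow> L" "\<And>n. fps_cong (Suc n) L (\<Sum>i\<le>n. t i)"
    using fps_limit[of "\<lambda>m. \<Sum>i\<le>m. t i"] cong by blast
  moreover from this(1) have "suminf t = L" unfolding sums_def_le[symmetric] by (rule sums_unique[symmetric])
  ultimately show ?thesis by simp
qed

definition double_sum :: "nat \<Rightarrow> rat fps" where
  "double_sum n = (\<Sum>i\<le>n. (-1) ^ i * fps_X ^ (i * (i + 1) div 2) * qi i ^ 2)"

text \<open>One of the two factors (q;q)_n is consumed in passing to the double sum, the other
  remains.\<close>

lemma Lambda_q_cong: "fps_cong (Suc n) Lambda_q (qp n * double_sum n)"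
proof -
  let ?t = "\<lambda>i. (- 1) ^ i * fps_X ^ ((i + 3 * i\<^sup>2) div 2) * qi i ^ 3"
  have t: "(\<lambda>i. (- 1) ^ i * fps_X ^ ((i + 3 * i ^ 2) div 2) / qp i ^ 3) = ?t"
    by (simp add: fps_divide_unit fps_inverse_power)
  have "fps_cong i (?t i) 0" for i
  proof -
    have "i \<le> (i + 3 * i\<^sup>2) div 2" using triangular_ge[of i] Lambda_exponent[of i] by simp
    then have "fps_X ^ i dvd (fps_X ^ ((i + 3 * i\<^sup>2) div 2) :: rat fps)" by (rule le_imp_power_dvd)
    then show ?thesis unfolding fps_cong_def by (simp add: dvd_mult dvd_mult2)
  qed
  from suminf_cong_partial[of ?t, OF this]
  have "fps_cong (Suc n) Lambda_q (qp n ^ 2 * (\<Sum>i\<le>n. ?t i))"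
    unfolding Lambda_q_def t by (intro fps_cong_mult fps_cong_power q_pochhammer_inf_cong)
  moreover have "fps_cong (Suc n) (qp n * (qp n * (\<Sum>i\<le>n. ?t i))) (qp n * double_sum n)"
    unfolding double_sum_def by (intro fps_cong_mult fps_cong_refl triple_to_double_sum)
  ultimately show ?thesis using fps_cong_trans by (simp only: power2_eq_square mult.assoc)
qed

definition box_series :: "nat \<Rightarrow> nat \<Rightarrow> rat fps" where
  "box_series n i = (\<Prod>j<i. (1 - fps_X ^ (n - j)) ^ 2 * inverse ((1 - fps_X ^ (2 * n - j)) * (1 - fps_X ^ Suc j)))"

definition cap_series :: "nat \<Rightarrow> nat \<Rightarrow> rat fps" where
  "cap_series n i = (\<Prod>x\<in>{Suc i..n}. (1 - fps_X ^ (x + n + n + 1)) * (1 - fps_X ^ x) * inverse ((1 - fps_X ^ (x + n)) ^ 2))"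

definition triangle_series :: "nat \<Rightarrow> rat fps" where
  "triangle_series n = (\<Sum>i\<le>n. (-1) ^ i * (fps_X ^ (i * (i + 1) div 2) * box_series n i * cap_series n i))"

text \<open>The precision is only \<open>Suc (n - i)\<close>, as the factors with small exponents
  are those with \<open>n - j\<close>, where \<open>j < i\<close>. The factor q^(i(i+1)/2) in
  \<open>triangle_series\<close> makes up for the missing \<open>i\<close>.\<close>

lemma box_series_cong:
  assumes "i \<le> n" shows "fps_cong (Suc (n - i)) (box_series n i) (qi i)"
proof -
  have "qi i = (\<Prod>j<i. inverse (1 - fps_X ^ Suc j))"
    by (induction i) (simp_all add: qp_Suc fps_inverse_mult)
  moreover have "fps_cong (Suc (n - i)) ((1 - fps_X ^ (n - j)) ^ 2 * inverse ((1 - fps_X ^ (2 * n - j)) * (1 - fps_X ^ Suc j)))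
      (inverse (1 - fps_X ^ Suc j))" if "j < i" for j
  proof -
    have "fps_cong (Suc (n - i)) ((1 - fps_X ^ (n - j)) ^ 2 * (inverse (1 - fps_X ^ (2 * n - j)) * inverse (1 - fps_X ^ Suc j)))
      (1 ^ 2 * (1 * inverse (1 - fps_X ^ Suc j)))"
      by (intro fps_cong_mult fps_cong_power fps_cong_one_minus fps_cong_inverse fps_cong_refl) (use that assms in auto)
    then show ?thesis by (simp add: fps_inverse_mult)
  qed
  ultimately show ?thesis unfolding box_series_def by (simp only:) (rule fps_cong_prod, simp only: lessThan_iff)
qed

lemma cap_series_cong:
  assumes "i \<le> n" shows "fps_cong (Suc n) (cap_series n i) (qp n * qi i)"
proof -
  have "fps_cong (Suc n) ((1 - fps_X ^ (x + n + n + 1)) * (1 - fps_X ^ x) * inverse ((1 - fps_X ^ (x + n)) ^ 2))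
      (1 * (1 - fps_X ^ x) * 1)" if "x \<in> {Suc i..n}" for x
  proof (intro fps_cong_mult fps_cong_one_minus fps_cong_refl fps_cong_inverse)
    have "fps_cong (Suc n) ((1 - fps_X ^ (x + n)) ^ 2) (1 ^ 2)"
      by (intro fps_cong_power fps_cong_one_minus) (use that in auto)
    then show "fps_cong (Suc n) ((1 - fps_X ^ (x + n)) ^ 2) 1" by simp
    show "fps_nth ((1 - fps_X ^ (x + n)) ^ 2) 0 = (1 :: rat)" using that by (simp add: power2_eq_square)
  qed auto
  then show ?thesis unfolding cap_series_def qp_tail[OF assms] mult_1_left mult_1_right by (rule fps_cong_prod)
qed

lemma triangle_series_cong: "fps_cong (Suc n) (triangle_series n) Lambda_q"
proof -
  have "fps_cong (Suc n) ((-1) ^ i * (fps_X ^ (i * (i + 1) div 2) * (box_series n i * cap_series n i)))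
     ((-1) ^ i * (fps_X ^ (i * (i + 1) div 2) * (qi i * (qp n * qi i))))" if "i \<le> n" for i
  proof (rule fps_cong_mult[OF fps_cong_refl], rule fps_cong_shift[where N = "Suc (n - i)"])
    show "fps_cong (Suc (n - i)) (box_series n i * cap_series n i) (qi i * (qp n * qi i))"
      by (rule fps_cong_mult[OF box_series_cong fps_cong_mono[OF _ cap_series_cong]]) (use that in auto)
    show "Suc n \<le> i * (i + 1) div 2 + Suc (n - i)" using triangular_ge[of i] that by simp
  qed
  then have "fps_cong (Suc n) (triangle_series n) (\<Sum>i\<le>n. (-1) ^ i * (fps_X ^ (i * (i + 1) div 2) * (qi i * (qp n * qi i))))"
    unfolding triangle_series_def by (intro fps_cong_sum) (simp add: mult.assoc)
  also have "(\<Sum>i\<le>n. (-1) ^ i * (fps_X ^ (i * (i + 1) div 2) * (qi i * (qp n * qi i)))) = qp n * double_sum n"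
    unfolding double_sum_def sum_distrib_left by (intro sum.cong refl) (simp add: power2_eq_square mult_ac)
  finally show ?thesis using Lambda_q_cong fps_cong_sym fps_cong_trans by blast
qed

lemma Lambda_q_nth_0: "fps_nth Lambda_q 0 = 1"
  using fps_cong_nth[OF Lambda_q_cong[of 0], of 0] by (simp add: double_sum_def)

section \<open>The coefficient of the triangle in closed form\<close>

definition box_ratio :: "nat \<Rightarrow> nat \<Rightarrow> ratA" where
  "box_ratio n i = qA ^ (i * (i + 1) div 2) * (\<Prod>j<i. (1 - qA ^ (n - j)) ^ 2 / ((1 - qA ^ (2 * n - j)) * (1 - qA ^ Suc j)))"

definition cap_ratio :: "nat \<Rightarrow> nat \<Rightarrow> ratA" where
  "cap_ratio n i = (\<Prod>x\<in>{Suc i..n}. (1 - qA ^ (x + n + n + 1)) * (1 - qA ^ x) / (1 - qA ^ (x + n)) ^ 2)"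

lemma minus_product_over_product: "- p * q / (v * r) = (- 1 / v) * (p * q / r)" for p q r v :: "'a::field"
  by simp

text \<open>One step of the recursion for \<open>box_coeff\<close> with named factors:
  \<open>w\<close> is A^2, \<open>Q\<close> is q^i, \<open>V\<close> is A^(2i), and \<open>d\<close>
  is (1 - q^n)^2, which cancels between the coefficients for passing and for capping.\<close>

lemma box_step_identity:
  fixes a b c d w B Q V :: "'a::field"
  assumes "b \<noteq> 0" "c \<noteq> 0" "d \<noteq> 0" "w \<noteq> 0" "V \<noteq> 0"
  shows "- (B / V) * (Q * a / d) / (- b * c / (w * d)) = B * (w * w * Q) * (a / (b * c)) / (w * V)"
  using assms by (simp add: mult_ac)

lemma box_coeff_eq: "i \<le> n \<Longrightarrow> box_coeff n i = box_ratio n i / varA ^ (2 * i)"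
proof (induction i)
  case 0 then show ?case by (simp add: box_ratio_def)
next
  case (Suc i)
  have e: "Suc i + (n - Suc i) = n" "n + (n - Suc i) + 1 = 2 * n - i" "i + (n - i) = n" using Suc.prems by auto
  have t: "Suc i * (Suc i + 1) div 2 = Suc i + i * (i + 1) div 2" using triangular_Suc[of i] by simp
  have q: "varA ^ 4 = varA ^ 2 * varA ^ 2" by (simp add: power_add[symmetric])
  have v: "varA ^ (2 * Suc i) = varA ^ 2 * varA ^ (2 * i)" by (simp add: power_add[symmetric])
  have b: "1 - qA ^ (2 * n - i) \<noteq> 0" and d: "1 - qA ^ n \<noteq> 0" by (rule qA_power_neq_1; use Suc.prems in simp)+
  have IH: "box_coeff n i = box_ratio n i / varA ^ (2 * i)" using Suc by simp
  have "box_coeff n (Suc i) = box_ratio n i * (varA ^ 2 * varA ^ 2 * qA ^ i) * ((1 - qA ^ (n - i)) ^ 2 / ((1 - qA ^ (2 * n - i)) * (1 - qA ^ Suc i))) / varA ^ (2 * Suc i)"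
    unfolding box_coeff.simps pass_coeff_def cap_coeff_def e IH v
    by (rule box_step_identity) (use b d varA_nonzero qA_power_neq_1[of "Suc i"] in simp_all)
  moreover have "box_ratio n (Suc i) = box_ratio n i * (varA ^ 2 * varA ^ 2 * qA ^ i) * ((1 - qA ^ (n - i)) ^ 2 / ((1 - qA ^ (2 * n - i)) * (1 - qA ^ Suc i)))"
    unfolding box_ratio_def t power_add power_Suc prod.lessThan_Suc q[symmetric] by (simp only: mult_ac)
  ultimately show ?case by simp
qed

lemma cap_coeff_prod:
  assumes "i \<le> n"
  shows "(\<Prod>x\<in>{Suc i..n}. cap_coeff x n) = (- 1) ^ (n - i) * cap_ratio n i / varA ^ (2 * (n - i))"
proof -
  have "(\<Prod>x\<in>{Suc i..n}. cap_coeff x n) = (\<Prod>x\<in>{Suc i..n}. (- 1 / varA ^ 2) * ((1 - qA ^ (x + n + n + 1)) * (1 - qA ^ x) / (1 - qA ^ (x + n)) ^ 2))"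
    unfolding cap_coeff_def by (simp only: minus_product_over_product)
  also have "\<dots> = (- 1 / varA ^ 2) ^ (n - i) * cap_ratio n i"
    unfolding prod.distrib cap_ratio_def by simp
  finally show ?thesis by (simp only: power_divide power_mult times_divide_eq_left)
qed

lemma product_rearrange: "(b / p) * ((s * t) * c / r) = s / (p * r) * (t * (b * c))" for b c p r s t :: "'a::field"
  by (simp add: mult_ac)

text \<open>The powers A^(2i) and A^(2(n-i)) in the two denominators combine to a power independent
  of \<open>i\<close>. The signs (-1)^(n-i) produce the alternating sum and a global sign.\<close>

lemma triangle_coeff_eq:
  "triangle_coeff n = (- 1) ^ n * (\<Sum>i\<le>n. (- 1) ^ i * (box_ratio n i * cap_ratio n i)) / varA ^ (2 * n)"
proof -
  have "box_coeff n i * (\<Prod>x\<in>{Suc i..n}. cap_coeff x n) = (- 1) ^ n / varA ^ (2 * n) * ((- 1) ^ i * (box_ratio n i * cap_ratio n i))"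
    if "i \<le> n" for i
  proof -
    have "(- 1 :: ratA) ^ (n - i) = (- 1) ^ n * (- 1) ^ i"
      using that by (simp add: power_add[symmetric] minus_one_power_iff)
    moreover have "2 * i + 2 * (n - i) = 2 * n" using that by simp
    then have "varA ^ (2 * n) = varA ^ (2 * i) * varA ^ (2 * (n - i))"
      unfolding power_add[symmetric] by (simp only:)
    ultimately show ?thesis unfolding box_coeff_eq[OF that] cap_coeff_prod[OF that] by (simp only: product_rearrange)
  qed
  then show ?thesis unfolding triangle_coeff_def sum_distrib_left sum_divide_distrib by (intro sum.cong refl) simp
qed

lemma box_ratio_expands:
  assumes "i \<le> n" shows "expands (box_ratio n i) (fps_X ^ (i * (i + 1) div 2) * box_series n i)"
proof -
  have "expands ((1 - qA ^ (n - j)) ^ 2 / ((1 - qA ^ (2 * n - j)) * (1 - qA ^ Suc j)))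
    ((1 - fps_X ^ (n - j)) ^ 2 * inverse ((1 - fps_X ^ (2 * n - j)) * (1 - fps_X ^ Suc j)))" if "j < i" for j
  proof -
    have "fps_nth ((1 - fps_X ^ (2 * n - j)) * (1 - fps_X ^ Suc j)) 0 \<noteq> (0 :: rat)"
      using that assms by (simp add: fps_mult_nth_0)
    then show ?thesis by (rule expands_divide[OF expands_power[OF expands_one_minus] expands_mult[OF expands_one_minus expands_one_minus]])
  qed
  then show ?thesis unfolding box_ratio_def box_series_def
    by (intro expands_mult[OF expands_power[OF expands_qA]] expands_prod) simp
qed

lemma cap_ratio_expands: "expands (cap_ratio n i) (cap_series n i)"
  unfolding cap_ratio_def cap_series_def
proof (rule expands_prod)
  fix x assume x: "x \<in> {Suc i..n}"
  have "fps_nth ((1 - fps_X ^ (x + n)) ^ 2) 0 \<noteq> (0 :: rat)"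
    using x by (simp add: power2_eq_square fps_mult_nth_0)
  then show "expands ((1 - qA ^ (x + n + n + 1)) * (1 - qA ^ x) / (1 - qA ^ (x + n)) ^ 2)
     ((1 - fps_X ^ (x + n + n + 1)) * (1 - fps_X ^ x) * inverse ((1 - fps_X ^ (x + n)) ^ 2))"
    by (rule expands_divide[OF expands_mult[OF expands_one_minus expands_one_minus] expands_power[OF expands_one_minus]])
qed

lemma triangle_coeff_expands:
  "expands (\<Sum>i\<le>n. (- 1) ^ i * (box_ratio n i * cap_ratio n i)) (triangle_series n)"
  unfolding triangle_series_def
proof (rule expands_sum)
  fix i assume "i \<in> {..n}"
  then have "expands (box_ratio n i * cap_ratio n i) (fps_X ^ (i * (i + 1) div 2) * box_series n i * cap_series n i)"
    by (intro expands_mult[OF box_ratio_expands cap_ratio_expands]) simp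
  then show "expands ((- 1) ^ i * (box_ratio n i * cap_ratio n i)) ((- 1) ^ i * (fps_X ^ (i * (i + 1) div 2) * box_series n i * cap_series n i))"
    by (rule expands_mult[OF expands_power[OF expands_uminus[OF expands_1]]])
qed

text \<open>This is where a hook on a diagram becomes a surgery, provided that the cap closes no
  circle.\<close>

lemma cup_cap_surgery:
  assumes "matching (k + 2) p" "a \<le> k" "p ! a \<noteq> Suc a"
  shows "cup_matching a (cap_matching a p) = surgery_matching a (Suc a) p"
proof (rule insert_matching_eqI[symmetric])
  have l: "length p = k + 2" using assms by (simp add: matching_def)
  then show "a \<le> length (cap_matching a p)" "length (surgery_matching a (Suc a) p) = length (cap_matching a p) + length [Suc 0, 0]"
    using assms by auto
  { fix i assume "i < length (cap_matching a p)"
    then have i: "i < k" using l by simp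
    have s: "shift_index a 2 i < k + 2" "shift_index a 2 i \<noteq> a" "shift_index a 2 i \<noteq> Suc a" using i by (auto simp: shift_index_def)
    have "surgery a (Suc a) ((!) p) (shift_index a 2 i) = bypass a (Suc a) ((!) p) (shift_index a 2 i)"
      using s by (simp add: surgery_def bypass_def)
    then show "surgery_matching a (Suc a) p ! shift_index a (length [Suc 0, 0]) i = shift_index a (length [Suc 0, 0]) (cap_matching a p ! i)"
      using s i l assms(2) nth_cap[OF assms(1), of a i] by (simp add: nth_surgery numeral_2_eq_2) }
  { fix i assume "i < length [Suc 0, 0]"
    then have "i = 0 \<or> i = 1" by auto
    then show "surgery_matching a (Suc a) p ! (a + i) = a + [Suc 0, 0] ! i"
      using l assms(2) by (auto simp: nth_surgery surgery_def) }
qed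

section \<open>The leading term of an adequate diagram\<close>

text \<open>\<open>regular b r\<close> says that \<open>r\<close> is a power series in \<open>q\<close>, divisible by \<open>q\<close> if \<open>b\<close> holds. The factor
  \<open>varA ^ (2 * loops D p)\<close> compensates for the powers of \<open>A\<close> in the \<open>loops D p\<close> circle values that
  \<open>D\<close> contributes above \<open>p\<close>.\<close>

definition good :: "bool \<Rightarrow> ratA \<Rightarrow> diagram \<Rightarrow> nat \<Rightarrow> skein \<Rightarrow> bool" where
  "good b \<kappa> D k v \<longleftrightarrow> proj k v = v \<and>
     (\<forall>p. planar_matching k p \<longrightarrow> (\<exists>r. regular b r \<and> lookup v p = \<kappa> * varA ^ (2 * loops D p) * r))"

lemma goodI: "proj k v = v \<Longrightarrow> (\<And>p. planar_matching k p \<Longrightarrow> \<exists>r. regular b r \<and> lookup v p = \<kappa> * varA ^ (2 * loops D p) * r) \<Longrightarrow> good b \<kappa> D k v"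
  by (simp add: good_def)

lemma good_proj: "good b \<kappa> D k v \<Longrightarrow> proj k v = v" by (simp add: good_def)

lemma good_lookup:
  assumes "good b \<kappa> D k v" "planar_matching k p"
  obtains r where "regular b r" "lookup v p = \<kappa> * varA ^ (2 * loops D p) * r"
  using assms by (auto simp: good_def)

lemma good_0: "good b \<kappa> D k 0"
  by (rule goodI) (auto simp: linD[OF lin_proj] intro: exI[of _ 0])

lemma good_add:
  assumes "good b \<kappa> D k u" "good b \<kappa> D k v" shows "good b \<kappa> D k (u + v)"
proof (rule goodI)
  show "proj k (u + v) = u + v" using assms by (simp add: linD[OF lin_proj] good_proj)
  fix p assume p: "planar_matching k p"
  obtain r s where "regular b r" "lookup u p = \<kappa> * varA ^ (2 * loops D p) * r"
    "regular b s" "lookup v p = \<kappa> * varA ^ (2 * loops D p) * s"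
    using good_lookup[OF assms(1) p] good_lookup[OF assms(2) p] by metis
  then show "\<exists>r. regular b r \<and> lookup (u + v) p = \<kappa> * varA ^ (2 * loops D p) * r"
    by (intro exI[of _ "r + s"]) (simp add: regular_add lookup_add distrib_left)
qed

lemma good_smul:
  assumes "regular c s" "good b \<kappa> D k v" shows "good (c \<or> b) \<kappa> D k (smul s v)"
proof (rule goodI)
  show "proj k (smul s v) = smul s v" using assms by (simp add: linD[OF lin_proj] good_proj)
  fix p assume p: "planar_matching k p"
  obtain r where "regular b r" "lookup v p = \<kappa> * varA ^ (2 * loops D p) * r"
    using good_lookup[OF assms(2) p] .
  then show "\<exists>r. regular (c \<or> b) r \<and> lookup (smul s v) p = \<kappa> * varA ^ (2 * loops D p) * r"
    by (intro exI[of _ "s * r"]) (simp add: regular_mult[OF assms(1)])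
qed

lemma good_scale: "regular False s \<Longrightarrow> good b \<kappa> D k v \<Longrightarrow> good b \<kappa> D k (smul s v)"
  using good_smul[of False s b \<kappa> D k v] by simp

lemma good_sum: "(\<And>i. i \<in> I \<Longrightarrow> good b \<kappa> D k (f i)) \<Longrightarrow> good b \<kappa> D k (\<Sum>i\<in>I. f i)"
  by (induction I rule: infinite_finite_induct) (simp_all add: good_0 good_add)

lemma good_weaken: "good b \<kappa> D k v \<Longrightarrow> good False \<kappa> D k v"
  unfolding good_def using regular_weaken by blast

lemma good_basis:
  assumes "planar_matching k p" "regular b r"
  shows "good b \<kappa> D k (smul (\<kappa> * varA ^ (2 * loops D p) * r) (basis p))"
proof (rule goodI)
  show "proj k (smul (\<kappa> * varA ^ (2 * loops D p) * r) (basis p)) = smul (\<kappa> * varA ^ (2 * loops D p) * r) (basis p)"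
    using assms by (simp add: linD[OF lin_proj] proj_basis)
  fix q
  show "\<exists>s. regular b s \<and> lookup (smul (\<kappa> * varA ^ (2 * loops D p) * r) (basis p)) q = \<kappa> * varA ^ (2 * loops D q) * s"
    by (rule exI[of _ "if q = p then r else 0"]) (use assms in \<open>auto simp: lookup_single when_def\<close>)
qed

text \<open>It suffices to test \<open>G\<close> on each diagram scaled by the power of A that
  \<open>good\<close> grants it; divisibility by q is then inherited from the coefficients of
  \<open>v\<close>.\<close>

lemma good_linear:
  assumes "lin G" "good b \<kappa> D k v"
    and "\<And>p. planar_matching k p \<Longrightarrow> good False \<kappa> D' k' (G (smul (\<kappa> * varA ^ (2 * loops D p)) (basis p)))"
  shows "good b \<kappa> D' k' (G v)"
proof -
  have "v \<in> skein_space k" using good_proj[OF assms(2)] by (simp add: mem_skein_space_iff)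
  then have pl: "planar_matching k p" if "p \<in> Poly_Mapping.keys v" for p using that by (simp add: skein_space_def)
  have "good b \<kappa> D' k' (smul (lookup v p) (G (basis p)))" if p: "p \<in> Poly_Mapping.keys v" for p
  proof -
    obtain r where r: "regular b r" "lookup v p = \<kappa> * varA ^ (2 * loops D p) * r" using good_lookup[OF assms(2) pl[OF p]] .
    have "smul (lookup v p) (G (basis p)) = smul r (G (smul (\<kappa> * varA ^ (2 * loops D p)) (basis p)))"
      by (simp add: r(2) linD(2)[OF assms(1)] mult_ac)
    then show ?thesis using good_smul[OF r(1) assms(3)[OF pl[OF p]]] by simp
  qed
  moreover have "G v = (\<Sum>p\<in>Poly_Mapping.keys v. smul (lookup v p) (G (basis p)))"
    by (subst skein_expand) (simp add: lin_sum[OF assms(1)] linD[OF assms(1)])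
  ultimately show ?thesis by (simp add: good_sum)
qed

definition follows :: "(nat \<times> nat \<Rightarrow> nat \<times> nat \<Rightarrow> bool) \<Rightarrow> diagram \<Rightarrow> nat \<Rightarrow> nat \<Rightarrow> bool" where
  "follows R D t k \<longleftrightarrow> equivp R \<and> tangle k D 0 \<and> connects R D t"

text \<open>The arcs of \<open>p\<close> stand for the part of the diagram below line
  \<open>t\<close>, with idempotents replaced by identities; the two ends of such an arc lie on the
  same circle of the whole diagram.\<close>

definition arcs_in :: "(nat \<times> nat \<Rightarrow> nat \<times> nat \<Rightarrow> bool) \<Rightarrow> nat \<Rightarrow> nat \<Rightarrow> nat list \<Rightarrow> bool" where
  "arcs_in R t k p \<longleftrightarrow> (\<forall>i<k. R (t, i) (t, p ! i))"

text \<open>The factor A^2, taken from Wenzl's coefficient, is balanced against the circles. A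
  circle closed by the hook contributes -(1 + q). A cut adds a circle, whose compensating power
  absorbs A^2. A merger loses a circle and leaves A^4 = q; by \<open>loops_surgery\<close> this is
  the only possibility when the two points lie on different circles.\<close>

lemma hook_basis_good:
  assumes "follows R D t (Suc (Suc k))" "arcs_in R t (Suc (Suc k)) p" "planar_matching (Suc (Suc k)) p" "i \<le> k"
  shows "good (\<not> R (t, i) (t, Suc i)) \<kappa> D (Suc (Suc k)) (smul (varA ^ 2) (hook k i (smul (\<kappa> * varA ^ (2 * loops D p)) (basis p))))"
proof -
  let ?L = "loops D p"
  let ?p' = "cup_matching i (cap_matching i p)"
  have m: "matching (k + 2) p" using planar_imp_matching[OF assms(3)] by simp
  have pl: "planar_matching k (cap_matching i p)" by (rule planar_cap'[OF assms(3,4)])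
  have pl': "planar_matching (Suc (Suc k)) ?p'" by (rule planar_cup'[OF pl assms(4)])
  have h: "smul (varA ^ 2) (hook k i (smul (\<kappa> * varA ^ (2 * ?L)) (basis p))) = smul (varA ^ 2 * loop_value i p * (\<kappa> * varA ^ (2 * ?L))) (basis ?p')"
    unfolding hook_def using assms(3) pl by (simp add: linD[OF lin_capk] linD[OF lin_cupk] capk_basis cupk_basis mult_ac)
  show ?thesis
  proof (cases "p ! i = Suc i")
    case True
    then have R: "R (t, i) (t, Suc i)" using assms(2,4) unfolding arcs_in_def by (metis le_imp_less_Suc less_SucI)
    have e: "?p' = p" by (rule cup_cap_restore[OF m assms(4) True])
    have "varA ^ 2 * loop_value i p = - (1 + qA)" using True circle_value_scaled by (simp add: loop_value_def)
    then have v: "varA ^ 2 * loop_value i p * (\<kappa> * varA ^ (2 * ?L)) = \<kappa> * varA ^ (2 * ?L) * (- (1 + qA))"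
      by (simp only: mult.commute)
    have "regular False (- (1 + qA))" by (intro regular_uminus regular_add regular_1 regular_weaken[OF regular_qA])
    from good_basis[OF assms(3) this, of \<kappa> D] show ?thesis unfolding h e v using R by simp
  next
    case False
    have p': "?p' = surgery_matching i (Suc i) p" by (rule cup_cap_surgery[OF m assms(4) False])
    have v: "varA ^ 2 * loop_value i p = varA ^ 2" using False by (simp add: loop_value_def)
    have "loops D ?p' + 1 = ?L \<or> (loops D ?p' = ?L + 1 \<and> R (t, i) (t, Suc i))"
      unfolding p'
    proof (rule loops_surgery)
      show "equivp R" "tangle (Suc (Suc k)) D 0" "connects R D t" using assms(1) by (auto simp: follows_def)
      show "alternating (Suc (Suc k)) p" by (rule planar_imp_alternating[OF assms(3)])
      show "R (t, j) (t, p ! j)" if "j < Suc (Suc k)" for j using assms(2) that by (simp add: arcs_in_def)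
    qed (use assms(4) False in auto)
    then show ?thesis
    proof
      assume e: "loops D ?p' + 1 = ?L"
      have "varA ^ 2 * (\<kappa> * varA ^ (2 * ?L)) = \<kappa> * varA ^ (2 * loops D ?p') * qA"
        unfolding e[symmetric] by (simp add: power_add distrib_left) (simp add: power4_eq_xxxx power2_eq_square)
      then have "good True \<kappa> D (Suc (Suc k)) (smul (varA ^ 2 * (\<kappa> * varA ^ (2 * ?L))) (basis ?p'))"
        using good_basis[OF pl' regular_qA, of \<kappa> D] by (simp only:)
      then show ?thesis unfolding h v using good_weaken by (cases "R (t, i) (t, Suc i)") auto
    next
      assume e: "loops D ?p' = ?L + 1 \<and> R (t, i) (t, Suc i)"
      then have "varA ^ 2 * (\<kappa> * varA ^ (2 * ?L)) = \<kappa> * varA ^ (2 * loops D ?p') * 1"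
        by (simp add: power_add distrib_left power2_eq_square)
      then have "good False \<kappa> D (Suc (Suc k)) (smul (varA ^ 2 * (\<kappa> * varA ^ (2 * ?L))) (basis ?p'))"
        using good_basis[OF pl' regular_1, of \<kappa> D] by (simp only:)
      then show ?thesis unfolding h v using e by simp
    qed
  qed
qed

text \<open>The relation that identifies all points serves for error terms, about whose circles
  nothing is known: hooks then still preserve \<open>good\<close>.\<close>

lemma connects_top: "connects (\<lambda>_ _. True) D t"
  by (induction D t rule: connects.induct[where P = "\<lambda>_. connects (\<lambda>_ _. True)"]) simp_all

lemma hook_good:
  assumes "tangle (Suc (Suc k)) D 0" "i \<le> k" "good b \<kappa> D (Suc (Suc k)) v"
  shows "good b \<kappa> D (Suc (Suc k)) (smul (varA ^ 2) (hook k i v))"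
proof (rule good_linear[OF lin_smul[OF lin_hook'] assms(3)])
  fix p assume "planar_matching (Suc (Suc k)) p"
  moreover have "follows (\<lambda>_ _. True) D 0 (Suc (Suc k))"
    using assms(1) by (simp add: follows_def connects_top equivpI reflpI sympI transpI)
  ultimately show "good False \<kappa> D (Suc (Suc k)) (smul (varA ^ 2) (hook k i (smul (\<kappa> * varA ^ (2 * loops D p)) (basis p))))"
    using hook_basis_good[of "\<lambda>_ _. True" D 0 k p i \<kappa>] assms(2) by (simp add: arcs_in_def)
qed

text \<open>The factor A^2 of Wenzl's coefficient is moved to the hook, so that the remaining
  quotient is a power series in q.\<close>

lemma JWop_step:
  assumes "\<And>i. i < m \<Longrightarrow> lin (e i)"
  shows "JWop e (Suc m) v = JWop e m v + smul ((1 - qA ^ Suc m) / (1 - qA ^ Suc (Suc m))) (JWop e m (smul (varA ^ 2) (e m (JWop e m v))))"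
  by (simp add: linD(2)[OF lin_JWop] assms wenzl_coeff_eq del: power_Suc)

lemma JWop_good:
  assumes "\<And>i. i < m \<Longrightarrow> lin (e i)"
    and "\<And>i v. i < m \<Longrightarrow> good b \<kappa> D k v \<Longrightarrow> good b \<kappa> D k (smul (varA ^ 2) (e i v))"
    and "good b \<kappa> D k v"
  shows "good b \<kappa> D k (JWop e m v)"
  using assms
proof (induction m arbitrary: v)
  case (Suc m)
  have IH: "good b \<kappa> D k u \<Longrightarrow> good b \<kappa> D k (JWop e m u)" for u by (rule Suc.IH) (use Suc.prems in auto)
  have "good b \<kappa> D k (JWop e m (smul (varA ^ 2) (e m (JWop e m v))))"
    by (intro IH Suc.prems(2,3)) simp
  moreover have "lin (e i)" if "i < m" for i using Suc.prems(1) that by simp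
  ultimately show ?case
    using JWop_step[of m e v] good_add[OF IH[OF Suc.prems(3)] good_scale[OF regular_wenzl_ratio]] by presburger
qed simp

text \<open>If every hook sends \<open>v\<close> to something divisible by q, then so does
  everything in the idempotent beyond its constant term: the last hook acts on \<open>v\<close> plus
  an error that is already divisible by q.\<close>

lemma JWop_unit:
  assumes "\<And>i. i < m \<Longrightarrow> lin (e i)"
    and "\<And>i v. i < m \<Longrightarrow> good True \<kappa> D k v \<Longrightarrow> good True \<kappa> D k (smul (varA ^ 2) (e i v))"
    and "\<And>i. i < m \<Longrightarrow> good True \<kappa> D k (smul (varA ^ 2) (e i v))"
  shows "good True \<kappa> D k (JWop e m v - v)"
  using assms
proof (induction m)
  case (Suc m)
  define w where "w = JWop e m v - v"
  have w: "good True \<kappa> D k w" unfolding w_def by (rule Suc.IH) (use Suc.prems in auto)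
  have "smul (varA ^ 2) (e m (v + w)) = smul (varA ^ 2) (e m v) + smul (varA ^ 2) (e m w)"
    using linD(1)[OF Suc.prems(1)] by (simp add: smul_add)
  then have "good True \<kappa> D k (smul (varA ^ 2) (e m (v + w)))"
    using good_add[OF Suc.prems(3) Suc.prems(2)[OF _ w]] by simp
  then have "good True \<kappa> D k (JWop e m (smul (varA ^ 2) (e m (v + w))))"
    by (intro JWop_good) (use Suc.prems in auto)
  then have "good True \<kappa> D k (w + smul ((1 - qA ^ Suc m) / (1 - qA ^ Suc (Suc m))) (JWop e m (smul (varA ^ 2) (e m (v + w)))))"
    by (rule good_add[OF w good_scale[OF regular_wenzl_ratio]])
  moreover have "lin (e i)" if "i < m" for i using Suc.prems(1) that by simp
  from JWop_step[of m e v, OF this]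
  have "JWop e (Suc m) v - v = w + smul ((1 - qA ^ Suc m) / (1 - qA ^ Suc (Suc m))) (JWop e m (smul (varA ^ 2) (e m (v + w))))"
    by (simp add: w_def del: power_Suc JWop.simps)
  ultimately show ?case by (simp only:)
qed (simp add: good_0)

lemma jw_hooks:
  assumes "a + m \<le> k" "i < m - 1"
  obtains l where "k = Suc (Suc l)" "a + i \<le> l" "k - 2 = l"
  using assms that[of "k - 2"] by simp

lemma jw_good:
  assumes "tangle k D 0" "a + m \<le> k" "good b \<kappa> D k v"
  shows "good b \<kappa> D k (jw k a m v)"
  unfolding jw_def good_proj[OF assms(3)]
proof (rule JWop_good[OF lin_hook' _ assms(3)])
  fix i u assume "i < m - 1" and u: "good b \<kappa> D k u"
  then obtain l where l: "k = Suc (Suc l)" "a + i \<le> l" "k - 2 = l" using jw_hooks[OF assms(2)] by blast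
  show "good b \<kappa> D k (smul (varA ^ 2) (hook (k - 2) (a + i) u))"
    unfolding l(3) using hook_good[of l D "a + i" b \<kappa> u] assms(1) l u by simp
qed

text \<open>In an adequate diagram every hook in the expansion of an idempotent merges two circles,
  so that only the identity term contributes to the lowest order.\<close>

lemma jw_unit:
  fixes \<kappa> :: ratA
  assumes "follows R D t k" "arcs_in R t k p" "planar_matching k p" "a + m \<le> k"
    and "\<And>i. Suc i < m \<Longrightarrow> \<not> R (t, a + i) (t, Suc (a + i))"
  defines "v \<equiv> smul (\<kappa> * varA ^ (2 * loops D p)) (basis p)"
  shows "good True \<kappa> D k (jw k a m v - v)"
proof -
  have p: "proj k v = v" using assms(3) by (simp add: v_def linD[OF lin_proj] proj_basis)
  have tangle: "tangle k D 0" using assms(1) by (simp add: follows_def)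
  show ?thesis
    unfolding jw_def p
  proof (rule JWop_unit[OF lin_hook'])
    fix i assume i: "i < m - 1"
    then obtain l where l: "k = Suc (Suc l)" "a + i \<le> l" "k - 2 = l" using jw_hooks[OF assms(4)] by blast
    show "good True \<kappa> D k (smul (varA ^ 2) (hook (k - 2) (a + i) u))" if "good True \<kappa> D k u" for u
      unfolding l(3) using hook_good[of l D "a + i" True \<kappa> u] tangle l that by simp
    show "good True \<kappa> D k (smul (varA ^ 2) (hook (k - 2) (a + i) v))"
      unfolding l(3) v_def using hook_basis_good[of R D t l p "a + i" \<kappa>] assms(1-3) assms(5)[of i] i l by simp
  qed
qed

lemma cup_good:
  assumes "good b \<kappa> (Cup a # D) k v" "a \<le> k" shows "good b \<kappa> D (Suc (Suc k)) (cupk k a v)"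
proof (rule good_linear[OF lin_cupk assms(1)])
  fix p assume p: "planar_matching k p"
  from good_basis[OF planar_cup'[OF p assms(2)] regular_1, of \<kappa> D]
  show "good False \<kappa> D (Suc (Suc k)) (cupk k a (smul (\<kappa> * varA ^ (2 * loops (Cup a # D) p)) (basis p)))"
    using p by (simp add: linD[OF lin_cupk] cupk_basis)
qed

text \<open>The value of a circle times A^2, that is -(1 + q), which has a nonzero constant term; it
  is 1 if the cap closes no circle.\<close>

definition loop_unit :: "nat \<Rightarrow> nat list \<Rightarrow> ratA" where
  "loop_unit a p = (if p ! a = Suc a then - (1 + qA) else 1)"

lemma loop_unit_regular: "regular False (loop_unit a p)"
  unfolding loop_unit_def using regular_uminus[OF regular_add[OF regular_1 regular_weaken[OF regular_qA]]] by simp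

lemma cap_basis_scaled:
  assumes "planar_matching (Suc (Suc k)) p"
  shows "capk k a (smul (\<kappa> * varA ^ (2 * loops (Cap a # D) p) * r) (basis p))
    = smul (\<kappa> * varA ^ (2 * loops D (cap_matching a p)) * (loop_unit a p * r)) (basis (cap_matching a p))"
proof (cases "p ! a = Suc a")
  case True
  have "varA ^ (2 * loops (Cap a # D) p) * loop_value a p = varA ^ (2 * loops D (cap_matching a p)) * (varA ^ 2 * circle_value)"
    using True by (simp add: loop_value_def power2_eq_square mult_ac)
  also have "varA ^ 2 * circle_value = loop_unit a p" using True circle_value_scaled by (simp add: loop_unit_def)
  finally have e: "varA ^ (2 * loops (Cap a # D) p) * loop_value a p = varA ^ (2 * loops D (cap_matching a p)) * loop_unit a p" .
  have "capk k a (smul (\<kappa> * varA ^ (2 * loops (Cap a # D) p) * r) (basis p))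
    = smul (\<kappa> * (varA ^ (2 * loops (Cap a # D) p) * loop_value a p) * r) (basis (cap_matching a p))"
    using assms by (simp add: linD[OF lin_capk] capk_basis mult_ac del: loops.simps)
  then show ?thesis unfolding e by (simp add: mult_ac del: loops.simps)
next
  case False
  then show ?thesis using assms by (simp add: linD[OF lin_capk] capk_basis loop_value_def loop_unit_def)
qed

lemma cap_good:
  assumes "good b \<kappa> (Cap a # D) (Suc (Suc k)) v" "a \<le> k" shows "good b \<kappa> D k (capk k a v)"
proof (rule good_linear[OF lin_capk assms(1)])
  fix p assume p: "planar_matching (Suc (Suc k)) p"
  show "good False \<kappa> D k (capk k a (smul (\<kappa> * varA ^ (2 * loops (Cap a # D) p)) (basis p)))"
    using cap_basis_scaled[OF p, of a \<kappa> D 1] good_basis[OF planar_cap'[OF p assms(2)] loop_unit_regular, of \<kappa> D a p] by (simp del: loops.simps)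
qed

definition unit :: "ratA \<Rightarrow> bool" where
  "unit r \<longleftrightarrow> (\<exists>F. expands r F \<and> fps_nth F 0 \<noteq> 0)"

lemma unit_1: "unit 1" unfolding unit_def by (intro exI[of _ 1]) simp

lemma unit_mult: "unit r \<Longrightarrow> unit s \<Longrightarrow> unit (r * s)"
  unfolding unit_def by (metis expands_mult fps_mult_nth_0 mult_eq_0_iff)

lemma unit_regular: "unit r \<Longrightarrow> regular False r" by (auto simp: unit_def regular_def)

lemma unit_add: "unit r \<Longrightarrow> regular True s \<Longrightarrow> unit (r + s)"
  unfolding unit_def regular_def by (metis add.right_neutral expands_add fps_add_nth)

lemma unit_loop: "unit (loop_unit a p)"
proof -
  have "expands (- (1 + qA)) (- (1 + fps_X))" by (intro expands_uminus expands_add expands_1 expands_qA)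
  moreover have "fps_nth (- (1 + fps_X)) 0 \<noteq> (0 :: rat)" by simp
  ultimately show ?thesis using unit_1 unfolding loop_unit_def unit_def by (cases "p ! a = Suc a") auto
qed

text \<open>The invariant along the slices: a unit multiple of the single diagram in which all
  idempotents so far are identities, at the order prescribed by its circles, plus an error divisible
  by q relative to that order.\<close>

definition leading :: "(nat \<times> nat \<Rightarrow> nat \<times> nat \<Rightarrow> bool) \<Rightarrow> ratA \<Rightarrow> diagram \<Rightarrow> nat \<Rightarrow> nat \<Rightarrow> skein \<Rightarrow> bool" where
  "leading R \<kappa> D t k v \<longleftrightarrow> (\<exists>p r w. planar_matching k p \<and> arcs_in R t k p \<and> unit r \<and> good True \<kappa> D k w \<and>
     v = smul (\<kappa> * varA ^ (2 * loops D p) * r) (basis p) + w)"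

lemma leadingI:
  "planar_matching k p \<Longrightarrow> arcs_in R t k p \<Longrightarrow> unit r \<Longrightarrow> good True \<kappa> D k w \<Longrightarrow>
    v = smul (\<kappa> * varA ^ (2 * loops D p) * r) (basis p) + w \<Longrightarrow> leading R \<kappa> D t k v"
  unfolding leading_def by blast

lemma leadingE:
  assumes "leading R \<kappa> D t k v"
  obtains p r w where "planar_matching k p" "arcs_in R t k p" "unit r" "good True \<kappa> D k w"
    "v = smul (\<kappa> * varA ^ (2 * loops D p) * r) (basis p) + w"
  using assms unfolding leading_def by blast

lemma leading_proj: "leading R \<kappa> D t k v \<Longrightarrow> proj k v = v"
  by (erule leadingE) (simp add: linD[OF lin_proj] proj_basis good_proj)

lemma leading_Cup:
  assumes "leading R \<kappa> (Cup a # D) t k v" "follows R (Cup a # D) t k"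
  shows "leading R \<kappa> D (Suc t) (Suc (Suc k)) (cupk k a v)"
proof -
  obtain p r w where p: "planar_matching k p" "arcs_in R t k p" "unit r" "good True \<kappa> (Cup a # D) k w"
    "v = smul (\<kappa> * varA ^ (2 * loops (Cup a # D) p) * r) (basis p) + w" using assms(1) by (rule leadingE)
  have a: "a \<le> k" using assms(2) by (simp add: follows_def)
  show ?thesis
  proof (rule leadingI[OF planar_cup'[OF p(1) a] _ p(3) cup_good[OF p(4) a]])
    show "arcs_in R (Suc t) (Suc (Suc k)) (cup_matching a p)"
      unfolding arcs_in_def
    proof (intro allI impI)
      fix i assume i: "i < Suc (Suc k)"
      show "R (Suc t, i) (Suc t, cup_matching a p ! i)"
        by (rule arcs_cup[where k = k]) (use assms(2) p a i in \<open>auto simp: follows_def arcs_in_def planar_length\<close>)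
    qed
    show "cupk k a v = smul (\<kappa> * varA ^ (2 * loops D (cup_matching a p)) * r) (basis (cup_matching a p)) + cupk k a w"
      using p(1) by (simp add: p(5) linD[OF lin_cupk] cupk_basis)
  qed
qed

lemma leading_Cap:
  assumes "leading R \<kappa> (Cap a # D) t (Suc (Suc k)) v" "follows R (Cap a # D) t (Suc (Suc k))"
  shows "leading R \<kappa> D (Suc t) k (capk k a v)"
proof -
  obtain p r w where p: "planar_matching (Suc (Suc k)) p" "arcs_in R t (Suc (Suc k)) p" "unit r" "good True \<kappa> (Cap a # D) (Suc (Suc k)) w"
    "v = smul (\<kappa> * varA ^ (2 * loops (Cap a # D) p) * r) (basis p) + w" using assms(1) by (rule leadingE)
  have a: "a \<le> k" using assms(2) by (simp add: follows_def)
  have m: "matching (k + 2) p" using planar_imp_matching[OF p(1)] by simp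
  show ?thesis
  proof (rule leadingI[OF planar_cap'[OF p(1) a] _ unit_mult[OF unit_loop[of a p] p(3)] cap_good[OF p(4) a]])
    show "arcs_in R (Suc t) k (cap_matching a p)"
      unfolding arcs_in_def
    proof (intro allI impI)
      fix i assume i: "i < k"
      show "R (Suc t, i) (Suc t, cap_matching a p ! i)"
        by (rule arcs_cap[OF _ m a]) (use assms(2) p i in \<open>auto simp: follows_def arcs_in_def\<close>)
    qed
    show "capk k a v = smul (\<kappa> * varA ^ (2 * loops D (cap_matching a p)) * (loop_unit a p * r)) (basis (cap_matching a p)) + capk k a w"
      by (simp add: p(5) linD(1)[OF lin_capk] cap_basis_scaled[OF p(1)] del: loops.simps)
  qed
qed

text \<open>The new error has two sources: what the idempotent adds to the leading diagram, small by
  the assumption on circles, and its action on the old error, which keeps that error small.\<close>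

lemma leading_Box:
  assumes "leading R \<kappa> (Box a m # D) t k v" "follows R (Box a m # D) t k"
    and "\<And>i. Suc i < m \<Longrightarrow> \<not> R (t, a + i) (t, Suc (a + i))"
  shows "leading R \<kappa> D (Suc t) k (jw k a m v)"
proof -
  let ?D = "Box a m # D"
  obtain p r w where p: "planar_matching k p" "arcs_in R t k p" "unit r" "good True \<kappa> ?D k w"
    "v = smul (\<kappa> * varA ^ (2 * loops ?D p) * r) (basis p) + w" using assms(1) by (rule leadingE)
  have a: "a + m \<le> k" and tangle: "tangle k ?D 0" and R: "equivp R" "\<And>j. R (t, j) (Suc t, j)"
    using assms(2) by (auto simp: follows_def)
  define u where "u = smul (\<kappa> * varA ^ (2 * loops ?D p)) (basis p)"
  have v: "v = smul r u + w" by (simp add: p(5) u_def mult_ac)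
  have "good True \<kappa> ?D k (smul r (jw k a m u - u) + jw k a m w)"
    unfolding u_def
    by (rule good_add[OF good_scale[OF unit_regular[OF p(3)] jw_unit[OF assms(2) p(2,1) a assms(3)]] jw_good[OF tangle a p(4)]])
  then have g: "good True \<kappa> D k (smul r (jw k a m u - u) + jw k a m w)" by (simp add: good_def)
  have pl: "p ! i < k" if "i < k" for i using p(1) that by (simp add: planar_matching_def)
  show ?thesis
  proof (rule leadingI[OF p(1) _ p(3) g])
    show "arcs_in R (Suc t) k p"
      unfolding arcs_in_def
    proof (intro allI impI)
      fix i assume "i < k"
      then have "R (t, i) (t, p ! i)" using p(2) by (simp add: arcs_in_def)
      then show "R (Suc t, i) (Suc t, p ! i)" by (rule equivp_transp[OF R(1) equivp_symp[OF R(1) R(2)] equivp_transp[OF R(1) _ R(2)]])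
    qed
    have "smul r (jw k a m u - u) = smul r (jw k a m u) - smul r u"
      by (rule poly_mapping_eqI) (simp add: lookup_minus right_diff_distrib)
    then have "jw k a m v = smul r u + (smul r (jw k a m u - u) + jw k a m w)"
      by (simp add: v linD[OF lin_jw])
    then show "jw k a m v = smul (\<kappa> * varA ^ (2 * loops D p) * r) (basis p) + (smul r (jw k a m u - u) + jw k a m w)"
      by (simp add: u_def mult_ac)
  qed
qed

text \<open>At the end only the empty diagram is left and no circles remain to be counted, so the
  error changes the coefficient by a multiple of q and leaves it a unit.\<close>

lemma leading_attach:
  assumes "leading R \<kappa> D t k v" "follows R D t k" "crossingless D"
    and "\<And>s a m i. s < length D \<Longrightarrow> D ! s = Box a m \<Longrightarrow> Suc i < m \<Longrightarrow> \<not> R (t + s, a + i) (t + s, Suc (a + i))"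
  shows "\<exists>r. unit r \<and> lookup (attach D v) [] = \<kappa> * r"
  using assms
proof (induction D arbitrary: t k v)
  case Nil
  then have k: "k = 0" by (simp add: follows_def)
  obtain p r w where p: "planar_matching k p" "unit r" "good True \<kappa> [] k w"
    "v = smul (\<kappa> * varA ^ (2 * loops [] p) * r) (basis p) + w" using Nil(1) by (rule leadingE)
  obtain s where "regular True s" "lookup w p = \<kappa> * varA ^ (2 * loops [] p) * s" using good_lookup[OF p(3,1)] .
  moreover have "p = []" using p(1) k by simp
  ultimately show ?case using unit_add[OF p(2)] by (intro exI[of _ "r + s"]) (simp add: p(4) lookup_add distrib_left)
next
  case (Cons s D)
  have sep: "\<not> R (Suc t + s', a + i) (Suc t + s', Suc (a + i))" if "s' < length D" "D ! s' = Box a m" "Suc i < m" for s' a m i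
    using Cons.prems(4)[of "Suc s'" a m i] that by simp
  have cl: "crossingless D" using Cons.prems(3) by (auto simp: crossingless_def)
  have "\<exists>l. leading R \<kappa> D (Suc t) l (slice_skein s v) \<and> follows R D (Suc t) l"
  proof (cases s)
    case (Cup a)
    have f: "follows R D (Suc t) (Suc (Suc k))" using Cons.prems(2) Cup by (simp add: follows_def)
    have "leading R \<kappa> D (Suc t) (Suc (Suc k)) (cupk k a v)"
      by (rule leading_Cup) (use Cons.prems(1,2) Cup in simp_all)
    moreover have "slice_skein s v = cupk k a v" unfolding Cup by (rule slice_skein_Cup[OF leading_proj[OF Cons.prems(1)]])
    ultimately show ?thesis using f by auto
  next
    case (Cap a)
    then have "a + 2 \<le> k" using Cons.prems(2) by (simp add: follows_def)
    define l where "l = k - 2"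
    with \<open>a + 2 \<le> k\<close> have l: "k = Suc (Suc l)" by simp
    have f: "follows R D (Suc t) l" using Cons.prems(2) Cap l by (simp add: follows_def)
    have "leading R \<kappa> D (Suc t) l (capk l a v)"
      by (rule leading_Cap) (use Cons.prems(1,2) Cap l in simp_all)
    moreover have "slice_skein s v = capk l a v"
      unfolding Cap by (rule slice_skein_Cap) (use leading_proj[OF Cons.prems(1)] l in simp)
    ultimately show ?thesis using f by auto
  next
    case (Cross b a)
    then show ?thesis using Cons.prems(3) by (auto simp: crossingless_def)
  next
    case (Box a m)
    have f: "follows R D (Suc t) k" and a: "a + m \<le> k" using Cons.prems(2) Box by (auto simp: follows_def)
    have "leading R \<kappa> D (Suc t) k (jw k a m v)"
      using leading_Box[of R \<kappa> a m D t k v] Cons.prems(1,2) Cons.prems(4)[of 0 a m] Box by simp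
    then show ?thesis using slice_skein_Box[OF leading_proj[OF Cons.prems(1)] a] Box f by auto
  qed
  then show ?case using Cons.IH[OF _ _ cl sep] by (auto simp: attach_Cons)
qed

lemma connects_drop:
  assumes "equivp R" "\<And>x y. adjacent D x y \<Longrightarrow> R x y" "crossingless D" "t \<le> length D"
  shows "connects R (drop t D) t"
  using assms(4)
proof (induction t rule: inc_induct)
  case base then show ?case by simp
next
  case (step t)
  have d: "drop t D = D ! t # drop (Suc t) D" using step by (simp add: Cons_nth_drop_Suc)
  have "connects R (D ! t # drop (Suc t) D) t"
  proof (cases "D ! t")
    case (Cross b a)
    then have "Cross b a \<in> set D" using step(2) nth_mem by metis
    then show ?thesis using assms(3) by (auto simp: crossingless_def)
  qed (use step assms(2) adjacent.intros[of t D] in simp_all)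
  then show ?case using d by simp
qed

theorem adequate_leading_term:
  assumes "adequate D"
  obtains N r where "unit r" "lookup (skein_of D) [] = r / varA ^ (2 * N)"
proof -
  let ?R = "same_circle D"
  have D: "tangle 0 D 0" "crossingless D"
    and sep: "\<And>t a m i j. t < length D \<Longrightarrow> D ! t = Box a m \<Longrightarrow> i < j \<Longrightarrow> j < m \<Longrightarrow> \<not> ?R (t, a + i) (t, a + j)"
    using assms by (auto simp: adequate_def)
  have R: "equivp ?R" unfolding same_circle_def by (rule equivp_evquivclp)
  have "connects ?R (drop 0 D) 0"
    by (rule connects_drop[OF R _ D(2)]) (auto simp: same_circle_def)
  then have f: "follows ?R D 0 0" using R D by (simp add: follows_def)
  \<comment> \<open>Chosen to cancel the power of A that belongs to all circles of the diagram, so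
    that the empty diagram starts with coefficient 1.\<close>
  let ?\<kappa> = "inverse (varA ^ (2 * loops D []))"
  have "leading ?R ?\<kappa> D 0 0 (basis [])"
    by (rule leadingI[of 0 "[]" _ _ 1 _ _ 0]) (simp_all add: arcs_in_def unit_1 good_0 varA_nonzero)
  from leading_attach[OF this f D(2)] sep obtain r where "unit r" "lookup (attach D (basis [])) [] = ?\<kappa> * r"
    by fastforce
  then show ?thesis using that[of r "loops D []"] by (simp add: skein_of_def divide_inverse mult.commute)
qed

section \<open>From the triangle element to its closures\<close>

lemma lin_apply_TL: "lin (apply_TL a m f)"
proof -
  have "lin (\<lambda>v. fold (\<lambda>i. cap_skein (c i)) is (F v))" if "lin F" for c :: "nat \<Rightarrow> nat" and "is" and F
    using that
  proof (induction "is" arbitrary: F)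
    case (Cons i "is")
    show ?case using Cons.IH[OF lin_comp[OF lin_cap_skein Cons.prems]] by simp
  qed simp
  from this[OF lin_insert_skein2] show ?thesis unfolding apply_TL_def[abs_def] .
qed

lemma lin_slice_skein: "lin (slice_skein s)"
proof (cases s)
  case (Cup a)
  then show ?thesis using lin_cup_skein by (simp add: lin_def)
next
  case (Cap a)
  then show ?thesis using lin_cap_skein by (simp add: lin_def)
next
  case (Cross b a)
  have "lin (\<lambda>v. smul c v + smul d (cup_skein a (cap_skein a v)))" for c d
    by (rule lin_plus[OF lin_smul[OF lin_ident] lin_smul[OF lin_comp[OF lin_cup_skein lin_cap_skein]]])
  from this[of varA "inverse varA"] this[of "inverse varA" varA] show ?thesis unfolding Cross by (cases b) (simp_all add: lin_def add.commute)
next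
  case (Box a m)
  then show ?thesis using lin_apply_TL by (simp add: lin_def)
qed

text \<open>A wiring may contain crossings, so the unprojected operators themselves must be shown to
  be linear.\<close>

lemma lin_attach: "lin (attach D)"
  unfolding attach_def by (induction D) (simp_all add: lin_def linD[OF lin_slice_skein])

lemma closure_value_triangle:
  "closure_value (skein_of (triangle_graph (2 * n))) x = triangle_coeff n * closure_value (skein_of (tau (2 * n) (2 * n) (2 * n))) x"
  by (simp add: closure_value_def skein_of_triangle linD[OF lin_attach])

theorem theorem4p14:
  fixes n :: nat and x :: diagram
  assumes "wiring (6 * n) x"
    and "adequate (tau (2 * n) (2 * n) (2 * n) @ x)"
  shows "agree_to_order n
    (laurent (closure_value (skein_of (triangle_graph (2 * n))) x))
    (q_series Lambda_q * laurent (closure_value (skein_of (tau (2 * n) (2 * n) (2 * n))) x))"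
proof -
  define T where "T = closure_value (skein_of (tau (2 * n) (2 * n) (2 * n))) x"
  define C where "C = (\<Sum>i\<le>n. (- 1) ^ i * (box_ratio n i * cap_ratio n i))"
  define s :: rat where "s = (- 1) ^ n"
  let ?S = "triangle_series n"
  obtain N r where r: "unit r" "lookup (skein_of (tau (2 * n) (2 * n) (2 * n) @ x)) [] = r / varA ^ (2 * N)"
    using adequate_leading_term[OF assms(2)] .
  then have T: "T = r / varA ^ (2 * N)" by (simp add: T_def closure_value_def skein_of_def attach_append)
  obtain F where F: "expands r F" "fps_nth F 0 \<noteq> 0" using r(1) by (auto simp: unit_def)
  have X: "fls_X_intpow (int m) = laurent (varA ^ m)" for m
    by (simp add: laurent_power laurent_varA fls_X_power)
  have V: "varA ^ m \<noteq> 0" for m using varA_nonzero by simp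
  have C: "expands C ?S" unfolding C_def by (rule triangle_coeff_expands)
  have s: "expands ((- 1) ^ n) (fps_const s)"
    using expands_power[OF expands_uminus[OF expands_1], of n] by (cases "even n") (simp_all add: s_def fps_const_neg[symmetric] del: fps_const_neg)
  \<comment> \<open>Precision \<open>Suc n\<close> includes the constant term even for
    \<open>n = 0\<close>; it is used below to see that the series of the triangle starts in degree
    0.\<close>
  have cong: "fps_cong (Suc n) (?S * F) (Lambda_q * F)"
    by (rule fps_cong_mult[OF triangle_series_cong fps_cong_refl])
  have nz: "fps_nth (Lambda_q * F) 0 \<noteq> 0" using F(2) Lambda_q_nth_0 by (simp add: fps_mult_nth_0)
  have tri: "closure_value (skein_of (triangle_graph (2 * n))) x = (- 1) ^ n * (C * r) / varA ^ (2 * n + 2 * N)"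
    unfolding closure_value_triangle T_def[symmetric] T triangle_coeff_eq C_def[symmetric] power_add by simp
  show ?thesis
    unfolding agree_to_order_def T_def[symmetric]
  \<comment> \<open>The powers of A clear the denominators A^(2n+2N) and A^(2N), and
    \<open>s\<close> is the global sign (-1)^n of the triangle coefficient.\<close>
  proof (intro exI conjI allI impI)
    have "expands ((- 1) ^ n * (C * r)) (fps_const s * (?S * F))" by (rule expands_mult[OF s expands_mult[OF C F(1)]])
    then show "fls_X_intpow (int (2 * n + 2 * N)) * laurent (closure_value (skein_of (triangle_graph (2 * n))) x) = q_series (fps_const s * (?S * F))"
      unfolding X tri laurent_mult[symmetric] using V by (simp add: expands_def)
    show "fps_nth (fps_const s * (?S * F)) 0 \<noteq> 0"
      using nz fps_cong_nth[OF cong, of 0] by (simp add: s_def)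
    have "fls_X_intpow (int (2 * N)) * laurent T = q_series F"
      unfolding X T laurent_mult[symmetric] using V F(1) by (simp add: expands_def)
    then show "fls_X_intpow (int (2 * N)) * (q_series Lambda_q * laurent T) = q_series (Lambda_q * F)"
      by (simp only: q_series_mult mult.left_commute)
    show "fps_nth (Lambda_q * F) 0 \<noteq> 0" by (rule nz)
    show "s \<in> {1, - 1}" by (cases "even n") (simp_all add: s_def)
    show "fps_nth (fps_const s * (?S * F)) i = s * fps_nth (Lambda_q * F) i" if "i < n" for i
      using fps_cong_nth[OF cong, of i] that by simp
  qed
qed

end
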